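(* There is an integer $n_0$ such that for every $\epsilon_1>0$ there exists $\delta>0$ with the following property. Let $n\ge n_0$, let $q$ be a prime power, let $G$ be one of the finite simple classical groups $L_n^{\pm}(q)$, $PSp_n(q)$, $P\Omega_n^{\pm}(q)$, and let $a=a(G)$. If $x \in G$ satisfies $\nu(x)=s$ and $|x^G|\le |G|^\delta$, then $$q^{(2a-\epsilon_1)ns} \le |x^G| \le q^{(2a+\epsilon_1)ns}.$$
   Context: Here $L_n^+(q)=PSL_n(q)$, $L_n^-(q)=PSU_n(q)$, and the orthogonal groups include the groups $P\Omega_n(q)$ with $n$ and $q$ odd. $x^G$ is the conjugacy class of $x$ in $G$. Define $a(G)=1$ if $G=L_n^{\pm}(q)$ and $a(G)=\frac12$ otherwise. Let $V=V_n(q^u)$ be the natural module for $G$ (of dimension $n$ over $\mathbb{F}_{q^u}$), where $u=2$ if $G$ is unitary and $u=1$ otherwise. Let $\bar{\mathbb F}$ be the algebraic closure of $\mathbb{F}_q$ and $\bar V=V\otimes\bar{\mathbb F}$. For $x\in G$ let $\hat x$ be a preimage of $x$ in $GL(V)$. The support of $x$ is $\nu(x)=\min\{\dim[\bar V,\lambda\hat x] : \lambda\in\bar{\mathbb F}^*\}$, where $[\bar V,g]=\{vg-v : v\in\bar V\}$; thus $n-\nu(x)$ is the largest dimension of an eigenspace of $\hat x$ on $\bar V$. *)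

theory Defs
  imports
    Complex_Main
    "HOL-Number_Theory.Prime_Powers"
    "HOL-Combinatorics.Permutations"
    "HOL-Algebra.Algebraic_Closure"
    "HOL-Algebra.SimpleGroups"
    "HOL-Algebra.Generated_Groups"
    "Jordan_Normal_Form.Missing_VectorSpace"
begin

text \<open>
  Since the dimension and the field both vary inside the theorem, fields are
  \<^theory>\<open>HOL-Algebra.Ring\<close> records and an n by n matrix is a doubly indexed extensional
  function on the index set {..<n}. Statements quantifying over all such fields with elements
  in a type 'a already cover every finite field, up to isomorphism, when 'a is nat: a finite
  field and its algebraic closure are countable.
\<close>

section \<open>Coordinate spaces and general linear groups\<close>

type_synonym 'a matrix = "nat \<Rightarrow> nat \<Rightarrow> 'a"

definition coord_space :: "'a ring \<Rightarrow> nat \<Rightarrow> ('a, nat \<Rightarrow> 'a) module" where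
  "coord_space F n = ring.func_space F {..<n}"

abbreviation vecs :: "'a ring \<Rightarrow> nat \<Rightarrow> (nat \<Rightarrow> 'a) set" where
  "vecs F n \<equiv> carrier (coord_space F n)"

definition subspace_dim :: "'a ring \<Rightarrow> nat \<Rightarrow> (nat \<Rightarrow> 'a) set \<Rightarrow> nat" where
  "subspace_dim F n W = vectorspace.dim F ((coord_space F n)\<lparr>carrier := W\<rparr>)"

definition scalar_mat :: "'a ring \<Rightarrow> nat \<Rightarrow> 'a \<Rightarrow> 'a matrix" where
  "scalar_mat F n c = (\<lambda>i\<in>{..<n}. \<lambda>j\<in>{..<n}. if i = j then c else \<zero>\<^bsub>F\<^esub>)"

definition mat_monoid :: "'a ring \<Rightarrow> nat \<Rightarrow> 'a matrix monoid" where
  "mat_monoid F n =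
     \<lparr>carrier = {..<n} \<rightarrow>\<^sub>E ({..<n} \<rightarrow>\<^sub>E carrier F),
      mult = (\<lambda>A B. \<lambda>i\<in>{..<n}. \<lambda>j\<in>{..<n}. \<Oplus>\<^bsub>F\<^esub>k\<in>{..<n}. A i k \<otimes>\<^bsub>F\<^esub> B k j),
      one = scalar_mat F n \<one>\<^bsub>F\<^esub>\<rparr>"

definition GL :: "'a ring \<Rightarrow> nat \<Rightarrow> 'a matrix monoid" where
  "GL F n = units_of (mat_monoid F n)"

definition mat_det :: "'a ring \<Rightarrow> nat \<Rightarrow> 'a matrix \<Rightarrow> 'a" where
  "mat_det F n A =
     (\<Oplus>\<^bsub>F\<^esub>\<pi>\<in>{\<pi>. \<pi> permutes {..<n}}.
        (if evenperm \<pi> then \<one>\<^bsub>F\<^esub> else \<ominus>\<^bsub>F\<^esub> \<one>\<^bsub>F\<^esub>) \<otimes>\<^bsub>F\<^esub> (\<Otimes>\<^bsub>F\<^esub>i\<in>{..<n}. A i (\<pi> i)))"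

definition SL_set :: "'a ring \<Rightarrow> nat \<Rightarrow> 'a matrix set" where
  "SL_set F n = {g \<in> carrier (GL F n). mat_det F n g = \<one>\<^bsub>F\<^esub>}"

text \<open>Groups act on row vectors from the right, as in the notation vg.\<close>

definition vec_mat :: "'a ring \<Rightarrow> nat \<Rightarrow> (nat \<Rightarrow> 'a) \<Rightarrow> 'a matrix \<Rightarrow> (nat \<Rightarrow> 'a)" where
  "vec_mat F n v g = (\<lambda>j\<in>{..<n}. \<Oplus>\<^bsub>F\<^esub>k\<in>{..<n}. v k \<otimes>\<^bsub>F\<^esub> g k j)"

section \<open>Forms and their isometry groups\<close>

text \<open>Sesquilinear with respect to a field automorphism \<sigma>; bilinear when \<sigma> is the identity.\<close>

definition sesquilinear_form ::
    "'a ring \<Rightarrow> nat \<Rightarrow> ('a \<Rightarrow> 'a) \<Rightarrow> ((nat \<Rightarrow> 'a) \<Rightarrow> (nat \<Rightarrow> 'a) \<Rightarrow> 'a) \<Rightarrow> bool" where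
  "sesquilinear_form F n \<sigma> f \<longleftrightarrow>
     (\<forall>u\<in>vecs F n. \<forall>v\<in>vecs F n. f u v \<in> carrier F) \<and>
     (\<forall>u\<in>vecs F n. \<forall>v\<in>vecs F n. \<forall>w\<in>vecs F n.
        f (u \<oplus>\<^bsub>coord_space F n\<^esub> v) w = f u w \<oplus>\<^bsub>F\<^esub> f v w \<and>
        f w (u \<oplus>\<^bsub>coord_space F n\<^esub> v) = f w u \<oplus>\<^bsub>F\<^esub> f w v) \<and>
     (\<forall>c\<in>carrier F. \<forall>u\<in>vecs F n. \<forall>v\<in>vecs F n.
        f (c \<odot>\<^bsub>coord_space F n\<^esub> u) v = c \<otimes>\<^bsub>F\<^esub> f u v \<and>
        f u (c \<odot>\<^bsub>coord_space F n\<^esub> v) = \<sigma> c \<otimes>\<^bsub>F\<^esub> f u v)"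

definition nondegenerate ::
    "'a ring \<Rightarrow> nat \<Rightarrow> ((nat \<Rightarrow> 'a) \<Rightarrow> (nat \<Rightarrow> 'a) \<Rightarrow> 'a) \<Rightarrow> bool" where
  "nondegenerate F n f \<longleftrightarrow>
     (\<forall>u\<in>vecs F n. (\<forall>v\<in>vecs F n. f u v = \<zero>\<^bsub>F\<^esub>) \<longrightarrow> u = \<zero>\<^bsub>coord_space F n\<^esub>)"

definition alternating_form ::
    "'a ring \<Rightarrow> nat \<Rightarrow> ((nat \<Rightarrow> 'a) \<Rightarrow> (nat \<Rightarrow> 'a) \<Rightarrow> 'a) \<Rightarrow> bool" where
  "alternating_form F n f \<longleftrightarrow>
     sesquilinear_form F n (\<lambda>c. c) f \<and> (\<forall>v\<in>vecs F n. f v v = \<zero>\<^bsub>F\<^esub>)"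

text \<open>Here F has \<open>q\<^sup>2\<close> elements, so that the q-th power map is its involution.\<close>

definition hermitian_form ::
    "'a ring \<Rightarrow> nat \<Rightarrow> nat \<Rightarrow> ((nat \<Rightarrow> 'a) \<Rightarrow> (nat \<Rightarrow> 'a) \<Rightarrow> 'a) \<Rightarrow> bool" where
  "hermitian_form F n q f \<longleftrightarrow>
     sesquilinear_form F n (\<lambda>c. c [^]\<^bsub>F\<^esub> q) f \<and>
     (\<forall>u\<in>vecs F n. \<forall>v\<in>vecs F n. f v u = (f u v) [^]\<^bsub>F\<^esub> q)"

definition polar_form ::
    "'a ring \<Rightarrow> nat \<Rightarrow> ((nat \<Rightarrow> 'a) \<Rightarrow> 'a) \<Rightarrow> (nat \<Rightarrow> 'a) \<Rightarrow> (nat \<Rightarrow> 'a) \<Rightarrow> 'a" where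
  "polar_form F n Q u v = Q (u \<oplus>\<^bsub>coord_space F n\<^esub> v) \<ominus>\<^bsub>F\<^esub> Q u \<ominus>\<^bsub>F\<^esub> Q v"

definition quadratic_form :: "'a ring \<Rightarrow> nat \<Rightarrow> ((nat \<Rightarrow> 'a) \<Rightarrow> 'a) \<Rightarrow> bool" where
  "quadratic_form F n Q \<longleftrightarrow>
     (\<forall>v\<in>vecs F n. Q v \<in> carrier F) \<and>
     (\<forall>c\<in>carrier F. \<forall>v\<in>vecs F n. Q (c \<odot>\<^bsub>coord_space F n\<^esub> v) = c \<otimes>\<^bsub>F\<^esub> c \<otimes>\<^bsub>F\<^esub> Q v) \<and>
     sesquilinear_form F n (\<lambda>c. c) (polar_form F n Q)"

text \<open>
  The usual notion of nondegeneracy for quadratic forms except in odd dimension over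
  fields of characteristic 2, a case which does not occur below.
\<close>

definition nondegenerate_quadratic_form ::
    "'a ring \<Rightarrow> nat \<Rightarrow> ((nat \<Rightarrow> 'a) \<Rightarrow> 'a) \<Rightarrow> bool" where
  "nondegenerate_quadratic_form F n Q \<longleftrightarrow>
     quadratic_form F n Q \<and> nondegenerate F n (polar_form F n Q)"

definition witt_index :: "'a ring \<Rightarrow> nat \<Rightarrow> ((nat \<Rightarrow> 'a) \<Rightarrow> 'a) \<Rightarrow> nat" where
  "witt_index F n Q =
     Max {subspace_dim F n W |W. subspace F W (coord_space F n) \<and> (\<forall>w\<in>W. Q w = \<zero>\<^bsub>F\<^esub>)}"

definition isometries ::
    "'a ring \<Rightarrow> nat \<Rightarrow> ((nat \<Rightarrow> 'a) \<Rightarrow> (nat \<Rightarrow> 'a) \<Rightarrow> 'a) \<Rightarrow> 'a matrix set" where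
  "isometries F n f =
     {g \<in> carrier (GL F n).
        \<forall>u\<in>vecs F n. \<forall>v\<in>vecs F n. f (vec_mat F n u g) (vec_mat F n v g) = f u v}"

definition orthogonal_set :: "'a ring \<Rightarrow> nat \<Rightarrow> ((nat \<Rightarrow> 'a) \<Rightarrow> 'a) \<Rightarrow> 'a matrix set" where
  "orthogonal_set F n Q =
     {g \<in> carrier (GL F n). \<forall>v\<in>vecs F n. Q (vec_mat F n v g) = Q v}"

text \<open>
  \<Omega> as the derived subgroup of the full orthogonal group. Over finite fields this agrees
  with the definition by spinor norm or quasideterminant, except in dimension 4, plus type,
  over the field of two elements.
\<close>

definition Omega_set :: "'a ring \<Rightarrow> nat \<Rightarrow> ((nat \<Rightarrow> 'a) \<Rightarrow> 'a) \<Rightarrow> 'a matrix set" where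
  "Omega_set F n Q = derived (GL F n) (orthogonal_set F n Q)"

section \<open>The finite simple classical groups\<close>

datatype classical_family =
  Linear | Unitary | Symplectic | Orthogonal_odd | Orthogonal_plus | Orthogonal_minus

text \<open>Below, F is the field of \<open>q ^ field_deg c\<close> elements over which the natural module is defined.\<close>

definition field_deg :: "classical_family \<Rightarrow> nat" where
  "field_deg c = (if c = Unitary then 2 else 1)"

definition a_const :: "classical_family \<Rightarrow> real" where
  "a_const c = (if c = Linear \<or> c = Unitary then 1 else 1/2)"

text \<open>
  The linear groups SL, SU, Sp and \<Omega>. Every nondegenerate form of the appropriate kind is
  allowed, not just a chosen standard one.
\<close>

fun is_linear_classical ::
    "classical_family \<Rightarrow> 'a ring \<Rightarrow> nat \<Rightarrow> nat \<Rightarrow> 'a matrix set \<Rightarrow> bool" where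
  "is_linear_classical Linear F n q H \<longleftrightarrow> H = SL_set F n"
| "is_linear_classical Unitary F n q H \<longleftrightarrow>
     (\<exists>f. hermitian_form F n q f \<and> nondegenerate F n f \<and> H = SL_set F n \<inter> isometries F n f)"
| "is_linear_classical Symplectic F n q H \<longleftrightarrow>
     (\<exists>f. alternating_form F n f \<and> nondegenerate F n f \<and> H = isometries F n f)"
| "is_linear_classical Orthogonal_odd F n q H \<longleftrightarrow>
     odd n \<and> odd q \<and> (\<exists>Q. nondegenerate_quadratic_form F n Q \<and> H = Omega_set F n Q)"
| "is_linear_classical Orthogonal_plus F n q H \<longleftrightarrow>
     even n \<and> (\<exists>Q. nondegenerate_quadratic_form F n Q \<and>
       witt_index F n Q = n div 2 \<and> H = Omega_set F n Q)"
| "is_linear_classical Orthogonal_minus F n q H \<longleftrightarrow>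
     even n \<and> (\<exists>Q. nondegenerate_quadratic_form F n Q \<and>
       witt_index F n Q = n div 2 - 1 \<and> H = Omega_set F n Q)"

definition scalars :: "'a ring \<Rightarrow> nat \<Rightarrow> 'a matrix set" where
  "scalars F n = scalar_mat F n ` (carrier F - {\<zero>\<^bsub>F\<^esub>})"

text \<open>
  The image of a subgroup H of GL in PGL. Its elements are full cosets of the group of
  scalars, so the members of such a coset are exactly its preimages in GL.
\<close>

definition proj_image :: "'a ring \<Rightarrow> nat \<Rightarrow> 'a matrix set \<Rightarrow> 'a matrix set monoid" where
  "proj_image F n H =
     (GL F n Mod scalars F n)\<lparr>carrier := (\<lambda>h. scalars F n #>\<^bsub>GL F n\<^esub> h) ` H\<rparr>"

definition simple_classical_group ::
    "classical_family \<Rightarrow> 'a ring \<Rightarrow> nat \<Rightarrow> nat \<Rightarrow> 'a matrix set monoid \<Rightarrow> bool" where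
  "simple_classical_group c F n q G \<longleftrightarrow>
     simple_group G \<and> (\<exists>H. is_linear_classical c F n q H \<and> G = proj_image F n H)"

section \<open>Conjugacy classes and support\<close>

definition conj_class :: "'g monoid \<Rightarrow> 'g \<Rightarrow> 'g set" where
  "conj_class G x = (\<lambda>g. inv\<^bsub>G\<^esub> g \<otimes>\<^bsub>G\<^esub> x \<otimes>\<^bsub>G\<^esub> g) ` carrier G"

definition comm_space :: "'a ring \<Rightarrow> nat \<Rightarrow> 'a matrix \<Rightarrow> (nat \<Rightarrow> 'a) set" where
  "comm_space L n g = (\<lambda>v. vec_mat L n v g \<ominus>\<^bsub>coord_space L n\<^esub> v) ` vecs L n"

text \<open>
  The support of a matrix g over a subfield of the algebraically closed field L; the space
  V tensored up to L is the coordinate space over L.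
\<close>

definition support :: "'a ring \<Rightarrow> nat \<Rightarrow> 'a matrix \<Rightarrow> nat" where
  "support L n g =
     Min ((\<lambda>c. subspace_dim L n (comm_space L n (scalar_mat L n c \<otimes>\<^bsub>mat_monoid L n\<^esub> g)))
          ` (carrier L - {\<zero>\<^bsub>L\<^esub>}))"

end

theory Submission
  imports "Jordan_Normal_Form.Determinant" Defs
begin

text \<open>
  Let h be a preimage of x. Call a totally singular subspace E good if
  (e, e') \<mapsto> f (e h) e' is nondegenerate on E, where f is the invariant form (for the special linear
  groups there is no form, and one uses a subspace E together with a subspace D of the dual space).
  Products of transvections, or of Siegel transformations, with centres in E then give about
  \<open>Q ^ (m (n - 2 m))\<close> elements, m = dim E (twice the exponent for SL), whose conjugates of h are
  pairwise not proportional. Hence a small class forces every good subspace to be small, and the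
  maximality of a good subspace forces h to agree with a scalar c on a subspace of codimension at most
  3 m. So the codimension r of the c-eigenspace is a small fraction of n; it is the support of x. There is
  then a good subspace of dimension exactly r, which gives the lower bound, and a conjugate of h is
  determined by r vectors (and r functionals for SL), which gives the upper bound.
\<close>

section \<open>Counting in finite vector spaces\<close>

text \<open>Two difficulties shape the argument. First, singular vectors do not form a subspace. In
  the groups with a form, E may only be enlarged by singular vectors, so its maximality speaks only
  about h on singular vectors; it is carried over to all vectors because a large enough subspace is
  generated by its singular vectors. This costs a bounded number of dimensions, which is where the
  additive constants come from. Second, classes live in the projective group, so conjugates of h
  must be separated up to a scalar; a nonzero good pair forces that scalar to be 1. The special
  linear group is put in the same frame by the dot product, which it does not preserve and which
  only turns functionals into vectors. Cardinalities replace dimensions: with Q = |F| every subspace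
  has Q-power order, and rank-nullity, annihilators and complements become identities between
  products. For unitary groups Q is the square of q, which is why an exponent of about n r in base Q
  means 2 n r in base q there, and n r for the other groups with a form.\<close>

lemma card_fibres_eq:
  assumes "finite A" "\<And>x. x \<in> A \<Longrightarrow> card {y \<in> A. f y = f x} = k"
  shows "card A = k * card (f ` A)"
proof -
  have "card A = (\<Sum>b\<in>f ` A. card {y \<in> A. f y = b})"
    using sum.image_gen[OF assms(1), of "\<lambda>_. 1::nat" f] by simp
  also have "\<dots> = (\<Sum>b\<in>f ` A. k)" by (rule sum.cong) (auto simp: assms(2))
  finally show ?thesis by simp
qed

lemma card_fibres_le:
  assumes "finite A" "\<And>x. x \<in> A \<Longrightarrow> card {y \<in> A. f y = f x} \<le> k"
  shows "card A \<le> k * card (f ` A)"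
proof -
  have "card A = (\<Sum>b\<in>f ` A. card {y \<in> A. f y = b})"
    using sum.image_gen[OF assms(1), of "\<lambda>_. 1::nat" f] by simp
  also have "\<dots> \<le> (\<Sum>b\<in>f ` A. k)" by (rule sum_mono) (auto simp: assms(2))
  finally show ?thesis by (simp add: mult.commute)
qed

section \<open>Subspaces, sums and lines in a vector space\<close>

locale vspace = vectorspace F V for F (structure) and V (structure)
begin

abbreviation sub :: "'c set \<Rightarrow> bool" where "sub U \<equiv> subspace F U V"

definition adj :: "'c set \<Rightarrow> 'c \<Rightarrow> 'c set" where
  "adj U y = (\<lambda>(x, c). x \<oplus>\<^bsub>V\<^esub> c \<odot>\<^bsub>V\<^esub> y) ` (U \<times> carrier F)"

definition plus_sub :: "'c set \<Rightarrow> 'c set \<Rightarrow> 'c set" where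
  "plus_sub U Y = (\<lambda>(x, y). x \<oplus>\<^bsub>V\<^esub> y) ` (U \<times> Y)"

lemma subI:
  assumes "U \<subseteq> carrier V" "\<zero>\<^bsub>V\<^esub> \<in> U" "\<And>x y. x \<in> U \<Longrightarrow> y \<in> U \<Longrightarrow> x \<oplus>\<^bsub>V\<^esub> y \<in> U"
    "\<And>c x. c \<in> carrier F \<Longrightarrow> x \<in> U \<Longrightarrow> c \<odot>\<^bsub>V\<^esub> x \<in> U"
  shows "sub U"
  using assms vectorspace_axioms module_axioms
  by (auto simp: VectorSpace.subspace_def LinearCombinations.submodule_def)

lemma
  assumes "sub U"
  shows sub_subset: "U \<subseteq> carrier V"
    and sub_in: "\<And>x. x \<in> U \<Longrightarrow> x \<in> carrier V"
    and sub_zero: "\<zero>\<^bsub>V\<^esub> \<in> U"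
    and sub_add: "\<And>x y. x \<in> U \<Longrightarrow> y \<in> U \<Longrightarrow> x \<oplus>\<^bsub>V\<^esub> y \<in> U"
    and sub_smult: "\<And>c x. c \<in> carrier F \<Longrightarrow> x \<in> U \<Longrightarrow> c \<odot>\<^bsub>V\<^esub> x \<in> U"
  using assms by (auto simp: VectorSpace.subspace_def LinearCombinations.submodule_def)

lemma sub_neg:
  assumes "sub U" "x \<in> U" shows "\<ominus>\<^bsub>V\<^esub> x \<in> U"
  using smult_minus_1[OF sub_in[OF assms]] sub_smult[OF assms(1) _ assms(2), of "\<ominus> \<one>"] by simp

lemma sub_minus:
  assumes "sub U" "x \<in> U" "y \<in> U" shows "x \<ominus>\<^bsub>V\<^esub> y \<in> U"
  unfolding a_minus_def using assms sub_neg sub_add by blast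

lemma sub_carrier: "sub (carrier V)"
  by (rule subI) auto

lemma sub_triv: "sub {\<zero>\<^bsub>V\<^esub>}"
  by (rule subI) auto

lemma sub_Int: "sub U \<Longrightarrow> sub Y \<Longrightarrow> sub (U \<inter> Y)"
  by (rule subI) (auto simp: sub_in sub_zero sub_add sub_smult)

lemma minus_in_carrier: "x \<in> carrier V \<Longrightarrow> y \<in> carrier V \<Longrightarrow> x \<ominus>\<^bsub>V\<^esub> y \<in> carrier V"
  by simp

text \<open>Sorting sums by associativity and commutativity can leave one or two summands between
  \<open>x\<close> and its negative; these rules cancel across the gap.\<close>

lemma vec_cancel:
  assumes "x \<in> carrier V" "y \<in> carrier V" "z \<in> carrier V" "w \<in> carrier V"
  shows "x \<oplus>\<^bsub>V\<^esub> (y \<oplus>\<^bsub>V\<^esub> \<ominus>\<^bsub>V\<^esub> x) = y"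
    "x \<oplus>\<^bsub>V\<^esub> (y \<oplus>\<^bsub>V\<^esub> (\<ominus>\<^bsub>V\<^esub> x \<oplus>\<^bsub>V\<^esub> z)) = y \<oplus>\<^bsub>V\<^esub> z"
    "x \<oplus>\<^bsub>V\<^esub> (y \<oplus>\<^bsub>V\<^esub> (z \<oplus>\<^bsub>V\<^esub> \<ominus>\<^bsub>V\<^esub> x)) = y \<oplus>\<^bsub>V\<^esub> z"
    "x \<oplus>\<^bsub>V\<^esub> (y \<oplus>\<^bsub>V\<^esub> (z \<oplus>\<^bsub>V\<^esub> (\<ominus>\<^bsub>V\<^esub> x \<oplus>\<^bsub>V\<^esub> w))) = y \<oplus>\<^bsub>V\<^esub> (z \<oplus>\<^bsub>V\<^esub> w)"
proof -
  have *: "x \<oplus>\<^bsub>V\<^esub> (a \<oplus>\<^bsub>V\<^esub> \<ominus>\<^bsub>V\<^esub> x) = a" if "a \<in> carrier V" for a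
    using that assms by (metis M.a_comm M.a_inv_closed M.r_neg2)
  show "x \<oplus>\<^bsub>V\<^esub> (y \<oplus>\<^bsub>V\<^esub> \<ominus>\<^bsub>V\<^esub> x) = y" using * assms by simp
  have **: "x \<oplus>\<^bsub>V\<^esub> (a \<oplus>\<^bsub>V\<^esub> (\<ominus>\<^bsub>V\<^esub> x \<oplus>\<^bsub>V\<^esub> b)) = a \<oplus>\<^bsub>V\<^esub> b" if "a \<in> carrier V" "b \<in> carrier V" for a b
    using that assms *[of "a \<oplus>\<^bsub>V\<^esub> b"] by (simp add: M.a_assoc M.a_comm[of "\<ominus>\<^bsub>V\<^esub> x" b])
  show "x \<oplus>\<^bsub>V\<^esub> (y \<oplus>\<^bsub>V\<^esub> (\<ominus>\<^bsub>V\<^esub> x \<oplus>\<^bsub>V\<^esub> z)) = y \<oplus>\<^bsub>V\<^esub> z" using ** assms by simp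
  show "x \<oplus>\<^bsub>V\<^esub> (y \<oplus>\<^bsub>V\<^esub> (z \<oplus>\<^bsub>V\<^esub> \<ominus>\<^bsub>V\<^esub> x)) = y \<oplus>\<^bsub>V\<^esub> z"
    using *[of "y \<oplus>\<^bsub>V\<^esub> z"] assms by (simp add: M.a_assoc)
  show "x \<oplus>\<^bsub>V\<^esub> (y \<oplus>\<^bsub>V\<^esub> (z \<oplus>\<^bsub>V\<^esub> (\<ominus>\<^bsub>V\<^esub> x \<oplus>\<^bsub>V\<^esub> w))) = y \<oplus>\<^bsub>V\<^esub> (z \<oplus>\<^bsub>V\<^esub> w)"
    using **[of "y \<oplus>\<^bsub>V\<^esub> z" w] assms by (simp add: M.a_assoc)
qed

lemmas vec_simps = a_minus_def M.minus_add M.a_ac M.r_neg M.r_neg1 M.r_neg2 M.l_neg vec_cancel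

lemma add_minus_cancel:
  assumes "x \<in> carrier V" "y \<in> carrier V"
  shows "(x \<oplus>\<^bsub>V\<^esub> y) \<ominus>\<^bsub>V\<^esub> x = y" "(x \<oplus>\<^bsub>V\<^esub> y) \<ominus>\<^bsub>V\<^esub> y = x" "(x \<ominus>\<^bsub>V\<^esub> y) \<oplus>\<^bsub>V\<^esub> y = x"
    "x \<oplus>\<^bsub>V\<^esub> (y \<ominus>\<^bsub>V\<^esub> x) = y"
  using assms by (auto simp: vec_simps)

lemma minus_eq_zero_iff:
  assumes "x \<in> carrier V" "y \<in> carrier V"
  shows "x \<ominus>\<^bsub>V\<^esub> y = \<zero>\<^bsub>V\<^esub> \<longleftrightarrow> x = y"
  using assms by simp

lemma smult_in_sub_iff:
  assumes "sub U" "c \<in> carrier F" "c \<noteq> \<zero>" "x \<in> carrier V"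
  shows "c \<odot>\<^bsub>V\<^esub> x \<in> U \<longleftrightarrow> x \<in> U"
proof
  assume "c \<odot>\<^bsub>V\<^esub> x \<in> U"
  moreover have i: "inv c \<in> carrier F" "inv c \<otimes> c = \<one>"
    using assms by (auto simp: field_Units)
  ultimately have "inv c \<odot>\<^bsub>V\<^esub> (c \<odot>\<^bsub>V\<^esub> x) \<in> U"
    using sub_smult[OF assms(1)] by blast
  moreover have "inv c \<odot>\<^bsub>V\<^esub> (c \<odot>\<^bsub>V\<^esub> x) = x"
    using i assms smult_assoc1[of "inv c" c x] by simp
  ultimately show "x \<in> U" by simp
qed (use assms sub_smult in auto)

lemma smult_eq_zero_iff:
  assumes "c \<in> carrier F" "x \<in> carrier V"
  shows "c \<odot>\<^bsub>V\<^esub> x = \<zero>\<^bsub>V\<^esub> \<longleftrightarrow> c = \<zero> \<or> x = \<zero>\<^bsub>V\<^esub>"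
  using smult_in_sub_iff[OF sub_triv assms(1) _ assms(2)] assms by auto

lemma in_adj_iff: "z \<in> adj U y \<longleftrightarrow> (\<exists>x\<in>U. \<exists>c\<in>carrier F. z = x \<oplus>\<^bsub>V\<^esub> c \<odot>\<^bsub>V\<^esub> y)"
  by (auto simp: adj_def)

lemma in_plus_sub_iff: "z \<in> plus_sub U Y \<longleftrightarrow> (\<exists>x\<in>U. \<exists>y\<in>Y. z = x \<oplus>\<^bsub>V\<^esub> y)"
  by (auto simp: plus_sub_def)

lemma sub_plus:
  assumes "sub U" "sub Y" shows "sub (plus_sub U Y)"
proof (rule subI)
  show "plus_sub U Y \<subseteq> carrier V"
    using assms sub_in by (auto simp: plus_sub_def)
  show "\<zero>\<^bsub>V\<^esub> \<in> plus_sub U Y"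
    unfolding in_plus_sub_iff
    by (rule bexI[OF _ sub_zero[OF assms(1)]], rule bexI[OF _ sub_zero[OF assms(2)]]) auto
next
  fix a b assume "a \<in> plus_sub U Y" "b \<in> plus_sub U Y"
  then obtain x y x' y' where h: "x \<in> U" "y \<in> Y" "x' \<in> U" "y' \<in> Y"
    "a = x \<oplus>\<^bsub>V\<^esub> y" "b = x' \<oplus>\<^bsub>V\<^esub> y'" by (auto simp: in_plus_sub_iff)
  then have "a \<oplus>\<^bsub>V\<^esub> b = (x \<oplus>\<^bsub>V\<^esub> x') \<oplus>\<^bsub>V\<^esub> (y \<oplus>\<^bsub>V\<^esub> y')"
    using assms sub_in by (simp add: M.a_ac)
  then show "a \<oplus>\<^bsub>V\<^esub> b \<in> plus_sub U Y"
    using h assms sub_add unfolding in_plus_sub_iff by blast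
next
  fix c a assume c: "c \<in> carrier F" and "a \<in> plus_sub U Y"
  then obtain x y where h: "x \<in> U" "y \<in> Y" "a = x \<oplus>\<^bsub>V\<^esub> y" by (auto simp: in_plus_sub_iff)
  then have "c \<odot>\<^bsub>V\<^esub> a = c \<odot>\<^bsub>V\<^esub> x \<oplus>\<^bsub>V\<^esub> c \<odot>\<^bsub>V\<^esub> y"
    using c assms sub_in by (simp add: smult_r_distr)
  then show "c \<odot>\<^bsub>V\<^esub> a \<in> plus_sub U Y"
    using h c assms sub_smult unfolding in_plus_sub_iff by blast
qed

lemma plus_sub_upper:
  assumes "sub U" "sub Y" shows "U \<subseteq> plus_sub U Y" "Y \<subseteq> plus_sub U Y"
proof -
  show "U \<subseteq> plus_sub U Y"
  proof
    fix x assume "x \<in> U"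
    then show "x \<in> plus_sub U Y" unfolding in_plus_sub_iff
      using sub_zero[OF assms(2)] sub_in[OF assms(1)] by (metis M.r_zero)
  qed
  show "Y \<subseteq> plus_sub U Y"
  proof
    fix x assume "x \<in> Y"
    then show "x \<in> plus_sub U Y" unfolding in_plus_sub_iff
      using sub_zero[OF assms(1)] sub_in[OF assms(2)] by (metis M.l_zero)
  qed
qed

lemma plus_sub_least: "sub Z \<Longrightarrow> U \<subseteq> Z \<Longrightarrow> Y \<subseteq> Z \<Longrightarrow> plus_sub U Y \<subseteq> Z"
  by (auto simp: plus_sub_def intro!: sub_add)

definition line :: "'c \<Rightarrow> 'c set" where "line y = (\<lambda>c. c \<odot>\<^bsub>V\<^esub> y) ` carrier F"

lemma sub_line: "y \<in> carrier V \<Longrightarrow> sub (line y)"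
proof (rule subI)
  assume y: "y \<in> carrier V"
  show "line y \<subseteq> carrier V" using y by (auto simp: line_def)
  show "\<zero>\<^bsub>V\<^esub> \<in> line y" using y by (auto simp: line_def intro!: image_eqI[of _ _ \<zero>])
  show "a \<oplus>\<^bsub>V\<^esub> b \<in> line y" if "a \<in> line y" "b \<in> line y" for a b
    using that y by (auto simp: line_def smult_l_distr[symmetric])
  show "c \<odot>\<^bsub>V\<^esub> a \<in> line y" if "c \<in> carrier F" "a \<in> line y" for c a
    using that y by (auto simp: line_def smult_assoc1[symmetric])
qed

lemma adj_eq_plus_line: "adj U y = plus_sub U (line y)"
  by (auto simp: adj_def plus_sub_def line_def)

lemma sub_adj: "sub U \<Longrightarrow> y \<in> carrier V \<Longrightarrow> sub (adj U y)"
  unfolding adj_eq_plus_line by (intro sub_plus sub_line)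

lemma line_self: "y \<in> carrier V \<Longrightarrow> y \<in> line y"
  by (auto simp: line_def intro!: image_eqI[of _ _ \<one>])

lemma adj_upper:
  assumes "sub U" "y \<in> carrier V" shows "U \<subseteq> adj U y" "y \<in> adj U y"
  using plus_sub_upper[OF assms(1) sub_line[OF assms(2)]] line_self[OF assms(2)]
  by (auto simp: adj_eq_plus_line)

lemma line_least: "sub Z \<Longrightarrow> y \<in> Z \<Longrightarrow> line y \<subseteq> Z"
  by (auto simp: line_def sub_smult)

lemma adj_least: "sub Z \<Longrightarrow> U \<subseteq> Z \<Longrightarrow> y \<in> Z \<Longrightarrow> adj U y \<subseteq> Z"
  unfolding adj_eq_plus_line by (intro plus_sub_least line_least)

lemma add_eq_add_imp:
  assumes "x \<in> carrier V" "y \<in> carrier V" "x' \<in> carrier V" "y' \<in> carrier V"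
    "x \<oplus>\<^bsub>V\<^esub> y = x' \<oplus>\<^bsub>V\<^esub> y'"
  shows "x \<ominus>\<^bsub>V\<^esub> x' = y' \<ominus>\<^bsub>V\<^esub> y"
proof -
  have "x = (x' \<oplus>\<^bsub>V\<^esub> y') \<ominus>\<^bsub>V\<^esub> y" using assms add_minus_cancel by metis
  then have "x \<ominus>\<^bsub>V\<^esub> x' = ((x' \<oplus>\<^bsub>V\<^esub> y') \<ominus>\<^bsub>V\<^esub> y) \<ominus>\<^bsub>V\<^esub> x'" by simp
  also have "\<dots> = y' \<ominus>\<^bsub>V\<^esub> y" using assms
    by (simp add: vec_simps)
  finally show ?thesis .
qed

lemma line_Int:
  assumes "sub U" "y \<in> carrier V" "y \<notin> U" shows "U \<inter> line y = {\<zero>\<^bsub>V\<^esub>}"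
proof
  show "U \<inter> line y \<subseteq> {\<zero>\<^bsub>V\<^esub>}"
  proof
    fix z assume "z \<in> U \<inter> line y"
    then obtain c where "c \<in> carrier F" "z = c \<odot>\<^bsub>V\<^esub> y" "z \<in> U" by (auto simp: line_def)
    then show "z \<in> {\<zero>\<^bsub>V\<^esub>}" using smult_in_sub_iff[OF assms(1) _ _ assms(2)] assms by (cases "c = \<zero>") auto
  qed
qed (use assms sub_zero sub_line in auto)

definition linear_on :: "'c set \<Rightarrow> ('c \<Rightarrow> 'a) \<Rightarrow> bool" where
  "linear_on Y \<phi> \<longleftrightarrow> \<phi> \<in> Y \<rightarrow> carrier F \<and> (\<forall>x\<in>Y. \<forall>y\<in>Y. \<phi> (x \<oplus>\<^bsub>V\<^esub> y) = \<phi> x \<oplus> \<phi> y)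
     \<and> (\<forall>c\<in>carrier F. \<forall>x\<in>Y. \<phi> (c \<odot>\<^bsub>V\<^esub> x) = c \<otimes> \<phi> x)"

lemma sub_linear_kernel:
  assumes "sub Y" "linear_on Y \<phi>" shows "sub {y \<in> Y. \<phi> y = \<zero>}"
proof (rule subI)
  have z: "\<zero>\<^bsub>V\<^esub> \<in> Y" using assms sub_zero by auto
  have "\<phi> (\<zero> \<odot>\<^bsub>V\<^esub> \<zero>\<^bsub>V\<^esub>) = \<zero> \<otimes> \<phi> \<zero>\<^bsub>V\<^esub>"
    using assms(2) z R.zero_closed unfolding linear_on_def by blast
  then show "\<zero>\<^bsub>V\<^esub> \<in> {y \<in> Y. \<phi> y = \<zero>}" using assms sub_zero by (auto simp: linear_on_def Pi_iff)
qed (use assms in \<open>auto simp: linear_on_def sub_in sub_add sub_smult\<close>)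

end

section \<open>Counting by powers of the field size\<close>

locale finite_vectorspace = vspace F V for F (structure) and V (structure) +
  assumes finite_F: "finite (carrier F)" and finite_V: "finite (carrier V)"
begin

definition Q :: nat where "Q = card (carrier F)"

lemma Q_ge_2: "Q \<ge> 2"
proof -
  have "card {\<zero>, \<one>} \<le> Q" unfolding Q_def by (intro card_mono) (auto simp: finite_F)
  then show ?thesis by simp
qed

lemma sub_finite: "sub U \<Longrightarrow> finite U"
  using sub_subset finite_V finite_subset by blast

lemma sub_card_pos: "sub U \<Longrightarrow> card U > 0"
  using sub_finite sub_zero by (auto simp: card_gt_0_iff)

lemma card_plus_direct:
  assumes "sub U" "sub Y" "U \<inter> Y = {\<zero>\<^bsub>V\<^esub>}"
  shows "card (plus_sub U Y) = card U * card Y"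
proof -
  have "inj_on (\<lambda>(x, y). x \<oplus>\<^bsub>V\<^esub> y) (U \<times> Y)"
  proof (rule inj_onI, clarify)
    fix x y x' y' assume h: "x \<in> U" "y \<in> Y" "x' \<in> U" "y' \<in> Y" "x \<oplus>\<^bsub>V\<^esub> y = x' \<oplus>\<^bsub>V\<^esub> y'"
    then have e: "x \<ominus>\<^bsub>V\<^esub> x' = y' \<ominus>\<^bsub>V\<^esub> y" using assms sub_in by (intro add_eq_add_imp) auto
    moreover have "x \<ominus>\<^bsub>V\<^esub> x' \<in> U" "y' \<ominus>\<^bsub>V\<^esub> y \<in> Y" using h assms sub_minus by auto
    ultimately have "x \<ominus>\<^bsub>V\<^esub> x' = \<zero>\<^bsub>V\<^esub>" "y' \<ominus>\<^bsub>V\<^esub> y = \<zero>\<^bsub>V\<^esub>" using assms(3) by auto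
    then show "x = x' \<and> y = y'" using h assms sub_in minus_eq_zero_iff by metis
  qed
  then show ?thesis unfolding plus_sub_def by (simp add: card_image card_cartesian_product)
qed

lemma card_plus_le:
  assumes "sub U" "sub Y" shows "card (plus_sub U Y) \<le> card U * card Y"
  unfolding plus_sub_def using assms sub_finite
  by (metis card_cartesian_product card_image_le finite_cartesian_product)

lemma card_line_le: "card (line y) \<le> Q"
  unfolding line_def Q_def by (rule card_image_le[OF finite_F])

lemma card_line:
  assumes "y \<in> carrier V" "y \<noteq> \<zero>\<^bsub>V\<^esub>" shows "card (line y) = Q"
proof -
  have "inj_on (\<lambda>c. c \<odot>\<^bsub>V\<^esub> y) (carrier F)"
  proof (rule inj_onI)
    fix a b assume h: "a \<in> carrier F" "b \<in> carrier F" "a \<odot>\<^bsub>V\<^esub> y = b \<odot>\<^bsub>V\<^esub> y"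
    then have "(a \<ominus> b) \<odot>\<^bsub>V\<^esub> y = \<zero>\<^bsub>V\<^esub>" using assms
      by (simp add: a_minus_def smult_l_distr smult_l_minus M.r_neg)
    then have "a \<ominus> b = \<zero>" using smult_eq_zero_iff assms h by auto
    then show "a = b" using h by simp
  qed
  then show ?thesis unfolding line_def Q_def by (rule card_image)
qed

lemma card_adj:
  assumes "sub U" "y \<in> carrier V" "y \<notin> U" shows "card (adj U y) = Q * card U"
proof -
  have "y \<noteq> \<zero>\<^bsub>V\<^esub>" using assms sub_zero by auto
  then show ?thesis
    unfolding adj_eq_plus_line
    by (simp add: card_plus_direct[OF assms(1) sub_line line_Int] card_line assms)
qed

text \<open>Adjoining a vector outside \<open>U\<close> multiplies the cardinality by
  \<open>Q\<close>, so growth inside the finite \<open>Y\<close> must stop. This is induction on the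
  dimension without choosing a basis.\<close>

lemma subspace_induct_from [consumes 3, case_names base adj]:
  assumes "sub X0" "sub Y" "X0 \<subseteq> Y" "P X0"
    and step: "\<And>U y. sub U \<Longrightarrow> X0 \<subseteq> U \<Longrightarrow> U \<subseteq> Y \<Longrightarrow> P U \<Longrightarrow> y \<in> Y \<Longrightarrow> y \<notin> U \<Longrightarrow> P (adj U y)"
  shows "P Y"
proof -
  have "P Y" if "sub U" "X0 \<subseteq> U" "U \<subseteq> Y" "P U" for U
    using that
  proof (induction "card Y - card U" arbitrary: U rule: less_induct)
    case less
    show ?case
    proof (cases "U = Y")
      case False
      then obtain y where y: "y \<in> Y" "y \<notin> U" using less.prems by auto
      have yV: "y \<in> carrier V" using y assms sub_in by auto
      have s: "sub (adj U y)" "adj U y \<subseteq> Y" "X0 \<subseteq> adj U y"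
        using less.prems y yV assms adj_upper[OF less.prems(1) yV] adj_least[OF assms(2) less.prems(3) y(1)]
        by (auto intro!: sub_adj)
      have "card (adj U y) = Q * card U" using card_adj less.prems y yV by auto
      moreover have "card U > 0" using sub_card_pos less.prems by auto
      ultimately have "card (adj U y) > card U" using Q_ge_2 by auto
      moreover have "card (adj U y) \<le> card Y" using s assms sub_finite card_mono by metis
      ultimately have "card Y - card (adj U y) < card Y - card U" by auto
      then show ?thesis using less.hyps s step less.prems y by auto
    qed (use less in auto)
  qed
  then show ?thesis using assms by auto
qed

lemma subspace_induct [consumes 1, case_names zero adj]:
  assumes "sub Y" "P {\<zero>\<^bsub>V\<^esub>}"
    and "\<And>U y. sub U \<Longrightarrow> U \<subseteq> Y \<Longrightarrow> P U \<Longrightarrow> y \<in> Y \<Longrightarrow> y \<notin> U \<Longrightarrow> P (adj U y)"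
  shows "P Y"
  using sub_triv assms(1) _ assms(2)
  by (rule subspace_induct_from) (use assms sub_zero in auto)

lemma card_sub_power:
  assumes "sub Y" shows "\<exists>k. card Y = Q ^ k"
  using assms
proof (induction rule: subspace_induct)
  case zero
  show ?case by (rule exI[of _ 0]) simp
next
  case (adj U y)
  then obtain k where "card U = Q ^ k" by blast
  then have "card (adj U y) = Q ^ Suc k"
    using card_adj[of U y] adj sub_in[OF assms] by simp
  then show ?case by blast
qed

text \<open>Along a chain from \<open>U\<close> to \<open>Y\<close> the complement grows by the same
  vector that the chain adjoins.\<close>

lemma complement_exists:
  assumes "sub U" "sub Y" "U \<subseteq> Y"
  shows "\<exists>Z. sub Z \<and> Z \<subseteq> Y \<and> U \<inter> Z = {\<zero>\<^bsub>V\<^esub>} \<and> plus_sub U Z = Y"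
  using assms
proof (induction rule: subspace_induct_from)
  case base
  show ?case
    using assms sub_triv sub_zero sub_in
    by (intro exI[of _ "{\<zero>\<^bsub>V\<^esub>}"]) (auto simp: plus_sub_def image_iff)
next
  case (adj A y)
  then obtain Z where Z: "sub Z" "Z \<subseteq> A" "U \<inter> Z = {\<zero>\<^bsub>V\<^esub>}" "plus_sub U Z = A" using assms by auto
  have y: "y \<in> carrier V" using adj assms sub_in by auto
  have "y \<notin> Z" using adj Z by auto
  have 1: "U \<inter> adj Z y = {\<zero>\<^bsub>V\<^esub>}"
  proof
    show "U \<inter> adj Z y \<subseteq> {\<zero>\<^bsub>V\<^esub>}"
    proof
      fix x assume "x \<in> U \<inter> adj Z y"
      then obtain z c where h: "z \<in> Z" "c \<in> carrier F" "x = z \<oplus>\<^bsub>V\<^esub> c \<odot>\<^bsub>V\<^esub> y" "x \<in> U"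
        by (auto simp: in_adj_iff)
      have zV: "z \<in> carrier V" "x \<in> carrier V" using h Z assms sub_in by auto
      have "c \<odot>\<^bsub>V\<^esub> y = x \<ominus>\<^bsub>V\<^esub> z" using h zV y add_minus_cancel by simp
      moreover have "x \<in> A" "z \<in> A" using h Z adj by auto
      ultimately have "c \<odot>\<^bsub>V\<^esub> y \<in> A" using sub_minus adj by auto
      then have "c = \<zero>" using smult_in_sub_iff[OF adj(1) h(2) _ y] adj by auto
      then have "x = z" using h y zV by simp
      then show "x \<in> {\<zero>\<^bsub>V\<^esub>}" using h Z by auto
    qed
  qed (use assms Z y sub_zero sub_adj in auto)
  have 2: "plus_sub U (adj Z y) = adj A y"
  proof
    have "U \<subseteq> A" "Z \<subseteq> A" using Z adj by auto
    then show "plus_sub U (adj Z y) \<subseteq> adj A y"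
      using adj y adj_upper[OF adj(1) y] sub_adj by (intro plus_sub_least adj_least) auto
    have s: "sub (plus_sub U (adj Z y))" using assms Z y sub_adj sub_plus by auto
    have u: "U \<subseteq> plus_sub U (adj Z y)" "adj Z y \<subseteq> plus_sub U (adj Z y)"
      using plus_sub_upper[OF assms(1) sub_adj[OF Z(1) y]] by auto
    have "Z \<subseteq> adj Z y" "y \<in> adj Z y" using adj_upper[OF Z(1) y] by auto
    then have "A \<subseteq> plus_sub U (adj Z y)" using plus_sub_least[OF s u(1), of Z] u Z(4) by auto
    then show "adj A y \<subseteq> plus_sub U (adj Z y)" using s u \<open>y \<in> adj Z y\<close> by (intro adj_least) auto
  qed
  have "adj Z y \<subseteq> adj A y" using Z adj y adj_upper[OF adj(1) y] sub_adj by (intro adj_least) auto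
  then show ?case using 1 2 sub_adj[OF Z(1) y] by auto
qed

text \<open>A translation carries every fibre of a functional into the kernel, and there are at most
  \<open>Q\<close> fibres.\<close>

lemma card_kernel_ge:
  assumes "sub Y" "linear_on Y \<phi>"
  shows "card Y \<le> Q * card {y \<in> Y. \<phi> y = \<zero>}"
proof -
  let ?K = "{y \<in> Y. \<phi> y = \<zero>}"
  have neg: "\<phi> (\<ominus>\<^bsub>V\<^esub> x) = \<ominus> \<phi> x" if "x \<in> Y" for x
  proof -
    have "\<phi> ((\<ominus> \<one>) \<odot>\<^bsub>V\<^esub> x) = (\<ominus> \<one>) \<otimes> \<phi> x" using assms that by (auto simp: linear_on_def)
    then show ?thesis using that assms sub_in smult_minus_1[of x]
      by (auto simp: linear_on_def Pi_iff l_minus)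
  qed
  have "card {y \<in> Y. \<phi> y = \<phi> x} \<le> card ?K" if x: "x \<in> Y" for x
  proof (rule card_inj_on_le[of "\<lambda>y. y \<ominus>\<^bsub>V\<^esub> x"])
    show "inj_on (\<lambda>y. y \<ominus>\<^bsub>V\<^esub> x) {y \<in> Y. \<phi> y = \<phi> x}"
      using x assms(1) sub_in by (intro inj_onI) (metis (mono_tags, lifting) add_minus_cancel(3) mem_Collect_eq)
    show "(\<lambda>y. y \<ominus>\<^bsub>V\<^esub> x) ` {y \<in> Y. \<phi> y = \<phi> x} \<subseteq> ?K"
    proof clarify
      fix y assume y: "y \<in> Y" "\<phi> y = \<phi> x"
      have "\<phi> (y \<oplus>\<^bsub>V\<^esub> (\<ominus>\<^bsub>V\<^esub> x)) = \<phi> y \<oplus> \<phi> (\<ominus>\<^bsub>V\<^esub> x)"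
        using assms y x sub_neg by (auto simp: linear_on_def)
      also have "\<dots> = \<zero>" using neg x y assms by (auto simp: linear_on_def Pi_iff R.r_neg)
      finally show "y \<ominus>\<^bsub>V\<^esub> x \<in> Y \<and> \<phi> (y \<ominus>\<^bsub>V\<^esub> x) = \<zero>"
        using y x assms sub_minus by (auto simp: a_minus_def)
    qed
    show "finite ?K" using assms sub_finite by auto
  qed
  then have "card Y \<le> card ?K * card (\<phi> ` Y)"
    using assms sub_finite by (intro card_fibres_le) auto
  also have "card (\<phi> ` Y) \<le> Q" unfolding Q_def
    using assms by (intro card_mono finite_F) (auto simp: linear_on_def)
  finally show ?thesis by (simp add: mult.commute)
qed

lemma exists_not_in:
  assumes "sub U" "card U < card Y" shows "\<exists>y\<in>Y. y \<notin> U"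
  using assms sub_finite card_mono by (metis linorder_not_less subsetI)

end

section \<open>Linear maps, images and kernels\<close>

context vspace
begin

definition lin :: "('c \<Rightarrow> 'c) \<Rightarrow> bool" where
  "lin T \<longleftrightarrow> T \<in> carrier V \<rightarrow> carrier V
     \<and> (\<forall>x\<in>carrier V. \<forall>y\<in>carrier V. T (x \<oplus>\<^bsub>V\<^esub> y) = T x \<oplus>\<^bsub>V\<^esub> T y)
     \<and> (\<forall>c\<in>carrier F. \<forall>x\<in>carrier V. T (c \<odot>\<^bsub>V\<^esub> x) = c \<odot>\<^bsub>V\<^esub> T x)"

lemma
  assumes "lin T"
  shows lin_closed: "\<And>x. x \<in> carrier V \<Longrightarrow> T x \<in> carrier V"
    and lin_add: "\<And>x y. x \<in> carrier V \<Longrightarrow> y \<in> carrier V \<Longrightarrow> T (x \<oplus>\<^bsub>V\<^esub> y) = T x \<oplus>\<^bsub>V\<^esub> T y"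
    and lin_smult: "\<And>c x. c \<in> carrier F \<Longrightarrow> x \<in> carrier V \<Longrightarrow> T (c \<odot>\<^bsub>V\<^esub> x) = c \<odot>\<^bsub>V\<^esub> T x"
  using assms by (auto simp: lin_def)

lemma lin_zero: "lin T \<Longrightarrow> T \<zero>\<^bsub>V\<^esub> = \<zero>\<^bsub>V\<^esub>"
  using lin_smult[of T \<zero> "\<zero>\<^bsub>V\<^esub>"] lin_closed[of T "\<zero>\<^bsub>V\<^esub>"] by simp

lemma lin_neg: "lin T \<Longrightarrow> x \<in> carrier V \<Longrightarrow> T (\<ominus>\<^bsub>V\<^esub> x) = \<ominus>\<^bsub>V\<^esub> T x"
  using lin_smult[of T "\<ominus> \<one>" x] lin_closed[of T x] by (simp add: smult_minus_1)

lemma lin_minus: "lin T \<Longrightarrow> x \<in> carrier V \<Longrightarrow> y \<in> carrier V \<Longrightarrow> T (x \<ominus>\<^bsub>V\<^esub> y) = T x \<ominus>\<^bsub>V\<^esub> T y"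
  by (simp add: a_minus_def lin_add lin_neg)

lemma sub_vimage: "lin T \<Longrightarrow> sub U \<Longrightarrow> sub {x \<in> carrier V. T x \<in> U}"
  by (rule subI) (auto simp: lin_zero lin_add lin_smult sub_zero sub_add sub_smult)

lemma sub_image:
  assumes "lin T" "sub U" shows "sub (T ` U)"
proof (rule subI)
  show "T ` U \<subseteq> carrier V" using assms sub_in lin_closed by auto
  show "\<zero>\<^bsub>V\<^esub> \<in> T ` U" using assms sub_zero lin_zero by (metis image_eqI)
  show "x \<oplus>\<^bsub>V\<^esub> y \<in> T ` U" if "x \<in> T ` U" "y \<in> T ` U" for x y
    using that assms sub_in sub_add by (auto simp: lin_add[symmetric])
  show "c \<odot>\<^bsub>V\<^esub> x \<in> T ` U" if "c \<in> carrier F" "x \<in> T ` U" for c x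
    using that assms sub_in sub_smult by (auto simp: lin_smult[symmetric])
qed

lemma lin_agree_sub:
  assumes "lin T" "lin T'" shows "sub {v \<in> carrier V. T v = T' v}"
  using assms by (intro subI) (auto simp: lin_zero lin_add lin_smult)

lemma lin_shift: "lin h \<Longrightarrow> c \<in> carrier F \<Longrightarrow> lin (\<lambda>v. h v \<ominus>\<^bsub>V\<^esub> c \<odot>\<^bsub>V\<^esub> v)"
proof -
  assume h: "lin h" and c: "c \<in> carrier F"
  have "a \<odot>\<^bsub>V\<^esub> (h x \<ominus>\<^bsub>V\<^esub> c \<odot>\<^bsub>V\<^esub> x) = a \<odot>\<^bsub>V\<^esub> h x \<ominus>\<^bsub>V\<^esub> c \<odot>\<^bsub>V\<^esub> (a \<odot>\<^bsub>V\<^esub> x)"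
    if "a \<in> carrier F" "x \<in> carrier V" for a x
  proof -
    have "c \<odot>\<^bsub>V\<^esub> (a \<odot>\<^bsub>V\<^esub> x) = a \<odot>\<^bsub>V\<^esub> (c \<odot>\<^bsub>V\<^esub> x)"
      using that c by (metis smult_assoc1 m_comm)
    then show ?thesis using that c lin_closed[OF h]
      by (simp add: a_minus_def smult_r_distr smult_r_minus)
  qed
  then show ?thesis
    unfolding lin_def using h c
    by (auto simp: lin_closed lin_add lin_smult smult_r_distr vec_simps)
qed

end

context finite_vectorspace
begin

text \<open>Rank-nullity in counting form: the fibres over the image are cosets of the
  kernel.\<close>

lemma card_image_kernel:
  assumes "lin T" "sub Y" shows "card Y = card {y \<in> Y. T y = \<zero>\<^bsub>V\<^esub>} * card (T ` Y)"
proof (rule card_fibres_eq)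
  show "finite Y" using assms sub_finite by auto
  fix x assume x: "x \<in> Y"
  have xV: "x \<in> carrier V" using assms x sub_in by auto
  have "bij_betw (\<lambda>y. y \<oplus>\<^bsub>V\<^esub> x) {y \<in> Y. T y = \<zero>\<^bsub>V\<^esub>} {y \<in> Y. T y = T x}"
  proof (rule bij_betw_byWitness[where f' = "\<lambda>y. y \<ominus>\<^bsub>V\<^esub> x"])
    show "\<forall>a\<in>{y \<in> Y. T y = \<zero>\<^bsub>V\<^esub>}. (a \<oplus>\<^bsub>V\<^esub> x) \<ominus>\<^bsub>V\<^esub> x = a"
      using assms sub_in xV add_minus_cancel by auto
    show "\<forall>a\<in>{y \<in> Y. T y = T x}. (a \<ominus>\<^bsub>V\<^esub> x) \<oplus>\<^bsub>V\<^esub> x = a"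
      using assms sub_in xV add_minus_cancel by auto
    show "(\<lambda>y. y \<oplus>\<^bsub>V\<^esub> x) ` {y \<in> Y. T y = \<zero>\<^bsub>V\<^esub>} \<subseteq> {y \<in> Y. T y = T x}"
      using assms sub_in x by (auto simp: lin_add sub_add lin_closed)
    show "(\<lambda>y. y \<ominus>\<^bsub>V\<^esub> x) ` {y \<in> Y. T y = T x} \<subseteq> {y \<in> Y. T y = \<zero>\<^bsub>V\<^esub>}"
      using assms sub_in x by (auto simp: lin_minus sub_minus lin_closed M.r_neg)
  qed
  then show "card {y \<in> Y. T y = T x} = card {y \<in> Y. T y = \<zero>\<^bsub>V\<^esub>}"
    by (simp add: bij_betw_same_card)
qed

end

section \<open>Reflexive sesquilinear forms\<close>

text \<open>One interface for alternating, hermitian and symmetric bilinear forms, and for the dot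
  product. Reflexivity makes left and right orthogonality agree; \<sigma> is an involution so that
  any scalar can be produced in the second argument.\<close>

locale form_space = finite_vectorspace F V for F (structure) and V (structure) +
  fixes f :: "'c \<Rightarrow> 'c \<Rightarrow> 'a" and \<sigma> :: "'a \<Rightarrow> 'a"
  assumes f_closed [simp]: "x \<in> carrier V \<Longrightarrow> y \<in> carrier V \<Longrightarrow> f x y \<in> carrier F"
    and f_add_left: "x \<in> carrier V \<Longrightarrow> y \<in> carrier V \<Longrightarrow> z \<in> carrier V \<Longrightarrow>
      f (x \<oplus>\<^bsub>V\<^esub> y) z = f x z \<oplus>\<^bsub>F\<^esub> f y z"
    and f_add_right: "x \<in> carrier V \<Longrightarrow> y \<in> carrier V \<Longrightarrow> z \<in> carrier V \<Longrightarrow>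
      f z (x \<oplus>\<^bsub>V\<^esub> y) = f z x \<oplus>\<^bsub>F\<^esub> f z y"
    and f_smult_left: "c \<in> carrier F \<Longrightarrow> x \<in> carrier V \<Longrightarrow> y \<in> carrier V \<Longrightarrow>
      f (c \<odot>\<^bsub>V\<^esub> x) y = c \<otimes>\<^bsub>F\<^esub> f x y"
    and f_smult_right: "c \<in> carrier F \<Longrightarrow> x \<in> carrier V \<Longrightarrow> y \<in> carrier V \<Longrightarrow>
      f x (c \<odot>\<^bsub>V\<^esub> y) = \<sigma> c \<otimes>\<^bsub>F\<^esub> f x y"
    and f_refl: "x \<in> carrier V \<Longrightarrow> y \<in> carrier V \<Longrightarrow> f x y = \<zero>\<^bsub>F\<^esub> \<Longrightarrow> f y x = \<zero>\<^bsub>F\<^esub>"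
    and f_nondeg: "x \<in> carrier V \<Longrightarrow> (\<And>y. y \<in> carrier V \<Longrightarrow> f x y = \<zero>\<^bsub>F\<^esub>) \<Longrightarrow> x = \<zero>\<^bsub>V\<^esub>"
    and \<sigma>_closed [simp]: "c \<in> carrier F \<Longrightarrow> \<sigma> c \<in> carrier F"
    and \<sigma>_\<sigma>: "c \<in> carrier F \<Longrightarrow> \<sigma> (\<sigma> c) = c"
begin

definition perp :: "'c set \<Rightarrow> 'c set" where
  "perp U = {y \<in> carrier V. \<forall>x\<in>U. f y x = \<zero>}"

lemma f_zero_left [simp]: "x \<in> carrier V \<Longrightarrow> f \<zero>\<^bsub>V\<^esub> x = \<zero>"
  using f_smult_left[of \<zero> "\<zero>\<^bsub>V\<^esub>" x] by simp

lemma f_zero_right [simp]: "x \<in> carrier V \<Longrightarrow> f x \<zero>\<^bsub>V\<^esub> = \<zero>"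
  using f_refl[of "\<zero>\<^bsub>V\<^esub>" x] by simp

lemma f_neg_left: "x \<in> carrier V \<Longrightarrow> y \<in> carrier V \<Longrightarrow> f (\<ominus>\<^bsub>V\<^esub> x) y = \<ominus> f x y"
  using f_smult_left[of "\<ominus> \<one>" x y] by (simp add: smult_minus_1 l_minus)

lemma f_neg_right: "x \<in> carrier V \<Longrightarrow> y \<in> carrier V \<Longrightarrow> f x (\<ominus>\<^bsub>V\<^esub> y) = \<ominus> f x y"
proof -
  assume "x \<in> carrier V" "y \<in> carrier V"
  then have "f x (\<ominus>\<^bsub>V\<^esub> y) \<oplus> f x y = \<zero>" "f x (\<ominus>\<^bsub>V\<^esub> y) \<in> carrier F" "f x y \<in> carrier F"
    using f_add_right[of "\<ominus>\<^bsub>V\<^esub> y" y x] by (auto simp: M.l_neg)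
  then show ?thesis by (simp add: R.minus_equality)
qed

lemma f_minus_left: "x \<in> carrier V \<Longrightarrow> y \<in> carrier V \<Longrightarrow> z \<in> carrier V \<Longrightarrow>
    f (x \<ominus>\<^bsub>V\<^esub> y) z = f x z \<ominus> f y z"
  by (simp add: a_minus_def f_add_left f_neg_left)

lemma f_minus_right: "x \<in> carrier V \<Longrightarrow> y \<in> carrier V \<Longrightarrow> z \<in> carrier V \<Longrightarrow>
    f z (x \<ominus>\<^bsub>V\<^esub> y) = f z x \<ominus> f z y"
  by (simp add: a_minus_def f_add_right f_neg_right)

lemma \<sigma>_zero: "\<sigma> c = \<zero> \<Longrightarrow> c \<in> carrier F \<Longrightarrow> x \<in> carrier V \<Longrightarrow> x \<noteq> \<zero>\<^bsub>V\<^esub> \<Longrightarrow> c = \<zero>"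
proof (rule ccontr)
  assume h: "\<sigma> c = \<zero>" "c \<in> carrier F" "x \<in> carrier V" "x \<noteq> \<zero>\<^bsub>V\<^esub>" "c \<noteq> \<zero>"
  then have "f y (c \<odot>\<^bsub>V\<^esub> x) = \<zero>" if "y \<in> carrier V" for y
    using that by (simp add: f_smult_right)
  then have "c \<odot>\<^bsub>V\<^esub> x = \<zero>\<^bsub>V\<^esub>" using h by (intro f_nondeg) (auto simp: f_refl)
  then show False using h smult_eq_zero_iff by auto
qed

lemma perp_in: "y \<in> perp U \<Longrightarrow> y \<in> carrier V" by (simp add: perp_def)

lemma perpI: "y \<in> carrier V \<Longrightarrow> (\<And>x. x \<in> U \<Longrightarrow> f y x = \<zero>) \<Longrightarrow> y \<in> perp U" by (simp add: perp_def)

lemma perp_anti: "U \<subseteq> W \<Longrightarrow> perp W \<subseteq> perp U" by (auto simp: perp_def)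

lemma sub_perp: "U \<subseteq> carrier V \<Longrightarrow> sub (perp U)"
  by (rule subI) (auto simp: perp_def f_add_left f_smult_left subset_iff)

lemma perp_plus_sub:
  assumes "sub U" "sub W" shows "perp (plus_sub U W) = perp U \<inter> perp W"
proof
  show "perp (plus_sub U W) \<subseteq> perp U \<inter> perp W"
    using perp_anti plus_sub_upper[OF assms] by blast
  show "perp U \<inter> perp W \<subseteq> perp (plus_sub U W)"
    using assms sub_in by (auto simp: perp_def in_plus_sub_iff f_add_right)
qed

lemma perp_line: "y \<in> carrier V \<Longrightarrow> perp (line y) = {x \<in> carrier V. f x y = \<zero>}"
  using line_self[of y] by (auto simp: perp_def line_def f_smult_right)

lemma perp_adj: "sub U \<Longrightarrow> y \<in> carrier V \<Longrightarrow> perp (adj U y) = {x \<in> perp U. f x y = \<zero>}"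
  unfolding adj_eq_plus_line
  by (simp add: perp_plus_sub sub_line perp_line) (auto simp: perp_def)

lemma linear_on_f: "sub Y \<Longrightarrow> x \<in> carrier V \<Longrightarrow> linear_on Y (\<lambda>y. f y x)"
  by (auto simp: linear_on_def sub_in f_add_left f_smult_left)

text \<open>Each vector adjoined to \<open>U\<close> imposes one more linear condition on
  \<open>Y\<close>, which costs at most a factor \<open>Q\<close>.\<close>

lemma card_Int_perp:
  assumes "sub Y" "sub U" shows "card Y \<le> card U * card (Y \<inter> perp U)"
  using assms(2)
proof (induction rule: subspace_induct)
  case zero
  have "Y \<inter> perp {\<zero>\<^bsub>V\<^esub>} = Y" using assms sub_in by (auto simp: perp_def)
  then show ?case by simp
next
  case (adj W y)
  have y: "y \<in> carrier V" using adj assms sub_in by auto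
  have s: "sub (Y \<inter> perp W)" using assms sub_perp sub_subset adj sub_Int by auto
  have "card Y \<le> card W * card (Y \<inter> perp W)" by fact
  also have "\<dots> \<le> card W * (Q * card {x \<in> Y \<inter> perp W. f x y = \<zero>})"
    by (intro mult_left_mono card_kernel_ge s linear_on_f y) auto
  also have "{x \<in> Y \<inter> perp W. f x y = \<zero>} = Y \<inter> perp (adj W y)"
    using adj y by (auto simp: perp_adj)
  finally show ?case using card_adj[of W y] adj y by (simp add: mult.assoc mult.left_commute)
qed

lemma perp_carrier: "perp (carrier V) = {\<zero>\<^bsub>V\<^esub>}"
  using f_nondeg by (auto simp: perp_def)

text \<open>One inequality is \<open>card_Int_perp\<close> with the whole space for
  \<open>Y\<close>. For the other, the product |U| |perp U| cannot decrease while \<open>U\<close>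
  grows, and at the whole space nondegeneracy makes it |V|.\<close>

lemma card_perp:
  assumes "sub U" shows "card U * card (perp U) = card (carrier V)"
proof (rule antisym)
  show "card (carrier V) \<le> card U * card (perp U)"
    using card_Int_perp[OF sub_carrier assms] by (simp add: inf.absorb2 perp_def subset_iff Collect_conj_eq)
  have "card U * card (perp U) \<le> card (carrier V) * card (perp (carrier V))"
    using assms sub_carrier sub_subset[OF assms]
  proof (induction rule: subspace_induct_from)
    case (adj W y)
    have s: "sub (perp W)" using sub_perp sub_subset adj by auto
    have "card U * card (perp U) \<le> card W * card (perp W)" by fact
    also have "\<dots> \<le> card W * (Q * card {x \<in> perp W. f x y = \<zero>})"
      by (intro mult_left_mono card_kernel_ge s linear_on_f) (use adj in auto)
    also have "{x \<in> perp W. f x y = \<zero>} = perp (adj W y)"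
      using adj by (auto simp: perp_adj)
    finally show ?case using card_adj[of W y] adj by (simp add: mult.assoc mult.left_commute)
  qed auto
  then show "card U * card (perp U) \<le> card (carrier V)" by (simp add: perp_carrier)
qed

lemma perp_perp:
  assumes "sub U" shows "perp (perp U) = U"
proof -
  have s: "sub (perp U)" "perp U \<subseteq> carrier V" using assms sub_perp sub_subset by auto
  have i: "U \<subseteq> perp (perp U)" using assms sub_in by (auto simp: perp_def f_refl)
  have "card U * card (perp U) = card (perp U) * card (perp (perp U))"
    using card_perp assms s by auto
  then have "card U = card (perp (perp U))" using sub_card_pos[OF s(1)] by (simp add: mult.commute)
  then show ?thesis using i card_subset_eq sub_finite sub_perp s by metis
qed

text \<open>Subtracting from \<open>w\<close> a suitable multiple of a fixed \<open>v\<close> with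
  \<open>f a v\<close> nonzero lands in the kernel of \<open>f a\<close>, hence in that of
  \<open>f b\<close>. Later this turns the absence of an extension into an eigenvector
  equation.\<close>

lemma functional_proportional:
  assumes R: "sub R" and a: "a \<in> carrier V" and b: "b \<in> carrier V"
    and h: "\<And>w. w \<in> R \<Longrightarrow> f a w = \<zero> \<Longrightarrow> f b w = \<zero>"
  shows "\<exists>c\<in>carrier F. \<forall>w\<in>R. f b w = c \<otimes> f a w"
proof (cases "\<forall>w\<in>R. f a w = \<zero>")
  case True then show ?thesis using h by (intro bexI[of _ \<zero>]) auto
next
  case False
  then obtain v where v: "v \<in> R" "f a v \<noteq> \<zero>" by auto
  have vV: "v \<in> carrier V" using v R sub_in by auto
  have av: "f a v \<in> carrier F" using a vV by auto
  have i: "inv (f a v) \<in> carrier F" "inv (f a v) \<otimes> f a v = \<one>"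
    using av v by (auto simp: field_Units)
  let ?c = "f b v \<otimes> inv (f a v)"
  have "f b w = ?c \<otimes> f a w" if w: "w \<in> R" for w
  proof -
    have wV: "w \<in> carrier V" using w R sub_in by auto
    \<comment> \<open>The form is \<sigma>-semilinear in its second argument, so the multiple of
      \<open>v\<close> that cancels \<open>f a w\<close> has to be twisted by \<sigma>.\<close>
    define d where "d = \<sigma> (f a w \<otimes> inv (f a v))"
    have d: "d \<in> carrier F" "\<sigma> d = f a w \<otimes> inv (f a v)"
      using a wV i by (auto simp: d_def \<sigma>_\<sigma>)
    let ?u = "w \<ominus>\<^bsub>V\<^esub> d \<odot>\<^bsub>V\<^esub> v"
    have u: "?u \<in> R" using R w v d sub_minus sub_smult by auto
    have "f a ?u = f a w \<ominus> f a w \<otimes> inv (f a v) \<otimes> f a v"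
      using a wV vV d by (simp add: f_minus_right f_smult_right)
    also have "\<dots> = \<zero>" using a wV vV i by (simp add: m_assoc)
    finally have "f b ?u = \<zero>" using h u by auto
    then have "f b w \<ominus> f a w \<otimes> inv (f a v) \<otimes> f b v = \<zero>"
      using b wV vV d by (simp add: f_minus_right f_smult_right)
    then have "f b w = f a w \<otimes> inv (f a v) \<otimes> f b v"
      using a b wV vV i by simp
    then show ?thesis using a b wV vV i by (simp add: m_ac)
  qed
  then show ?thesis using b vV i by (intro bexI[of _ ?c]) auto
qed

end

section \<open>Maps that are scalar modulo a subspace\<close>

context finite_vectorspace
begin

lemma adj_commute:
  assumes "sub U" "x \<in> carrier V" "y \<in> carrier V"
  shows "adj (adj U x) y = adj (adj U y) x"
proof -
  have "adj (adj U x) y \<subseteq> adj (adj U y) x" if x: "x \<in> carrier V" and y: "y \<in> carrier V" for x y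
    using adj_upper[OF sub_adj[OF assms(1) y] x] adj_upper[OF assms(1) y]
    by (intro adj_least sub_adj assms x y) auto
  then show ?thesis using assms by blast
qed

text \<open>The classical argument that a map with only eigenvectors is a scalar, done modulo
  \<open>E\<close>: comparing \<open>r\<close>, \<open>t\<close> and their sum gives a combination
  of \<open>r\<close> and \<open>t\<close> in \<open>E \<inter> R\<close>, which is zero, so both
  coefficients vanish.\<close>

lemma eigenvalue_unique:
  assumes "sub E" "sub R" "E \<inter> R = {\<zero>\<^bsub>V\<^esub>}" "lin h" "a \<in> carrier F" "b \<in> carrier F" "c \<in> carrier F"
    "r \<in> R" "t \<in> R" "r \<noteq> \<zero>\<^bsub>V\<^esub>" "t \<notin> line r"
    "h r \<ominus>\<^bsub>V\<^esub> a \<odot>\<^bsub>V\<^esub> r \<in> E" "h t \<ominus>\<^bsub>V\<^esub> b \<odot>\<^bsub>V\<^esub> t \<in> E"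
    "h (r \<oplus>\<^bsub>V\<^esub> t) \<ominus>\<^bsub>V\<^esub> c \<odot>\<^bsub>V\<^esub> (r \<oplus>\<^bsub>V\<^esub> t) \<in> E"
  shows "a = b"
proof -
  have V: "r \<in> carrier V" "t \<in> carrier V" using assms sub_in by auto
  have H: "h r \<in> carrier V" "h t \<in> carrier V" using V lin_closed assms by auto
  have "(h r \<ominus>\<^bsub>V\<^esub> a \<odot>\<^bsub>V\<^esub> r) \<oplus>\<^bsub>V\<^esub> (h t \<ominus>\<^bsub>V\<^esub> b \<odot>\<^bsub>V\<^esub> t) \<ominus>\<^bsub>V\<^esub> (h (r \<oplus>\<^bsub>V\<^esub> t) \<ominus>\<^bsub>V\<^esub> c \<odot>\<^bsub>V\<^esub> (r \<oplus>\<^bsub>V\<^esub> t))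
     = (c \<ominus> a) \<odot>\<^bsub>V\<^esub> r \<oplus>\<^bsub>V\<^esub> (c \<ominus> b) \<odot>\<^bsub>V\<^esub> t" (is "?l = ?u")
    using V H assms
    by (simp add: lin_add smult_r_distr minus_eq smult_l_distr smult_l_minus vec_simps)
  moreover have "?l \<in> E" using assms sub_add sub_minus by simp
  moreover have "?u \<in> R" using assms by (auto intro!: sub_add[OF assms(2)] sub_smult[OF assms(2)])
  ultimately have "?u \<in> E \<inter> R" by simp
  then have u: "?u = \<zero>\<^bsub>V\<^esub>" using assms(3) by auto
  have "(c \<ominus> b) \<odot>\<^bsub>V\<^esub> t = \<ominus>\<^bsub>V\<^esub> ((c \<ominus> a) \<odot>\<^bsub>V\<^esub> r)"
    using u V assms by (metis M.a_comm M.minus_equality R.minus_closed smult_closed)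
  also have "\<dots> \<in> line r" using V assms by (intro sub_neg sub_line) (auto simp: line_def)
  finally have cb: "c \<ominus> b = \<zero>"
    using smult_in_sub_iff[OF sub_line, of r "c \<ominus> b" t] V assms by auto
  then have "(c \<ominus> a) \<odot>\<^bsub>V\<^esub> r = \<zero>\<^bsub>V\<^esub>"
    using u[unfolded cb] V assms by simp
  then have "c \<ominus> a = \<zero>" using smult_eq_zero_iff V assms by auto
  then show ?thesis using cb assms by simp
qed

text \<open>\<open>h\<close> minus \<open>c\<close> sends \<open>R\<close> into \<open>E\<close>, so
  its kernel has codimension at most dim E in \<open>R\<close>, and \<open>R\<close> itself has
  codimension at most 2 dim E in the whole space. This is the origin of the exponent 3.\<close>

lemma kernel_bound:
  assumes h: "lin h" and c: "c \<in> carrier F" and R: "sub R" and E: "sub E"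
    and RE: "\<And>r. r \<in> R \<Longrightarrow> h r \<ominus>\<^bsub>V\<^esub> c \<odot>\<^bsub>V\<^esub> r \<in> E"
    and le: "card (carrier V) \<le> card E * card E * card R"
  shows "card (carrier V) \<le> card E ^ 3 * card {v \<in> carrier V. h v = c \<odot>\<^bsub>V\<^esub> v}"
proof -
  let ?T = "\<lambda>v. h v \<ominus>\<^bsub>V\<^esub> c \<odot>\<^bsub>V\<^esub> v" and ?K = "{v \<in> carrier V. h v = c \<odot>\<^bsub>V\<^esub> v}"
  have "card R = card {y \<in> R. ?T y = \<zero>\<^bsub>V\<^esub>} * card (?T ` R)"
    by (rule card_image_kernel[OF lin_shift[OF h c] R])
  also have "\<dots> \<le> card ?K * card E"
  proof (intro mult_mono card_mono)
    show "{y \<in> R. ?T y = \<zero>\<^bsub>V\<^esub>} \<subseteq> ?K"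
      using R sub_in c lin_closed[OF h] by auto
    show "?T ` R \<subseteq> E" using RE by auto
  qed (use finite_V sub_finite E in auto)
  finally have "card E * card E * card R \<le> card E * card E * (card ?K * card E)" by simp
  then have "card (carrier V) \<le> card E * card E * (card ?K * card E)" using le by (rule order_trans[rotated])
  then show ?thesis by (simp add: power3_eq_cube mult_ac)
qed

end

section \<open>Good pairs: extension, maximality, existence\<close>

context form_space
begin

text \<open>The form turns \<open>D\<close> into a space of functionals, all vanishing on
  \<open>E\<close>. Nondegeneracy of the pairing of \<open>h e\<close> with \<open>d\<close> is
  demanded on the side of \<open>E\<close>; equal cardinality then gives the side of
  \<open>D\<close>. The groups with a form use the case D = E.\<close>

definition good :: "('c \<Rightarrow> 'c) \<Rightarrow> 'c set \<Rightarrow> 'c set \<Rightarrow> bool" where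
  "good h E D \<longleftrightarrow> sub E \<and> sub D \<and> card E = card D \<and> (\<forall>e\<in>E. \<forall>d\<in>D. f e d = \<zero>)
     \<and> (\<forall>e\<in>E. (\<forall>d\<in>D. f (h e) d = \<zero>) \<longrightarrow> e = \<zero>\<^bsub>V\<^esub>)"

lemma good_triv: "good h {\<zero>\<^bsub>V\<^esub>} {\<zero>\<^bsub>V\<^esub>}"
  by (simp add: good_def sub_triv)

text \<open>Both \<open>r\<close> and \<open>h r\<close> are orthogonal to \<open>D\<close>, hence
  the Gram matrix of the enlarged pairing is block triangular with new diagonal entry
  \<open>f (h r) p\<close>.\<close>

lemma good_extend:
  assumes h: "lin h" and g: "good h E D" and r: "r \<in> perp D" "h r \<in> perp D" and p: "p \<in> perp E"
    and rp: "f r p = \<zero>" "f (h r) p \<noteq> \<zero>"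
  shows "good h (adj E r) (adj D p)" "r \<notin> E" "p \<notin> D"
proof -
  have s: "sub E" "sub D" and c: "card E = card D" and o: "\<And>e d. e \<in> E \<Longrightarrow> d \<in> D \<Longrightarrow> f e d = \<zero>"
    and nd: "\<And>e. e \<in> E \<Longrightarrow> (\<And>d. d \<in> D \<Longrightarrow> f (h e) d = \<zero>) \<Longrightarrow> e = \<zero>\<^bsub>V\<^esub>"
    using g by (auto simp: good_def)
  have V: "r \<in> carrier V" "p \<in> carrier V" "h r \<in> carrier V"
    using r p perp_in by auto
  have EV: "e \<in> carrier V" "h e \<in> carrier V" if "e \<in> E" for e using that s sub_in lin_closed[OF h] by auto
  have DV: "d \<in> carrier V" if "d \<in> D" for d using that s sub_in by auto
  show rE: "r \<notin> E"
  proof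
    assume "r \<in> E"
    then have "r = \<zero>\<^bsub>V\<^esub>" using nd r by (auto simp: perp_def)
    then show False using rp V lin_zero[OF h] by auto
  qed
  show pD: "p \<notin> D" using r rp by (auto simp: perp_def)
  have ep: "f e p = \<zero>" if "e \<in> E" for e
    using that p V EV by (auto simp: perp_def intro: f_refl)
  have "f x y = \<zero>" if xy: "x \<in> adj E r" "y \<in> adj D p" for x y
  proof -
    obtain e a where e: "e \<in> E" "a \<in> carrier F" "x = e \<oplus>\<^bsub>V\<^esub> a \<odot>\<^bsub>V\<^esub> r" using xy by (auto simp: in_adj_iff)
    obtain d b where d: "d \<in> D" "b \<in> carrier F" "y = d \<oplus>\<^bsub>V\<^esub> b \<odot>\<^bsub>V\<^esub> p" using xy by (auto simp: in_adj_iff)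
    have "f r d = \<zero>" using r d by (auto simp: perp_def)
    then show ?thesis using e d V EV DV ep o rp
      by (simp add: f_add_left f_add_right f_smult_left f_smult_right)
  qed
  moreover have "x = \<zero>\<^bsub>V\<^esub>" if x: "x \<in> adj E r" and xd: "\<And>y. y \<in> adj D p \<Longrightarrow> f (h x) y = \<zero>" for x
  proof -
    obtain e a where e: "e \<in> E" "a \<in> carrier F" "x = e \<oplus>\<^bsub>V\<^esub> a \<odot>\<^bsub>V\<^esub> r" using x by (auto simp: in_adj_iff)
    have hx: "h x = h e \<oplus>\<^bsub>V\<^esub> a \<odot>\<^bsub>V\<^esub> h r" using e V EV h by (simp add: lin_add lin_smult)
    have "f (h e) d = \<zero>" if d: "d \<in> D" for d
    proof -
      have "f (h x) d = \<zero>" using d xd adj_upper[OF s(2) V(2)] by auto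
      moreover have "f (h r) d = \<zero>" using r d by (auto simp: perp_def)
      ultimately show ?thesis using hx e d V EV DV by (simp add: f_add_left f_smult_left)
    qed
    then have e0: "e = \<zero>\<^bsub>V\<^esub>" using nd e by auto
    have "f (h x) p = \<zero>" using xd adj_upper[OF s(2) V(2)] by auto
    then have "a \<otimes> f (h r) p = \<zero>" using hx e0 e V lin_zero[OF h]
      by (simp add: f_smult_left)
    then have "a = \<zero>" using rp V e integral_iff by auto
    then show ?thesis using e e0 V by simp
  qed
  ultimately show "good h (adj E r) (adj D p)"
    unfolding good_def using s c V sub_adj card_adj rE pD by auto
qed

text \<open>Orthogonality to \<open>D\<close> is imposed twice, on \<open>r\<close> and on
  \<open>h r\<close>, so the codimension is at most twice dim D.\<close>

lemma card_double_perp_ge: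
  assumes h: "lin h" "inj_on h (carrier V)" and D: "sub D"
  shows "sub {r \<in> perp D. h r \<in> perp D}"
    "card (carrier V) \<le> card D * card D * card {r \<in> perp D. h r \<in> perp D}"
proof -
  let ?R = "{r \<in> perp D. h r \<in> perp D}"
  have sp: "sub (perp D)" using D sub_perp sub_subset by auto
  have eq: "?R = perp D \<inter> {x \<in> carrier V. h x \<in> perp D}" using perp_in by auto
  show "sub ?R" unfolding eq by (intro sub_Int sp sub_vimage h)
  have "card (perp D) = card (h ` perp D)"
    using inj_on_subset[OF h(2)] sub_subset[OF sp] card_image by metis
  also have "\<dots> \<le> card D * card (h ` perp D \<inter> perp D)"
    by (intro card_Int_perp sub_image h sp D)
  also have "h ` perp D \<inter> perp D = h ` ?R" by auto
  also have "card (h ` ?R) \<le> card ?R" by (rule card_image_le) (use sp sub_finite in auto)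
  finally have "card D * card (perp D) \<le> card D * (card D * card ?R)" by simp
  then show "card (carrier V) \<le> card D * card D * card ?R" using card_perp[OF D] by (simp add: mult_ac)
qed

lemma good_Int:
  assumes "good h E D" "sub R" "R \<subseteq> {r \<in> perp D. h r \<in> perp D}" shows "E \<inter> R = {\<zero>\<^bsub>V\<^esub>}"
  using assms sub_zero by (auto simp: good_def perp_def)

text \<open>If no extension exists, then for \<open>r\<close> in \<open>R\<close> every w in
  \<open>perp E\<close> orthogonal to \<open>r\<close> is orthogonal to \<open>h r\<close>. The two
  functionals are then proportional on \<open>perp E\<close>, so \<open>h r\<close> minus a multiple
  of \<open>r\<close> lies in \<open>perp (perp E) = E\<close>. The scalars of different
  \<open>r\<close> agree by \<open>eigenvalue_unique\<close>.\<close>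

lemma good_maximal_eigenspace:
  assumes h: "lin h" "inj_on h (carrier V)" and g: "good h E D"
    and max: "\<And>E' D'. good h E' D' \<Longrightarrow> card E' \<noteq> Q * card E"
  shows "\<exists>c\<in>carrier F. card (carrier V) \<le> card E ^ 3 * card {v \<in> carrier V. h v = c \<odot>\<^bsub>V\<^esub> v}"
proof -
  define R where "R = {r \<in> perp D. h r \<in> perp D}"
  have s: "sub E" "sub D" "card E = card D" using g by (auto simp: good_def)
  have sR: "sub R" and cR: "card (carrier V) \<le> card E * card E * card R"
    using card_double_perp_ge[OF h s(2)] s by (auto simp: R_def)
  have ER: "E \<inter> R = {\<zero>\<^bsub>V\<^esub>}" using good_Int[OF g sR] by (simp add: R_def)
  have sE: "sub (perp E)" using s sub_perp sub_subset by auto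
  have ex: "\<exists>c\<in>carrier F. h r \<ominus>\<^bsub>V\<^esub> c \<odot>\<^bsub>V\<^esub> r \<in> E" if r: "r \<in> R" for r
  proof -
    have V: "r \<in> carrier V" "h r \<in> carrier V" using r perp_in by (auto simp: R_def)
    have "f (h r) w = \<zero>" if w: "w \<in> perp E" "f r w = \<zero>" for w
    proof (rule ccontr)
      assume n: "f (h r) w \<noteq> \<zero>"
      have "good h (adj E r) (adj D w)" "r \<notin> E"
        using good_extend[OF h(1) g _ _ w(1) w(2) n] r by (auto simp: R_def)
      then show False using max card_adj[OF s(1) V(1)] by auto
    qed
    then obtain c where c: "c \<in> carrier F" "\<And>w. w \<in> perp E \<Longrightarrow> f (h r) w = c \<otimes> f r w"
      using functional_proportional[OF sE V] by blast
    have "h r \<ominus>\<^bsub>V\<^esub> c \<odot>\<^bsub>V\<^esub> r \<in> perp (perp E)"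
    proof (rule perpI)
      fix w assume "w \<in> perp E"
      then show "f (h r \<ominus>\<^bsub>V\<^esub> c \<odot>\<^bsub>V\<^esub> r) w = \<zero>"
        using c V perp_in by (simp add: f_minus_left f_smult_left)
    qed (use c V in auto)
    then show ?thesis using c perp_perp[OF s(1)] by auto
  qed
  have "\<exists>c\<in>carrier F. \<forall>r\<in>R. h r \<ominus>\<^bsub>V\<^esub> c \<odot>\<^bsub>V\<^esub> r \<in> E"
  proof (cases "R = {\<zero>\<^bsub>V\<^esub>}")
    case True
    then show ?thesis using ex by auto
  next
    case False
    then obtain r where r: "r \<in> R" "r \<noteq> \<zero>\<^bsub>V\<^esub>" using sub_zero[OF sR] by auto
    have rV: "r \<in> carrier V" "h r \<in> carrier V" using r sR sub_in lin_closed[OF h(1)] by auto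
    obtain a where a: "a \<in> carrier F" "h r \<ominus>\<^bsub>V\<^esub> a \<odot>\<^bsub>V\<^esub> r \<in> E" using ex r by blast
    have "h t \<ominus>\<^bsub>V\<^esub> a \<odot>\<^bsub>V\<^esub> t \<in> E" if t: "t \<in> R" for t
    proof (cases "t \<in> line r")
      case True
      then obtain d where d: "d \<in> carrier F" "t = d \<odot>\<^bsub>V\<^esub> r" by (auto simp: line_def)
      have "h t \<ominus>\<^bsub>V\<^esub> a \<odot>\<^bsub>V\<^esub> t = d \<odot>\<^bsub>V\<^esub> (h r \<ominus>\<^bsub>V\<^esub> a \<odot>\<^bsub>V\<^esub> r)"
        using lin_smult[OF lin_shift[OF h(1) a(1)] d(1) rV(1)] d by simp
      then show ?thesis using a d s sub_smult by auto
    next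
      case False
      obtain b where b: "b \<in> carrier F" "h t \<ominus>\<^bsub>V\<^esub> b \<odot>\<^bsub>V\<^esub> t \<in> E" using ex t by blast
      obtain c where c: "c \<in> carrier F" "h (r \<oplus>\<^bsub>V\<^esub> t) \<ominus>\<^bsub>V\<^esub> c \<odot>\<^bsub>V\<^esub> (r \<oplus>\<^bsub>V\<^esub> t) \<in> E"
        using ex sub_add[OF sR r(1) t] by blast
      have "a = b" by (rule eigenvalue_unique[OF s(1) sR ER h(1) a(1) b(1) c(1) r(1) t r(2) False a(2) b(2) c(2)])
      then show ?thesis using b by simp
    qed
    then show ?thesis using a by auto
  qed
  then show ?thesis using kernel_bound[OF h(1) _ sR s(1) _ cR] by blast
qed

text \<open>\<open>E\<close> is chosen of the size of \<open>W\<close>, which contains the image of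
  h - c, and meeting neither \<open>W\<close> nor \<open>K\<close>, which contains the kernel. As
  \<open>E\<close> is orthogonal to \<open>D\<close>, pairing \<open>h e\<close> with
  \<open>D\<close> is pairing (h - c) e with \<open>D\<close>. Taking \<open>D\<close> as a
  complement of \<open>perp W \<inter> perp E\<close> in \<open>perp E\<close> puts (h - c) e into
  \<open>E \<inter> W\<close> for every e in the radical; so e lies in \<open>E \<inter> K\<close>
  and is zero.\<close>

lemma good_complementary:
  assumes h: "lin h" and c: "c \<in> carrier F" and W: "sub W" and K: "sub K"
    and hW: "\<And>v. v \<in> carrier V \<Longrightarrow> h v \<ominus>\<^bsub>V\<^esub> c \<odot>\<^bsub>V\<^esub> v \<in> W"
    and hK: "\<And>v. v \<in> carrier V \<Longrightarrow> h v = c \<odot>\<^bsub>V\<^esub> v \<Longrightarrow> v \<in> K"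
    and WK: "card W * card K = card (carrier V)" "card W * card W \<le> card (carrier V)"
  shows "\<exists>E D. good h E D \<and> card E = card W"
proof -
  define P where "P E \<longleftrightarrow> sub E \<and> E \<inter> K = {\<zero>\<^bsub>V\<^esub>} \<and> E \<inter> W = {\<zero>\<^bsub>V\<^esub>} \<and> card E \<le> card W" for E
  have "P {\<zero>\<^bsub>V\<^esub>}" using sub_triv sub_zero K W sub_card_pos[OF W] by (auto simp: P_def)
  then obtain E where E: "P E" and m: "\<And>E'. P E' \<Longrightarrow> card E' \<le> card E"
    using ex_has_greatest_nat[of P "{\<zero>\<^bsub>V\<^esub>}" card "Suc (card W)"] by (auto simp: P_def)
  have sE: "sub E" and EK: "E \<inter> K = {\<zero>\<^bsub>V\<^esub>}" and EW: "E \<inter> W = {\<zero>\<^bsub>V\<^esub>}" using E by (auto simp: P_def)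
  have cE: "card E = card W"
  proof (rule ccontr)
    assume "card E \<noteq> card W"
    then have lt: "card E < card W" using E by (auto simp: P_def)
    obtain i j where ij: "card E = Q ^ i" "card W = Q ^ j" using card_sub_power sE W by metis
    then have "i < j" using lt Q_ge_2 by simp
    then have le: "Q * card E \<le> card W" using ij Q_ge_2
      by (metis Suc_leI one_le_numeral order_trans power_Suc power_increasing)
    have cA: "card (plus_sub K E) < card (carrier V)"
      using card_plus_le[OF K sE] WK lt sub_card_pos[OF K]
      by (metis (no_types, lifting) le_less_trans mult.commute mult_less_cancel2)
    have cB: "card (plus_sub W E) < card (carrier V)"
      using card_plus_le[OF W sE] WK lt sub_card_pos[OF W]
      by (metis (no_types, lifting) le_less_trans less_le_trans mult_less_cancel1)
    have sA: "sub (plus_sub K E)" and sB: "sub (plus_sub W E)" using K W sE sub_plus by auto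
    obtain a where a: "a \<in> carrier V" "a \<notin> plus_sub K E" using exists_not_in[OF sA cA] by auto
    obtain b where b: "b \<in> carrier V" "b \<notin> plus_sub W E" using exists_not_in[OF sB cB] by auto
    \<comment> \<open>A space is not the union of two proper subspaces: if \<open>a\<close> and
      \<open>b\<close> each lie in the other one, their sum avoids both.\<close>
    have "\<exists>v\<in>carrier V. v \<notin> plus_sub K E \<and> v \<notin> plus_sub W E"
    proof (cases "a \<in> plus_sub W E \<and> b \<in> plus_sub K E")
      case True
      have "a \<oplus>\<^bsub>V\<^esub> b \<notin> plus_sub K E"
        using sub_minus[OF sA, of "a \<oplus>\<^bsub>V\<^esub> b" b] True a b add_minus_cancel by auto
      moreover have "a \<oplus>\<^bsub>V\<^esub> b \<notin> plus_sub W E"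
        using sub_minus[OF sB, of "a \<oplus>\<^bsub>V\<^esub> b" a] True a b add_minus_cancel by auto
      ultimately show ?thesis using a b by auto
    qed (use a b in auto)
    then obtain v where v: "v \<in> carrier V" "v \<notin> plus_sub K E" "v \<notin> plus_sub W E" by auto
    have "adj E v \<inter> Z = {\<zero>\<^bsub>V\<^esub>}" if Z: "sub Z" "E \<inter> Z = {\<zero>\<^bsub>V\<^esub>}" "v \<notin> plus_sub Z E" for Z
    proof
      show "adj E v \<inter> Z \<subseteq> {\<zero>\<^bsub>V\<^esub>}"
      proof
        fix x assume "x \<in> adj E v \<inter> Z"
        then obtain e d where x: "e \<in> E" "d \<in> carrier F" "x = e \<oplus>\<^bsub>V\<^esub> d \<odot>\<^bsub>V\<^esub> v" "x \<in> Z" by (auto simp: in_adj_iff)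
        have eV: "e \<in> carrier V" "x \<in> carrier V" using x sE Z sub_in by auto
        have "d \<odot>\<^bsub>V\<^esub> v = x \<ominus>\<^bsub>V\<^esub> e" using x eV v add_minus_cancel by simp
        also have "\<dots> \<in> plus_sub Z E"
          using plus_sub_upper[OF Z(1) sE] x by (intro sub_minus sub_plus Z sE) auto
        finally have "d = \<zero>" using smult_in_sub_iff[OF sub_plus[OF Z(1) sE] x(2) _ v(1)] Z(3) by auto
        then have "x = e" using x v eV by simp
        then show "x \<in> {\<zero>\<^bsub>V\<^esub>}" using x Z by auto
      qed
      show "{\<zero>\<^bsub>V\<^esub>} \<subseteq> adj E v \<inter> Z" using sub_zero sub_adj sE v Z by auto
    qed
    moreover have "v \<notin> E" using v plus_sub_upper[OF K sE] by auto
    ultimately have "P (adj E v)" "card (adj E v) = Q * card E"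
      using K W EK EW v le card_adj[OF sE v(1)] sub_adj[OF sE v(1)] by (auto simp: P_def)
    then show False using m Q_ge_2 sub_card_pos[OF sE] by fastforce
  qed
  define Y where "Y = perp W \<inter> perp E"
  have sp: "sub (perp E)" "sub (perp W)" using sE W sub_perp sub_subset by auto
  have sY: "sub Y" "Y \<subseteq> perp E" using sp sub_Int by (auto simp: Y_def)
  obtain D where D: "sub D" "D \<subseteq> perp E" "Y \<inter> D = {\<zero>\<^bsub>V\<^esub>}" "plus_sub Y D = perp E"
    using complement_exists[OF sY(1) sp(1) sY(2)] by auto
  \<comment> \<open>The index of \<open>Y\<close> in \<open>perp E\<close> equals the index of
    \<open>E\<close> in W + E, which is |W| because \<open>E\<close> and \<open>W\<close> meet
    trivially.\<close>
  have cD: "card D = card W"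
  proof -
    have "card (perp E) = card Y * card D" using card_plus_direct[OF sY(1) D(1,3)] D(4) by simp
    moreover have "card E * card (perp E) = card (carrier V)" by (rule card_perp[OF sE])
    moreover have "card (plus_sub W E) * card Y = card (carrier V)"
      using card_perp[OF sub_plus[OF W sE]] perp_plus_sub[OF W sE] by (simp add: Y_def)
    moreover have "card (plus_sub W E) = card W * card E"
      using card_plus_direct[OF W sE] EW by (simp add: Int_commute)
    ultimately have "(card E * card Y) * card D = (card E * card Y) * card W" by (simp add: mult_ac)
    then show ?thesis using sub_card_pos[OF sE] sub_card_pos[OF sY(1)] by simp
  qed
  have "good h E D"
    unfolding good_def
  proof (intro conjI ballI impI)
    show "f e d = \<zero>" if "e \<in> E" "d \<in> D" for e d
      using that D sE sub_in by (auto simp: perp_def intro!: f_refl[of d e])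
    show "e = \<zero>\<^bsub>V\<^esub>" if e: "e \<in> E" and ed: "\<forall>d\<in>D. f (h e) d = \<zero>" for e
    proof -
      have eV: "e \<in> carrier V" "h e \<in> carrier V" using e sE sub_in lin_closed[OF h] by auto
      let ?w = "h e \<ominus>\<^bsub>V\<^esub> c \<odot>\<^bsub>V\<^esub> e"
      have wV: "?w \<in> carrier V" using eV c by auto
      have "?w \<in> perp D"
      proof (rule perpI[OF wV])
        fix d assume d: "d \<in> D"
        have "f e d = \<zero>" using d e eV D sub_in by (auto simp: perp_def intro!: f_refl[of d e])
        then show "f ?w d = \<zero>" using d ed eV c D sub_in by (simp add: f_minus_left f_smult_left)
      qed
      moreover have "?w \<in> perp Y"
        using hW[OF eV(1)] perp_perp[OF W] perp_anti[of Y "perp W"] by (auto simp: Y_def)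
      ultimately have "?w \<in> perp (perp E)" using perp_plus_sub[OF sY(1) D(1)] D(4) by auto
      then have "?w \<in> E \<inter> W" using perp_perp[OF sE] hW[OF eV(1)] by auto
      then have "?w = \<zero>\<^bsub>V\<^esub>" using EW by auto
      then have "h e = c \<odot>\<^bsub>V\<^esub> e" using eV c minus_eq_zero_iff by simp
      then show ?thesis using hK[OF eV(1)] e EK by auto
    qed
  qed (use sE D cE cD in auto)
  then show ?thesis using cE by auto
qed

end

section \<open>Singular vectors\<close>

text \<open>\<open>S\<close> is the set of singular vectors: all vectors for an alternating form,
  the isotropic ones for a hermitian form, the zeros of q for a quadratic form. It is a parameter
  because in characteristic 2 the bilinear form does not determine it. Dimension 5 in
  \<open>S_exists\<close> is what the argument for quadratic forms uses.\<close>

locale polar_space = form_space F V f \<sigma> for F (structure) and V (structure) and f \<sigma> +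
  fixes S :: "'c set"
  assumes S_subset: "S \<subseteq> carrier V"
    and S_smult: "c \<in> carrier F \<Longrightarrow> v \<in> S \<Longrightarrow> c \<odot>\<^bsub>V\<^esub> v \<in> S"
    and S_add: "u \<in> S \<Longrightarrow> v \<in> S \<Longrightarrow> f u v = \<zero>\<^bsub>F\<^esub> \<Longrightarrow> u \<oplus>\<^bsub>V\<^esub> v \<in> S"
    and S_self: "v \<in> S \<Longrightarrow> f v v = \<zero>\<^bsub>F\<^esub>"
    and S_shift: "e \<in> S \<Longrightarrow> v \<in> carrier V \<Longrightarrow> f v e \<noteq> \<zero>\<^bsub>F\<^esub> \<Longrightarrow>
      \<exists>c\<in>carrier F. v \<oplus>\<^bsub>V\<^esub> c \<odot>\<^bsub>V\<^esub> e \<in> S"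
    and S_exists: "subspace F Y V \<Longrightarrow> card (carrier F) ^ 5 \<le> card Y \<Longrightarrow> \<exists>v\<in>Y \<inter> S. v \<noteq> \<zero>\<^bsub>V\<^esub>"
begin

lemma S_in: "v \<in> S \<Longrightarrow> v \<in> carrier V" using S_subset by auto

text \<open>A complement of \<open>Y \<inter> Z\<close> in \<open>Y\<close> has dimension at least
  5, and its nonzero singular vectors lie outside \<open>Z\<close>.\<close>

lemma singular_outside:
  assumes Y: "sub Y" and Z: "sub Z" and c: "Q ^ 5 * card Z \<le> card Y"
  shows "\<exists>v\<in>Y \<inter> S. v \<notin> Z"
proof -
  have s: "sub (Y \<inter> Z)" using Y Z sub_Int by auto
  obtain Z' where Z': "sub Z'" "Z' \<subseteq> Y" "(Y \<inter> Z) \<inter> Z' = {\<zero>\<^bsub>V\<^esub>}" "plus_sub (Y \<inter> Z) Z' = Y"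
    using complement_exists[OF s Y] by auto
  have "card Y \<le> card (Y \<inter> Z) * card Z'" using card_plus_le[OF s Z'(1)] Z' by simp
  also have "\<dots> \<le> card Z * card Z'" using sub_finite[OF Z] by (intro mult_right_mono card_mono) auto
  finally have "card Y \<le> card Z * card Z'" .
  from order_trans[OF c this] have "Q ^ 5 * card Z \<le> card Z' * card Z" by (simp only: mult_ac)
  then have "Q ^ 5 \<le> card Z'" using sub_card_pos[OF Z] by simp
  then obtain v where "v \<in> Z' \<inter> S" "v \<noteq> \<zero>\<^bsub>V\<^esub>" using S_exists[OF Z'(1)] by (auto simp: Q_def)
  then show ?thesis using Z' by (intro bexI[of _ v]) auto
qed

text \<open>Fix a singular \<open>e\<close> in \<open>Y\<close> outside \<open>Z\<close>. A vector
  of \<open>Y\<close> not orthogonal to \<open>e\<close> is the difference of a singular vector and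
  a multiple of \<open>e\<close>; any other one is a difference of two vectors of the first kind.
  \<open>A\<close> is assumed closed under differences only, since one application concerns a set
  whose closure under scalars is not known beforehand.\<close>

lemma singular_generate:
  assumes Y: "sub Y" and Z: "sub Z" and c: "Q ^ 5 * card Z \<le> card Y"
    and rad: "\<And>e. e \<in> Y \<Longrightarrow> e \<notin> Z \<Longrightarrow> \<exists>y\<in>Y. f y e \<noteq> \<zero>"
    and A: "\<And>a b. a \<in> A \<Longrightarrow> b \<in> A \<Longrightarrow> a \<ominus>\<^bsub>V\<^esub> b \<in> A" "Y \<inter> S \<subseteq> A"
  shows "Y \<subseteq> A"
proof -
  obtain e where e: "e \<in> Y" "e \<in> S" "e \<notin> Z" using singular_outside[OF Y Z c] by auto
  have eV: "e \<in> carrier V" using e S_in by auto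
  have 1: "y \<in> A" if y: "y \<in> Y" "f y e \<noteq> \<zero>" for y
  proof -
    have yV: "y \<in> carrier V" using y Y sub_in by auto
    obtain d where d: "d \<in> carrier F" "y \<oplus>\<^bsub>V\<^esub> d \<odot>\<^bsub>V\<^esub> e \<in> S" using S_shift e y yV by blast
    have "d \<odot>\<^bsub>V\<^esub> e \<in> Y" using Y e d sub_smult by auto
    moreover from this have "y \<oplus>\<^bsub>V\<^esub> d \<odot>\<^bsub>V\<^esub> e \<in> Y" using Y y sub_add by auto
    ultimately have "(y \<oplus>\<^bsub>V\<^esub> d \<odot>\<^bsub>V\<^esub> e) \<ominus>\<^bsub>V\<^esub> d \<odot>\<^bsub>V\<^esub> e \<in> A" using A d e S_smult by blast
    then show ?thesis using yV d eV add_minus_cancel by simp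
  qed
  obtain y0 where y0: "y0 \<in> Y" "f y0 e \<noteq> \<zero>" using rad e by blast
  show ?thesis
  proof
    fix y assume y: "y \<in> Y"
    have V: "y \<in> carrier V" "y0 \<in> carrier V" using y y0 Y sub_in by auto
    show "y \<in> A"
    proof (cases "f y e = \<zero>")
      case True
      then have "f (y \<oplus>\<^bsub>V\<^esub> y0) e \<noteq> \<zero>" using V eV y0 by (simp add: f_add_left)
      then have "y \<oplus>\<^bsub>V\<^esub> y0 \<in> A" "y0 \<in> A" using 1 y y0 Y sub_add by auto
      then show ?thesis using A(1)[of "y \<oplus>\<^bsub>V\<^esub> y0" y0] V add_minus_cancel by simp
    qed (use 1 y in auto)
  qed
qed

lemma adj_singular:
  assumes E: "sub E" "E \<subseteq> S" and v: "v \<in> S" "v \<in> perp E" shows "adj E v \<subseteq> S"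
proof
  fix x assume "x \<in> adj E v"
  then obtain e c where x: "e \<in> E" "c \<in> carrier F" "x = e \<oplus>\<^bsub>V\<^esub> c \<odot>\<^bsub>V\<^esub> v" by (auto simp: in_adj_iff)
  have V: "e \<in> carrier V" "v \<in> carrier V" using x E v S_in by auto
  have "f (c \<odot>\<^bsub>V\<^esub> v) e = \<zero>" using v x V by (simp add: f_smult_left perp_def)
  then have "f e (c \<odot>\<^bsub>V\<^esub> v) = \<zero>" using V x f_refl by simp
  then show "x \<in> S" using x E v S_smult S_add by auto
qed

text \<open>The counterpart of \<open>good_maximal_eigenspace\<close> for D = E. Only singular
  vectors may be adjoined, and a single \<open>r\<close> helps only if \<open>f (h r) r\<close> is
  nonzero; otherwise two orthogonal singular vectors are adjoined together. Hence \<open>max\<close>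
  excludes growth by one and by two dimensions.\<close>

lemma good_self_maximal_eigenspace:
  assumes h: "lin h" "inj_on h (carrier V)" and g: "good h E E" and ES: "E \<subseteq> S"
    and big: "Q ^ 9 * (card E * card E) \<le> card (carrier V)"
    and max: "\<And>E'. good h E' E' \<Longrightarrow> E' \<subseteq> S \<Longrightarrow> card E' \<noteq> Q * card E \<and> card E' \<noteq> Q * (Q * card E)"
  shows "\<exists>c\<in>carrier F. card (carrier V) \<le> card E ^ 3 * card {v \<in> carrier V. h v = c \<odot>\<^bsub>V\<^esub> v}"
proof -
  define R where "R = {r \<in> perp E. h r \<in> perp E}"
  have sE: "sub E" using g by (auto simp: good_def)
  have sR: "sub R" and cR: "card (carrier V) \<le> card E * card E * card R"
    using card_double_perp_ge[OF h sE] by (auto simp: R_def)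
  have ER: "E \<inter> R = {\<zero>\<^bsub>V\<^esub>}" using good_Int[OF g sR] by (simp add: R_def)
  have spE: "sub (perp E)" using sE sub_perp sub_subset by auto
  have RV: "r \<in> carrier V" "h r \<in> carrier V" if "r \<in> R" for r
    using that sR sub_in lin_closed[OF h(1)] by auto
  have "E \<subseteq> perp E" using g sE sub_in by (auto simp: good_def perp_def)
  then have "plus_sub E R \<subseteq> perp E" by (intro plus_sub_least spE) (auto simp: R_def)
  moreover have "card (perp E) \<le> card (plus_sub E R)"
  proof -
    have "card E * card (perp E) \<le> card E * (card E * card R)" using card_perp[OF sE] cR by (simp add: mult.assoc)
    then show ?thesis using card_plus_direct[OF sE sR ER] sub_card_pos[OF sE] by simp
  qed
  ultimately have dec: "plus_sub E R = perp E" using sub_finite[OF spE] by (metis card_seteq)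
  \<comment> \<open>Since \<open>perp E\<close> is the sum of \<open>E\<close> and \<open>R\<close>,
    a vector of \<open>R\<close> orthogonal to \<open>R\<close> lies in
    \<open>perp (perp E) = E\<close>. So the form is nondegenerate on \<open>R\<close>.\<close>
  have nd: "r \<in> R \<Longrightarrow> r \<in> perp R \<Longrightarrow> r = \<zero>\<^bsub>V\<^esub>" for r
    using perp_plus_sub[OF sE sR] dec perp_perp[OF sE] ER by (auto simp: R_def)
  \<comment> \<open>9 = 2 + 5 + 2: later a singular vector of \<open>R\<close> is needed that is
    orthogonal to two given vectors and outside their span.\<close>
  have cR9: "Q ^ 9 \<le> card R"
  proof -
    have "(card E * card E) * Q ^ 9 \<le> (card E * card E) * card R"
      using order_trans[OF big cR] by (simp only: mult_ac)
    then show ?thesis using sub_card_pos[OF sE] by simp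
  qed
  have b1: "f (h r) r = \<zero>" if r: "r \<in> R" "r \<in> S" for r
  proof (rule ccontr)
    assume n: "f (h r) r \<noteq> \<zero>"
    have "good h (adj E r) (adj E r)" "r \<notin> E"
      using good_extend[OF h(1) g, of r r] n r S_self[OF r(2)] by (auto simp: R_def)
    then show False using max[of "adj E r"] card_adj[OF sE, of r] RV r adj_singular[OF sE ES, of r] by (auto simp: R_def)
  qed
  \<comment> \<open>Otherwise \<open>b1\<close> for the sum of \<open>r\<close> and \<open>t\<close>
    gives \<open>f (h t) r\<close> = - \<open>f (h r) t\<close>. The 2 by 2 block of
    \<open>r\<close> and \<open>t\<close> then has zero diagonal and invertible off-diagonal
    entries, and \<open>E\<close> could grow by two dimensions.\<close>
  have b2: "f (h r) t = \<zero>" if r: "r \<in> R" "r \<in> S" and t: "t \<in> R" "t \<in> S" and rt: "f r t = \<zero>" for r t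
  proof (rule ccontr)
    assume n: "f (h r) t \<noteq> \<zero>"
    have V: "r \<in> carrier V" "t \<in> carrier V" "h r \<in> carrier V" "h t \<in> carrier V" using RV r t by auto
    have tr: "f t r = \<zero>" using rt V f_refl by auto
    have "f (h (r \<oplus>\<^bsub>V\<^esub> t)) (r \<oplus>\<^bsub>V\<^esub> t) = \<zero>"
      by (rule b1) (use r t sR sub_add S_add rt in auto)
    then have "f (h r) t \<oplus> f (h t) r = \<zero>"
      using V b1 r t h by (simp add: lin_add f_add_left f_add_right R.a_comm)
    then have n2: "f (h t) r \<noteq> \<zero>" using n V by auto
    have g1: "good h (adj E r) (adj E t)" "r \<notin> E" "t \<notin> E"
      using good_extend[OF h(1) g, of r t] r t rt n by (auto simp: R_def)
    have p: "t \<in> perp (adj E t)" "h t \<in> perp (adj E t)" "r \<in> perp (adj E r)"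
      using V r t S_self b1 by (auto simp: perp_adj[OF sE] R_def)
    have g2: "good h (adj (adj E r) t) (adj (adj E t) r)" "t \<notin> adj E r"
      using good_extend[OF h(1) g1(1) p tr n2] by auto
    \<comment> \<open>\<open>r\<close> was paired with \<open>t\<close> first and \<open>t\<close>
      with \<open>r\<close> second; both sides span the same subspace, so the new pair again
      consists of two equal subspaces.\<close>
    have eq: "adj (adj E t) r = adj (adj E r) t" by (rule adj_commute[OF sE V(2,1)])
    have s1: "sub (adj E r)" "adj E r \<subseteq> S" using sub_adj sE V adj_singular[OF sE ES, of r] r by (auto simp: R_def)
    have "t \<in> perp (adj E r)" using V t tr by (auto simp: perp_adj[OF sE] R_def)
    then have "adj (adj E r) t \<subseteq> S" using adj_singular[OF s1] t by auto
    then show False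
      using max[of "adj (adj E r) t"] g2 eq card_adj[OF s1(1) V(2)] card_adj[OF sE V(1)] g1 by simp
  qed
  \<comment> \<open>From singular vectors to all \<open>w\<close> orthogonal to \<open>r\<close>:
    the subspace \<open>?Y\<close> is generated by its singular vectors, because its radical is
    contained in \<open>line r\<close>.\<close>
  have b3: "f (h r) w = \<zero>" if r: "r \<in> R" "r \<in> S" and w: "w \<in> R" "f r w = \<zero>" for r w
  proof -
    have V: "r \<in> carrier V" "h r \<in> carrier V" using RV r by auto
    let ?Y = "{w \<in> R. f w r = \<zero>}" and ?A = "{w \<in> carrier V. f (h r) w = \<zero>}"
    have sY: "sub ?Y" using sub_linear_kernel[OF sR linear_on_f[OF sR V(1)]] .
    have "card R \<le> Q * card ?Y" by (rule card_kernel_ge[OF sR linear_on_f[OF sR V(1)]])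
    then have "Q * Q ^ 8 \<le> Q * card ?Y" using cR9 by (simp add: power_Suc[symmetric] del: power_Suc)
    then have "Q ^ 8 \<le> card ?Y" using Q_ge_2 by simp
    moreover have "Q ^ 5 * card (line r) \<le> Q ^ 5 * Q" using card_line_le by simp
    moreover have "Q ^ 5 * Q \<le> Q ^ 8" using power_increasing[of 6 8 Q] Q_ge_2 by (simp add: numeral_eq_Suc)
    ultimately have c: "Q ^ 5 * card (line r) \<le> card ?Y" by linarith
    have "?Y \<subseteq> ?A"
    proof (rule singular_generate[OF sY sub_line[OF V(1)] c])
      fix e assume e: "e \<in> ?Y" "e \<notin> line r"
      have eV: "e \<in> carrier V" using e RV by auto
      show "\<exists>y\<in>?Y. f y e \<noteq> \<zero>"
      proof (rule ccontr)
        assume n: "\<not> (\<exists>y\<in>?Y. f y e \<noteq> \<zero>)"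
        have "f e y = \<zero>" if y: "y \<in> R" "f r y = \<zero>" for y
        proof -
          have "f y r = \<zero>" using y V RV f_refl by auto
          then have "f y e = \<zero>" using n y by auto
          then show ?thesis using y eV RV f_refl by auto
        qed
        then obtain c where c: "c \<in> carrier F" "\<And>y. y \<in> R \<Longrightarrow> f e y = c \<otimes> f r y"
          using functional_proportional[OF sR V(1) eV] by blast
        have "e \<ominus>\<^bsub>V\<^esub> c \<odot>\<^bsub>V\<^esub> r \<in> perp R"
          using c V eV RV by (intro perpI) (auto simp: f_minus_left f_smult_left)
        moreover have "e \<ominus>\<^bsub>V\<^esub> c \<odot>\<^bsub>V\<^esub> r \<in> R" using e r c sR sub_minus sub_smult by auto
        ultimately have "e \<ominus>\<^bsub>V\<^esub> c \<odot>\<^bsub>V\<^esub> r = \<zero>\<^bsub>V\<^esub>" by (intro nd)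
        then have "e = c \<odot>\<^bsub>V\<^esub> r" using V eV c(1) minus_eq_zero_iff by simp
        then show False using e c by (auto simp: line_def)
      qed
    next
      show "?Y \<inter> S \<subseteq> ?A"
        using b2[OF r] V RV f_refl by auto
      show "a \<ominus>\<^bsub>V\<^esub> b \<in> ?A" if "a \<in> ?A" "b \<in> ?A" for a b
        using that V by (auto simp: f_minus_right)
    qed
    moreover have "f w r = \<zero>" using w V RV f_refl by auto
    ultimately show ?thesis using w by auto
  qed
  \<comment> \<open>The difference is orthogonal to \<open>R\<close> by the choice of
    \<open>c\<close> and to \<open>E\<close> because \<open>r\<close> and \<open>h r\<close> are, so
    it lies in \<open>perp (perp E) = E\<close>.\<close>
  have ex: "\<exists>c\<in>carrier F. h r \<ominus>\<^bsub>V\<^esub> c \<odot>\<^bsub>V\<^esub> r \<in> E" if r: "r \<in> R" "r \<in> S" for r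
  proof -
    have V: "r \<in> carrier V" "h r \<in> carrier V" using r RV by auto
    obtain c where c: "c \<in> carrier F" "\<And>w. w \<in> R \<Longrightarrow> f (h r) w = c \<otimes> f r w"
      using functional_proportional[OF sR V] b3 r by blast
    have "h r \<ominus>\<^bsub>V\<^esub> c \<odot>\<^bsub>V\<^esub> r \<in> perp R"
      using c V RV by (intro perpI) (auto simp: f_minus_left f_smult_left)
    moreover have "h r \<ominus>\<^bsub>V\<^esub> c \<odot>\<^bsub>V\<^esub> r \<in> perp E"
      using r c by (auto simp: R_def intro!: sub_minus[OF spE] sub_smult[OF spE])
    ultimately have "h r \<ominus>\<^bsub>V\<^esub> c \<odot>\<^bsub>V\<^esub> r \<in> perp (perp E)"
      using perp_plus_sub[OF sE sR] dec by auto
    then show ?thesis using c perp_perp[OF sE] by auto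
  qed
  have common: "a = b"
    if r: "r \<in> R" "r \<in> S" "r \<noteq> \<zero>\<^bsub>V\<^esub>" and t: "t \<in> R" "t \<in> S" "t \<notin> line r" and rt: "f r t = \<zero>"
      and a: "a \<in> carrier F" "h r \<ominus>\<^bsub>V\<^esub> a \<odot>\<^bsub>V\<^esub> r \<in> E" and b: "b \<in> carrier F" "h t \<ominus>\<^bsub>V\<^esub> b \<odot>\<^bsub>V\<^esub> t \<in> E"
    for r t a b
  proof -
    obtain c where c: "c \<in> carrier F" "h (r \<oplus>\<^bsub>V\<^esub> t) \<ominus>\<^bsub>V\<^esub> c \<odot>\<^bsub>V\<^esub> (r \<oplus>\<^bsub>V\<^esub> t) \<in> E"
      using ex[of "r \<oplus>\<^bsub>V\<^esub> t"] S_add rt r t sub_add[OF sR] by blast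
    show ?thesis
      by (rule eigenvalue_unique[OF sE sR ER h(1) a(1) b(1) c(1) r(1) t(1) r(3) t(3) a(2) b(2) c(2)])
  qed
  obtain r where r: "r \<in> R" "r \<in> S" "r \<noteq> \<zero>\<^bsub>V\<^esub>"
  proof -
    have "Q ^ 5 \<le> card R" using cR9 power_increasing[of 5 9 Q] Q_ge_2 by linarith
    then show ?thesis using S_exists[OF sR] that by (auto simp: Q_def)
  qed
  have rV: "r \<in> carrier V" "h r \<in> carrier V" using r RV by auto
  obtain a where a: "a \<in> carrier F" "h r \<ominus>\<^bsub>V\<^esub> a \<odot>\<^bsub>V\<^esub> r \<in> E" using ex r by blast
  have all_S: "h t \<ominus>\<^bsub>V\<^esub> a \<odot>\<^bsub>V\<^esub> t \<in> E" if t: "t \<in> R" "t \<in> S" for t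
  proof (cases "t = \<zero>\<^bsub>V\<^esub>")
    case True
    then show ?thesis using a sub_zero[OF sE] lin_zero[OF h(1)] sub_minus[OF sE, of "\<zero>\<^bsub>V\<^esub>" "\<zero>\<^bsub>V\<^esub>"] by simp
  next
    case False
    have tV: "t \<in> carrier V" "h t \<in> carrier V" using t RV by auto
    obtain b where b: "b \<in> carrier F" "h t \<ominus>\<^bsub>V\<^esub> b \<odot>\<^bsub>V\<^esub> t \<in> E" using ex t by blast
    \<comment> \<open>\<open>r\<close> and \<open>t\<close> need not be orthogonal, so their scalars
      are compared through a singular \<open>w\<close> that is orthogonal to both and lies outside
      their span.\<close>
    let ?Y = "{w \<in> {w \<in> R. f w r = \<zero>}. f w t = \<zero>}"
    have sY1: "sub {w \<in> R. f w r = \<zero>}" by (rule sub_linear_kernel[OF sR linear_on_f[OF sR rV(1)]])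
    have sY: "sub ?Y" by (rule sub_linear_kernel[OF sY1 linear_on_f[OF sY1 tV(1)]])
    have "card R \<le> Q * card {w \<in> R. f w r = \<zero>}" by (rule card_kernel_ge[OF sR linear_on_f[OF sR rV(1)]])
    also have "\<dots> \<le> Q * (Q * card ?Y)"
      by (intro mult_left_mono card_kernel_ge[OF sY1 linear_on_f[OF sY1 tV(1)]]) auto
    finally have "Q * (Q * Q ^ 7) \<le> Q * (Q * card ?Y)" using cR9 by (simp add: power_Suc[symmetric] del: power_Suc)
    then have "Q ^ 7 \<le> card ?Y" using Q_ge_2 by simp
    moreover have "card (adj (line r) t) \<le> Q * Q"
      unfolding adj_eq_plus_line
      by (rule order_trans[OF card_plus_le[OF sub_line[OF rV(1)] sub_line[OF tV(1)]]])
        (intro mult_mono card_line_le, auto)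
    then have "Q ^ 5 * card (adj (line r) t) \<le> Q ^ 7" 
      using mult_left_mono[of "card (adj (line r) t)" "Q * Q" "Q ^ 5"] by (simp add: numeral_eq_Suc mult_ac)
    ultimately have "Q ^ 5 * card (adj (line r) t) \<le> card ?Y" by linarith
    then obtain w where w: "w \<in> ?Y" "w \<in> S" "w \<notin> adj (line r) t"
      using singular_outside[OF sY sub_adj[OF sub_line[OF rV(1)] tV(1)]] by auto
    have "line t \<subseteq> adj (line r) t" unfolding adj_eq_plus_line
      by (rule plus_sub_upper(2)[OF sub_line[OF rV(1)] sub_line[OF tV(1)]])
    then have wl: "w \<notin> line r" "w \<notin> line t"
      using w adj_upper[OF sub_line[OF rV(1)] tV(1)] by auto
    obtain d where d: "d \<in> carrier F" "h w \<ominus>\<^bsub>V\<^esub> d \<odot>\<^bsub>V\<^esub> w \<in> E" using ex w by blast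
    have "a = d" by (rule common[OF r, of w]) (use w wl a d rV RV f_refl in auto)
    moreover have "b = d" by (rule common[OF t False, of w]) (use w wl b d tV RV f_refl in auto)
    ultimately show ?thesis using b by simp
  qed
  have "R \<subseteq> {t \<in> carrier V. h t \<ominus>\<^bsub>V\<^esub> a \<odot>\<^bsub>V\<^esub> t \<in> E}"
  proof (rule singular_generate[OF sR sub_triv])
    have "Q ^ 5 \<le> Q ^ 9" using power_increasing[of 5 9 Q] Q_ge_2 by simp
    then have "Q ^ 5 \<le> card R" using cR9 by (rule order_trans)
    then show "Q ^ 5 * card {\<zero>\<^bsub>V\<^esub>} \<le> card R" by simp
    show "\<exists>y\<in>R. f y e \<noteq> \<zero>" if "e \<in> R" "e \<notin> {\<zero>\<^bsub>V\<^esub>}" for e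
    proof -
      have "e \<notin> perp R" "e \<in> carrier V" using that nd RV by auto
      then obtain y where "y \<in> R" "f e y \<noteq> \<zero>" by (auto simp: perp_def)
      then show ?thesis using f_refl RV \<open>e \<in> carrier V\<close> by blast
    qed
    have "sub {t \<in> carrier V. h t \<ominus>\<^bsub>V\<^esub> a \<odot>\<^bsub>V\<^esub> t \<in> E}"
      by (rule sub_vimage[OF lin_shift[OF h(1) a(1)] sE])
    then show "x \<ominus>\<^bsub>V\<^esub> y \<in> {t \<in> carrier V. h t \<ominus>\<^bsub>V\<^esub> a \<odot>\<^bsub>V\<^esub> t \<in> E}"
      if "x \<in> {t \<in> carrier V. h t \<ominus>\<^bsub>V\<^esub> a \<odot>\<^bsub>V\<^esub> t \<in> E}" "y \<in> {t \<in> carrier V. h t \<ominus>\<^bsub>V\<^esub> a \<odot>\<^bsub>V\<^esub> t \<in> E}" for x y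
      using sub_minus that by blast
    show "R \<inter> S \<subseteq> {t \<in> carrier V. h t \<ominus>\<^bsub>V\<^esub> a \<odot>\<^bsub>V\<^esub> t \<in> E}" using all_S RV by auto
  qed
  then show ?thesis using kernel_bound[OF h(1) a(1) sR sE _ cR] a by blast
qed

text \<open>As in \<open>good_complementary\<close>, but with D = E totally singular. Once
  \<open>E\<close> has the size of \<open>W\<close> and meets \<open>perp W\<close> trivially, the
  whole space is the sum of \<open>E\<close> and \<open>perp W\<close>; dually \<open>W\<close>
  meets \<open>perp E\<close> trivially, and the radical vanishes. The condition on
  \<open>E \<inter> W\<close> is carried along so that the greedy enlargement of \<open>E\<close>
  does not get stuck.\<close>

lemma good_self_complementary:
  assumes h: "lin h" and c: "c \<in> carrier F" and W: "sub W" 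
    and hW: "\<And>v. v \<in> carrier V \<Longrightarrow> h v \<ominus>\<^bsub>V\<^esub> c \<odot>\<^bsub>V\<^esub> v \<in> W"
    and hK: "\<And>v. v \<in> carrier V \<Longrightarrow> h v = c \<odot>\<^bsub>V\<^esub> v \<Longrightarrow> v \<in> perp W"
    and big: "Q ^ 7 * (card W * card W * card W) \<le> card (carrier V)"
  shows "\<exists>E. good h E E \<and> E \<subseteq> S \<and> card E = card W"
proof -
  let ?K = "perp W"
  have K: "sub ?K" using W sub_perp sub_subset by auto
  define P where "P E \<longleftrightarrow> sub E \<and> E \<subseteq> S \<and> E \<subseteq> perp E \<and> E \<inter> ?K = {\<zero>\<^bsub>V\<^esub>} \<and> E \<inter> W = {\<zero>\<^bsub>V\<^esub>} \<and> card E \<le> card W" for E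
  have zS: "\<zero>\<^bsub>V\<^esub> \<in> S"
  proof -
    have "card W * card W * card W \<ge> 1" using sub_card_pos[OF W] by simp
    then have "Q ^ 7 * 1 \<le> card (carrier V)" using big by (meson mult_left_mono order_trans zero_le)
    moreover have "Q ^ 5 \<le> Q ^ 7" using power_increasing[of 5 7 Q] Q_ge_2 by simp
    ultimately have "Q ^ 5 \<le> card (carrier V)" by linarith
    then obtain v where "v \<in> S" using S_exists[OF sub_carrier] by (auto simp: Q_def)
    then show ?thesis using S_smult[of \<zero> v] S_in by simp
  qed
  have "P {\<zero>\<^bsub>V\<^esub>}" using sub_triv sub_zero K W sub_card_pos[OF W] zS by (auto simp: P_def perp_def)
  then obtain E where E: "P E" and m: "\<And>E'. P E' \<Longrightarrow> card E' \<le> card E"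
    using ex_has_greatest_nat[of P "{\<zero>\<^bsub>V\<^esub>}" card "Suc (card W)"] by (auto simp: P_def)
  have sE: "sub E" and ES: "E \<subseteq> S" and EE: "E \<subseteq> perp E" and EK: "E \<inter> ?K = {\<zero>\<^bsub>V\<^esub>}" and EW: "E \<inter> W = {\<zero>\<^bsub>V\<^esub>}"
    and leW: "card E \<le> card W" using E by (auto simp: P_def)
  have spE: "sub (perp E)" using sE sub_perp sub_subset by auto
  have cE: "card E = card W"
  proof (rule ccontr)
    assume "card E \<noteq> card W"
    then have lt: "card E < card W" using leW by auto
    obtain i j where ij: "card E = Q ^ i" "card W = Q ^ j" using card_sub_power sE W by metis
    then have "i < j" using lt Q_ge_2 by simp
    then have le: "Q * card E \<le> card W" using ij Q_ge_2
      by (metis Suc_leI one_le_numeral order_trans power_Suc power_increasing)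
    have big': "Q ^ 7 * (card W * card W) \<le> card (perp E)"
    proof -
      have "card W * (Q ^ 7 * (card W * card W)) \<le> card E * card (perp E)" using big card_perp[OF sE] by (simp add: mult_ac)
      also have "\<dots> \<le> card W * card (perp E)" using leW by simp
      finally show ?thesis using sub_card_pos[OF W] by simp
    qed
    have cW: "1 \<le> card W" using sub_card_pos[OF W] by simp
    have cEW: "card E \<le> card W * card W" using mult_mono[OF leW cW] by simp
    have big1: "Q ^ 5 * card E \<le> card (perp E)"
    proof -
      have "Q ^ 5 * card E \<le> Q ^ 7 * (card W * card W)" 
        using cEW power_increasing[of 5 7 Q] Q_ge_2 by (intro mult_mono) auto
      then show ?thesis using big' by linarith
    qed
    let ?A = "plus_sub ?K E" and ?B = "plus_sub W E"
    have sA: "sub ?A" and sB: "sub ?B" using K W sE sub_plus by auto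
    \<comment> \<open>If \<open>perp E\<close> were contained in \<open>?A\<close>, dualising would
      give \<open>W \<inter> perp E \<subseteq> E\<close>. But |E| < |W| leaves a nonzero vector in
      \<open>W \<inter> perp E\<close>, while \<open>E \<inter> W\<close> is zero.\<close>
    have notA: "\<not> perp E \<subseteq> ?A"
    proof
      assume "perp E \<subseteq> ?A"
      then have i: "perp ?A \<subseteq> E" using perp_anti perp_perp[OF sE] by blast
      have "card W \<le> card E * card (W \<inter> perp E)" by (rule card_Int_perp[OF W sE])
      then have "card E * 1 < card E * card (W \<inter> perp E)" using lt by linarith
      then have "1 < card (W \<inter> perp E)" by simp
      then obtain w where w: "w \<in> W" "w \<in> perp E" "w \<noteq> \<zero>\<^bsub>V\<^esub>"
        using exists_not_in[OF sub_triv, of "W \<inter> perp E"] by auto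
      then have "w \<in> perp ?A" using perp_plus_sub[OF K sE] perp_perp[OF W] by auto
      then show False using i w EW by auto
    qed
    have radE: "\<exists>y\<in>perp E. f y e \<noteq> \<zero>" if "e \<in> perp E" "e \<notin> E" for e
    proof (rule ccontr)
      assume "\<not> ?thesis"
      then have "e \<in> perp (perp E)" using that perp_in by (auto simp: perp_def[of "perp E"] intro: f_refl)
      then show False using that perp_perp[OF sE] by auto
    qed
    obtain v where v: "v \<in> perp E" "v \<in> S" "v \<notin> ?A"
      using singular_generate[OF spE sE big1 radE, of ?A] sub_minus[OF sA] notA by auto
    have vV: "v \<in> carrier V" using v S_in by auto
    have vE: "v \<notin> E" using v plus_sub_upper[OF K sE] by auto
    \<comment> \<open>The argument for two proper subspaces again. Now the sum of the two vectors
      must stay singular, so the second one is sought in the orthogonal space of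
      \<open>adj E v\<close>.\<close>
    have "\<exists>u. u \<in> perp E \<and> u \<in> S \<and> u \<notin> ?A \<and> u \<notin> ?B"
    proof (cases "v \<in> ?B")
      case True
      let ?Y = "perp (adj E v)"
      have sEv: "sub (adj E v)" by (rule sub_adj[OF sE vV])
      have sY: "sub ?Y" using sEv sub_perp sub_subset by auto
      have cY: "card (perp E) \<le> Q * card ?Y"
        using card_kernel_ge[OF spE linear_on_f[OF spE vV]] perp_adj[OF sE vV] by simp
      then have cY': "Q ^ 6 * (card W * card W) \<le> card ?Y"
      proof -
        have "Q * (Q ^ 6 * (card W * card W)) \<le> Q * card ?Y" 
          using order_trans[OF big' cY] by (simp add: numeral_eq_Suc mult.assoc)
        then show ?thesis using Q_ge_2 by simp
      qed
      have cEv: "card (adj E v) = Q * card E" by (rule card_adj[OF sE vV vE])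
      have c1: "Q ^ 5 * card (adj E v) \<le> card ?Y"
      proof -
        have "Q ^ 5 * card (adj E v) = Q ^ 6 * card E" using cEv by (simp add: numeral_eq_Suc)
        also have "\<dots> \<le> Q ^ 6 * (card W * card W)" using cEW by simp
        finally show ?thesis using cY' by linarith
      qed
      have radY: "\<exists>y\<in>?Y. f y e \<noteq> \<zero>" if "e \<in> ?Y" "e \<notin> adj E v" for e
      proof (rule ccontr)
        assume "\<not> ?thesis"
        then have "e \<in> perp ?Y" using that perp_in by (auto simp: perp_def[of ?Y] intro: f_refl)
        then show False using that perp_perp[OF sEv] by auto
      qed
      have notB: "\<not> ?Y \<subseteq> ?B"
      proof
        assume "?Y \<subseteq> ?B"
        then have "card ?Y \<le> card ?B" using sub_finite[OF sB] card_mono by auto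
        also have "\<dots> \<le> card W * card E" by (rule card_plus_le[OF W sE])
        also have "\<dots> \<le> card W * card W" using leW by simp
        finally have "Q ^ 6 * (card W * card W) \<le> 1 * (card W * card W)" using cY' by linarith
        then have "Q ^ 6 \<le> 1" using cW by (simp del: mult_1)
        then show False using Q_ge_2 power_increasing[of 1 6 Q] by simp
      qed
      obtain w where w: "w \<in> ?Y" "w \<in> S" "w \<notin> ?B"
        using singular_generate[OF sY sEv c1 radY, of ?B] sub_minus[OF sB] notB by auto
      have wV: "w \<in> carrier V" using w S_in by auto
      have wE: "w \<in> perp E" "f w v = \<zero>" using w perp_adj[OF sE vV] by auto
      show ?thesis
      proof (cases "w \<in> ?A")
        case True2: True
        have "w \<oplus>\<^bsub>V\<^esub> v \<in> S" "w \<oplus>\<^bsub>V\<^esub> v \<in> perp E" using w v wE S_add sub_add[OF spE] by auto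
        moreover have "w \<oplus>\<^bsub>V\<^esub> v \<notin> ?A"
          using sub_minus[OF sA, of "w \<oplus>\<^bsub>V\<^esub> v" w] True2 v wV vV add_minus_cancel by auto
        moreover have "w \<oplus>\<^bsub>V\<^esub> v \<notin> ?B"
          using sub_minus[OF sB, of "w \<oplus>\<^bsub>V\<^esub> v" v] True w wV vV add_minus_cancel by auto
        ultimately show ?thesis by blast
      qed (use w wE in auto)
    qed (use v in auto)
    then obtain u where u: "u \<in> perp E" "u \<in> S" "u \<notin> ?A" "u \<notin> ?B" by auto
    have uV: "u \<in> carrier V" using u S_in by auto
    have int: "adj E u \<inter> Z = {\<zero>\<^bsub>V\<^esub>}" if Z: "sub Z" "E \<inter> Z = {\<zero>\<^bsub>V\<^esub>}" "u \<notin> plus_sub Z E" for Z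
    proof
      show "adj E u \<inter> Z \<subseteq> {\<zero>\<^bsub>V\<^esub>}"
      proof
        fix x assume "x \<in> adj E u \<inter> Z"
        then obtain e d where x: "e \<in> E" "d \<in> carrier F" "x = e \<oplus>\<^bsub>V\<^esub> d \<odot>\<^bsub>V\<^esub> u" "x \<in> Z" by (auto simp: in_adj_iff)
        have eV: "e \<in> carrier V" "x \<in> carrier V" using x sE Z sub_in by auto
        have "d \<odot>\<^bsub>V\<^esub> u = x \<ominus>\<^bsub>V\<^esub> e" using x eV uV add_minus_cancel by simp
        also have "\<dots> \<in> plus_sub Z E"
          using plus_sub_upper[OF Z(1) sE] x by (intro sub_minus sub_plus Z sE) auto
        finally have "d = \<zero>" using smult_in_sub_iff[OF sub_plus[OF Z(1) sE] x(2) _ uV] Z(3) by auto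
        then have "x = e" using x uV eV by simp
        then show "x \<in> {\<zero>\<^bsub>V\<^esub>}" using x Z by auto
      qed
      show "{\<zero>\<^bsub>V\<^esub>} \<subseteq> adj E u \<inter> Z" using sub_zero sub_adj sE uV Z by auto
    qed
    have "adj E u \<subseteq> perp (adj E u)"
    proof -
      have "E \<subseteq> perp (adj E u)" 
        unfolding perp_adj[OF sE uV] using EE u sE sub_in uV f_refl by (auto simp: perp_def)
      moreover have "u \<in> perp (adj E u)" using u S_self uV perp_adj[OF sE uV] by auto
      ultimately show ?thesis using sub_adj[OF sE uV] by (intro adj_least sub_perp sub_subset) auto
    qed
    moreover have "u \<notin> E" using u plus_sub_upper[OF K sE] by auto
    ultimately have "P (adj E u)" "card (adj E u) = Q * card E"
      using int[OF K EK u(3)] int[OF W EW u(4)] le card_adj[OF sE uV] sub_adj[OF sE uV] adj_singular[OF sE ES u(2,1)]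
      by (auto simp: P_def)
    then show False using m Q_ge_2 sub_card_pos[OF sE] by fastforce
  qed
  have "plus_sub E ?K = carrier V"
  proof (rule card_subset_eq[OF finite_V])
    show "plus_sub E ?K \<subseteq> carrier V" using sE K sub_plus sub_subset by auto
    show "card (plus_sub E ?K) = card (carrier V)"
      using card_plus_direct[OF sE K EK] cE card_perp[OF W] by simp
  qed
  then have z: "w = \<zero>\<^bsub>V\<^esub>" if "w \<in> W" "w \<in> perp E" for w
    using that perp_plus_sub[OF sE K] perp_perp[OF W] perp_carrier by auto
  have "good h E E"
    unfolding good_def
  proof (intro conjI ballI impI)
    show "f e d = \<zero>" if "e \<in> E" "d \<in> E" for e d
      using that EE by (auto simp: perp_def)
    show "e = \<zero>\<^bsub>V\<^esub>" if e: "e \<in> E" and ed: "\<forall>d\<in>E. f (h e) d = \<zero>" for e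
    proof -
      have eV: "e \<in> carrier V" "h e \<in> carrier V" using e sE sub_in lin_closed[OF h] by auto
      let ?w = "h e \<ominus>\<^bsub>V\<^esub> c \<odot>\<^bsub>V\<^esub> e"
      have wV: "?w \<in> carrier V" using eV c by auto
      have "?w \<in> perp E"
      proof (rule perpI[OF wV])
        fix d assume d: "d \<in> E"
        have "f e d = \<zero>" using d e EE by (auto simp: perp_def)
        then show "f ?w d = \<zero>" using d ed eV c sE sub_in by (simp add: f_minus_left f_smult_left)
      qed
      then have "?w = \<zero>\<^bsub>V\<^esub>" using z hW eV by blast
      then have "h e = c \<odot>\<^bsub>V\<^esub> e" using eV c minus_eq_zero_iff by simp
      then show ?thesis using hK[OF eV(1)] e EK by auto
    qed
  qed (use sE in auto)
  then show ?thesis using cE ES by auto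
qed

end

section \<open>Groups acting linearly\<close>

text \<open>A right action: the first factor of a product acts first.\<close>

locale linear_action = finite_vectorspace F V + Gp: group Gp
  for F (structure) and V (structure) and Gp :: "('g, 'h) monoid_scheme" +
  fixes act :: "'g \<Rightarrow> 'c \<Rightarrow> 'c"
  assumes act_lin: "g \<in> carrier Gp \<Longrightarrow> lin (act g)"
    and act_mult: "g \<in> carrier Gp \<Longrightarrow> k \<in> carrier Gp \<Longrightarrow> v \<in> carrier V \<Longrightarrow>
      act (g \<otimes>\<^bsub>Gp\<^esub> k) v = act k (act g v)"
    and act_one: "v \<in> carrier V \<Longrightarrow> act \<one>\<^bsub>Gp\<^esub> v = v"
    and act_faithful: "g \<in> carrier Gp \<Longrightarrow> k \<in> carrier Gp \<Longrightarrow>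
      (\<And>v. v \<in> carrier V \<Longrightarrow> act g v = act k v) \<Longrightarrow> g = k"
begin

lemma act_closed: "g \<in> carrier Gp \<Longrightarrow> v \<in> carrier V \<Longrightarrow> act g v \<in> carrier V"
  using act_lin lin_closed by blast

lemma act_inv:
  assumes "g \<in> carrier Gp" "v \<in> carrier V"
  shows "act (inv\<^bsub>Gp\<^esub> g) (act g v) = v" "act g (act (inv\<^bsub>Gp\<^esub> g) v) = v"
  using act_mult[of g "inv\<^bsub>Gp\<^esub> g" v] act_mult[of "inv\<^bsub>Gp\<^esub> g" g v] act_one assms by auto

lemma act_inj: "g \<in> carrier Gp \<Longrightarrow> inj_on (act g) (carrier V)"
  by (rule inj_on_inverseI[of _ "act (inv\<^bsub>Gp\<^esub> g)"]) (simp add: act_inv)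

text \<open>If the conjugates by \<open>t\<close> and \<open>t'\<close> are proportional, then
  \<open>t\<close> times the inverse of \<open>t'\<close> commutes with \<open>h\<close> up to the
  scalar. Separating conjugates is thus a question about elements that almost centralise
  \<open>h\<close>.\<close>

lemma conj_proportional:
  assumes "h \<in> carrier Gp" "t \<in> carrier Gp" "t' \<in> carrier Gp" "c \<in> carrier F"
    and eq: "\<And>v. v \<in> carrier V \<Longrightarrow>
      act (inv\<^bsub>Gp\<^esub> t \<otimes>\<^bsub>Gp\<^esub> h \<otimes>\<^bsub>Gp\<^esub> t) v = c \<odot>\<^bsub>V\<^esub> act (inv\<^bsub>Gp\<^esub> t' \<otimes>\<^bsub>Gp\<^esub> h \<otimes>\<^bsub>Gp\<^esub> t') v"
    and y: "y \<in> carrier V"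
  shows "act (t \<otimes>\<^bsub>Gp\<^esub> inv\<^bsub>Gp\<^esub> t') (act h y) = c \<odot>\<^bsub>V\<^esub> act h (act (t \<otimes>\<^bsub>Gp\<^esub> inv\<^bsub>Gp\<^esub> t') y)"
proof -
  have "act t (act h y) = act (inv\<^bsub>Gp\<^esub> t \<otimes>\<^bsub>Gp\<^esub> h \<otimes>\<^bsub>Gp\<^esub> t) (act t y)"
    using assms act_closed by (simp add: act_mult act_inv)
  also have "\<dots> = c \<odot>\<^bsub>V\<^esub> act t' (act h (act (t \<otimes>\<^bsub>Gp\<^esub> inv\<^bsub>Gp\<^esub> t') y))"
    using assms act_closed by (simp add: act_mult)
  finally have "act (inv\<^bsub>Gp\<^esub> t') (act t (act h y))
      = act (inv\<^bsub>Gp\<^esub> t') (c \<odot>\<^bsub>V\<^esub> act t' (act h (act (t \<otimes>\<^bsub>Gp\<^esub> inv\<^bsub>Gp\<^esub> t') y)))" by simp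
  then show ?thesis
    using assms act_closed lin_smult[OF act_lin, of "inv\<^bsub>Gp\<^esub> t'"] by (simp add: act_mult act_inv)
qed

lemma conj_eq_if_commute:
  assumes "h \<in> carrier Gp" "t \<in> carrier Gp" "t' \<in> carrier Gp"
    and eq: "\<And>y. y \<in> carrier V \<Longrightarrow>
      act (t \<otimes>\<^bsub>Gp\<^esub> inv\<^bsub>Gp\<^esub> t') (act h y) = act h (act (t \<otimes>\<^bsub>Gp\<^esub> inv\<^bsub>Gp\<^esub> t') y)"
  shows "inv\<^bsub>Gp\<^esub> t \<otimes>\<^bsub>Gp\<^esub> h \<otimes>\<^bsub>Gp\<^esub> t = inv\<^bsub>Gp\<^esub> t' \<otimes>\<^bsub>Gp\<^esub> h \<otimes>\<^bsub>Gp\<^esub> t'"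
proof (rule act_faithful)
  fix v assume v: "v \<in> carrier V"
  define y where "y = act (inv\<^bsub>Gp\<^esub> t) v"
  have y: "y \<in> carrier V" "v = act t y" using assms v act_closed act_inv by (auto simp: y_def)
  have "act t' (act (t \<otimes>\<^bsub>Gp\<^esub> inv\<^bsub>Gp\<^esub> t') (act h y)) = act t' (act h (act (t \<otimes>\<^bsub>Gp\<^esub> inv\<^bsub>Gp\<^esub> t') y))"
    using eq y by simp
  then show "act (inv\<^bsub>Gp\<^esub> t \<otimes>\<^bsub>Gp\<^esub> h \<otimes>\<^bsub>Gp\<^esub> t) v = act (inv\<^bsub>Gp\<^esub> t' \<otimes>\<^bsub>Gp\<^esub> h \<otimes>\<^bsub>Gp\<^esub> t') v"
    using assms y act_closed by (simp add: act_mult act_inv)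
qed (use assms in auto)

end

section \<open>Counting subspaces and maps of low rank\<close>

context finite_vectorspace
begin

text \<open>The span of the first entries of a sequence, so that subspaces can be counted by
  tuples.\<close>

fun gen :: "(nat \<Rightarrow> 'c) \<Rightarrow> nat \<Rightarrow> 'c set" where
  "gen b 0 = {\<zero>\<^bsub>V\<^esub>}"
| "gen b (Suc k) = adj (gen b k) (b k)"

lemma gen_cong: "(\<And>i. i < k \<Longrightarrow> b i = b' i) \<Longrightarrow> gen b k = gen b' k"
  by (induction k) auto

lemma gen_least: "sub Z \<Longrightarrow> (\<And>i. i < k \<Longrightarrow> b i \<in> Z) \<Longrightarrow> gen b k \<subseteq> Z"
proof (induction k)
  case (Suc k)
  then show ?case using adj_least[OF Suc.prems(1), of "gen b k" "b k"] by simp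
qed (simp add: sub_zero)

lemma sub_eq_gen:
  assumes "sub Y"
  shows "\<exists>k b. card Y = Q ^ k \<and> b \<in> {..<k} \<rightarrow>\<^sub>E Y \<and> gen b k = Y"
proof -
  have "\<exists>k b. card Y = Q ^ k \<and> (\<forall>i<k. b i \<in> Y) \<and> gen b k = Y"
    using assms
  proof (induction rule: subspace_induct)
    case zero
    show ?case by (intro exI[of _ 0]) auto
  next
    case (adj U y)
    have y: "y \<in> carrier V" using adj assms sub_in by auto
    obtain k b where b: "card U = Q ^ k" "\<forall>i<k. b i \<in> U" "gen b k = U" using adj by auto
    let ?b = "b(k := y)"
    have "gen ?b (Suc k) = adj U y" using b gen_cong[of k ?b b] by simp
    moreover have "card (adj U y) = Q ^ Suc k" using card_adj[of U y] adj y b by simp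
    moreover have "\<forall>i<Suc k. ?b i \<in> adj U y" using b adj_upper[OF adj(1) y] by (auto simp: less_Suc_eq)
    ultimately show ?case by blast
  qed
  then obtain k b where b: "card Y = Q ^ k" "\<forall>i<k. b i \<in> Y" "gen b k = Y" by auto
  then show ?thesis using gen_cong[of k b "restrict b {..<k}"]
    by (intro exI[of _ k] exI[of _ "restrict b {..<k}"]) auto
qed

lemma Q_power_inj: "Q ^ i = Q ^ j \<Longrightarrow> i = j"
  using Q_ge_2 by simp

lemma sub_eq_gen':
  assumes "sub Y" "card Y = Q ^ k"
  shows "\<exists>b. b \<in> {..<k} \<rightarrow>\<^sub>E Y \<and> gen b k = Y"
  using sub_eq_gen[OF assms(1)] assms(2) Q_power_inj by metis

lemma card_le_card_if_determined:
  assumes "finite (\<phi> ` A)" "\<And>a b. a \<in> A \<Longrightarrow> b \<in> A \<Longrightarrow> \<phi> a = \<phi> b \<Longrightarrow> \<psi> a = \<psi> b"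
  shows "card (\<psi> ` A) \<le> card (\<phi> ` A)"
proof (rule surj_card_le[OF assms(1), of _ "\<lambda>x. \<psi> (SOME a. a \<in> A \<and> \<phi> a = x)"])
  show "\<psi> ` A \<subseteq> (\<lambda>x. \<psi> (SOME a. a \<in> A \<and> \<phi> a = x)) ` \<phi> ` A"
  proof
    fix y assume "y \<in> \<psi> ` A"
    then obtain a where a: "a \<in> A" "y = \<psi> a" by auto
    have "(SOME b. b \<in> A \<and> \<phi> b = \<phi> a) \<in> A \<and> \<phi> (SOME b. b \<in> A \<and> \<phi> b = \<phi> a) = \<phi> a"
      by (rule someI[of _ a]) (use a in auto)
    then have "y = \<psi> (SOME b. b \<in> A \<and> \<phi> b = \<phi> a)" using a assms(2) by metis
    then show "y \<in> (\<lambda>x. \<psi> (SOME a. a \<in> A \<and> \<phi> a = x)) ` \<phi> ` A" using a by blast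
  qed
qed

text \<open>Every such subspace is spanned by a \<open>k\<close>-tuple. Counting tuples overcounts,
  but the leading term of the exponent is right.\<close>

lemma card_subs_le:
  "card {U. sub U \<and> card U = Q ^ k} \<le> card (carrier V) ^ k"
proof -
  have "{U. sub U \<and> card U = Q ^ k} \<subseteq> (\<lambda>b. gen b k) ` ({..<k} \<rightarrow>\<^sub>E carrier V)"
  proof clarify
    fix U assume U: "sub U" "card U = Q ^ k"
    then obtain b where "b \<in> {..<k} \<rightarrow>\<^sub>E U" "gen b k = U" using sub_eq_gen' by blast
    then show "U \<in> (\<lambda>b. gen b k) ` ({..<k} \<rightarrow>\<^sub>E carrier V)"
      using sub_subset[OF U(1)] by (intro image_eqI[of _ _ b]) (auto simp: PiE_iff)
  qed
  then have "card {U. sub U \<and> card U = Q ^ k} \<le> card ({..<k} \<rightarrow>\<^sub>E carrier V)"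
    using finite_V by (intro surj_card_le) (auto simp: finite_PiE)
  then show ?thesis by (simp add: card_PiE)
qed

end

context form_space
begin

text \<open>A map of rank \<open>s\<close> is determined by its kernel and by its values on
  \<open>s\<close> vectors spanning a complement of it; each of the two takes at most |V|^s
  values.\<close>

lemma card_low_rank_le:
  assumes lin: "\<And>a. a \<in> A \<Longrightarrow> lin (N a)"
    and ker: "\<And>a. a \<in> A \<Longrightarrow> Q ^ s * card {v \<in> carrier V. N a v = \<zero>\<^bsub>V\<^esub>} = card (carrier V)"
    and inj: "\<And>a b. a \<in> A \<Longrightarrow> b \<in> A \<Longrightarrow> (\<And>v. v \<in> carrier V \<Longrightarrow> N a v = N b v) \<Longrightarrow> a = b"
  shows "card A \<le> card (carrier V) ^ (2 * s)"
proof -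
  define ker where "ker a = {v \<in> carrier V. N a v = \<zero>\<^bsub>V\<^esub>}" for a
  have sk: "sub (ker a)" if "a \<in> A" for a
    using sub_vimage[OF lin[OF that] sub_triv] by (simp add: ker_def)
  \<comment> \<open>The chosen vectors depend on the kernel alone, so two maps with the same kernel
    are compared on the same vectors.\<close>
  define basis where "basis U = (SOME b. b \<in> {..<s} \<rightarrow>\<^sub>E carrier V \<and> plus_sub U (gen b s) = carrier V)" for U
  have basis: "basis (ker a) \<in> {..<s} \<rightarrow>\<^sub>E carrier V \<and> plus_sub (ker a) (gen (basis (ker a)) s) = carrier V"
    if a: "a \<in> A" for a
  proof -
    obtain Z where Z: "sub Z" "ker a \<inter> Z = {\<zero>\<^bsub>V\<^esub>}" "plus_sub (ker a) Z = carrier V"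
      using complement_exists[OF sk[OF a] sub_carrier sub_subset[OF sk[OF a]]] by auto
    have "card (ker a) * card Z = card (carrier V)"
      using card_plus_direct[OF sk[OF a] Z(1,2)] Z(3) by simp
    moreover have "Q ^ s * card (ker a) = card (carrier V)" using ker[OF a] by (simp add: ker_def)
    ultimately have "card (ker a) * card Z = card (ker a) * Q ^ s" by (simp only: mult.commute)
    then have "card Z = Q ^ s" using sub_card_pos[OF sk[OF a]] by simp
    then obtain b where "b \<in> {..<s} \<rightarrow>\<^sub>E Z" "gen b s = Z" using sub_eq_gen' Z by blast
    then have "b \<in> {..<s} \<rightarrow>\<^sub>E carrier V \<and> plus_sub (ker a) (gen b s) = carrier V"
      using Z sub_subset[OF Z(1)] by (auto simp: PiE_iff)
    then show ?thesis unfolding basis_def by (rule someI[where P = "\<lambda>b. b \<in> {..<s} \<rightarrow>\<^sub>E carrier V \<and> plus_sub (ker a) (gen b s) = carrier V"])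
  qed
  \<comment> \<open>The kernel is recorded by its orthogonal space, of dimension \<open>s\<close>
    instead of n - s; this keeps the number of choices below |V|^s.\<close>
  define \<phi> where "\<phi> a = (perp (ker a), restrict (\<lambda>i. N a (basis (ker a) i)) {..<s})" for a
  let ?B = "{U. sub U \<and> card U = Q ^ s} \<times> ({..<s} \<rightarrow>\<^sub>E carrier V)"
  have fs: "finite {U. sub U \<and> card U = Q ^ s}"
    by (rule finite_subset[of _ "Pow (carrier V)"]) (use sub_subset finite_V in auto)
  have inj': "inj_on \<phi> A"
  proof (rule inj_onI)
    fix a b assume a: "a \<in> A" and b: "b \<in> A" and e: "\<phi> a = \<phi> b"
    have k: "ker a = ker b" 
    proof -
      have "perp (ker a) = perp (ker b)" using e unfolding \<phi>_def prod.inject by (rule conjunct1)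
      then have "perp (perp (ker a)) = perp (perp (ker b))" by (rule arg_cong)
      then show ?thesis unfolding perp_perp[OF sk[OF a]] perp_perp[OF sk[OF b]] .
    qed
    let ?b = "basis (ker a)"
    have "N a (?b i) = N b (?b i)" if "i < s" for i
      using e k that unfolding \<phi>_def by (metis (mono_tags, lifting) lessThan_iff prod.inject restrict_apply')
    then have "gen ?b s \<subseteq> {v \<in> carrier V. N a v = N b v}"
      using basis[OF a] by (intro gen_least lin_agree_sub lin a b) auto
    moreover have "ker a \<subseteq> {v \<in> carrier V. N a v = N b v}" using k by (auto simp: ker_def)
    ultimately have "carrier V \<subseteq> {v \<in> carrier V. N a v = N b v}"
      using conjunct2[OF basis[OF a]]
        plus_sub_least[OF lin_agree_sub[OF lin[OF a] lin[OF b]], of "ker a" "gen ?b s"] by simp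
    then show "a = b" using inj a b by blast
  qed
  have "\<phi> ` A \<subseteq> ?B"
  proof clarify
    fix U c a assume a: "a \<in> A" and "(U, c) = \<phi> a"
    then have U: "U = perp (ker a)" "c = restrict (\<lambda>i. N a (basis (ker a) i)) {..<s}" by (auto simp: \<phi>_def)
    have "card (ker a) * card U = card (ker a) * Q ^ s"
      using card_perp[OF sk[OF a]] ker[OF a] U by (simp add: ker_def mult.commute)
    then have "card U = Q ^ s" using sub_card_pos[OF sk[OF a]] by simp
    moreover have "sub U" using U sub_perp sub_subset[OF sk[OF a]] by auto
    moreover have "c \<in> {..<s} \<rightarrow>\<^sub>E carrier V"
      using U basis[OF a] lin_closed[OF lin[OF a]] by (auto simp: PiE_iff)
    ultimately show "U \<in> {U. sub U \<and> card U = Q ^ s} \<and> c \<in> {..<s} \<rightarrow>\<^sub>E carrier V" by auto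
  qed
  then have "card A \<le> card ?B"
    using inj' fs finite_V by (intro card_inj_on_le[of \<phi>]) (auto simp: finite_PiE)
  also have "\<dots> \<le> card (carrier V) ^ s * card (carrier V) ^ s"
    using card_subs_le by (simp add: card_cartesian_product card_PiE)
  finally show ?thesis by (simp add: power_add mult_2)
qed

section \<open>Isometries with a large eigenspace\<close>

definition isometry :: "('c \<Rightarrow> 'c) \<Rightarrow> bool" where
  "isometry g \<longleftrightarrow> lin g \<and> (\<forall>x\<in>carrier V. \<forall>y\<in>carrier V. f (g x) (g y) = f x y)"

lemma isometry_inj: "isometry g \<Longrightarrow> inj_on g (carrier V)"
proof (rule inj_onI)
  fix x y assume g: "isometry g" and V: "x \<in> carrier V" "y \<in> carrier V" and e: "g x = g y"
  have "f (x \<ominus>\<^bsub>V\<^esub> y) z = \<zero>" if z: "z \<in> carrier V" for z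
  proof -
    have "f (x \<ominus>\<^bsub>V\<^esub> y) z = f (g (x \<ominus>\<^bsub>V\<^esub> y)) (g z)" using g V z by (auto simp: isometry_def)
    also have "g (x \<ominus>\<^bsub>V\<^esub> y) = \<zero>\<^bsub>V\<^esub>" 
      using g V e lin_minus[of g x y] lin_closed[of g y] by (simp add: isometry_def)
    finally show ?thesis using g z lin_closed by (auto simp: isometry_def)
  qed
  then have "x \<ominus>\<^bsub>V\<^esub> y = \<zero>\<^bsub>V\<^esub>" using V by (intro f_nondeg) auto
  then show "x = y" using V by simp
qed

lemma isometry_surj: "isometry g \<Longrightarrow> g ` carrier V = carrier V"
  using isometry_inj finite_V lin_closed by (intro endo_inj_surj) (auto simp: isometry_def)

text \<open>A totally isotropic subspace has at most half the dimension, so some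
  \<open>f x y\<close> is nonzero on the eigenspace, which forces
  \<open>c \<otimes> \<sigma> c = \<one>\<close>. With this, orthogonality to the image of h - c is
  the same as being an eigenvector for \<open>c\<close>.\<close>

lemma isometry_eigenspace_perp:
  assumes h: "isometry h" and c: "c \<in> carrier F"
    and big: "card (carrier V) < card {v \<in> carrier V. h v = c \<odot>\<^bsub>V\<^esub> v} * card {v \<in> carrier V. h v = c \<odot>\<^bsub>V\<^esub> v}"
  shows "perp ((\<lambda>v. h v \<ominus>\<^bsub>V\<^esub> c \<odot>\<^bsub>V\<^esub> v) ` carrier V) = {v \<in> carrier V. h v = c \<odot>\<^bsub>V\<^esub> v}" (is "perp ?W = ?K")
proof -
  have lh: "lin h" and iso: "\<And>x y. x \<in> carrier V \<Longrightarrow> y \<in> carrier V \<Longrightarrow> f (h x) (h y) = f x y"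
    using h by (auto simp: isometry_def)
  have hV: "x \<in> carrier V \<Longrightarrow> h x \<in> carrier V" for x using lh lin_closed by auto
  have sK: "sub ?K"
  proof -
    have "?K = {v \<in> carrier V. h v \<ominus>\<^bsub>V\<^esub> c \<odot>\<^bsub>V\<^esub> v \<in> {\<zero>\<^bsub>V\<^esub>}}" 
      by (intro Collect_cong conj_cong refl) (simp add: hV c)
    then show ?thesis using sub_vimage[OF lin_shift[OF lh c] sub_triv] by simp
  qed
  have "\<not> ?K \<subseteq> perp ?K"
  proof
    assume "?K \<subseteq> perp ?K"
    then have "card ?K \<le> card (perp ?K)" by (rule card_mono[OF sub_finite[OF sub_perp[OF sub_subset[OF sK]]]])
    then have "card ?K * card ?K \<le> card ?K * card (perp ?K)" by (rule mult_le_mono2)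
    then show False using big unfolding card_perp[OF sK] by linarith
  qed
  then obtain x y where xy: "x \<in> ?K" "y \<in> ?K" "f x y \<noteq> \<zero>" by (auto simp: perp_def)
  have "f x y = (c \<otimes> \<sigma> c) \<otimes> f x y"
    using iso[of x y] xy c by (simp add: f_smult_left f_smult_right m_ac)
  then have cc: "c \<otimes> \<sigma> c = \<one>" using xy c
    m_rcancel[of "f x y" \<one> "c \<otimes> \<sigma> c"] by auto
  have eq: "f x (h y) = \<sigma> c \<otimes> f x y" if x: "x \<in> ?K" and y: "y \<in> carrier V" for x y
  proof -
    have V: "x \<in> carrier V" "h x = c \<odot>\<^bsub>V\<^esub> x" using x by auto
    have "\<sigma> c \<otimes> f x y = \<sigma> c \<otimes> (c \<otimes> f x (h y))" using iso[of x y] V y hV c by (simp add: f_smult_left)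
    also have "\<dots> = (c \<otimes> \<sigma> c) \<otimes> f x (h y)" using V y hV c by (simp add: m_ac)
    finally show ?thesis using cc V y hV by simp
  qed
  have "f x (h y \<ominus>\<^bsub>V\<^esub> c \<odot>\<^bsub>V\<^esub> y) = \<zero>" if x: "x \<in> ?K" and y: "y \<in> carrier V" for x y
    using x y c hV eq by (simp add: f_minus_right f_smult_right)
  then have "?K \<subseteq> perp ?W" by (auto simp: perp_def)
  moreover have "x \<in> ?K" if x: "x \<in> perp ?W" for x
  proof -
    have V: "x \<in> carrier V" "h x \<in> carrier V" using x perp_in hV by auto
    have "f (h x \<ominus>\<^bsub>V\<^esub> c \<odot>\<^bsub>V\<^esub> x) z = \<zero>" if z: "z \<in> carrier V" for z
    proof -
      obtain y where y: "y \<in> carrier V" "z = h y" using isometry_surj[OF h] z by blast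
      have "f x (h y \<ominus>\<^bsub>V\<^esub> c \<odot>\<^bsub>V\<^esub> y) = \<zero>" using x y by (auto simp: perp_def)
      then have "f x (h y) = \<sigma> c \<otimes> f x y" using V y hV c by (simp add: f_minus_right f_smult_right)
      then have "c \<otimes> f x (h y) = (c \<otimes> \<sigma> c) \<otimes> f x y" using V y c by (simp add: m_assoc)
      then show ?thesis using V y c hV iso cc by (simp add: f_minus_left f_smult_left)
    qed
    then have "h x \<ominus>\<^bsub>V\<^esub> c \<odot>\<^bsub>V\<^esub> x = \<zero>\<^bsub>V\<^esub>" using V c by (intro f_nondeg) auto
    then show ?thesis using V c minus_eq_zero_iff by auto
  qed
  ultimately show ?thesis by blast
qed

text \<open>For an isometry fixing the image of h - c pointwise, g y - y is orthogonal to that image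
  and hence in the kernel of h - c. So a conjugate of \<open>h\<close> depends only on where the
  conjugating isometry sends a spanning set of the image.\<close>

lemma isometry_commute_if_fix:
  assumes h: "lin h" and c: "c \<in> carrier F" and g: "isometry g"
    and fixed: "\<And>v. v \<in> carrier V \<Longrightarrow> g (h v \<ominus>\<^bsub>V\<^esub> c \<odot>\<^bsub>V\<^esub> v) = h v \<ominus>\<^bsub>V\<^esub> c \<odot>\<^bsub>V\<^esub> v"
    and perp: "perp ((\<lambda>v. h v \<ominus>\<^bsub>V\<^esub> c \<odot>\<^bsub>V\<^esub> v) ` carrier V) \<subseteq> {v \<in> carrier V. h v = c \<odot>\<^bsub>V\<^esub> v}"
    and y: "y \<in> carrier V"
  shows "g (h y) = h (g y)"
proof -
  let ?n = "\<lambda>v. h v \<ominus>\<^bsub>V\<^esub> c \<odot>\<^bsub>V\<^esub> v"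
  have lg: "lin g" and iso: "\<And>x y. x \<in> carrier V \<Longrightarrow> y \<in> carrier V \<Longrightarrow> f (g x) (g y) = f x y"
    using g by (auto simp: isometry_def)
  have V: "y \<in> carrier V" "g y \<in> carrier V" "h y \<in> carrier V" "h (g y) \<in> carrier V" "g (h y) \<in> carrier V"
    using y lin_closed[OF lg] lin_closed[OF h] by auto
  have nV: "v \<in> carrier V \<Longrightarrow> ?n v \<in> carrier V" for v using lin_closed[OF h] c by auto
  have "g y \<ominus>\<^bsub>V\<^esub> y \<in> perp (?n ` carrier V)"
  proof (rule perpI)
    fix w assume "w \<in> ?n ` carrier V"
    then have w: "w \<in> carrier V" "g w = w" using nV fixed by auto
    have "f (g y) w = f y w" using iso[of y w] w y by simp
    then show "f (g y \<ominus>\<^bsub>V\<^esub> y) w = \<zero>" using V w by (simp add: f_minus_left)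
  qed (use V in auto)
  then have "h (g y \<ominus>\<^bsub>V\<^esub> y) = c \<odot>\<^bsub>V\<^esub> (g y \<ominus>\<^bsub>V\<^esub> y)" using perp by auto
  then have 1: "h (g y) \<ominus>\<^bsub>V\<^esub> h y = c \<odot>\<^bsub>V\<^esub> g y \<ominus>\<^bsub>V\<^esub> c \<odot>\<^bsub>V\<^esub> y"
    using V c lin_minus[OF h] by (simp add: a_minus_def smult_r_distr smult_r_minus)
  have 2: "g (h y) \<ominus>\<^bsub>V\<^esub> c \<odot>\<^bsub>V\<^esub> g y = h y \<ominus>\<^bsub>V\<^esub> c \<odot>\<^bsub>V\<^esub> y"
    using fixed[OF y] V c lin_minus[OF lg] lin_smult[OF lg] by simp
  have "g (h y) = (g (h y) \<ominus>\<^bsub>V\<^esub> c \<odot>\<^bsub>V\<^esub> g y) \<oplus>\<^bsub>V\<^esub> c \<odot>\<^bsub>V\<^esub> g y" using V c add_minus_cancel by simp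
  also have "\<dots> = h y \<oplus>\<^bsub>V\<^esub> (c \<odot>\<^bsub>V\<^esub> g y \<ominus>\<^bsub>V\<^esub> c \<odot>\<^bsub>V\<^esub> y)" unfolding 2 using V c by (simp add: vec_simps)
  also have "\<dots> = h (g y)" unfolding 1[symmetric] using V add_minus_cancel by simp
  finally show ?thesis .
qed

end

lemma (in finite_vectorspace) minus_self: "x \<in> carrier V \<Longrightarrow> x \<ominus>\<^bsub>V\<^esub> x = \<zero>\<^bsub>V\<^esub>"
  by (simp add: a_minus_def M.r_neg)

section \<open>Conjugates up to scalars and products of transvections\<close>

context linear_action
begin

abbreviation conj :: "'g \<Rightarrow> 'g \<Rightarrow> 'g" where
  "conj h t \<equiv> inv\<^bsub>Gp\<^esub> t \<otimes>\<^bsub>Gp\<^esub> h \<otimes>\<^bsub>Gp\<^esub> t"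

text \<open>Proportional matrices become equal in the projective group, so distinctness of
  conjugates is demanded up to every nonzero scalar.\<close>

definition separated :: "'g \<Rightarrow> 'g set \<Rightarrow> bool" where
  "separated h T \<longleftrightarrow> (\<forall>t\<in>T. \<forall>t'\<in>T. \<forall>c\<in>carrier F. c \<noteq> \<zero> \<longrightarrow>
     (\<forall>v\<in>carrier V. act (conj h t) v = c \<odot>\<^bsub>V\<^esub> act (conj h t') v) \<longrightarrow> t = t')"

end

locale form_action = form_space F V f \<sigma> + linear_action F V Gp act
  for F (structure) and V (structure) and f \<sigma> and Gp :: "('g, 'h) monoid_scheme" and act
begin

text \<open>Let e_1, ..., e_m be adjoined one at a time until they span \<open>E\<close>. A product
  of maps with parameters v_1, ..., v_m in \<open>Z\<close> acts on \<open>Y\<close> as y plus the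
  sum of all f(y, v_i) e_i, because \<open>E\<close> is orthogonal to \<open>Z\<close>, and the
  parameters can be recovered from this action. Only the action on \<open>Y\<close> is prescribed,
  since a Siegel transformation has this simple shape only on vectors orthogonal to its
  centre.\<close>

lemma transvection_products:
  assumes M: "M \<subseteq> carrier Gp" "\<one>\<^bsub>Gp\<^esub> \<in> M" "\<And>t u. t \<in> M \<Longrightarrow> u \<in> M \<Longrightarrow> t \<otimes>\<^bsub>Gp\<^esub> u \<in> M"
    and E: "sub E" "card E = Q ^ m" and Y: "sub Y" "E \<subseteq> Y" and Z: "sub Z"
    and EZ: "\<And>e v. e \<in> E \<Longrightarrow> v \<in> Z \<Longrightarrow> f e v = \<zero>"
    and YZ: "\<And>v. v \<in> Z \<Longrightarrow> (\<And>y. y \<in> Y \<Longrightarrow> f y v = \<zero>) \<Longrightarrow> v = \<zero>\<^bsub>V\<^esub>"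
    and tv: "\<And>e v. e \<in> E \<Longrightarrow> v \<in> Z \<Longrightarrow> \<exists>u\<in>M. \<forall>y\<in>Y. act u y = y \<oplus>\<^bsub>V\<^esub> f y v \<odot>\<^bsub>V\<^esub> e"
  shows "\<exists>T. T \<subseteq> M \<and> card T = card Z ^ m \<and> (\<forall>t\<in>T. \<forall>y\<in>Y. act t y \<ominus>\<^bsub>V\<^esub> y \<in> E)
    \<and> (\<forall>t\<in>T. \<forall>e\<in>E. act t e = e)
    \<and> (\<forall>t\<in>T. \<forall>t'\<in>T. (\<forall>y\<in>Y. act t y = act t' y) \<longrightarrow> t = t')"
proof -
  have EV: "e \<in> carrier V" if "e \<in> E" for e using that E sub_in by auto
  have YV: "y \<in> carrier V" if "y \<in> Y" for y using that Y sub_in by auto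
  have ZV: "v \<in> carrier V" if "v \<in> Z" for v using that Z sub_in by auto
  have aV: "t \<in> M \<Longrightarrow> y \<in> carrier V \<Longrightarrow> act t y \<in> carrier V" for t y using M act_closed by auto
  define P where "P W k T \<longleftrightarrow> card W = Q ^ k \<and> T \<subseteq> M \<and> card T = card Z ^ k
    \<and> (\<forall>t\<in>T. \<forall>y\<in>Y. act t y \<ominus>\<^bsub>V\<^esub> y \<in> W) \<and> (\<forall>t\<in>T. \<forall>e\<in>E. act t e = e)
    \<and> (\<forall>t\<in>T. \<forall>t'\<in>T. (\<forall>y\<in>Y. act t y = act t' y) \<longrightarrow> t = t')" for W k T
  have "\<exists>k T. P E k T"
  proof -
    have "\<exists>k T. P W k T" if "sub W" "W \<subseteq> E" for W
      using that
    proof (induction rule: subspace_induct)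
      case zero
      have "\<forall>y\<in>Y. act \<one>\<^bsub>Gp\<^esub> y \<ominus>\<^bsub>V\<^esub> y = \<zero>\<^bsub>V\<^esub>" using act_one YV by simp
      then show ?case using M act_one EV by (intro exI[of _ 0] exI[of _ "{\<one>\<^bsub>Gp\<^esub>}"]) (auto simp: P_def)
    next
      case (adj U e)
      have e: "e \<in> E" using adj that by auto
      then have eV: "e \<in> carrier V" using EV by auto
      have UE: "U \<subseteq> E" using adj that by auto
      obtain k T where PU: "P U k T" using adj.IH UE by blast
      have kT: "card U = Q ^ k" "T \<subseteq> M" "card T = card Z ^ k" using PU by (simp_all add: P_def)
      have TU: "\<And>t y. t \<in> T \<Longrightarrow> y \<in> Y \<Longrightarrow> act t y \<ominus>\<^bsub>V\<^esub> y \<in> U" using PU by (simp add: P_def)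
      have TE: "\<And>t e. t \<in> T \<Longrightarrow> e \<in> E \<Longrightarrow> act t e = e" using PU by (simp add: P_def)
      have Tinj: "\<And>t t'. t \<in> T \<Longrightarrow> t' \<in> T \<Longrightarrow> (\<And>y. y \<in> Y \<Longrightarrow> act t y = act t' y) \<Longrightarrow> t = t'"
        using PU by (simp add: P_def)
      obtain u where u: "\<And>v. v \<in> Z \<Longrightarrow> u v \<in> M" "\<And>v y. v \<in> Z \<Longrightarrow> y \<in> Y \<Longrightarrow> act (u v) y = y \<oplus>\<^bsub>V\<^esub> f y v \<odot>\<^bsub>V\<^esub> e"
        using tv[OF e] by metis
      let ?g = "\<lambda>(t, v). t \<otimes>\<^bsub>Gp\<^esub> u v"
      have g: "act (t \<otimes>\<^bsub>Gp\<^esub> u v) y = act t y \<oplus>\<^bsub>V\<^esub> f y v \<odot>\<^bsub>V\<^esub> e" if t: "t \<in> T" and v: "v \<in> Z" and y: "y \<in> Y" for t v y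
      proof -
        let ?w = "act t y \<ominus>\<^bsub>V\<^esub> y"
        have w: "?w \<in> E" using TU[OF t y] UE by auto
        have ty: "act t y = y \<oplus>\<^bsub>V\<^esub> ?w" using add_minus_cancel aV kT t y YV by auto
        then have "act t y \<in> Y" using w Y y sub_add[OF Y(1), of y ?w] by auto
        moreover have "f (act t y) v = f y v"
        proof -
          have "f (y \<oplus>\<^bsub>V\<^esub> ?w) v = f y v \<oplus> f ?w v" by (rule f_add_left[OF YV[OF y] EV[OF w] ZV[OF v]])
          then show ?thesis unfolding ty[symmetric] EZ[OF w v] using YV[OF y] ZV[OF v] by simp
        qed
        moreover have "act (t \<otimes>\<^bsub>Gp\<^esub> u v) y = act (u v) (act t y)"
          using act_mult[of t "u v" y] t v y kT u(1)[OF v] M YV by blast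
        ultimately show ?thesis using u v by simp
      qed
      have inj: "t = t' \<and> v = v'"
        if t: "t \<in> T" "t' \<in> T" and v: "v \<in> Z" "v' \<in> Z"
          and eq: "\<And>y. y \<in> Y \<Longrightarrow> act (t \<otimes>\<^bsub>Gp\<^esub> u v) y = act (t' \<otimes>\<^bsub>Gp\<^esub> u v') y" for t t' v v'
      proof -
        \<comment> \<open>Modulo \<open>U\<close> only the multiple of \<open>e\<close> survives,
          and \<open>e\<close> is not in \<open>U\<close>.\<close>
        have *: "f y v' = f y v" if y: "y \<in> Y" for y
        proof -
          have V: "act t y \<in> carrier V" "act t' y \<in> carrier V" "f y v \<in> carrier F" "f y v' \<in> carrier F"
            using t v y kT aV YV ZV by auto
          have "act t y \<oplus>\<^bsub>V\<^esub> f y v \<odot>\<^bsub>V\<^esub> e = act t' y \<oplus>\<^bsub>V\<^esub> f y v' \<odot>\<^bsub>V\<^esub> e"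
            using eq[OF y] g t v y by simp
          then have "act t y \<ominus>\<^bsub>V\<^esub> act t' y = f y v' \<odot>\<^bsub>V\<^esub> e \<ominus>\<^bsub>V\<^esub> f y v \<odot>\<^bsub>V\<^esub> e"
            using V eV by (intro add_eq_add_imp) auto
          also have "\<dots> = (f y v' \<ominus> f y v) \<odot>\<^bsub>V\<^esub> e"
            using V eV by (simp add: a_minus_def smult_l_distr smult_l_minus)
          finally have "(f y v' \<ominus> f y v) \<odot>\<^bsub>V\<^esub> e = (act t y \<ominus>\<^bsub>V\<^esub> y) \<ominus>\<^bsub>V\<^esub> (act t' y \<ominus>\<^bsub>V\<^esub> y)"
            using V eV YV[OF y] by (simp add: vec_simps)
          also have "\<dots> \<in> U" using TU t y sub_minus[OF adj(1)] by auto
          finally have "f y v' \<ominus> f y v = \<zero>" using smult_in_sub_iff[OF adj(1) _ _ eV, of "f y v' \<ominus> f y v"] V adj by auto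
          then show ?thesis using V by simp
        qed
        have "v' \<ominus>\<^bsub>V\<^esub> v = \<zero>\<^bsub>V\<^esub>"
          by (rule YZ) (use v sub_minus[OF Z] * ZV YV in \<open>auto simp: f_minus_right\<close>)
        then have vv: "v = v'" using v ZV minus_eq_zero_iff by auto
        have "act t y = act t' y" if y: "y \<in> Y" for y
        proof -
          have V: "act t y \<in> carrier V" "act t' y \<in> carrier V" "f y v \<odot>\<^bsub>V\<^esub> e \<in> carrier V"
            using t v y kT aV YV ZV eV by auto
          have "act t y \<oplus>\<^bsub>V\<^esub> f y v \<odot>\<^bsub>V\<^esub> e = act t' y \<oplus>\<^bsub>V\<^esub> f y v \<odot>\<^bsub>V\<^esub> e"
            using eq[OF y] g t v y vv by simp
          then show ?thesis using V by simp
        qed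
        then show ?thesis using Tinj t vv by auto
      qed
      have f1: "card (adj U e) = Q ^ Suc k" using card_adj[of U e] adj eV kT by simp
      have f2: "?g ` (T \<times> Z) \<subseteq> M" using kT u M by auto
      have f3: "card (?g ` (T \<times> Z)) = card Z ^ Suc k"
      proof -
        have "inj_on ?g (T \<times> Z)" using inj by (intro inj_onI) auto
        then show ?thesis using kT by (simp add: card_image card_cartesian_product mult.commute)
      qed
      have f4: "act s y \<ominus>\<^bsub>V\<^esub> y \<in> adj U e" if s: "s \<in> ?g ` (T \<times> Z)" and y: "y \<in> Y" for s y
      proof -
        obtain t v where tv: "t \<in> T" "v \<in> Z" "s = t \<otimes>\<^bsub>Gp\<^esub> u v" using s by auto
        have "act s y \<ominus>\<^bsub>V\<^esub> y = (act t y \<ominus>\<^bsub>V\<^esub> y) \<oplus>\<^bsub>V\<^esub> f y v \<odot>\<^bsub>V\<^esub> e"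
          using tv g y aV kT YV ZV eV subsetD[OF kT(2) tv(1)] by (simp add: vec_simps)
        moreover have "f y v \<in> carrier F" using y tv YV ZV by auto
        ultimately show ?thesis using TU[OF tv(1) y] unfolding in_adj_iff by blast
      qed
      have f5: "act s x = x" if s: "s \<in> ?g ` (T \<times> Z)" and x: "x \<in> E" for s x
      proof -
        obtain t v where tv: "t \<in> T" "v \<in> Z" "s = t \<otimes>\<^bsub>Gp\<^esub> u v" using s by auto
        have "x \<in> Y" using x Y by auto
        then have "act s x = act t x \<oplus>\<^bsub>V\<^esub> f x v \<odot>\<^bsub>V\<^esub> e" using g tv by simp
        then show ?thesis using EZ x tv TE EV eV by simp
      qed
      have f6: "s = s'" if s: "s \<in> ?g ` (T \<times> Z)" "s' \<in> ?g ` (T \<times> Z)"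
        and eq: "\<And>y. y \<in> Y \<Longrightarrow> act s y = act s' y" for s s'
      proof -
        obtain t v where tv: "t \<in> T" "v \<in> Z" "s = t \<otimes>\<^bsub>Gp\<^esub> u v" using s by auto
        obtain t' v' where tv': "t' \<in> T" "v' \<in> Z" "s' = t' \<otimes>\<^bsub>Gp\<^esub> u v'" using s by auto
        show ?thesis using inj[of t t' v v'] eq tv tv' by simp
      qed
      have "P (adj U e) (Suc k) (?g ` (T \<times> Z))"
        unfolding P_def
      proof (intro conjI ballI impI)
        fix s s' assume "s \<in> ?g ` (T \<times> Z)" "s' \<in> ?g ` (T \<times> Z)" "\<forall>y\<in>Y. act s y = act s' y"
        then show "s = s'" by (intro f6) auto
      qed (rule f1 f2 f3 | rule f4 f5, assumption, assumption)+
      then show ?case by blast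
    qed
    then show ?thesis using E by blast
  qed
  then obtain k T where kT: "P E k T" by blast
  then have "k = m" using E(2) Q_power_inj[of k m] by (simp add: P_def)
  then show ?thesis using kT by (intro exI[of _ T]) (simp add: P_def)
qed

text \<open>The mirror image: the functionals run through a basis of \<open>D\<close> and the
  centres vary in \<open>Z\<close>, so that a product acts as y plus the sum of all f(y, d_i) w_i.
  It is trivial on \<open>perp D\<close>, and the centres are recovered modulo \<open>E\<close>,
  which meets \<open>Z\<close> trivially.\<close>

lemma dual_transvection_products:
  assumes M: "M \<subseteq> carrier Gp" "\<one>\<^bsub>Gp\<^esub> \<in> M" "\<And>t u. t \<in> M \<Longrightarrow> u \<in> M \<Longrightarrow> t \<otimes>\<^bsub>Gp\<^esub> u \<in> M"
    and D: "sub D" "card D = Q ^ m" and E: "sub E"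
    and Z: "sub Z" "Z \<subseteq> perp D" "E \<inter> Z = {\<zero>\<^bsub>V\<^esub>}"
    and tv: "\<And>d w. d \<in> D \<Longrightarrow> w \<in> Z \<Longrightarrow> \<exists>u\<in>M. \<forall>y\<in>carrier V. act u y = y \<oplus>\<^bsub>V\<^esub> f y d \<odot>\<^bsub>V\<^esub> w"
  shows "\<exists>T. T \<subseteq> M \<and> card T = card Z ^ m \<and> (\<forall>t\<in>T. \<forall>y\<in>carrier V. act t y \<ominus>\<^bsub>V\<^esub> y \<in> perp D)
    \<and> (\<forall>t\<in>T. \<forall>y\<in>perp D. act t y = y)
    \<and> (\<forall>t\<in>T. \<forall>t'\<in>T. (\<forall>y\<in>carrier V. act t y \<ominus>\<^bsub>V\<^esub> act t' y \<in> E) \<longrightarrow> t = t')"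
proof -
  have ZV: "v \<in> carrier V" if "v \<in> Z" for v using that Z sub_in by auto
  have aV: "t \<in> M \<Longrightarrow> y \<in> carrier V \<Longrightarrow> act t y \<in> carrier V" for t y using M act_closed by auto
  have spD: "sub (perp D)" using D sub_perp sub_subset by auto
  define P where "P W k T \<longleftrightarrow> card W = Q ^ k \<and> T \<subseteq> M \<and> card T = card Z ^ k
    \<and> (\<forall>t\<in>T. \<forall>y\<in>carrier V. act t y \<ominus>\<^bsub>V\<^esub> y \<in> perp D) \<and> (\<forall>t\<in>T. \<forall>y\<in>perp W. act t y = y)
    \<and> (\<forall>t\<in>T. \<forall>t'\<in>T. (\<forall>y\<in>carrier V. act t y \<ominus>\<^bsub>V\<^esub> act t' y \<in> E) \<longrightarrow> t = t')" for W k T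
  have ind: "\<exists>k T. P W k T" if "sub W" "W \<subseteq> D" for W
    using that
  proof (induction rule: subspace_induct)
    case zero
    have "\<forall>y\<in>carrier V. act \<one>\<^bsub>Gp\<^esub> y \<ominus>\<^bsub>V\<^esub> y = \<zero>\<^bsub>V\<^esub>" using act_one by (simp add: minus_self)
    then show ?case using M act_one perp_in sub_zero[OF spD]
      by (intro exI[of _ 0] exI[of _ "{\<one>\<^bsub>Gp\<^esub>}"]) (auto simp: P_def minus_self)
  next
    case (adj U d)
    have d: "d \<in> D" using adj that by auto
    then have dV: "d \<in> carrier V" using D sub_in by auto
    have UD: "U \<subseteq> D" using adj that by auto
    obtain k T where PU: "P U k T" using adj.IH UD by blast
    have kT: "card U = Q ^ k" "T \<subseteq> M" "card T = card Z ^ k" using PU by (simp_all add: P_def)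
    have TD: "\<And>t y. t \<in> T \<Longrightarrow> y \<in> carrier V \<Longrightarrow> act t y \<ominus>\<^bsub>V\<^esub> y \<in> perp D" using PU by (simp add: P_def)
    have TU: "\<And>t e. t \<in> T \<Longrightarrow> e \<in> perp U \<Longrightarrow> act t e = e" using PU by (simp add: P_def)
    have Tinj: "\<And>t t'. t \<in> T \<Longrightarrow> t' \<in> T \<Longrightarrow> (\<And>y. y \<in> carrier V \<Longrightarrow> act t y \<ominus>\<^bsub>V\<^esub> act t' y \<in> E) \<Longrightarrow> t = t'"
      using PU by (simp add: P_def)
    obtain u where u: "\<And>v. v \<in> Z \<Longrightarrow> u v \<in> M"
      "\<And>v y. v \<in> Z \<Longrightarrow> y \<in> carrier V \<Longrightarrow> act (u v) y = y \<oplus>\<^bsub>V\<^esub> f y d \<odot>\<^bsub>V\<^esub> v"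
      using tv[OF d] by metis
    let ?g = "\<lambda>(t, v). t \<otimes>\<^bsub>Gp\<^esub> u v"
    have g: "act (t \<otimes>\<^bsub>Gp\<^esub> u v) y = act t y \<oplus>\<^bsub>V\<^esub> f y d \<odot>\<^bsub>V\<^esub> v" if t: "t \<in> T" and v: "v \<in> Z" and y: "y \<in> carrier V" for t v y
    proof -
      let ?w = "act t y \<ominus>\<^bsub>V\<^esub> y"
      have tyV: "act t y \<in> carrier V" using aV kT t y by auto
      have w: "f ?w d = \<zero>" using TD[OF t y] d by (auto simp: perp_def)
      then have "f (act t y) d = f y d" using tyV y dV by (simp add: f_minus_left)
      moreover have "act (t \<otimes>\<^bsub>Gp\<^esub> u v) y = act (u v) (act t y)"
        using act_mult[of t "u v" y] t v y kT u(1)[OF v] M by blast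
      ultimately show ?thesis using u v tyV by simp
    qed
    have inj: "t = t' \<and> v = v'"
      if t: "t \<in> T" "t' \<in> T" and v: "v \<in> Z" "v' \<in> Z"
        and eq: "\<And>y. y \<in> carrier V \<Longrightarrow> act (t \<otimes>\<^bsub>Gp\<^esub> u v) y \<ominus>\<^bsub>V\<^esub> act (t' \<otimes>\<^bsub>Gp\<^esub> u v') y \<in> E" for t t' v v'
    proof -
      \<comment> \<open>As \<open>d\<close> is not in \<open>U\<close>, some vector orthogonal to
        \<open>U\<close> is not orthogonal to \<open>d\<close>. The earlier factors fix it, so the
        last centre can be read off there.\<close>
      have "perp (adj U d) \<noteq> perp U"
      proof
        assume "perp (adj U d) = perp U"
        then have "perp (perp (adj U d)) = perp (perp U)" by simp
        then have "adj U d = U" using perp_perp sub_adj adj dV by auto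
        then show False using adj adj_upper[OF adj(1) dV] by auto
      qed
      then obtain y where y: "y \<in> perp U" "f y d \<noteq> \<zero>" using perp_adj[OF adj(1) dV] by auto
      have yV: "y \<in> carrier V" using y perp_in by auto
      have V: "v \<in> carrier V" "v' \<in> carrier V" "f y d \<in> carrier F" using v ZV yV dV by auto
      have "(y \<oplus>\<^bsub>V\<^esub> f y d \<odot>\<^bsub>V\<^esub> v) \<ominus>\<^bsub>V\<^esub> (y \<oplus>\<^bsub>V\<^esub> f y d \<odot>\<^bsub>V\<^esub> v') \<in> E"
        using eq[OF yV] g t v yV TU y by simp
      also have "(y \<oplus>\<^bsub>V\<^esub> f y d \<odot>\<^bsub>V\<^esub> v) \<ominus>\<^bsub>V\<^esub> (y \<oplus>\<^bsub>V\<^esub> f y d \<odot>\<^bsub>V\<^esub> v') = f y d \<odot>\<^bsub>V\<^esub> (v \<ominus>\<^bsub>V\<^esub> v')"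
        using V yV by (simp add: vec_simps smult_r_distr smult_r_minus)
      finally have "v \<ominus>\<^bsub>V\<^esub> v' \<in> E" using smult_in_sub_iff[OF E V(3) y(2)] V by simp
      then have "v \<ominus>\<^bsub>V\<^esub> v' = \<zero>\<^bsub>V\<^esub>" using Z sub_minus[OF Z(1)] v by auto
      then have vv: "v = v'" using V minus_eq_zero_iff by simp
      have "act t y \<ominus>\<^bsub>V\<^esub> act t' y \<in> E" if y: "y \<in> carrier V" for y
      proof -
        have V: "act t y \<in> carrier V" "act t' y \<in> carrier V" "f y d \<odot>\<^bsub>V\<^esub> v \<in> carrier V"
          using t v y kT aV ZV dV by auto
        have "act (t \<otimes>\<^bsub>Gp\<^esub> u v) y \<ominus>\<^bsub>V\<^esub> act (t' \<otimes>\<^bsub>Gp\<^esub> u v') y = act t y \<ominus>\<^bsub>V\<^esub> act t' y"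
          using g t v y vv V by (simp add: vec_simps)
        then show ?thesis using eq[OF y] by simp
      qed
      then show ?thesis using Tinj t vv by auto
    qed
    have f1: "card (adj U d) = Q ^ Suc k" using card_adj[of U d] adj dV kT by simp
    have f2: "?g ` (T \<times> Z) \<subseteq> M" using kT u M by auto
    have f3: "card (?g ` (T \<times> Z)) = card Z ^ Suc k"
    proof -
      have "inj_on ?g (T \<times> Z)"
      proof (rule inj_onI, clarify)
        fix t v t' v' assume h: "t \<in> T" "v \<in> Z" "t' \<in> T" "v' \<in> Z" "t \<otimes>\<^bsub>Gp\<^esub> u v = t' \<otimes>\<^bsub>Gp\<^esub> u v'"
        have "act (t' \<otimes>\<^bsub>Gp\<^esub> u v') y \<in> carrier V" if "y \<in> carrier V" for y
          using that h(3,4) kT u(1) M by (intro aV) auto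
        then show "t = t' \<and> v = v'" using h inj[of t t' v v'] sub_zero[OF E] by (simp add: M.r_neg a_minus_def)
      qed
      then show ?thesis using kT by (simp add: card_image card_cartesian_product mult.commute)
    qed
    have f4: "act s y \<ominus>\<^bsub>V\<^esub> y \<in> perp D" if s: "s \<in> ?g ` (T \<times> Z)" and y: "y \<in> carrier V" for s y
    proof -
      obtain t v where tv: "t \<in> T" "v \<in> Z" "s = t \<otimes>\<^bsub>Gp\<^esub> u v" using s by auto
      have "act s y \<ominus>\<^bsub>V\<^esub> y = (act t y \<ominus>\<^bsub>V\<^esub> y) \<oplus>\<^bsub>V\<^esub> f y d \<odot>\<^bsub>V\<^esub> v"
        using tv g y aV kT ZV dV subsetD[OF kT(2) tv(1)] by (simp add: vec_simps)
      then show ?thesis using TD[OF tv(1) y] y tv dV Z(2) by (auto intro!: sub_add[OF spD] sub_smult[OF spD])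
    qed
    have f5: "act s x = x" if s: "s \<in> ?g ` (T \<times> Z)" and x: "x \<in> perp (adj U d)" for s x
    proof -
      obtain t v where tv: "t \<in> T" "v \<in> Z" "s = t \<otimes>\<^bsub>Gp\<^esub> u v" using s by auto
      have x': "x \<in> perp U" "f x d = \<zero>" using x perp_adj[OF adj(1) dV] by auto
      then have xV: "x \<in> carrier V" using perp_in by auto
      have "act s x = act t x \<oplus>\<^bsub>V\<^esub> f x d \<odot>\<^bsub>V\<^esub> v" using g tv xV by simp
      then show ?thesis using x' tv TU ZV xV by simp
    qed
    have f6: "s = s'" if s: "s \<in> ?g ` (T \<times> Z)" "s' \<in> ?g ` (T \<times> Z)"
      and eq: "\<And>y. y \<in> carrier V \<Longrightarrow> act s y \<ominus>\<^bsub>V\<^esub> act s' y \<in> E" for s s'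
    proof -
      obtain t v where tv: "t \<in> T" "v \<in> Z" "s = t \<otimes>\<^bsub>Gp\<^esub> u v" using s by auto
      obtain t' v' where tv': "t' \<in> T" "v' \<in> Z" "s' = t' \<otimes>\<^bsub>Gp\<^esub> u v'" using s by auto
      show ?thesis using inj[of t t' v v'] eq tv tv' by simp
    qed
    have "P (adj U d) (Suc k) (?g ` (T \<times> Z))"
        unfolding P_def
      proof (intro conjI ballI impI)
        fix s s' assume "s \<in> ?g ` (T \<times> Z)" "s' \<in> ?g ` (T \<times> Z)" "\<forall>y\<in>carrier V. act s y \<ominus>\<^bsub>V\<^esub> act s' y \<in> E"
        then show "s = s'" by (intro f6) auto
      qed (rule f1 f2 f3 | rule f4 f5, assumption, assumption)+
    then show ?case by blast
  qed
  obtain k T where kT: "P D k T" using ind[OF D(1) subset_refl] by blast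
  then have "k = m" using D(2) Q_power_inj[of k m] by (simp add: P_def)
  then show ?thesis using kT by (intro exI[of _ T]) (simp add: P_def)
qed

text \<open>Some \<open>f (h e) d\<close> is nonzero and is unchanged by multiplication with
  \<open>c\<close>. This removes the scalar in the proofs of \<open>separated\<close>.\<close>

lemma scalar_eq_one:
  assumes g: "good h E D" and lh: "lin h" and E: "E \<noteq> {\<zero>\<^bsub>V\<^esub>}" and c: "c \<in> carrier F"
    and gh: "\<And>e. e \<in> E \<Longrightarrow> c \<odot>\<^bsub>V\<^esub> h e \<ominus>\<^bsub>V\<^esub> h e \<in> perp D"
  shows "c = \<one>"
proof -
  have s: "sub E" using g by (auto simp: good_def)
  obtain e where e: "e \<in> E" "e \<noteq> \<zero>\<^bsub>V\<^esub>" using E sub_zero[OF s] by auto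
  then have "\<not> (\<forall>d\<in>D. f (h e) d = \<zero>)" using g unfolding good_def by blast
  then obtain d where d: "d \<in> D" "f (h e) d \<noteq> \<zero>" by blast
  have V: "h e \<in> carrier V" "d \<in> carrier V" using e d g sub_in lin_closed[OF lh] by (auto simp: good_def)
  have "f (c \<odot>\<^bsub>V\<^esub> h e \<ominus>\<^bsub>V\<^esub> h e) d = \<zero>" using gh[OF e(1)] d by (auto simp: perp_def)
  then have "c \<otimes> f (h e) d = \<one> \<otimes> f (h e) d" using V c by (simp add: f_minus_left f_smult_left)
  then show ?thesis using m_rcancel[of "f (h e) d" c \<one>] V d c by auto
qed

text \<open>By nondegeneracy \<open>h\<close> maps \<open>E\<close> to a subspace meeting
  \<open>perp D\<close> trivially, and the sizes leave no gap.\<close>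

lemma good_image_complement:
  assumes g: "good h E D" and lh: "lin h" "inj_on h (carrier V)"
  shows "plus_sub (h ` E) (perp D) = carrier V"
proof (rule card_subset_eq[OF finite_V])
  have s: "sub E" "sub D" "card E = card D" using g by (auto simp: good_def)
  have s': "sub (h ` E)" "sub (perp D)" using s sub_image lh sub_perp sub_subset by auto
  show "plus_sub (h ` E) (perp D) \<subseteq> carrier V" using sub_plus[OF s'] sub_subset by auto
  have "h ` E \<inter> perp D = {\<zero>\<^bsub>V\<^esub>}"
  proof
    show "h ` E \<inter> perp D \<subseteq> {\<zero>\<^bsub>V\<^esub>}" using g lin_zero[OF lh(1)] by (auto simp: good_def perp_def)
  qed (use s' sub_zero in auto)
  moreover have "card (h ` E) = card D" using s sub_subset inj_on_subset[OF lh(2)] card_image by metis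
  ultimately show "card (plus_sub (h ` E) (perp D)) = card (carrier V)"
    using card_plus_direct[OF s'] card_perp[OF s(2)] by simp
qed

lemma good_perp_decomp:
  assumes g: "good h E D" and lh: "lin h" "inj_on h (carrier V)"
  shows "plus_sub E {r \<in> perp D. h r \<in> perp D} = perp D"
proof -
  define R where "R = {r \<in> perp D. h r \<in> perp D}"
  have s: "sub E" "sub D" "card E = card D" using g by (auto simp: good_def)
  have sR: "sub R" and cR: "card (carrier V) \<le> card D * card D * card R"
    using card_double_perp_ge[OF lh s(2)] by (auto simp: R_def)
  have ER: "E \<inter> R = {\<zero>\<^bsub>V\<^esub>}" using good_Int[OF g sR] by (simp add: R_def)
  have spD: "sub (perp D)" using s sub_perp sub_subset by auto
  have "E \<subseteq> perp D" using g s sub_in by (auto simp: good_def perp_def)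
  then have "plus_sub E R \<subseteq> perp D" by (intro plus_sub_least spD) (auto simp: R_def)
  moreover have "card (perp D) \<le> card (plus_sub E R)"
  proof -
    have "card D * card (perp D) \<le> card D * (card D * card R)" using card_perp[OF s(2)] cR by (simp add: mult.assoc)
    then show ?thesis using card_plus_direct[OF s(1) sR ER] s sub_card_pos[OF s(2)] by simp
  qed
  ultimately show ?thesis using sub_finite[OF spD] unfolding R_def by (metis card_seteq)
qed

text \<open>\<open>T\<close> consists of products from the unipotent group of the flag E \<subseteq>
  perp D \<subseteq> V: trivial on \<open>E\<close>, on perp D / E and on V / perp D. If |V| = Q^n,
  its size is Q^(2m(n - 2m)). Suppose the quotient g of two elements commutes with \<open>h\<close>
  up to a scalar. The scalar is 1. As g fixes \<open>E\<close>, it fixes the image of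
  \<open>E\<close> under \<open>h\<close>. It fixes every x in \<open>perp D\<close> with h x in
  \<open>perp D\<close>, because g x - x lies in \<open>E\<close> and \<open>h\<close> maps it into
  \<open>perp D\<close>. These three subspaces span V, so g is trivial.\<close>

lemma separated_dual_pair:
  assumes h: "h \<in> carrier Gp" and g: "good (act h) E D" and cE: "card E = Q ^ m"
    and M: "subgroup M Gp"
    and tv: "\<And>w p. w \<in> carrier V \<Longrightarrow> p \<in> carrier V \<Longrightarrow> f w p = \<zero> \<Longrightarrow>
      \<exists>u\<in>M. \<forall>x\<in>carrier V. act u x = x \<oplus>\<^bsub>V\<^esub> f x p \<odot>\<^bsub>V\<^esub> w"
  shows "\<exists>T\<subseteq>M. separated h T \<and> card T * Q ^ (4 * m * m) = card (carrier V) ^ (2 * m)"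
proof -
  have s: "sub E" "sub D" "card D = Q ^ m" using g cE by (auto simp: good_def)
  have lh: "lin (act h)" "inj_on (act h) (carrier V)" using h act_lin act_inj by auto
  have spD: "sub (perp D)" and spE: "sub (perp E)" using s sub_perp sub_subset by auto
  have ED: "E \<subseteq> perp D" using g s sub_in by (auto simp: good_def perp_def)
  have DE: "D \<subseteq> perp E" using g s sub_in by (auto simp: good_def perp_def intro: f_refl)
  obtain Z1 where Z1: "sub Z1" "Z1 \<subseteq> perp E" "D \<inter> Z1 = {\<zero>\<^bsub>V\<^esub>}" "plus_sub D Z1 = perp E"
    using complement_exists[OF s(2) spE DE] by auto
  obtain Z2 where Z2: "sub Z2" "Z2 \<subseteq> perp D" "E \<inter> Z2 = {\<zero>\<^bsub>V\<^esub>}" "plus_sub E Z2 = perp D"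
    using complement_exists[OF s(1) spD ED] by auto
  have cZ1: "Q ^ m * (Q ^ m * card Z1) = card (carrier V)"
    using card_perp[OF s(1)] card_plus_direct[OF s(2) Z1(1,3)] Z1(4) cE s by simp
  have cZ2: "Q ^ m * (Q ^ m * card Z2) = card (carrier V)"
    using card_perp[OF s(2)] card_plus_direct[OF s(1) Z2(1,3)] Z2(4) cE s by simp
  have MG: "M \<subseteq> carrier Gp" "\<one>\<^bsub>Gp\<^esub> \<in> M" "\<And>t u. t \<in> M \<Longrightarrow> u \<in> M \<Longrightarrow> t \<otimes>\<^bsub>Gp\<^esub> u \<in> M" "\<And>t. t \<in> M \<Longrightarrow> inv\<^bsub>Gp\<^esub> t \<in> M"
    using M by (auto simp: subgroup_def)
  \<comment> \<open>The first set of products has to move every vector of the space by an element of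
    \<open>E\<close>; the formula on \<open>perp D\<close> alone would not give this.\<close>
  define M1 where "M1 = {t \<in> M. \<forall>y\<in>carrier V. act t y \<ominus>\<^bsub>V\<^esub> y \<in> E}"
  have M1: "M1 \<subseteq> carrier Gp" "\<one>\<^bsub>Gp\<^esub> \<in> M1"
    using MG act_one sub_zero[OF s(1)] by (auto simp: M1_def minus_self)
  have M1m: "t \<otimes>\<^bsub>Gp\<^esub> u \<in> M1" if t: "t \<in> M1" and u: "u \<in> M1" for t u
  proof -
    have "act (t \<otimes>\<^bsub>Gp\<^esub> u) y \<ominus>\<^bsub>V\<^esub> y \<in> E" if y: "y \<in> carrier V" for y
    proof -
      have V: "act t y \<in> carrier V" "act u (act t y) \<in> carrier V" using M1(1) t u y act_closed by (meson subsetD)+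
      have "act (t \<otimes>\<^bsub>Gp\<^esub> u) y \<ominus>\<^bsub>V\<^esub> y = (act u (act t y) \<ominus>\<^bsub>V\<^esub> act t y) \<oplus>\<^bsub>V\<^esub> (act t y \<ominus>\<^bsub>V\<^esub> y)"
        using act_mult[of t u y] M1(1) t u y V by (simp add: subset_iff vec_simps)
      then show ?thesis using t u V y by (auto simp: M1_def intro!: sub_add[OF s(1)])
    qed
    then show ?thesis using t u MG by (auto simp: M1_def)
  qed
  have "\<exists>T. T \<subseteq> M1 \<and> card T = card Z1 ^ m \<and> (\<forall>t\<in>T. \<forall>y\<in>perp D. act t y \<ominus>\<^bsub>V\<^esub> y \<in> E)
    \<and> (\<forall>t\<in>T. \<forall>e\<in>E. act t e = e)
    \<and> (\<forall>t\<in>T. \<forall>t'\<in>T. (\<forall>y\<in>perp D. act t y = act t' y) \<longrightarrow> t = t')"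
  proof (rule transvection_products[OF M1 M1m s(1) cE spD ED Z1(1)])
    show ez: "f e v = \<zero>" if "e \<in> E" "v \<in> Z1" for e v
      using that Z1 s sub_in by (auto simp: perp_def intro!: f_refl[of v e])
    show "v = \<zero>\<^bsub>V\<^esub>" if v: "v \<in> Z1" and yv: "\<And>y. y \<in> perp D \<Longrightarrow> f y v = \<zero>" for v
    proof -
      have "v \<in> perp (perp D)" using v yv Z1(1) sub_in perp_in by (intro perpI) (auto intro: f_refl)
      then show ?thesis using perp_perp[OF s(2)] v Z1 by auto
    qed
    show "\<exists>u\<in>M1. \<forall>y\<in>perp D. act u y = y \<oplus>\<^bsub>V\<^esub> f y v \<odot>\<^bsub>V\<^esub> e" if e: "e \<in> E" and v: "v \<in> Z1" for e v
    proof -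
      have V: "e \<in> carrier V" "v \<in> carrier V" using e v s Z1 sub_in by auto
      obtain u where u: "u \<in> M" "\<And>x. x \<in> carrier V \<Longrightarrow> act u x = x \<oplus>\<^bsub>V\<^esub> f x v \<odot>\<^bsub>V\<^esub> e"
        using tv[OF V ez[OF e v]] by blast
      have "act u y \<ominus>\<^bsub>V\<^esub> y \<in> E" if y: "y \<in> carrier V" for y
        using u(2)[OF y] y V e add_minus_cancel(1)[of y "f y v \<odot>\<^bsub>V\<^esub> e"] sub_smult[OF s(1)] by simp
      then show ?thesis using u perp_in by (intro bexI[of _ u]) (auto simp: M1_def)
    qed
  qed auto
  then obtain T1 where T1: "T1 \<subseteq> M1" "card T1 = card Z1 ^ m"
    and T1E: "\<forall>t\<in>T1. \<forall>e\<in>E. act t e = e"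
    and T1inj: "\<forall>t\<in>T1. \<forall>t'\<in>T1. (\<forall>y\<in>perp D. act t y = act t' y) \<longrightarrow> t = t'" by blast
  have "\<exists>T. T \<subseteq> M \<and> card T = card Z2 ^ m \<and> (\<forall>t\<in>T. \<forall>y\<in>carrier V. act t y \<ominus>\<^bsub>V\<^esub> y \<in> perp D)
    \<and> (\<forall>t\<in>T. \<forall>y\<in>perp D. act t y = y)
    \<and> (\<forall>t\<in>T. \<forall>t'\<in>T. (\<forall>y\<in>carrier V. act t y \<ominus>\<^bsub>V\<^esub> act t' y \<in> E) \<longrightarrow> t = t')"
    by (rule dual_transvection_products[OF MG(1-3) s(2,3,1) Z2(1-3)])
      (use tv Z2 s sub_in in \<open>auto simp: perp_def subset_iff\<close>)
  then obtain T2 where T2: "T2 \<subseteq> M" "card T2 = card Z2 ^ m"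
    and T2D': "\<forall>t\<in>T2. \<forall>y\<in>carrier V. act t y \<ominus>\<^bsub>V\<^esub> y \<in> perp D"
    and T2f: "\<forall>t\<in>T2. \<forall>y\<in>perp D. act t y = y"
    and T2inj: "\<forall>t\<in>T2. \<forall>t'\<in>T2. (\<forall>y\<in>carrier V. act t y \<ominus>\<^bsub>V\<^esub> act t' y \<in> E) \<longrightarrow> t = t'" by blast
  have T2D: "\<And>t y. t \<in> T2 \<Longrightarrow> y \<in> carrier V \<Longrightarrow> act t y \<ominus>\<^bsub>V\<^esub> y \<in> perp D" using T2D' by blast
  let ?g = "\<lambda>(t, u). t \<otimes>\<^bsub>Gp\<^esub> u"
  have TG: "t \<in> carrier Gp" "t \<in> M" if "t \<in> T1" for t using that T1 MG by (auto simp: M1_def)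
  have TG2: "t \<in> carrier Gp" "t \<in> M" if "t \<in> T2" for t using that T2 MG by auto
  have T1D: "act t y \<ominus>\<^bsub>V\<^esub> y \<in> E" if "t \<in> T1" "y \<in> carrier V" for t y using that T1 by (auto simp: M1_def)
  have T1p: "act t y \<in> perp D" if t: "t \<in> T1" and y: "y \<in> perp D" for t y
  proof -
    have yV: "y \<in> carrier V" using y perp_in by auto
    have "act t y = (act t y \<ominus>\<^bsub>V\<^esub> y) \<oplus>\<^bsub>V\<^esub> y" using act_closed[OF TG(1)[OF t] yV] yV add_minus_cancel by simp
    moreover have "act t y \<ominus>\<^bsub>V\<^esub> y \<in> perp D" using T1D t yV ED by auto
    ultimately show ?thesis using sub_add[OF spD _ y] by metis
  qed
  have inj: "t = t' \<and> u = u'" if t: "t \<in> T1" "t' \<in> T1" and u: "u \<in> T2" "u' \<in> T2"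
    and eq: "\<And>y. y \<in> carrier V \<Longrightarrow> act (t \<otimes>\<^bsub>Gp\<^esub> u) y = act (t' \<otimes>\<^bsub>Gp\<^esub> u') y" for t t' u u'
  proof -
    have "act t y = act t' y" if y: "y \<in> perp D" for y
      using eq[of y] act_mult TG TG2 t u y perp_in T2f T1p by simp
    then have tt: "t = t'" using T1inj t by auto
    have "act u y = act u' y" if y: "y \<in> carrier V" for y
    proof -
      have x: "act (inv\<^bsub>Gp\<^esub> t) y \<in> carrier V" using TG(1)[OF t(1)] y act_closed by auto
      have "act u (act t (act (inv\<^bsub>Gp\<^esub> t) y)) = act u' (act t (act (inv\<^bsub>Gp\<^esub> t) y))"
        using eq[OF x] act_mult TG TG2 t u x tt by simp
      then show ?thesis using act_inv TG t y by simp
    qed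
    then have "u = u'" 
      using T2inj u act_closed[OF TG2(1)[OF u(2)]] sub_zero[OF s(1)] by (simp add: minus_self)
    then show ?thesis using tt by simp
  qed
  have "separated h (?g ` (T1 \<times> T2))"
    unfolding separated_def
  proof (intro ballI impI)
    fix r r' c assume r: "r \<in> ?g ` (T1 \<times> T2)" "r' \<in> ?g ` (T1 \<times> T2)" and c: "c \<in> carrier F" "c \<noteq> \<zero>"
      and eq: "\<forall>v\<in>carrier V. act (conj h r) v = c \<odot>\<^bsub>V\<^esub> act (conj h r') v"
    have pr: "r \<in> carrier Gp" "\<And>e. e \<in> E \<Longrightarrow> act r e = e"
      "\<And>y. y \<in> perp D \<Longrightarrow> act r y \<ominus>\<^bsub>V\<^esub> y \<in> E" "\<And>y. y \<in> carrier V \<Longrightarrow> act r y \<ominus>\<^bsub>V\<^esub> y \<in> perp D"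
      if rT: "r \<in> ?g ` (T1 \<times> T2)" for r
    proof -
      obtain t u where tu: "t \<in> T1" "u \<in> T2" "r = t \<otimes>\<^bsub>Gp\<^esub> u" using rT by auto
      show "r \<in> carrier Gp" using tu TG TG2 by auto
      have ar: "act r y = act u (act t y)" if "y \<in> carrier V" for y using act_mult TG TG2 tu that by simp
      show "act r e = e" if "e \<in> E" for e using ar that s sub_in T1E T2f ED tu by auto
      show "act r y \<ominus>\<^bsub>V\<^esub> y \<in> E" if "y \<in> perp D" for y
        using ar that perp_in T2f T1p T1D tu by simp
      show "act r y \<ominus>\<^bsub>V\<^esub> y \<in> perp D" if y: "y \<in> carrier V" for y
      proof -
        have V: "act t y \<in> carrier V" "act u (act t y) \<in> carrier V" using act_closed TG TG2 tu y by auto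
        have "act r y \<ominus>\<^bsub>V\<^esub> y = (act u (act t y) \<ominus>\<^bsub>V\<^esub> act t y) \<oplus>\<^bsub>V\<^esub> (act t y \<ominus>\<^bsub>V\<^esub> y)"
          using ar[OF y] V y by (simp add: vec_simps)
        then show ?thesis using T2D[OF tu(2) V(1)] T1D[OF tu(1) y] ED sub_add[OF spD] by auto
      qed
    qed
    define g where "g = r \<otimes>\<^bsub>Gp\<^esub> inv\<^bsub>Gp\<^esub> r'"
    have gG: "g \<in> carrier Gp" using pr(1) r by (auto simp: g_def)
    have gV: "y \<in> carrier V \<Longrightarrow> act g y \<in> carrier V" for y using gG act_closed by auto
    have rg: "act r' (act g y) = act r y" if y: "y \<in> carrier V" for y
      using act_mult[of r "inv\<^bsub>Gp\<^esub> r'" y] act_inv(2)[of r' "act r y"] act_closed pr(1) r y by (simp add: g_def)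
    have gE: "act g e = e" if e: "e \<in> E" for e
    proof -
      have "e \<in> carrier V" using e s sub_in by auto
      then have "act r' (act g e) = act r' e" using rg pr(2)[OF r(1) e] pr(2)[OF r(2) e] by simp
      then show ?thesis using act_inj[OF pr(1)[OF r(2)]] gV \<open>e \<in> carrier V\<close> by (auto dest: inj_onD)
    qed
    have diff: "act g y \<ominus>\<^bsub>V\<^esub> y = (act r y \<ominus>\<^bsub>V\<^esub> y) \<ominus>\<^bsub>V\<^esub> (act r' (act g y) \<ominus>\<^bsub>V\<^esub> act g y)" if y: "y \<in> carrier V" for y
    proof -
      have "act r y \<in> carrier V" using act_closed pr(1) r y by auto
      then show ?thesis using rg[OF y] gV[OF y] y by (simp add: vec_simps)
    qed
    have gD: "act g y \<ominus>\<^bsub>V\<^esub> y \<in> perp D" if y: "y \<in> carrier V" for y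
      unfolding diff[OF y] using pr(4)[OF r(1) y] pr(4)[OF r(2) gV[OF y]] sub_minus[OF spD] by auto
    have gpD: "act g y \<ominus>\<^bsub>V\<^esub> y \<in> E" if y: "y \<in> perp D" for y
    proof -
      have yV: "y \<in> carrier V" using y perp_in by auto
      have "act g y = (act g y \<ominus>\<^bsub>V\<^esub> y) \<oplus>\<^bsub>V\<^esub> y" using gV yV add_minus_cancel by simp
      then have "act g y \<in> perp D" using gD[OF yV] sub_add[OF spD _ y] by metis
      then show ?thesis
        unfolding diff[OF yV] using pr(3)[OF r(1) y] pr(3)[OF r(2)] sub_minus[OF s(1)] by auto
    qed
    have comm: "act g (act h y) = c \<odot>\<^bsub>V\<^esub> act h (act g y)" if y: "y \<in> carrier V" for y
      unfolding g_def using conj_proportional[OF h pr(1)[OF r(1)] pr(1)[OF r(2)] c(1) _ y] eq by blast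
    \<comment> \<open>For zero \<open>E\<close> the scalar \<open>c\<close> is not determined; but
      then \<open>D\<close> is zero, \<open>perp D\<close> is the whole space and \<open>gpD\<close>
      already shows that \<open>g\<close> is trivial.\<close>
    have "act g y = y" if y: "y \<in> carrier V" for y
    proof (cases "E = {\<zero>\<^bsub>V\<^esub>}")
      case True
      then have "card D = 1" using s(3) cE by simp
      then have "D = {\<zero>\<^bsub>V\<^esub>}" using sub_zero[OF s(2)] by (metis card_1_singletonE singletonD)
      then have "y \<in> perp D" using y by (auto simp: perp_def)
      from gpD[OF this] show ?thesis using True gV[OF y] y minus_eq_zero_iff by simp
    next
      case False
      have "c = \<one>"
      proof (rule scalar_eq_one[OF g lh(1) False c(1)])
        fix e assume e: "e \<in> E"
        then have eV: "e \<in> carrier V" using s sub_in by auto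
        show "c \<odot>\<^bsub>V\<^esub> act h e \<ominus>\<^bsub>V\<^esub> act h e \<in> perp D"
          using gD[of "act h e"] comm[OF eV] gE[OF e] lin_closed[OF lh(1) eV] by simp
      qed
      then have comm: "act g (act h y) = act h (act g y)" if "y \<in> carrier V" for y
        using comm that gV lin_closed[OF lh(1)] by simp
      let ?R = "{r \<in> perp D. act h r \<in> perp D}"
      have hR: "act g x = x" if x: "x \<in> ?R" for x
      proof -
        have V: "x \<in> carrier V" "act g x \<in> carrier V" "act h x \<in> carrier V" using x perp_in gV by auto
        have "act g (act h x) \<ominus>\<^bsub>V\<^esub> act h x \<in> perp D" using gD V by auto
        then have "act h (act g x \<ominus>\<^bsub>V\<^esub> x) \<in> perp D" using comm V lin_minus[OF lh(1)] by simp
        moreover have "act g x \<ominus>\<^bsub>V\<^esub> x \<in> E" using gpD x by auto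
        ultimately have "act g x \<ominus>\<^bsub>V\<^esub> x = \<zero>\<^bsub>V\<^esub>" using g by (auto simp: good_def perp_def)
        then show ?thesis using V minus_eq_zero_iff by simp
      qed
      have sfix: "sub {v \<in> carrier V. act g v = v}"
        by (rule lin_agree_sub[OF act_lin[OF gG]]) (auto simp: lin_def)
      have "plus_sub E ?R \<subseteq> {v \<in> carrier V. act g v = v}"
        by (rule plus_sub_least[OF sfix]) (use gE hR s sub_in perp_in in auto)
      then have "perp D \<subseteq> {v \<in> carrier V. act g v = v}" using good_perp_decomp[OF g lh] by simp
      moreover have "act h ` E \<subseteq> {v \<in> carrier V. act g v = v}"
        using comm gE s sub_in lin_closed[OF lh(1)] by auto
      ultimately have "plus_sub (act h ` E) (perp D) \<subseteq> {v \<in> carrier V. act g v = v}"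
        by (intro plus_sub_least[OF sfix])
      then show ?thesis using good_image_complement[OF g lh] y by auto
    qed
    then have rr: "act r y = act r' y" if "y \<in> carrier V" for y using rg that by metis
    obtain t u t' u' where tu: "t \<in> T1" "t' \<in> T1" "u \<in> T2" "u' \<in> T2" "r = t \<otimes>\<^bsub>Gp\<^esub> u" "r' = t' \<otimes>\<^bsub>Gp\<^esub> u'"
      using r by auto
    have "t = t' \<and> u = u'" using rr unfolding tu(5,6) by (rule inj[OF tu(1-4)])
    then show "r = r'" using tu by simp
  qed
  moreover have "card (?g ` (T1 \<times> T2)) = card Z1 ^ m * card Z2 ^ m"
  proof -
    have "inj_on ?g (T1 \<times> T2)" using inj by (intro inj_onI) auto
    then show ?thesis using T1 T2 by (simp add: card_image card_cartesian_product)
  qed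
  moreover have "card Z1 ^ m * card Z2 ^ m * Q ^ (4 * m * m) = card (carrier V) ^ (2 * m)"
  proof -
    have "card (carrier V) ^ (2 * m) = card (carrier V) ^ m * card (carrier V) ^ m" by (simp add: mult_2 power_add)
    also have "\<dots> = (Q ^ m * (Q ^ m * card Z1)) ^ m * (Q ^ m * (Q ^ m * card Z2)) ^ m" using cZ1 cZ2 by simp
    also have "\<dots> = card Z1 ^ m * card Z2 ^ m * ((Q ^ m) ^ m * (Q ^ m) ^ m * (Q ^ m) ^ m * (Q ^ m) ^ m)"
      by (simp only: power_mult_distrib mult_ac)
    also have "(Q ^ m) ^ m * (Q ^ m) ^ m * (Q ^ m) ^ m * (Q ^ m) ^ m = Q ^ (4 * m * m)"
    proof -
      have "m * m + m * m + m * m + m * m = 4 * m * m" by simp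
      then show ?thesis by (simp only: power_mult[symmetric] power_add[symmetric])
    qed
    finally show ?thesis by simp
  qed
  moreover have "?g ` (T1 \<times> T2) \<subseteq> M" using TG TG2 MG by auto
  ultimately show ?thesis by (intro exI[of _ "?g ` (T1 \<times> T2)"]) auto
qed

end

locale polar_action = polar_space F V f \<sigma> S + form_action F V f \<sigma> Gp act
  for F (structure) and V (structure) and f \<sigma> S and Gp :: "('g, 'h) monoid_scheme" and act
begin

text \<open>Invariance of the form replaces the second set of products. If g fixes \<open>E\<close>
  and its image under \<open>h\<close> pointwise, then for y in \<open>perp E\<close> the vector g y
  - y lies in \<open>E = perp (perp E)\<close> and is orthogonal to that image; the image and
  \<open>perp E\<close> span the space, so g y = y. Hence it is enough that elements of
  \<open>T\<close> differ on \<open>perp E\<close>, and |T| is Q^(m(n - 2m)) if |V| = Q^n.\<close>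

lemma separated_singular:
  assumes h: "h \<in> carrier Gp" and g: "good (act h) E E" and cE: "card E = Q ^ m" and ES: "E \<subseteq> S"
    and M: "subgroup M Gp" and iso: "\<And>t. t \<in> M \<Longrightarrow> isometry (act t)"
    and tv: "\<And>e v. e \<in> S \<Longrightarrow> v \<in> carrier V \<Longrightarrow> f v e = \<zero> \<Longrightarrow>
      \<exists>u\<in>M. \<forall>y\<in>carrier V. f y e = \<zero> \<longrightarrow> act u y = y \<oplus>\<^bsub>V\<^esub> f y v \<odot>\<^bsub>V\<^esub> e"
  shows "\<exists>T\<subseteq>M. separated h T \<and> card T * Q ^ (2 * m * m) = card (carrier V) ^ m"
proof -
  have sE: "sub E" using g by (auto simp: good_def)
  have lh: "lin (act h)" "inj_on (act h) (carrier V)" using h act_lin act_inj by auto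
  have spE: "sub (perp E)" using sE sub_perp sub_subset by auto
  have EE: "E \<subseteq> perp E" using g sE sub_in by (auto simp: good_def perp_def)
  obtain Z where Z: "sub Z" "Z \<subseteq> perp E" "E \<inter> Z = {\<zero>\<^bsub>V\<^esub>}" "plus_sub E Z = perp E"
    using complement_exists[OF sE spE EE] by auto
  have cZ: "Q ^ m * (Q ^ m * card Z) = card (carrier V)"
    using card_perp[OF sE] card_plus_direct[OF sE Z(1,3)] Z(4) cE by simp
  have MG: "M \<subseteq> carrier Gp" "\<one>\<^bsub>Gp\<^esub> \<in> M" "\<And>t u. t \<in> M \<Longrightarrow> u \<in> M \<Longrightarrow> t \<otimes>\<^bsub>Gp\<^esub> u \<in> M" "\<And>t. t \<in> M \<Longrightarrow> inv\<^bsub>Gp\<^esub> t \<in> M"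
    using M by (auto simp: subgroup_def)
  have "\<exists>T. T \<subseteq> M \<and> card T = card Z ^ m \<and> (\<forall>t\<in>T. \<forall>y\<in>perp E. act t y \<ominus>\<^bsub>V\<^esub> y \<in> E)
    \<and> (\<forall>t\<in>T. \<forall>e\<in>E. act t e = e)
    \<and> (\<forall>t\<in>T. \<forall>t'\<in>T. (\<forall>y\<in>perp E. act t y = act t' y) \<longrightarrow> t = t')"
  proof (rule transvection_products[OF MG(1-3) sE cE spE EE Z(1)])
    show "f e v = \<zero>" if "e \<in> E" "v \<in> Z" for e v
      using that Z sE sub_in by (auto simp: perp_def intro!: f_refl[of v e])
    show "v = \<zero>\<^bsub>V\<^esub>" if v: "v \<in> Z" and yv: "\<And>y. y \<in> perp E \<Longrightarrow> f y v = \<zero>" for v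
    proof -
      have "v \<in> perp (perp E)" using v yv Z(1) sub_in perp_in by (intro perpI) (auto intro: f_refl)
      then show ?thesis using perp_perp[OF sE] v Z by auto
    qed
    show "\<exists>u\<in>M. \<forall>y\<in>perp E. act u y = y \<oplus>\<^bsub>V\<^esub> f y v \<odot>\<^bsub>V\<^esub> e" if e: "e \<in> E" and v: "v \<in> Z" for e v
    proof -
      have "e \<in> S" "v \<in> carrier V" "f v e = \<zero>" using e v ES Z sub_in by (auto simp: perp_def)
      then obtain u where "u \<in> M" "\<forall>y\<in>carrier V. f y e = \<zero> \<longrightarrow> act u y = y \<oplus>\<^bsub>V\<^esub> f y v \<odot>\<^bsub>V\<^esub> e"
        using tv by blast
      then show ?thesis using e by (intro bexI[of _ u]) (auto simp: perp_def)
    qed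
  qed auto
  then obtain T where T: "T \<subseteq> M" "card T = card Z ^ m"
    and Tp: "\<forall>t\<in>T. \<forall>y\<in>perp E. act t y \<ominus>\<^bsub>V\<^esub> y \<in> E"
    and TE: "\<forall>t\<in>T. \<forall>e\<in>E. act t e = e"
    and Tinj: "\<forall>t\<in>T. \<forall>t'\<in>T. (\<forall>y\<in>perp E. act t y = act t' y) \<longrightarrow> t = t'" by blast
  have "separated h T"
    unfolding separated_def
  proof (intro ballI impI)
    fix r r' c assume r: "r \<in> T" "r' \<in> T" and c: "c \<in> carrier F" "c \<noteq> \<zero>"
      and eq: "\<forall>v\<in>carrier V. act (conj h r) v = c \<odot>\<^bsub>V\<^esub> act (conj h r') v"
    have rM: "r \<in> M" "r' \<in> M" and rG: "r \<in> carrier Gp" "r' \<in> carrier Gp" using r T MG by auto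
    define g' where "g' = r \<otimes>\<^bsub>Gp\<^esub> inv\<^bsub>Gp\<^esub> r'"
    have gM: "g' \<in> M" using rM MG by (auto simp: g'_def)
    then have gG: "g' \<in> carrier Gp" using MG by auto
    have gV: "y \<in> carrier V \<Longrightarrow> act g' y \<in> carrier V" for y using gG act_closed by auto
    have giso: "f (act g' x) (act g' y) = f x y" if "x \<in> carrier V" "y \<in> carrier V" for x y
      using iso[OF gM] that by (auto simp: isometry_def)
    have EV: "e \<in> E \<Longrightarrow> e \<in> carrier V" for e using sE sub_in by auto
    have rg: "act r' (act g' y) = act r y" if y: "y \<in> carrier V" for y
      using act_mult[of r "inv\<^bsub>Gp\<^esub> r'" y] act_inv(2)[of r' "act r y"] act_closed rG y by (simp add: g'_def)
    have gE: "act g' e = e" if e: "e \<in> E" for e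
    proof -
      have "act r' (act g' e) = act r' e" using rg[OF EV[OF e]] TE r e by simp
      then show ?thesis using act_inj[OF rG(2)] gV EV[OF e] by (auto dest: inj_onD)
    qed
    have gpE: "act g' y \<ominus>\<^bsub>V\<^esub> y \<in> E" if y: "y \<in> perp E" for y
    proof -
      have yV: "y \<in> carrier V" using y perp_in by auto
      have "act g' y \<in> perp E"
      proof (rule perpI)
        fix e assume e: "e \<in> E"
        have "f (act g' y) (act g' e) = \<zero>" using giso[OF yV EV[OF e]] y e by (simp add: perp_def)
        then show "f (act g' y) e = \<zero>" using gE[OF e] by simp
      qed (use gV yV in auto)
      then have "act r y \<ominus>\<^bsub>V\<^esub> y \<in> E" "act r' (act g' y) \<ominus>\<^bsub>V\<^esub> act g' y \<in> E" using Tp r y by auto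
      then have "(act r y \<ominus>\<^bsub>V\<^esub> y) \<ominus>\<^bsub>V\<^esub> (act r' (act g' y) \<ominus>\<^bsub>V\<^esub> act g' y) \<in> E" using sub_minus[OF sE] by auto
      moreover have "act r y \<in> carrier V" using act_closed rG yV by auto
      ultimately show ?thesis using rg[OF yV] gV[OF yV] yV by (simp add: vec_simps)
    qed
    have comm: "act g' (act h y) = c \<odot>\<^bsub>V\<^esub> act h (act g' y)" if y: "y \<in> carrier V" for y
      unfolding g'_def using conj_proportional[OF h rG c(1) _ y] eq by blast
    have "act g' y = y" if y: "y \<in> perp E" for y
    proof (cases "E = {\<zero>\<^bsub>V\<^esub>}")
      case True
      have "y \<in> carrier V" using y perp_in by auto
      then show ?thesis using gpE[OF y] True gV minus_eq_zero_iff by auto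
    next
      case False
      have hV: "e \<in> E \<Longrightarrow> act h e \<in> carrier V" for e using EV lin_closed[OF lh(1)] by auto
      have "c = \<one>"
      proof (rule scalar_eq_one[OF g lh(1) False c(1)])
        fix e assume e: "e \<in> E"
        show "c \<odot>\<^bsub>V\<^esub> act h e \<ominus>\<^bsub>V\<^esub> act h e \<in> perp E"
        proof (rule perpI)
          fix d assume d: "d \<in> E"
          have "f (act g' (act h e)) (act g' d) = f (act h e) d" by (rule giso[OF hV[OF e] EV[OF d]])
          then show "f (c \<odot>\<^bsub>V\<^esub> act h e \<ominus>\<^bsub>V\<^esub> act h e) d = \<zero>"
            using comm[OF EV[OF e]] gE e d hV EV c by (simp add: f_minus_left)
        qed (use hV e c in auto)
      qed
      then have ghe: "act g' (act h e) = act h e" if "e \<in> E" for e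
        using comm[OF EV[OF that]] gE[OF that] hV[OF that] by simp
      have yV: "y \<in> carrier V" using y perp_in by auto
      have "act g' y \<ominus>\<^bsub>V\<^esub> y \<in> perp (act h ` E)"
      proof (rule perpI)
        fix w assume "w \<in> act h ` E"
        then obtain e where e: "e \<in> E" "w = act h e" by auto
        have "f (act g' y) (act g' w) = f y w" using giso yV hV e by auto
        then show "f (act g' y \<ominus>\<^bsub>V\<^esub> y) w = \<zero>" using ghe e hV yV gV by (simp add: f_minus_left)
      qed (use gV yV in auto)
      moreover have "act g' y \<ominus>\<^bsub>V\<^esub> y \<in> perp (perp E)" using gpE[OF y] perp_perp[OF sE] by simp
      ultimately have "act g' y \<ominus>\<^bsub>V\<^esub> y \<in> perp (carrier V)"
        using perp_plus_sub[OF sub_image[OF lh(1) sE] spE] good_image_complement[OF g lh] by auto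
      then show ?thesis using perp_carrier gV yV minus_eq_zero_iff by auto
    qed
    then have "act r y = act r' y" if "y \<in> perp E" for y using rg that perp_in by metis
    then show "r = r'" using r Tinj by auto
  qed
  moreover have "card T * Q ^ (2 * m * m) = card (carrier V) ^ m"
  proof -
    have "card (carrier V) ^ m = (Q ^ m * (Q ^ m * card Z)) ^ m" using cZ by simp
    also have "\<dots> = card Z ^ m * ((Q ^ m) ^ m * (Q ^ m) ^ m)" by (simp only: power_mult_distrib mult_ac)
    also have "(Q ^ m) ^ m * (Q ^ m) ^ m = Q ^ (2 * m * m)"
    proof -
      have "m * m + m * m = 2 * m * m" by simp
      then show ?thesis by (simp only: power_mult[symmetric] power_add[symmetric])
    qed
    finally show ?thesis using T by simp
  qed
  ultimately show ?thesis using T by blast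
qed

end

section \<open>Bounds for the number of conjugates\<close>

context linear_action
begin

definition eigenspace :: "'g \<Rightarrow> 'a \<Rightarrow> 'c set" where
  "eigenspace h c = {v \<in> carrier V. act h v = c \<odot>\<^bsub>V\<^esub> v}"

text \<open>The parameter b is 2 for the linear groups and 1 for the groups preserving a form.\<close>

definition class_bounds :: "nat \<Rightarrow> nat \<Rightarrow> 'g set \<Rightarrow> 'g \<Rightarrow> bool" where
  "class_bounds b n M h \<longleftrightarrow>
     (\<exists>m T. 8 * m \<le> n \<and> T \<subseteq> M \<and> separated h T \<and> card T * Q ^ (2 * b * m * m) = Q ^ (b * n * m)
        \<and> (n < 8 * (m + 2) \<or> (\<exists>c\<in>carrier F. Q ^ n \<le> Q ^ (3 * m) * card (eigenspace h c)))) \<and>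
     (\<forall>c\<in>carrier F. \<forall>r. Q ^ r * card (eigenspace h c) = Q ^ n \<and> 9 + 3 * r \<le> n \<longrightarrow>
        card (conj h ` M) \<le> Q ^ (b * n * r) \<and>
        (\<exists>T\<subseteq>M. separated h T \<and> card T * Q ^ (2 * b * r * r) = Q ^ (b * n * r)))"

lemma sub_eigenspace:
  assumes "h \<in> carrier Gp" "c \<in> carrier F" shows "sub (eigenspace h c)"
  unfolding eigenspace_def using assms
  by (intro lin_agree_sub act_lin) (auto simp: lin_def smult_r_distr smult_assoc1[symmetric] m_comm)

lemma eigenspace_alt:
  assumes "h \<in> carrier Gp" "c \<in> carrier F"
  shows "eigenspace h c = {v \<in> carrier V. act h v \<ominus>\<^bsub>V\<^esub> c \<odot>\<^bsub>V\<^esub> v = \<zero>\<^bsub>V\<^esub>}"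
  unfolding eigenspace_def
  by (intro Collect_cong conj_cong refl) (simp add: act_closed assms)

lemma card_comm_image:
  assumes "h \<in> carrier Gp" "c \<in> carrier F"
  shows "card ((\<lambda>v. act h v \<ominus>\<^bsub>V\<^esub> c \<odot>\<^bsub>V\<^esub> v) ` carrier V) * card (eigenspace h c) = card (carrier V)"
  using card_image_kernel[OF lin_shift[OF act_lin[OF assms(1)] assms(2)] sub_carrier]
  by (simp add: eigenspace_alt[OF assms])

end

context form_action
begin

text \<open>Among the good pairs of dimension m with 8 m \<le> n take a largest one. The cap keeps
  the loss 4 m^2 at no more than a quarter of the exponent 2 n m. Near the cap maximality says
  nothing about extensions, which is the alternative n < 8 (m + 2) in
  \<open>class_bounds\<close>.\<close>

lemma class_bounds_dual_pair:
  assumes M: "subgroup M Gp" and hM: "h \<in> M" and n: "card (carrier V) = Q ^ n" "n > 0"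
    and tv: "\<And>w p. w \<in> carrier V \<Longrightarrow> p \<in> carrier V \<Longrightarrow> f w p = \<zero> \<Longrightarrow>
      \<exists>u\<in>M. \<forall>x\<in>carrier V. act u x = x \<oplus>\<^bsub>V\<^esub> f x p \<odot>\<^bsub>V\<^esub> w"
  shows "class_bounds 2 n M h"
proof -
  have MG: "M \<subseteq> carrier Gp" using M by (auto simp: subgroup_def)
  have h: "h \<in> carrier Gp" using hM MG by auto
  have lh: "lin (act h)" "inj_on (act h) (carrier V)" using h act_lin act_inj by auto
  define P where "P m \<longleftrightarrow> 8 * m \<le> n \<and> (\<exists>E D. good (act h) E D \<and> card E = Q ^ m)" for m
  have "P 0" using good_triv[of "act h"] unfolding P_def
    by (intro conjI exI[of _ "{\<zero>\<^bsub>V\<^esub>}"]) auto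
  then obtain m where m: "P m" and max: "\<And>k. P k \<Longrightarrow> k \<le> m"
    using ex_has_greatest_nat[of P 0 "\<lambda>x. x" "Suc n"] by (auto simp: P_def)
  obtain E D where ED: "good (act h) E D" "card E = Q ^ m" "8 * m \<le> n" using m by (auto simp: P_def)
  obtain T where T: "T \<subseteq> M" "separated h T" "card T * Q ^ (4 * m * m) = (Q ^ n) ^ (2 * m)"
    using separated_dual_pair[OF h ED(1,2) M tv] unfolding n(1) by blast
  have "n < 8 * (m + 2) \<or> (\<exists>c\<in>carrier F. Q ^ n \<le> Q ^ (3 * m) * card (eigenspace h c))"
  proof (cases "n < 8 * (m + 1)")
    case False
    have "card E' \<noteq> Q * card E" if "good (act h) E' D'" for E' D'
      using max[of "Suc m"] that False ED(2) by (auto simp: P_def)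
    then obtain c where "c \<in> carrier F"
      "card (carrier V) \<le> card E ^ 3 * card {v \<in> carrier V. act h v = c \<odot>\<^bsub>V\<^esub> v}"
      using good_maximal_eigenspace[OF lh ED(1)] by blast
    then show ?thesis using ED(2) n by (auto simp: eigenspace_def power_mult[symmetric] mult.commute)
  qed simp
  moreover have "card (conj h ` M) \<le> Q ^ (2 * n * r) \<and>
        (\<exists>T\<subseteq>M. separated h T \<and> card T * Q ^ (2 * 2 * r * r) = Q ^ (2 * n * r))"
    if c: "c \<in> carrier F" and r: "Q ^ r * card (eigenspace h c) = Q ^ n" "9 + 3 * r \<le> n" for c r
  proof
    let ?W = "(\<lambda>v. act h v \<ominus>\<^bsub>V\<^esub> c \<odot>\<^bsub>V\<^esub> v) ` carrier V"
    have sK: "sub (eigenspace h c)" by (rule sub_eigenspace[OF h c])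
    have W: "sub ?W" by (rule sub_image[OF lin_shift[OF lh(1) c] sub_carrier])
    have "card ?W * card (eigenspace h c) = Q ^ r * card (eigenspace h c)"
      using card_comm_image[OF h c] n r by simp
    then have cW: "card ?W = Q ^ r" using sub_card_pos[OF sK] by simp
    have "card ?W * card ?W \<le> card (carrier V)"
      unfolding cW n power_add[symmetric] using r Q_ge_2 by (intro power_increasing) auto
    then have "\<exists>E D. good (act h) E D \<and> card E = card ?W"
      using card_comm_image[OF h c] by (intro good_complementary[OF lh(1) c W sK]) (auto simp: eigenspace_def)
    then obtain E D where "good (act h) E D" "card E = Q ^ r" using cW by auto
    then have "\<exists>T\<subseteq>M. separated h T \<and> card T * Q ^ (4 * r * r) = Q ^ (n * (2 * r))"
      using separated_dual_pair[OF h _ _ M tv, of E D r] unfolding n(1) power_mult[symmetric] by blast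
    then show "\<exists>T\<subseteq>M. separated h T \<and> card T * Q ^ (2 * 2 * r * r) = Q ^ (2 * n * r)"
      by (simp add: mult_ac)
    \<comment> \<open>Subtracting \<open>c\<close> turns the conjugates into maps of rank
      \<open>r\<close>, which are counted by kernel and values.\<close>
    have "card (conj h ` M) \<le> card (carrier V) ^ (2 * r)"
    proof (rule card_low_rank_le[of _ "\<lambda>a v. act a v \<ominus>\<^bsub>V\<^esub> c \<odot>\<^bsub>V\<^esub> v"])
      fix a assume "a \<in> conj h ` M"
      then obtain t where t: "t \<in> carrier Gp" "a = conj h t" using MG by auto
      have aG: "a \<in> carrier Gp" using t h by auto
      show "lin (\<lambda>v. act a v \<ominus>\<^bsub>V\<^esub> c \<odot>\<^bsub>V\<^esub> v)" by (rule lin_shift[OF act_lin[OF aG] c])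
      have iff: "act a v = c \<odot>\<^bsub>V\<^esub> v \<longleftrightarrow> act h (act (inv\<^bsub>Gp\<^esub> t) v) = c \<odot>\<^bsub>V\<^esub> act (inv\<^bsub>Gp\<^esub> t) v"
        if v: "v \<in> carrier V" for v
      proof -
        let ?w = "act (inv\<^bsub>Gp\<^esub> t) v"
        have w: "?w \<in> carrier V" "v = act t ?w" using t v act_closed act_inv by auto
        have "act a v = act t (act h ?w)" using t h v act_closed by (simp add: act_mult)
        moreover have "c \<odot>\<^bsub>V\<^esub> v = act t (c \<odot>\<^bsub>V\<^esub> ?w)" using lin_smult[OF act_lin[OF t(1)] c w(1)] w(2) by simp
        ultimately show ?thesis
          using inj_on_eq_iff[OF act_inj[OF t(1)], of "act h ?w" "c \<odot>\<^bsub>V\<^esub> ?w"] w c act_closed[OF h] by simp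
      qed
      have "bij_betw (act t) (eigenspace h c) (eigenspace a c)"
      proof (rule bij_betw_byWitness[where f' = "act (inv\<^bsub>Gp\<^esub> t)"])
        show "act t ` eigenspace h c \<subseteq> eigenspace a c"
          using iff t act_closed act_inv by (auto simp: eigenspace_def)
        show "act (inv\<^bsub>Gp\<^esub> t) ` eigenspace a c \<subseteq> eigenspace h c"
          using iff t act_closed by (auto simp: eigenspace_def)
      qed (use t act_inv in \<open>auto simp: eigenspace_def\<close>)
      then have "card (eigenspace a c) = card (eigenspace h c)" by (simp add: bij_betw_same_card)
      then show "Q ^ r * card {v \<in> carrier V. act a v \<ominus>\<^bsub>V\<^esub> c \<odot>\<^bsub>V\<^esub> v = \<zero>\<^bsub>V\<^esub>} = card (carrier V)"
        using r n by (simp add: eigenspace_alt[OF aG c, symmetric])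
    next
      fix a b assume ab: "a \<in> conj h ` M" "b \<in> conj h ` M"
        and eq: "\<And>v. v \<in> carrier V \<Longrightarrow> act a v \<ominus>\<^bsub>V\<^esub> c \<odot>\<^bsub>V\<^esub> v = act b v \<ominus>\<^bsub>V\<^esub> c \<odot>\<^bsub>V\<^esub> v"
      have G: "a \<in> carrier Gp" "b \<in> carrier Gp" using ab h MG by auto
      show "a = b"
      proof (rule act_faithful[OF G])
        fix v assume v: "v \<in> carrier V"
        have "act a v = (act a v \<ominus>\<^bsub>V\<^esub> c \<odot>\<^bsub>V\<^esub> v) \<oplus>\<^bsub>V\<^esub> c \<odot>\<^bsub>V\<^esub> v" using v G c act_closed add_minus_cancel by simp
        also have "\<dots> = (act b v \<ominus>\<^bsub>V\<^esub> c \<odot>\<^bsub>V\<^esub> v) \<oplus>\<^bsub>V\<^esub> c \<odot>\<^bsub>V\<^esub> v" using eq[OF v] by simp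
        also have "\<dots> = act b v" using v G c act_closed add_minus_cancel by simp
        finally show "act a v = act b v" .
      qed
    qed
    then show "card (conj h ` M) \<le> Q ^ (2 * n * r)" using n by (simp add: power_mult[symmetric] mult_ac)
  qed
  ultimately show ?thesis
    unfolding class_bounds_def using T ED(3) by (auto simp: power_mult[symmetric] mult_ac)
qed

end

context polar_action
begin

text \<open>Maximality is now tested against growth by two dimensions, so m + 2 has to respect the
  cap. In the upper bound a conjugate is determined by the images of \<open>r\<close> vectors
  spanning the image of h - c; the kernel need not be counted separately, and this halves the
  exponent in comparison with the special linear group.\<close>

lemma class_bounds_polar:
  assumes M: "subgroup M Gp" and hM: "h \<in> M" and n: "card (carrier V) = Q ^ n" "n \<ge> 12"
    and iso: "\<And>t. t \<in> M \<Longrightarrow> isometry (act t)"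
    and tv: "\<And>e v. e \<in> S \<Longrightarrow> v \<in> carrier V \<Longrightarrow> f v e = \<zero> \<Longrightarrow>
      \<exists>u\<in>M. \<forall>y\<in>carrier V. f y e = \<zero> \<longrightarrow> act u y = y \<oplus>\<^bsub>V\<^esub> f y v \<odot>\<^bsub>V\<^esub> e"
  shows "class_bounds 1 n M h"
proof -
  have MG: "M \<subseteq> carrier Gp" using M by (auto simp: subgroup_def)
  have h: "h \<in> carrier Gp" using hM MG by auto
  have lh: "lin (act h)" "inj_on (act h) (carrier V)" using h act_lin act_inj by auto
  define P where "P m \<longleftrightarrow> 8 * m \<le> n \<and> (\<exists>E. good (act h) E E \<and> E \<subseteq> S \<and> card E = Q ^ m)" for m
  have zS: "\<zero>\<^bsub>V\<^esub> \<in> S"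
  proof -
    have "Q ^ 5 \<le> card (carrier V)" unfolding n using n Q_ge_2 by (intro power_increasing) auto
    then obtain v where "v \<in> S" using S_exists[OF sub_carrier] by (auto simp: Q_def)
    then show ?thesis using S_smult[of \<zero> v] S_in by simp
  qed
  then have "P 0" using good_triv by (auto simp: P_def intro!: exI[of _ "{\<zero>\<^bsub>V\<^esub>}"])
  then obtain m where m: "P m" and max: "\<And>k. P k \<Longrightarrow> k \<le> m"
    using ex_has_greatest_nat[of P 0 "\<lambda>x. x" "Suc n"] by (auto simp: P_def)
  obtain E where E: "good (act h) E E" "E \<subseteq> S" "card E = Q ^ m" "8 * m \<le> n" using m by (auto simp: P_def)
  obtain T where T: "T \<subseteq> M" "separated h T" "card T * Q ^ (2 * m * m) = (Q ^ n) ^ m"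
    using separated_singular[OF h E(1,3,2) M iso tv] unfolding n(1) by blast
  have "n < 8 * (m + 2) \<or> (\<exists>c\<in>carrier F. Q ^ n \<le> Q ^ (3 * m) * card (eigenspace h c))"
  proof (cases "n < 8 * (m + 2)")
    case False
    have "card E' \<noteq> Q * card E \<and> card E' \<noteq> Q * (Q * card E)" if "good (act h) E' E'" "E' \<subseteq> S" for E'
      using max[of "Suc m"] max[of "Suc (Suc m)"] that False E(3) by (auto simp: P_def)
    moreover have "Q ^ 9 * (card E * card E) \<le> card (carrier V)"
      unfolding E(3) n power_add[symmetric] using E n Q_ge_2 by (intro power_increasing) auto
    ultimately obtain c where "c \<in> carrier F"
      "card (carrier V) \<le> card E ^ 3 * card {v \<in> carrier V. act h v = c \<odot>\<^bsub>V\<^esub> v}"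
      using good_self_maximal_eigenspace[OF lh E(1,2)] by blast
    then show ?thesis using E(3) n by (auto simp: eigenspace_def power_mult[symmetric] mult.commute)
  qed simp
  moreover have "card (conj h ` M) \<le> Q ^ (n * r) \<and>
        (\<exists>T\<subseteq>M. separated h T \<and> card T * Q ^ (2 * r * r) = Q ^ (n * r))"
    if c: "c \<in> carrier F" and r: "Q ^ r * card (eigenspace h c) = Q ^ n" "9 + 3 * r \<le> n" for c r
  proof
    let ?W = "(\<lambda>v. act h v \<ominus>\<^bsub>V\<^esub> c \<odot>\<^bsub>V\<^esub> v) ` carrier V"
    have sK: "sub (eigenspace h c)" by (rule sub_eigenspace[OF h c])
    have W: "sub ?W" by (rule sub_image[OF lin_shift[OF lh(1) c] sub_carrier])
    have "card ?W * card (eigenspace h c) = Q ^ r * card (eigenspace h c)"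
      using card_comm_image[OF h c] n r by simp
    then have cW: "card ?W = Q ^ r" using sub_card_pos[OF sK] by simp
    have "Q ^ r * card (eigenspace h c) = Q ^ r * Q ^ (n - r)"
      using r by (simp add: power_add[symmetric])
    then have cK: "card (eigenspace h c) = Q ^ (n - r)" using Q_ge_2 by simp
    have big: "card (carrier V) < card (eigenspace h c) * card (eigenspace h c)"
      unfolding cK n power_add[symmetric] using r Q_ge_2 by (intro power_strict_increasing) auto
    have pW: "perp ?W = eigenspace h c"
      unfolding eigenspace_def
      by (rule isometry_eigenspace_perp[OF iso[OF hM] c big[unfolded eigenspace_def]])
    have "Q ^ 7 * (card ?W * card ?W * card ?W) \<le> card (carrier V)"
      unfolding cW n power_add[symmetric] using r Q_ge_2 by (intro power_increasing) auto
    then have "\<exists>E. good (act h) E E \<and> E \<subseteq> S \<and> card E = card ?W"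
      by (intro good_self_complementary[OF lh(1) c W]) (auto simp: pW eigenspace_def)
    then obtain E where "good (act h) E E" "E \<subseteq> S" "card E = Q ^ r" using cW by auto
    then show "\<exists>T\<subseteq>M. separated h T \<and> card T * Q ^ (2 * r * r) = Q ^ (n * r)"
      using separated_singular[OF h _ _ _ M iso tv, of E r] unfolding n(1) power_mult[symmetric] by blast
    obtain b where b: "b \<in> {..<r} \<rightarrow>\<^sub>E ?W" "gen b r = ?W" using sub_eq_gen'[OF W cW] by auto
    have bV: "b i \<in> carrier V" if "i < r" for i using b that sub_in[OF W] by (auto simp: PiE_iff)
    let ?\<phi> = "\<lambda>t. restrict (\<lambda>i. act t (b i)) {..<r}"
    have im: "?\<phi> ` M \<subseteq> {..<r} \<rightarrow>\<^sub>E carrier V" 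
    proof (rule image_subsetI)
      fix t assume "t \<in> M"
      then show "?\<phi> t \<in> {..<r} \<rightarrow>\<^sub>E carrier V" using bV act_closed[of t] MG by (intro restrict_PiE_iff[THEN iffD2]) auto
    qed
    have fin: "finite ({..<r} \<rightarrow>\<^sub>E carrier V)" using finite_V by (intro finite_PiE) auto
    have "card (conj h ` M) \<le> card (?\<phi> ` M)"
    proof (rule card_le_card_if_determined)
      show "finite (?\<phi> ` M)" using finite_subset[OF im fin] .
      \<comment> \<open>If \<open>t\<close> and \<open>t'\<close> agree on the spanning vectors,
        their quotient fixes the image of h - c pointwise and so commutes with
        \<open>h\<close>.\<close>
      fix t t' assume t: "t \<in> M" "t' \<in> M" and eq: "?\<phi> t = ?\<phi> t'"
      have tG: "t \<in> carrier Gp" "t' \<in> carrier Gp" using t MG by auto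
      let ?g = "t \<otimes>\<^bsub>Gp\<^esub> inv\<^bsub>Gp\<^esub> t'"
      have gM: "?g \<in> M" using t M by (simp add: subgroup.m_closed subgroup.m_inv_closed)
      have sfix: "sub {v \<in> carrier V. act ?g v = v}"
        by (rule lin_agree_sub) (use act_lin tG in \<open>auto simp: lin_def\<close>)
      have "act ?g (b i) = b i" if i: "i < r" for i
      proof -
        have "act t (b i) = act t' (b i)" using fun_cong[OF eq, of i] i by simp
        then show ?thesis using tG bV[OF i] by (simp add: act_mult act_inv)
      qed
      then have fixW: "?W \<subseteq> {v \<in> carrier V. act ?g v = v}"
        unfolding b(2)[symmetric] using bV by (intro gen_least[OF sfix]) auto
      have "act ?g (act h y) = act h (act ?g y)" if y: "y \<in> carrier V" for y
        by (rule isometry_commute_if_fix[OF lh(1) c iso[OF gM] _ _ y])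
          (use fixW pW in \<open>auto simp: eigenspace_def\<close>)
      then show "conj h t = conj h t'" by (rule conj_eq_if_commute[OF h tG])
    qed
    also have "\<dots> \<le> card ({..<r} \<rightarrow>\<^sub>E carrier V)" by (rule card_mono[OF fin im])
    also have "\<dots> = Q ^ (n * r)" using n by (simp add: card_PiE power_mult[symmetric])
    finally show "card (conj h ` M) \<le> Q ^ (n * r)" .
  qed
  ultimately show ?thesis
    unfolding class_bounds_def using T E(4) by (auto simp: power_mult[symmetric] mult_ac)
qed

end

section \<open>Coordinate spaces and matrices\<close>

lemma (in abelian_monoid) finsum_swap:
  assumes "finite A" "finite B" "\<And>i j. i \<in> A \<Longrightarrow> j \<in> B \<Longrightarrow> g i j \<in> carrier G"
  shows "(\<Oplus>i\<in>A. \<Oplus>j\<in>B. g i j) = (\<Oplus>j\<in>B. \<Oplus>i\<in>A. g i j)"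
  using assms(1,3)
proof (induction A rule: finite_induct)
  case empty
  then show ?case by simp
next
  case (insert x A)
  have "(\<Oplus>j\<in>B. g x j) \<oplus> (\<Oplus>j\<in>B. \<Oplus>i\<in>A. g i j) = (\<Oplus>j\<in>B. g x j \<oplus> (\<Oplus>i\<in>A. g i j))"
    using insert by (subst finsum_addf) (auto intro!: finsum_closed)
  also have "\<dots> = (\<Oplus>j\<in>B. \<Oplus>i\<in>insert x A. g i j)"
    using insert by (intro finsum_cong') (auto intro!: finsum_closed)
  finally show ?case using insert by (subst finsum_insert) (auto intro!: finsum_closed)
qed

lemma coord_simps:
  fixes F :: "'a ring" (structure)
  assumes "ring F"
  shows "carrier (coord_space F n) = {..<n} \<rightarrow>\<^sub>E carrier F"
    "\<zero>\<^bsub>coord_space F n\<^esub> = (\<lambda>i\<in>{..<n}. \<zero>)"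
    "u \<oplus>\<^bsub>coord_space F n\<^esub> v = (\<lambda>i\<in>{..<n}. u i \<oplus> v i)"
    "c \<odot>\<^bsub>coord_space F n\<^esub> v = (\<lambda>i\<in>{..<n}. c \<otimes> v i)"
  using assms by (simp_all add: coord_space_def ring.func_space_def)

lemma vectorspace_coord_space:
  assumes "field F" shows "vectorspace F (coord_space F n)"
proof -
  interpret field F by fact
  show ?thesis unfolding coord_space_def
    by (intro vectorspace.intro func_space_is_module field_axioms)
qed

locale coord = vspace F "coord_space F n" for F :: "'a ring" (structure) and n :: nat

lemma coordI: "field F \<Longrightarrow> coord F n"
  by (intro coord.intro vspace.intro vectorspace_coord_space)

context coord
begin

lemmas coord_simps = coord_simps[OF ring_axioms]

abbreviation V where "V \<equiv> coord_space F n"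
abbreviation MM where "MM \<equiv> mat_monoid F n"
abbreviation vm where "vm v A \<equiv> vec_mat F n v A"

lemma add_eval: "i < n \<Longrightarrow> (u \<oplus>\<^bsub>V\<^esub> v) i = u i \<oplus> v i"
  by (simp add: coord_simps(3))

lemma smult_eval: "i < n \<Longrightarrow> (c \<odot>\<^bsub>V\<^esub> v) i = c \<otimes> v i"
  by (simp add: coord_simps(4))

lemma vec_in: "v \<in> carrier V \<Longrightarrow> i < n \<Longrightarrow> v i \<in> carrier F"
  by (auto simp: coord_simps PiE_iff)

lemma vecI: "(\<And>i. i < n \<Longrightarrow> g i \<in> carrier F) \<Longrightarrow> (\<lambda>i\<in>{..<n}. g i) \<in> carrier V"
  by (auto simp: coord_simps)

lemma vec_eqI: "u \<in> carrier V \<Longrightarrow> v \<in> carrier V \<Longrightarrow> (\<And>i. i < n \<Longrightarrow> u i = v i) \<Longrightarrow> u = v"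
  unfolding coord_simps by (rule PiE_ext) auto

lemma mat_carrier: "carrier MM = {..<n} \<rightarrow>\<^sub>E ({..<n} \<rightarrow>\<^sub>E carrier F)"
  by (simp add: mat_monoid_def)

lemma mat_row: "A \<in> carrier MM \<Longrightarrow> i < n \<Longrightarrow> A i \<in> carrier V"
  by (auto simp: mat_carrier coord_simps PiE_iff)

lemma mat_entry: "A \<in> carrier MM \<Longrightarrow> i < n \<Longrightarrow> j < n \<Longrightarrow> A i j \<in> carrier F"
  using mat_row vec_in by blast

lemma mat_eqI: "A \<in> carrier MM \<Longrightarrow> B \<in> carrier MM \<Longrightarrow> (\<And>i. i < n \<Longrightarrow> A i = B i) \<Longrightarrow> A = B"
  unfolding mat_carrier by (rule PiE_ext) auto

lemma matI: "(\<And>i. i < n \<Longrightarrow> A i \<in> carrier V) \<Longrightarrow> (\<lambda>i\<in>{..<n}. A i) \<in> carrier MM"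
  by (auto simp: mat_carrier coord_simps)

lemma vm_eval: "j < n \<Longrightarrow> vm v A j = (\<Oplus>k\<in>{..<n}. v k \<otimes> A k j)"
  by (simp add: vec_mat_def)

lemma vm_closed: "v \<in> carrier V \<Longrightarrow> A \<in> carrier MM \<Longrightarrow> vm v A \<in> carrier V"
  unfolding vec_mat_def by (intro vecI R.finsum_closed) (auto simp: vec_in mat_entry)

lemma vm_lin: "A \<in> carrier MM \<Longrightarrow> lin (\<lambda>v. vm v A)"
  unfolding lin_def
proof (intro conjI ballI)
  assume A: "A \<in> carrier MM"
  show "(\<lambda>v. vm v A) \<in> carrier V \<rightarrow> carrier V" using A vm_closed by auto
  fix u v assume u: "u \<in> carrier V" and v: "v \<in> carrier V"
  show "vm (u \<oplus>\<^bsub>V\<^esub> v) A = vm u A \<oplus>\<^bsub>V\<^esub> vm v A"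
  proof (rule vec_eqI)
    fix j assume j: "j < n"
    have "vm (u \<oplus>\<^bsub>V\<^esub> v) A j = (\<Oplus>k\<in>{..<n}. u k \<otimes> A k j \<oplus> v k \<otimes> A k j)"
      unfolding vm_eval[OF j] using A u v j
      by (intro R.finsum_cong') (auto simp: coord_simps(3) vec_in mat_entry l_distr)
    also have "\<dots> = vm u A j \<oplus> vm v A j"
      unfolding vm_eval[OF j] using A u v j by (intro R.finsum_addf) (auto simp: vec_in mat_entry)
    finally show "vm (u \<oplus>\<^bsub>V\<^esub> v) A j = (vm u A \<oplus>\<^bsub>V\<^esub> vm v A) j" using j by (simp add: coord_simps(3))
  qed (use A u v vm_closed in auto)
next
  assume A: "A \<in> carrier MM"
  fix c v assume c: "c \<in> carrier F" and v: "v \<in> carrier V"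
  show "vm (c \<odot>\<^bsub>V\<^esub> v) A = c \<odot>\<^bsub>V\<^esub> vm v A"
  proof (rule vec_eqI)
    fix j assume j: "j < n"
    have "vm (c \<odot>\<^bsub>V\<^esub> v) A j = (\<Oplus>k\<in>{..<n}. c \<otimes> (v k \<otimes> A k j))"
      unfolding vm_eval[OF j] using A c v j
      by (intro R.finsum_cong') (auto simp: coord_simps(4) vec_in mat_entry m_assoc)
    also have "\<dots> = c \<otimes> vm v A j"
      unfolding vm_eval[OF j] using A c v j by (intro R.finsum_rdistr[symmetric]) (auto simp: vec_in mat_entry)
    finally show "vm (c \<odot>\<^bsub>V\<^esub> v) A j = (c \<odot>\<^bsub>V\<^esub> vm v A) j" using j by (simp add: coord_simps(4))
  qed (use A c v vm_closed in auto)
qed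

lemma mat_mult_row: "i < n \<Longrightarrow> (A \<otimes>\<^bsub>MM\<^esub> B) i = vm (A i) B"
  by (simp add: mat_monoid_def vec_mat_def)

lemma mat_mult_closed: "A \<in> carrier MM \<Longrightarrow> B \<in> carrier MM \<Longrightarrow> A \<otimes>\<^bsub>MM\<^esub> B \<in> carrier MM"
proof -
  assume A: "A \<in> carrier MM" and B: "B \<in> carrier MM"
  have "A \<otimes>\<^bsub>MM\<^esub> B = (\<lambda>i\<in>{..<n}. vm (A i) B)" by (simp add: mat_monoid_def vec_mat_def)
  then show ?thesis using A B matI vm_closed mat_row by simp
qed

lemma vm_mult:
  assumes "v \<in> carrier V" "A \<in> carrier MM" "B \<in> carrier MM"
  shows "vm v (A \<otimes>\<^bsub>MM\<^esub> B) = vm (vm v A) B"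
proof (rule vec_eqI)
  fix l assume l: "l < n"
  have "vm v (A \<otimes>\<^bsub>MM\<^esub> B) l = (\<Oplus>k\<in>{..<n}. v k \<otimes> (\<Oplus>j\<in>{..<n}. A k j \<otimes> B j l))"
    unfolding vm_eval[OF l] using assms l
    by (intro R.finsum_cong') (auto simp: mat_mult_row vm_eval vec_in mat_entry intro!: R.finsum_closed)
  also have "\<dots> = (\<Oplus>k\<in>{..<n}. \<Oplus>j\<in>{..<n}. v k \<otimes> (A k j \<otimes> B j l))"
    using assms l by (intro R.finsum_cong' R.finsum_rdistr) (auto simp: vec_in mat_entry intro!: R.finsum_closed)
  also have "\<dots> = (\<Oplus>j\<in>{..<n}. \<Oplus>k\<in>{..<n}. v k \<otimes> (A k j \<otimes> B j l))"
    using assms l by (intro R.finsum_swap) (auto simp: vec_in mat_entry)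
  also have "\<dots> = (\<Oplus>j\<in>{..<n}. vm v A j \<otimes> B j l)"
  proof (intro R.finsum_cong' refl)
    fix j assume j: "j \<in> {..<n}"
    have "(\<Oplus>k\<in>{..<n}. v k \<otimes> (A k j \<otimes> B j l)) = (\<Oplus>k\<in>{..<n}. (v k \<otimes> A k j) \<otimes> B j l)"
      using assms l j by (intro R.finsum_cong') (auto simp: vec_in mat_entry m_assoc)
    also have "\<dots> = (\<Oplus>k\<in>{..<n}. v k \<otimes> A k j) \<otimes> B j l"
      using assms l j by (intro R.finsum_ldistr[symmetric]) (auto simp: vec_in mat_entry)
    finally show "(\<Oplus>k\<in>{..<n}. v k \<otimes> (A k j \<otimes> B j l)) = vm v A j \<otimes> B j l" using j by (simp add: vm_eval)
  qed (use assms l in \<open>auto simp: vec_in mat_entry vm_closed\<close>)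
  also have "\<dots> = vm (vm v A) B l" using l by (simp add: vm_eval[of l "vm v A"])
  finally show "vm v (A \<otimes>\<^bsub>MM\<^esub> B) l = vm (vm v A) B l" .
qed (use assms vm_closed mat_mult_closed in auto)

definition unit_v :: "nat \<Rightarrow> nat \<Rightarrow> 'a" where
  "unit_v i = (\<lambda>j\<in>{..<n}. if i = j then \<one> else \<zero>)"

lemma unit_v_closed: "unit_v i \<in> carrier V"
  unfolding unit_v_def by (intro vecI) auto

lemma vm_unit_v: "i < n \<Longrightarrow> A \<in> carrier MM \<Longrightarrow> vm (unit_v i) A = A i"
proof (rule vec_eqI)
  fix j assume i: "i < n" and A: "A \<in> carrier MM" and j: "j < n"
  have "vm (unit_v i) A j = (\<Oplus>k\<in>{..<n}. if i = k then A k j else \<zero>)"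
    unfolding vm_eval[OF j] using A j by (intro R.finsum_cong') (auto simp: unit_v_def mat_entry)
  also have "\<dots> = A i j" using A i j by (intro R.finsum_singleton) (auto simp: mat_entry)
  finally show "vm (unit_v i) A j = A i j" .
qed (use unit_v_closed vm_closed mat_row in auto)

lemma scalar_mat_closed: "c \<in> carrier F \<Longrightarrow> scalar_mat F n c \<in> carrier MM"
  unfolding scalar_mat_def by (intro matI vecI) auto

lemma vm_scalar: 
  assumes "v \<in> carrier V" "c \<in> carrier F" shows "vm v (scalar_mat F n c) = c \<odot>\<^bsub>V\<^esub> v"
proof (rule vec_eqI)
  fix j assume j: "j < n"
  have "vm v (scalar_mat F n c) j = (\<Oplus>k\<in>{..<n}. if j = k then c \<otimes> v k else \<zero>)"
    unfolding vm_eval[OF j] using assms j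
    by (intro R.finsum_cong') (auto simp: scalar_mat_def vec_in m_comm)
  also have "\<dots> = c \<otimes> v j" using assms j by (intro R.finsum_singleton) (auto simp: vec_in)
  finally show "vm v (scalar_mat F n c) j = (c \<odot>\<^bsub>V\<^esub> v) j" using j by (simp add: coord_simps)
qed (use assms vm_closed scalar_mat_closed in auto)

lemma one_MM: "\<one>\<^bsub>MM\<^esub> = scalar_mat F n \<one>"
  by (simp add: mat_monoid_def)

lemma mat_faithful:
  assumes "A \<in> carrier MM" "B \<in> carrier MM" "\<And>v. v \<in> carrier V \<Longrightarrow> vm v A = vm v B"
  shows "A = B"
  using assms vm_unit_v unit_v_closed by (intro mat_eqI) metis+

lemma monoid_MM: "monoid MM"
proof (rule monoidI)
  show c: "\<And>x y. x \<in> carrier MM \<Longrightarrow> y \<in> carrier MM \<Longrightarrow> x \<otimes>\<^bsub>MM\<^esub> y \<in> carrier MM" by (rule mat_mult_closed)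
  show o: "\<one>\<^bsub>MM\<^esub> \<in> carrier MM" by (simp add: one_MM scalar_mat_closed)
  show "x \<otimes>\<^bsub>MM\<^esub> y \<otimes>\<^bsub>MM\<^esub> z = x \<otimes>\<^bsub>MM\<^esub> (y \<otimes>\<^bsub>MM\<^esub> z)" if "x \<in> carrier MM" "y \<in> carrier MM" "z \<in> carrier MM" for x y z
    using that by (intro mat_faithful) (auto simp: c vm_mult vm_closed)
  show "\<one>\<^bsub>MM\<^esub> \<otimes>\<^bsub>MM\<^esub> x = x" if "x \<in> carrier MM" for x
    using that o by (intro mat_faithful) (auto simp: c vm_mult one_MM vm_scalar)
  show "x \<otimes>\<^bsub>MM\<^esub> \<one>\<^bsub>MM\<^esub> = x" if "x \<in> carrier MM" for x
    using that o by (intro mat_faithful) (auto simp: c vm_mult one_MM vm_scalar vm_closed)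
qed

lemma group_GL: "group (GL F n)"
  unfolding GL_def by (rule monoid.units_group[OF monoid_MM])

lemma GL_simps:
  "carrier (GL F n) = Units MM" "x \<otimes>\<^bsub>GL F n\<^esub> y = x \<otimes>\<^bsub>MM\<^esub> y" "\<one>\<^bsub>GL F n\<^esub> = \<one>\<^bsub>MM\<^esub>"
  by (simp_all add: GL_def units_of_def)

lemma GL_in_MM: "g \<in> carrier (GL F n) \<Longrightarrow> g \<in> carrier MM"
  by (auto simp: GL_simps Units_def)

text \<open>Induction on the number of leading coordinates that may be nonzero. It serves in place
  of the standard basis in what follows.\<close>

lemma unit_v_generate:
  assumes U: "sub U" "\<And>i. i < n \<Longrightarrow> unit_v i \<in> U" shows "carrier V \<subseteq> U"
proof -
  have "v \<in> carrier V \<Longrightarrow> (\<And>i. m \<le> i \<Longrightarrow> i < n \<Longrightarrow> v i = \<zero>) \<Longrightarrow> v \<in> U" for m v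
  proof (induction m arbitrary: v)
    case 0
    have "v = \<zero>\<^bsub>V\<^esub>"
      by (rule vec_eqI) (use 0 M.zero_closed in \<open>auto simp: coord_simps(2) simp del: M.zero_closed\<close>)
    then show ?case using sub_zero[OF U(1)] by simp
  next
    case (Suc m)
    show ?case
    proof (cases "m < n")
      case True
      let ?w = "v \<ominus>\<^bsub>V\<^esub> v m \<odot>\<^bsub>V\<^esub> unit_v m"
      have vm: "v m \<in> carrier F" using vec_in Suc True by auto
      have w: "?w \<in> carrier V" using Suc vm unit_v_closed by auto
      have "?w i = \<zero>" if i: "m \<le> i" "i < n" for i
      proof -
        have "v = ?w \<oplus>\<^bsub>V\<^esub> v m \<odot>\<^bsub>V\<^esub> unit_v m" using Suc vm unit_v_closed add_minus_cancel by simp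
        then have "v i = (?w \<oplus>\<^bsub>V\<^esub> v m \<odot>\<^bsub>V\<^esub> unit_v m) i" by (rule fun_cong)
        also have "\<dots> = ?w i \<oplus> (v m \<otimes> unit_v m i)" by (simp only: add_eval[OF i(2)] smult_eval[OF i(2)])
        finally have e: "v i = ?w i \<oplus> (v m \<otimes> (if m = i then \<one> else \<zero>))"
          using i by (simp add: unit_v_def)
        have wi: "?w i \<in> carrier F" using w i vec_in by blast
        show ?thesis
        proof (cases "m = i")
          case True
          then have "\<zero> \<oplus> v m = ?w i \<oplus> v m" using e vm by simp
          then show ?thesis using R.add.r_cancel[of "\<zero>" "?w i" "v m"] wi vm by simp
        next
          case False
          then have "v i = \<zero>" using Suc.prems i by auto
          then show ?thesis using e wi vm False by simp
        qed
      qed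
      then have "?w \<in> U" using Suc.IH w by blast
      then have "?w \<oplus>\<^bsub>V\<^esub> v m \<odot>\<^bsub>V\<^esub> unit_v m \<in> U" using U vm True sub_add sub_smult by auto
      then show ?thesis using Suc vm unit_v_closed add_minus_cancel by simp
    qed (use Suc in auto)
  qed
  then show ?thesis by (metis leD subsetI)
qed

end

locale finite_coord = coord F n for F :: "'a ring" (structure) and n :: nat +
  assumes finite_field: "finite (carrier F)"

sublocale finite_coord \<subseteq> finite_vectorspace F "coord_space F n"
  by unfold_locales (auto simp: finite_field coord_simps intro: finite_PiE)

lemma finite_coordI: "field F \<Longrightarrow> finite (carrier F) \<Longrightarrow> finite_coord F n"
  by (intro finite_coord.intro coordI finite_coord_axioms.intro)

sublocale finite_coord \<subseteq> linear_action F "coord_space F n" "GL F n" "\<lambda>g v. vec_mat F n v g"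
proof -
  interpret G: group "GL F n" by (rule group_GL)
  show "linear_action F (coord_space F n) (GL F n) (\<lambda>g v. vec_mat F n v g)"
  proof unfold_locales
    show "\<And>g. g \<in> carrier (GL F n) \<Longrightarrow> lin (\<lambda>v. vm v g)" using vm_lin GL_in_MM by blast
    show "\<And>g k v. g \<in> carrier (GL F n) \<Longrightarrow> k \<in> carrier (GL F n) \<Longrightarrow> v \<in> carrier V \<Longrightarrow>
        vm v (g \<otimes>\<^bsub>GL F n\<^esub> k) = vm (vm v g) k"
      by (simp add: GL_simps(2) vm_mult GL_in_MM)
    show "\<And>v. v \<in> carrier V \<Longrightarrow> vm v \<one>\<^bsub>GL F n\<^esub> = v" by (simp add: GL_simps(3) one_MM vm_scalar)
    show "\<And>g k. g \<in> carrier (GL F n) \<Longrightarrow> k \<in> carrier (GL F n) \<Longrightarrow>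
        (\<And>v. v \<in> carrier V \<Longrightarrow> vm v g = vm v k) \<Longrightarrow> g = k"
      by (rule mat_faithful) (auto simp: GL_in_MM)
  qed
qed

context finite_coord
begin

lemma card_V: "card (carrier V) = Q ^ n"
  by (simp add: coord_simps card_PiE Q_def)

lemma lin_imp_mat:
  assumes "lin T" shows "\<exists>A\<in>carrier MM. \<forall>v\<in>carrier V. vm v A = T v"
proof -
  let ?A = "\<lambda>i\<in>{..<n}. T (unit_v i)"
  have A: "?A \<in> carrier MM" using matI lin_closed[OF assms] unit_v_closed by auto
  have "carrier V \<subseteq> {v \<in> carrier V. vm v ?A = T v}"
    using A unit_v_closed vm_unit_v[OF _ A] by (intro unit_v_generate lin_agree_sub vm_lin assms) auto
  then show ?thesis using A by blast
qed

text \<open>An injective map of a finite space is bijective; its inverse is linear and so is given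
  by a matrix too.\<close>

lemma lin_inj_imp_GL:
  assumes T: "lin T" "inj_on T (carrier V)"
  shows "\<exists>g\<in>carrier (GL F n). \<forall>v\<in>carrier V. vm v g = T v"
proof -
  have surj: "T ` carrier V = carrier V"
    using T lin_closed[OF T(1)] finite_V by (intro endo_inj_surj) auto
  define T' where "T' = inv_into (carrier V) T"
  have T'V: "v \<in> carrier V \<Longrightarrow> T' v \<in> carrier V" for v using surj by (metis T'_def inv_into_into)
  have TT': "v \<in> carrier V \<Longrightarrow> T (T' v) = v" for v using surj by (metis T'_def f_inv_into_f)
  have T'T: "v \<in> carrier V \<Longrightarrow> T' (T v) = v" for v using T by (simp add: T'_def)
  have "lin T'"
    unfolding lin_def
  proof (intro conjI ballI)
    fix x y assume V: "x \<in> carrier V" "y \<in> carrier V"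
    have "T (T' x \<oplus>\<^bsub>V\<^esub> T' y) = x \<oplus>\<^bsub>V\<^esub> y"
      using lin_add[OF T(1) T'V[OF V(1)] T'V[OF V(2)]] TT' V by simp
    then show "T' (x \<oplus>\<^bsub>V\<^esub> y) = T' x \<oplus>\<^bsub>V\<^esub> T' y"
      using T'T[OF M.add.m_closed[OF T'V[OF V(1)] T'V[OF V(2)]]] by simp
  next
    fix c x assume V: "c \<in> carrier F" "x \<in> carrier V"
    have "T (c \<odot>\<^bsub>V\<^esub> T' x) = c \<odot>\<^bsub>V\<^esub> x"
      using lin_smult[OF T(1) V(1) T'V[OF V(2)]] TT' V by simp
    then show "T' (c \<odot>\<^bsub>V\<^esub> x) = c \<odot>\<^bsub>V\<^esub> T' x"
      using T'T[OF smult_closed[OF V(1) T'V[OF V(2)]]] by simp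
  qed (use T'V in auto)
  then obtain B where B: "B \<in> carrier MM" "\<forall>v\<in>carrier V. vm v B = T' v" using lin_imp_mat by blast
  obtain A where A: "A \<in> carrier MM" "\<forall>v\<in>carrier V. vm v A = T v" using lin_imp_mat[OF T(1)] by blast
  note AB = A(1) bspec[OF A(2)] B(1) bspec[OF B(2)]
  have o: "\<one>\<^bsub>MM\<^esub> \<in> carrier MM" by (simp add: one_MM scalar_mat_closed)
  have "A \<otimes>\<^bsub>MM\<^esub> B = \<one>\<^bsub>MM\<^esub>" "B \<otimes>\<^bsub>MM\<^esub> A = \<one>\<^bsub>MM\<^esub>"
    using AB o T'T TT' T'V lin_closed[OF T(1)]
    by (auto intro!: mat_faithful simp: mat_mult_closed vm_mult one_MM vm_scalar)
  then have "A \<in> carrier (GL F n)" using AB by (auto simp: GL_simps Units_def)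
  then show ?thesis using AB by blast
qed

lemma scalar_mat_GL:
  assumes c: "c \<in> carrier F" "c \<noteq> \<zero>" shows "scalar_mat F n c \<in> carrier (GL F n)"
proof -
  have ic: "inv c \<in> carrier F" "inv c \<otimes> c = \<one>" "c \<otimes> inv c = \<one>" using c by (auto simp: field_Units)
  have "scalar_mat F n a \<otimes>\<^bsub>MM\<^esub> scalar_mat F n b = \<one>\<^bsub>MM\<^esub>"
    if "a \<in> carrier F" "b \<in> carrier F" "b \<otimes> a = \<one>" for a b
    using that by (intro mat_faithful)
      (auto simp: mat_mult_closed scalar_mat_closed vm_mult one_MM vm_scalar smult_assoc1[symmetric])
  from this[OF c(1) ic(1,2)] this[OF ic(1) c(1) ic(3)] show ?thesis
    using c ic scalar_mat_closed by (auto simp: GL_simps Units_def)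
qed

end

section \<open>Determinants over finite fields\<close>

text \<open>
  A finite field is a quotient of the polynomial ring over the integers (evaluate at a primitive
  element). Lifting matrices along this quotient map transfers multiplicativity of the determinant
  from matrices over a type-class ring to matrices over a carrier set.
\<close>

definition (in cring) int_eval :: "'a \<Rightarrow> int poly \<Rightarrow> 'a" where
  "int_eval a p = fold_coeffs (\<lambda>c y. add_pow R c \<one> \<oplus> a \<otimes> y) p \<zero>"

context cring
begin

lemma add_pow_int_0 [simp]: "[(0::int)] \<cdot> x = \<zero>"
  by (simp add: add_pow_def int_pow_def2)

lemma int_eval_0 [simp]: "int_eval a 0 = \<zero>" by (simp add: int_eval_def)

lemma int_eval_pCons: "a \<in> carrier R \<Longrightarrow> int_eval a (pCons c p) = add_pow R c \<one> \<oplus> a \<otimes> int_eval a p"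
  by (cases "c = 0 \<and> p = 0") (auto simp: int_eval_def)

lemma int_eval_closed [simp]: "a \<in> carrier R \<Longrightarrow> int_eval a p \<in> carrier R"
  by (induction p) (auto simp: int_eval_pCons)

lemma int_eval_add:
  assumes a: "a \<in> carrier R" shows "int_eval a (p + q) = int_eval a p \<oplus> int_eval a q"
proof (induction p q rule: poly_induct2)
  case (pCons c p d q)
  have "add_pow R (c + d) \<one> = add_pow R c \<one> \<oplus> add_pow R d \<one>" by (simp add: add.int_pow_mult)
  then show ?case using a pCons by (simp add: int_eval_pCons r_distr a_ac)
qed simp

lemma int_eval_smult:
  assumes a: "a \<in> carrier R" shows "int_eval a (smult c p) = add_pow R c \<one> \<otimes> int_eval a p"
proof (induction p)
  case (pCons d p)
  have "add_pow R (c * d) \<one> = add_pow R c \<one> \<otimes> add_pow R d \<one>"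
    by (simp add: add_pow_ldistr_int add.int_pow_pow mult.commute)
  then show ?case using a pCons by (simp add: int_eval_pCons r_distr m_lcomm)
qed simp

lemma int_eval_mult:
  assumes a: "a \<in> carrier R" shows "int_eval a (p * q) = int_eval a p \<otimes> int_eval a q"
proof (induction p)
  case (pCons d p)
  then show ?case using a
    by (simp add: int_eval_add int_eval_smult int_eval_pCons mult_pCons_left l_distr m_assoc)
qed (use a in simp)

lemma int_eval_1: "a \<in> carrier R \<Longrightarrow> int_eval a 1 = \<one>"
  by (simp add: one_pCons int_eval_pCons)

lemma int_eval_minus_1: "a \<in> carrier R \<Longrightarrow> int_eval a (- 1) = \<ominus> \<one>"
  using int_eval_add[of a "- 1" 1] int_eval_1[of a] by (simp add: minus_equality)

lemma int_eval_sum: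
  assumes "a \<in> carrier R" "finite A" shows "int_eval a (sum g A) = (\<Oplus>i\<in>A. int_eval a (g i))"
  using assms(2) by induction (use assms(1) in \<open>auto simp: int_eval_add\<close>)

lemma int_eval_prod:
  assumes "a \<in> carrier R" "finite A" shows "int_eval a (prod g A) = (\<Otimes>i\<in>A. int_eval a (g i))"
  using assms(2) by induction (use assms(1) in \<open>auto simp: int_eval_mult int_eval_1\<close>)

end

text \<open>The multiplicative group is cyclic, and at a generator the monomials take every nonzero
  value.\<close>

lemma (in field) int_eval_surj:
  assumes "finite (carrier R)"
  shows "\<exists>a\<in>carrier R. \<forall>b\<in>carrier R. \<exists>p. int_eval a p = b"
proof -
  obtain a where a: "a \<in> carrier (Multiplicative_Group.mult_of R)" "carrier (Multiplicative_Group.mult_of R) = {a [^] i | i::nat. i \<in> UNIV}"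
    using finite_field_mult_group_has_gen[OF assms] by auto
  have aR: "a \<in> carrier R" using a by simp
  have pow: "\<exists>p. int_eval a p = a [^] i" for i :: nat
  proof (induction i)
    case 0
    show ?case using int_eval_1[OF aR] by auto
  next
    case (Suc i)
    then obtain p where "int_eval a p = a [^] i" by auto
    then have "int_eval a (pCons 0 p) = a [^] Suc i" using aR by (simp add: int_eval_pCons m_comm)
    then show ?case by blast
  qed
  have "\<exists>p. int_eval a p = b" if b: "b \<in> carrier R" for b
  proof (cases "b = \<zero>")
    case True
    then show ?thesis using int_eval_0 by metis
  next
    case False
    then have "b \<in> carrier (Multiplicative_Group.mult_of R)" using b by simp
    then obtain i :: nat where "b = a [^] i" using a(2) by blast
    then show ?thesis using pow by blast
  qed
  then show ?thesis using aR by blast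
qed

lemma (in field) finite_field_power_card:
  assumes "finite (carrier R)" "a \<in> carrier R" shows "a [^] card (carrier R) = a"
proof (cases "a = \<zero>")
  case True
  have "card (carrier R) \<noteq> 0" using assms by auto
  then obtain k where "card (carrier R) = Suc k" using not0_implies_Suc by blast
  then show ?thesis using True by simp
next
  case False
  have "group (Multiplicative_Group.mult_of R)" by (rule field_mult_group)
  then have "a [^]\<^bsub>Multiplicative_Group.mult_of R\<^esub> Coset.order (Multiplicative_Group.mult_of R) = \<one>\<^bsub>Multiplicative_Group.mult_of R\<^esub>"
    using False assms by (intro group.pow_order_eq_1) auto
  then have "a [^] (card (carrier R) - 1) = \<one>"
    using order_mult_of[OF assms(1)] by (simp add: Multiplicative_Group.nat_pow_mult_of Coset.order_def)
  moreover have "card (carrier R) = Suc (card (carrier R) - 1)"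
    using assms by (metis Suc_pred' card_gt_0_iff empty_iff)
  ultimately show ?thesis using assms by (metis l_one nat_pow_Suc)
qed

context finite_coord
begin

text \<open>Evaluation is a ring homomorphism, so it passes through the sum over permutations term
  by term.\<close>

lemma mat_det_lift:
  assumes a: "a \<in> carrier F" and C: "C \<in> carrier_mat n n"
    and AC: "\<And>i j. i < n \<Longrightarrow> j < n \<Longrightarrow> int_eval a (C $$ (i, j)) = A i j"
  shows "mat_det F n A = int_eval a (det C)"
proof -
  have fin: "finite {\<pi>. \<pi> permutes {..<n}}" by (simp add: finite_permutations)
  have "int_eval a (det C) = int_eval a (\<Sum>\<pi>\<in>{\<pi>. \<pi> permutes {..<n}}. signof \<pi> * (\<Prod>i<n. C $$ (i, \<pi> i)))"
    using C by (simp add: det_def lessThan_atLeast0)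
  also have "\<dots> = (\<Oplus>\<pi>\<in>{\<pi>. \<pi> permutes {..<n}}. int_eval a (signof \<pi> * (\<Prod>i<n. C $$ (i, \<pi> i))))"
    by (rule int_eval_sum[OF a fin])
  also have "\<dots> = mat_det F n A"
    unfolding mat_det_def
  proof (intro R.finsum_cong' refl)
    fix \<pi> assume "\<pi> \<in> {\<pi>. \<pi> permutes {..<n}}"
    then have \<pi>: "\<pi> i < n" if "i < n" for i using that permutes_in_image[of \<pi> "{..<n}" i] by auto
    have "int_eval a (signof \<pi>) = (if evenperm \<pi> then \<one> else \<ominus> \<one>)"
      using a by (simp add: sign_def int_eval_1 int_eval_minus_1)
    moreover have "int_eval a (\<Prod>i<n. C $$ (i, \<pi> i)) = (\<Otimes>i\<in>{..<n}. A i (\<pi> i))"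
      using a \<pi> AC by (subst int_eval_prod) (auto intro!: finprod_cong' simp flip: AC)
    ultimately show "int_eval a (signof \<pi> * (\<Prod>i<n. C $$ (i, \<pi> i)))
        = (if evenperm \<pi> then \<one> else \<ominus> \<one>) \<otimes> (\<Otimes>i\<in>{..<n}. A i (\<pi> i))"
      using a by (simp add: int_eval_mult)
  next
    show "(\<lambda>\<pi>. (if evenperm \<pi> then \<one> else \<ominus> \<one>) \<otimes> (\<Otimes>i\<in>{..<n}. A i (\<pi> i)))
        \<in> {\<pi>. \<pi> permutes {..<n}} \<rightarrow> carrier F"
    proof
      fix \<pi> assume "\<pi> \<in> {\<pi>. \<pi> permutes {..<n}}"
      then have \<pi>: "\<pi> i < n" if "i < n" for i using that permutes_in_image[of \<pi> "{..<n}" i] by auto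
      then have "A i (\<pi> i) \<in> carrier F" if "i < n" for i using that AC a int_eval_closed by metis
      then show "(if evenperm \<pi> then \<one> else \<ominus> \<one>) \<otimes> (\<Otimes>i\<in>{..<n}. A i (\<pi> i)) \<in> carrier F"
        by (auto intro!: finprod_closed)
    qed
  qed
  finally show ?thesis by simp
qed

lemma mat_lift_exists:
  assumes "\<forall>b\<in>carrier F. \<exists>p. int_eval a p = b" "A \<in> carrier MM"
  shows "\<exists>C\<in>carrier_mat n n. \<forall>i<n. \<forall>j<n. int_eval a (C $$ (i, j)) = A i j"
proof -
  let ?C = "mat n n (\<lambda>(i, j). SOME p. int_eval a p = A i j)"
  have "int_eval a (SOME p. int_eval a p = A i j) = A i j" if "i < n" "j < n" for i j
  proof -
    have "\<exists>p. int_eval a p = A i j" using assms(1) mat_entry[OF assms(2) that] by blast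
    then show ?thesis by (rule someI_ex)
  qed
  then show ?thesis by (intro bexI[of _ ?C]) auto
qed

lemma mat_det_mult:
  assumes "A \<in> carrier MM" "B \<in> carrier MM"
  shows "mat_det F n (A \<otimes>\<^bsub>MM\<^esub> B) = mat_det F n A \<otimes> mat_det F n B"
    "mat_det F n A \<in> carrier F"
proof -
  obtain a where a: "a \<in> carrier F" "\<forall>b\<in>carrier F. \<exists>p. int_eval a p = b"
    using int_eval_surj[OF finite_F] by auto
  obtain C D where C: "C \<in> carrier_mat n n" "\<And>i j. i < n \<Longrightarrow> j < n \<Longrightarrow> int_eval a (C $$ (i, j)) = A i j"
    and D: "D \<in> carrier_mat n n" "\<And>i j. i < n \<Longrightarrow> j < n \<Longrightarrow> int_eval a (D $$ (i, j)) = B i j"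
  proof -
    obtain C where C: "C \<in> carrier_mat n n" "\<forall>i<n. \<forall>j<n. int_eval a (C $$ (i, j)) = A i j"
      using mat_lift_exists[OF a(2) assms(1)] by blast
    obtain D where D: "D \<in> carrier_mat n n" "\<forall>i<n. \<forall>j<n. int_eval a (D $$ (i, j)) = B i j"
      using mat_lift_exists[OF a(2) assms(2)] by blast
    show ?thesis by (rule that[of C D]) (use C D in auto)
  qed
  have "int_eval a ((C * D) $$ (i, j)) = (A \<otimes>\<^bsub>MM\<^esub> B) i j" if ij: "i < n" "j < n" for i j
  proof -
    have "(C * D) $$ (i, j) = (\<Sum>k<n. C $$ (i, k) * D $$ (k, j))"
      using C(1) D(1) ij by (auto simp: scalar_prod_def lessThan_atLeast0 intro!: sum.cong)
    then have "int_eval a ((C * D) $$ (i, j)) = (\<Oplus>k\<in>{..<n}. int_eval a (C $$ (i, k) * D $$ (k, j)))"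
      by (simp only: int_eval_sum[OF a(1) finite_lessThan])
    also have "\<dots> = (\<Oplus>k\<in>{..<n}. A i k \<otimes> B k j)"
      using C D ij a assms by (intro R.finsum_cong') (auto simp: int_eval_mult mat_entry)
    finally show ?thesis using ij by (simp add: mat_mult_row vm_eval)
  qed
  then have "mat_det F n (A \<otimes>\<^bsub>MM\<^esub> B) = int_eval a (det (C * D))"
    using C D by (intro mat_det_lift[OF a(1)]) auto
  also have "\<dots> = int_eval a (det C) \<otimes> int_eval a (det D)"
    using C D a by (simp add: det_mult int_eval_mult)
  also have "\<dots> = mat_det F n A \<otimes> mat_det F n B"
    using mat_det_lift[OF a(1) C(1), of A] mat_det_lift[OF a(1) D(1), of B] C D by simp
  finally show "mat_det F n (A \<otimes>\<^bsub>MM\<^esub> B) = mat_det F n A \<otimes> mat_det F n B" .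
  show "mat_det F n A \<in> carrier F" using mat_det_lift[OF a(1) C(1), of A] C a by simp
qed

lemma mat_det_one: "mat_det F n \<one>\<^bsub>MM\<^esub> = \<one>"
proof -
  obtain a where a: "a \<in> carrier F" using R.one_closed by blast
  have "mat_det F n \<one>\<^bsub>MM\<^esub> = int_eval a (det (1\<^sub>m n))"
    using a by (intro mat_det_lift) (auto simp: one_MM scalar_mat_def int_eval_1)
  then show ?thesis using a by (simp add: int_eval_1)
qed

lemma subgroup_SL: "subgroup (SL_set F n) (GL F n)"
proof (rule Gp.subgroupI)
  show "SL_set F n \<subseteq> carrier (GL F n)" by (auto simp: SL_set_def)
  have o: "\<one>\<^bsub>MM\<^esub> \<in> SL_set F n"
    using mat_det_one Gp.one_closed by (simp add: SL_set_def GL_simps)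
  then show "SL_set F n \<noteq> {}" by auto
  show "a \<otimes>\<^bsub>GL F n\<^esub> b \<in> SL_set F n" if "a \<in> SL_set F n" "b \<in> SL_set F n" for a b
    using that Gp.m_closed[of a b] by (auto simp: SL_set_def GL_simps(2) mat_det_mult GL_in_MM)
  show "inv\<^bsub>GL F n\<^esub> a \<in> SL_set F n" if a: "a \<in> SL_set F n" for a
  proof -
    have aG: "a \<in> carrier (GL F n)" "inv\<^bsub>GL F n\<^esub> a \<in> carrier (GL F n)" using a by (auto simp: SL_set_def)
    have "mat_det F n (a \<otimes>\<^bsub>MM\<^esub> inv\<^bsub>GL F n\<^esub> a) = \<one>"
      using Gp.r_inv[OF aG(1)] mat_det_one by (simp add: GL_simps)
    then have "mat_det F n (inv\<^bsub>GL F n\<^esub> a) = \<one>"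
      using aG a mat_det_mult(2)[OF GL_in_MM GL_in_MM, OF aG(2) aG(2)] by (simp add: mat_det_mult(1) GL_in_MM SL_set_def)
    then show ?thesis using aG by (simp add: SL_set_def)
  qed
qed

text \<open>The determinant of an element of Q-power order is 1 because \<open>x\<^sup>Q = x\<close> in the field.\<close>

lemma mat_det_eq_one:
  assumes g: "g \<in> carrier (GL F n)" and p: "g [^]\<^bsub>GL F n\<^esub> Q = \<one>\<^bsub>GL F n\<^esub>"
  shows "mat_det F n g = \<one>"
proof -
  have d: "mat_det F n g \<in> carrier F" using mat_det_mult(2) GL_in_MM g by blast
  have "mat_det F n (g [^]\<^bsub>GL F n\<^esub> k) = mat_det F n g [^] k" for k :: nat
  proof (induction k)
    case 0
    show ?case using mat_det_one by (simp add: GL_simps)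
  next
    case (Suc k)
    have "g [^]\<^bsub>GL F n\<^esub> k \<in> carrier (GL F n)" using g by simp
    then show ?case using Suc g by (simp add: GL_simps(2) mat_det_mult GL_in_MM)
  qed
  then have "mat_det F n g [^] Q = \<one>" using p mat_det_one by (metis GL_simps(3))
  then show ?thesis using finite_field_power_card[OF finite_F d] by (simp add: Q_def)
qed

lemma Q_annihilates: "v \<in> carrier V \<Longrightarrow> [Q] \<cdot>\<^bsub>V\<^esub> v = \<zero>\<^bsub>V\<^esub>"
proof -
  assume v: "v \<in> carrier V"
  have "group (add_monoid F)" by (rule R.add.is_group)
  then have "\<one> [^]\<^bsub>add_monoid F\<^esub> Coset.order (add_monoid F) = \<one>\<^bsub>add_monoid F\<^esub>"
    by (rule group.pow_order_eq_1) simp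
  then have q: "[Q] \<cdot>\<^bsub>F\<^esub> \<one> = \<zero>" by (simp add: add_pow_def Coset.order_def Q_def)
  have "[k] \<cdot>\<^bsub>V\<^esub> v = ([k] \<cdot>\<^bsub>F\<^esub> \<one>) \<odot>\<^bsub>V\<^esub> v" for k :: nat
    using v by (induction k) (auto simp: smult_l_distr)
  then show ?thesis using q v by simp
qed

text \<open>The k-th power of the transvection is x + k \<phi>(x) w, so its Q-th power is trivial,
  and the determinant is 1 without being expanded.\<close>

lemma transvection_SL:
  assumes w: "w \<in> carrier V" and \<phi>: "linear_on (carrier V) \<phi>" "\<phi> w = \<zero>"
  shows "\<exists>u\<in>SL_set F n. \<forall>x\<in>carrier V. vm x u = x \<oplus>\<^bsub>V\<^esub> \<phi> x \<odot>\<^bsub>V\<^esub> w"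
proof -
  let ?T = "\<lambda>x. x \<oplus>\<^bsub>V\<^esub> \<phi> x \<odot>\<^bsub>V\<^esub> w"
  have \<phi>F: "\<phi> x \<in> carrier F" if "x \<in> carrier V" for x using \<phi> that by (auto simp: linear_on_def)
  have \<phi>a: "\<phi> (x \<oplus>\<^bsub>V\<^esub> y) = \<phi> x \<oplus> \<phi> y" if "x \<in> carrier V" "y \<in> carrier V" for x y
    using \<phi> that by (auto simp: linear_on_def)
  have \<phi>s: "\<phi> (c \<odot>\<^bsub>V\<^esub> x) = c \<otimes> \<phi> x" if "c \<in> carrier F" "x \<in> carrier V" for c x
    using \<phi> that by (auto simp: linear_on_def)
  have lT: "lin ?T"
    unfolding lin_def using w
    by (auto simp: \<phi>F \<phi>a \<phi>s smult_l_distr smult_r_distr smult_assoc1 M.a_ac)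
  have \<phi>T: "\<phi> (x \<oplus>\<^bsub>V\<^esub> c \<odot>\<^bsub>V\<^esub> w) = \<phi> x" if "x \<in> carrier V" "c \<in> carrier F" for x c
    using that w \<phi>(2) by (simp add: \<phi>F \<phi>a \<phi>s)
  have inj: "inj_on ?T (carrier V)"
  proof (rule inj_onI)
    fix x y assume V: "x \<in> carrier V" "y \<in> carrier V" and e: "?T x = ?T y"
    have "\<phi> x = \<phi> y" using \<phi>T[OF V(1) \<phi>F[OF V(1)]] \<phi>T[OF V(2) \<phi>F[OF V(2)]] e by simp
    then show "x = y" using e V w \<phi>F by simp
  qed
  obtain u where u: "u \<in> carrier (GL F n)" "\<forall>x\<in>carrier V. vm x u = ?T x"
    using lin_inj_imp_GL[OF lT inj] by blast
  have pow: "vm x (u [^]\<^bsub>GL F n\<^esub> k) = x \<oplus>\<^bsub>V\<^esub> [k] \<cdot>\<^bsub>V\<^esub> (\<phi> x \<odot>\<^bsub>V\<^esub> w)" if x: "x \<in> carrier V" for x and k :: nat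
  proof (induction k)
    case 0
    show ?case using x act_one by simp
  next
    case (Suc k)
    have m: "[k] \<cdot>\<^bsub>V\<^esub> (\<phi> x \<odot>\<^bsub>V\<^esub> w) \<in> carrier V" using x w \<phi>F by simp
    have km: "[k] \<cdot>\<^bsub>V\<^esub> (\<phi> x \<odot>\<^bsub>V\<^esub> w) = ([k] \<cdot>\<^bsub>F\<^esub> \<phi> x) \<odot>\<^bsub>V\<^esub> w"
      using x w \<phi>F by (induction k) (auto simp: smult_l_distr)
    have "vm x (u [^]\<^bsub>GL F n\<^esub> Suc k) = vm (x \<oplus>\<^bsub>V\<^esub> [k] \<cdot>\<^bsub>V\<^esub> (\<phi> x \<odot>\<^bsub>V\<^esub> w)) u"
      using act_mult[of "u [^]\<^bsub>GL F n\<^esub> k" u x] u x Suc by simp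
    also have "\<dots> = (x \<oplus>\<^bsub>V\<^esub> [k] \<cdot>\<^bsub>V\<^esub> (\<phi> x \<odot>\<^bsub>V\<^esub> w)) \<oplus>\<^bsub>V\<^esub> \<phi> x \<odot>\<^bsub>V\<^esub> w"
      using u(2) x m \<phi>T[OF x, of "[k] \<cdot>\<^bsub>F\<^esub> \<phi> x"] \<phi>F km by simp
    also have "\<dots> = x \<oplus>\<^bsub>V\<^esub> [Suc k] \<cdot>\<^bsub>V\<^esub> (\<phi> x \<odot>\<^bsub>V\<^esub> w)" using x m w \<phi>F by (simp add: M.a_assoc)
    finally show ?case .
  qed
  have "u [^]\<^bsub>GL F n\<^esub> Q = \<one>\<^bsub>GL F n\<^esub>"
    using u w \<phi>F by (intro act_faithful) (auto simp: pow Q_annihilates act_one)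
  then have "u \<in> SL_set F n" using mat_det_eq_one u by (auto simp: SL_set_def)
  then show ?thesis using u by blast
qed

end

section \<open>Linear, symplectic and unitary groups\<close>

text \<open>Dividing by one solution carries all of them into the d-th roots of unity.\<close>

lemma (in field) card_coset_roots_le:
  assumes fin: "finite (carrier R)" and d: "d \<noteq> 0"
  shows "card {x \<in> carrier R. x \<noteq> \<zero> \<and> x [^] (d::nat) = a} \<le> d"
proof (cases "\<exists>x0\<in>carrier R. x0 \<noteq> \<zero> \<and> x0 [^] d = a")
  case True
  then obtain x0 where x0: "x0 \<in> carrier R" "x0 \<noteq> \<zero>" "x0 [^] d = a" by auto
  have i: "inv x0 \<in> carrier R" "x0 \<otimes> inv x0 = \<one>" "inv x0 \<otimes> x0 = \<one>" using x0 by (auto simp: field_Units)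
  have aR: "a \<in> carrier R" using x0 by auto
  have ia: "a \<otimes> inv x0 [^] d = \<one>"
    using x0 i by (simp add: nat_pow_distrib[symmetric] flip: x0(3))
  have "card {x \<in> carrier R. x \<noteq> \<zero> \<and> x [^] d = a} \<le> card {x \<in> carrier R. x [^] d = \<one>}"
  proof (rule card_inj_on_le[of "\<lambda>x. x \<otimes> inv x0"])
    show "inj_on (\<lambda>x. x \<otimes> inv x0) {x \<in> carrier R. x \<noteq> \<zero> \<and> x [^] d = a}"
    proof (rule inj_onI)
      fix x y assume h: "x \<in> {x \<in> carrier R. x \<noteq> \<zero> \<and> x [^] d = a}"
        "y \<in> {x \<in> carrier R. x \<noteq> \<zero> \<and> x [^] d = a}" "x \<otimes> inv x0 = y \<otimes> inv x0"
      then have "x \<otimes> inv x0 \<otimes> x0 = y \<otimes> inv x0 \<otimes> x0" by simp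
      then show "x = y" using h(1,2) i x0 by (simp add: m_assoc)
    qed
    show "(\<lambda>x. x \<otimes> inv x0) ` {x \<in> carrier R. x \<noteq> \<zero> \<and> x [^] d = a} \<subseteq> {x \<in> carrier R. x [^] d = \<one>}"
      using i ia by (auto simp: nat_pow_distrib)
    show "finite {x \<in> carrier R. x [^] d = \<one>}" using fin by auto
  qed
  also have "\<dots> \<le> d" by (rule num_roots_le_deg[OF fin d])
  finally show ?thesis .
next
  case False
  then have "{x \<in> carrier R. x \<noteq> \<zero> \<and> x [^] d = a} = {}" by blast
  then show ?thesis by (simp only: card.empty)
qed

text \<open>One computation for both kinds of form: \<epsilon> = -1 with trivial \<sigma> in the
  symplectic case, \<epsilon> = 1 in the unitary case. The condition on \<open>c\<close> makes the
  last term cancel the contribution of \<open>f v v\<close>. On vectors orthogonal to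
  \<open>e\<close> the map is x + f(x, v) e.\<close>

lemma (in form_space) siegel_isometry:
  assumes eps: "\<epsilon> \<in> carrier F" "\<epsilon> \<otimes> \<epsilon> = \<one>" "\<sigma> \<epsilon> = \<epsilon>"
    and herm: "\<And>x y. x \<in> carrier V \<Longrightarrow> y \<in> carrier V \<Longrightarrow> \<sigma> (f y x) = \<epsilon> \<otimes> f x y"
    and mult: "\<And>a b. a \<in> carrier F \<Longrightarrow> b \<in> carrier F \<Longrightarrow> \<sigma> (a \<otimes> b) = \<sigma> a \<otimes> \<sigma> b"
    and neg: "\<And>a. a \<in> carrier F \<Longrightarrow> \<sigma> (\<ominus> a) = \<ominus> \<sigma> a"
    and e: "e \<in> carrier V" "f e e = \<zero>" and v: "v \<in> carrier V" "f v e = \<zero>"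
    and c: "c \<in> carrier F" "c \<oplus> (\<epsilon> \<otimes> \<sigma> c \<oplus> \<epsilon> \<otimes> f v v) = \<zero>"
    and x: "x \<in> carrier V" and y: "y \<in> carrier V"
    and T: "\<And>x. x \<in> carrier V \<Longrightarrow> T x = ((x \<oplus>\<^bsub>V\<^esub> f x v \<odot>\<^bsub>V\<^esub> e) \<oplus>\<^bsub>V\<^esub> (\<ominus> (\<epsilon> \<otimes> f x e)) \<odot>\<^bsub>V\<^esub> v) \<oplus>\<^bsub>V\<^esub> (c \<otimes> f x e) \<odot>\<^bsub>V\<^esub> e"
  shows "f (T x) (T y) = f x y"
proof -
  have ev: "f e v = \<zero>" using v e f_refl by auto
  define a b a' b' n' where "a = f x e" and "b = f x v" and "a' = f e y" and "b' = f v y" and "n' = f v v"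
  have F: "a \<in> carrier F" "b \<in> carrier F" "a' \<in> carrier F" "b' \<in> carrier F" "f x y \<in> carrier F" "\<sigma> c \<in> carrier F" "n' \<in> carrier F"
    using x y e v c by (auto simp: a_def b_def a'_def b'_def n'_def)
  have sa: "\<sigma> (f y e) = \<epsilon> \<otimes> a'" and sb: "\<sigma> (f y v) = \<epsilon> \<otimes> b'" using herm x y e v by (auto simp: a'_def b'_def)
  \<comment> \<open>Here \<epsilon>^2 = 1 enters: the \<epsilon> produced by swapping the arguments
    cancels the one in front.\<close>
  have s1: "\<sigma> (\<ominus> (\<epsilon> \<otimes> f y e)) = \<ominus> a'"
    using eps F y e by (simp add: neg mult sa m_assoc[symmetric])
  have s2: "\<sigma> (c \<otimes> f y e) = \<sigma> c \<otimes> (\<epsilon> \<otimes> a')" using c y e by (simp add: mult sa)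
  have "f (T x) (T y) = f x y \<oplus> b \<otimes> a' \<oplus> (\<ominus> (\<epsilon> \<otimes> a)) \<otimes> b' \<oplus> (c \<otimes> a) \<otimes> a'
     \<oplus> (\<epsilon> \<otimes> b') \<otimes> a \<oplus> (\<ominus> a') \<otimes> b \<oplus> (\<ominus> a') \<otimes> ((\<ominus> (\<epsilon> \<otimes> a)) \<otimes> n') \<oplus> (\<sigma> c \<otimes> (\<epsilon> \<otimes> a')) \<otimes> a"
    unfolding T[OF x] T[OF y]
    using x y e v c F eps ev
    by (simp add: f_add_left f_add_right f_smult_left f_smult_right s1 s2 sb
        a_def[symmetric] b_def[symmetric] a'_def[symmetric] b'_def[symmetric] n'_def[symmetric] R.a_ac r_distr)
  \<comment> \<open>The terms containing \<open>b\<close> or \<open>b'\<close> cancel in pairs; what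
    remains is a multiple of the left side of the condition on \<open>c\<close>.\<close>
  also have "\<dots> = f x y \<oplus> (a \<otimes> a') \<otimes> (c \<oplus> (\<epsilon> \<otimes> \<sigma> c \<oplus> \<epsilon> \<otimes> n'))"
    using F c eps by algebra
  also have "\<dots> = f x y" using c F by (simp add: n'_def)
  finally show ?thesis .
qed

context finite_coord
begin

text \<open>A Siegel transformation is a product of three transvections, so its determinant is 1.
  The first two factors leave the value \<open>f x e\<close> unchanged because \<open>f e e\<close>
  and \<open>f v e\<close> vanish, so the factors can be evaluated one after another.\<close>

lemma transvection_triple:
  assumes fs: "form_space F V f \<tau>" and a: "a \<in> carrier F" "c \<in> carrier F"
    and e: "e \<in> carrier V" "f e e = \<zero>" and v: "v \<in> carrier V" "f v e = \<zero>"
  shows "\<exists>u\<in>SL_set F n. \<forall>x\<in>carrier V.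
    vm x u = ((x \<oplus>\<^bsub>V\<^esub> f x v \<odot>\<^bsub>V\<^esub> e) \<oplus>\<^bsub>V\<^esub> (\<ominus> (a \<otimes> f x e)) \<odot>\<^bsub>V\<^esub> v) \<oplus>\<^bsub>V\<^esub> (c \<otimes> f x e) \<odot>\<^bsub>V\<^esub> e"
proof -
  interpret f: form_space F V f \<tau> by fact
  have ev: "f e v = \<zero>" using v e f.f_refl by auto
  have "linear_on (carrier V) (\<lambda>x. f x v)" by (rule f.linear_on_f[OF sub_carrier v(1)])
  then obtain t1 where t1: "t1 \<in> SL_set F n" "\<forall>x\<in>carrier V. vm x t1 = x \<oplus>\<^bsub>V\<^esub> f x v \<odot>\<^bsub>V\<^esub> e"
    using transvection_SL[where \<phi> = "\<lambda>x. f x v", OF e(1) _ ev] by blast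
  have "linear_on (carrier V) (\<lambda>x. \<ominus> (a \<otimes> f x e))"
    using a e by (auto simp: linear_on_def f.f_add_left f.f_smult_left r_distr R.minus_add m_lcomm r_minus)
  moreover have "\<ominus> (a \<otimes> f v e) = \<zero>" using a v by simp
  ultimately obtain t2 where t2: "t2 \<in> SL_set F n" "\<forall>x\<in>carrier V. vm x t2 = x \<oplus>\<^bsub>V\<^esub> (\<ominus> (a \<otimes> f x e)) \<odot>\<^bsub>V\<^esub> v"
    using transvection_SL[OF v(1), of "\<lambda>x. \<ominus> (a \<otimes> f x e)"] by blast
  have "linear_on (carrier V) (\<lambda>x. c \<otimes> f x e)"
    using a e by (auto simp: linear_on_def f.f_add_left f.f_smult_left r_distr m_lcomm)
  moreover have "c \<otimes> f e e = \<zero>" using a e by simp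
  ultimately obtain t3 where t3: "t3 \<in> SL_set F n" "\<forall>x\<in>carrier V. vm x t3 = x \<oplus>\<^bsub>V\<^esub> (c \<otimes> f x e) \<odot>\<^bsub>V\<^esub> e"
    using transvection_SL[OF e(1), of "\<lambda>x. c \<otimes> f x e"] by blast
  have G: "t1 \<in> carrier (GL F n)" "t2 \<in> carrier (GL F n)" "t3 \<in> carrier (GL F n)"
    using t1 t2 t3 by (auto simp: SL_set_def)
  let ?u = "t1 \<otimes>\<^bsub>GL F n\<^esub> t2 \<otimes>\<^bsub>GL F n\<^esub> t3"
  have "vm x ?u = ((x \<oplus>\<^bsub>V\<^esub> f x v \<odot>\<^bsub>V\<^esub> e) \<oplus>\<^bsub>V\<^esub> (\<ominus> (a \<otimes> f x e)) \<odot>\<^bsub>V\<^esub> v) \<oplus>\<^bsub>V\<^esub> (c \<otimes> f x e) \<odot>\<^bsub>V\<^esub> e"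
    if x: "x \<in> carrier V" for x
  proof -
    let ?x1 = "x \<oplus>\<^bsub>V\<^esub> f x v \<odot>\<^bsub>V\<^esub> e"
    let ?x2 = "?x1 \<oplus>\<^bsub>V\<^esub> (\<ominus> (a \<otimes> f x e)) \<odot>\<^bsub>V\<^esub> v"
    have c1: "?x1 \<in> carrier V" "?x2 \<in> carrier V" using x e v a by auto
    have f1: "f ?x1 e = f x e" using x e v by (simp add: f.f_add_left f.f_smult_left)
    have f2: "f ?x2 e = f x e" using x e v a by (simp add: f.f_add_left f.f_smult_left)
    have "vm x ?u = vm (vm (vm x t1) t2) t3" using G x act_closed by (simp add: act_mult)
    also have "vm x t1 = ?x1" using t1 x by simp
    also have "vm ?x1 t2 = ?x2" using t2 c1 f1 by simp
    also have "vm ?x2 t3 = ?x2 \<oplus>\<^bsub>V\<^esub> (c \<otimes> f x e) \<odot>\<^bsub>V\<^esub> e" using t3 c1 f2 by simp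
    finally show ?thesis .
  qed
  moreover have "?u \<in> SL_set F n"
    using subgroup_SL t1 t2 t3 by (simp add: subgroup.m_closed)
  ultimately show ?thesis by blast
qed

lemma subgroup_isometries:
  assumes "\<And>u v. u \<in> carrier V \<Longrightarrow> v \<in> carrier V \<Longrightarrow> f u v \<in> carrier F"
  shows "subgroup (isometries F n f) (GL F n)"
proof (rule Gp.subgroupI)
  show "isometries F n f \<noteq> {}" using act_one Gp.one_closed by (auto simp: isometries_def)
  show "a \<otimes>\<^bsub>GL F n\<^esub> b \<in> isometries F n f" if "a \<in> isometries F n f" "b \<in> isometries F n f" for a b
    using that by (auto simp: isometries_def act_mult act_closed)
  show "inv\<^bsub>GL F n\<^esub> a \<in> isometries F n f" if a: "a \<in> isometries F n f" for a
  proof -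
    have aG: "a \<in> carrier (GL F n)" using a by (auto simp: isometries_def)
    have "f (vm u (inv\<^bsub>GL F n\<^esub> a)) (vm v (inv\<^bsub>GL F n\<^esub> a)) = f u v" if uv: "u \<in> carrier V" "v \<in> carrier V" for u v
    proof -
      let ?u = "vm u (inv\<^bsub>GL F n\<^esub> a)" and ?v = "vm v (inv\<^bsub>GL F n\<^esub> a)"
      have "?u \<in> carrier V" "?v \<in> carrier V" using uv aG act_closed by auto
      then have "f (vm ?u a) (vm ?v a) = f ?u ?v" using a by (auto simp: isometries_def)
      then show ?thesis using act_inv aG uv by simp
    qed
    then show ?thesis using aG by (auto simp: isometries_def)
  qed
qed (auto simp: isometries_def)

text \<open>Not invariant under the group: it identifies the dual space with the space itself, so
  that the results on good pairs apply to the special linear group.\<close>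

definition dot :: "(nat \<Rightarrow> 'a) \<Rightarrow> (nat \<Rightarrow> 'a) \<Rightarrow> 'a" where
  "dot u v = (\<Oplus>i\<in>{..<n}. u i \<otimes> v i)"

lemma dot_form_space: "form_space F V dot (\<lambda>c. c)"
proof unfold_locales
  have comm: "dot x y = dot y x" if "x \<in> carrier V" "y \<in> carrier V" for x y
    unfolding dot_def using that by (intro R.finsum_cong') (auto simp: vec_in m_comm)
  have cl: "dot x y \<in> carrier F" if "x \<in> carrier V" "y \<in> carrier V" for x y
    unfolding dot_def using that by (intro R.finsum_closed) (auto simp: vec_in)
  have add: "dot (x \<oplus>\<^bsub>V\<^esub> y) z = dot x z \<oplus> dot y z"
    if "x \<in> carrier V" "y \<in> carrier V" "z \<in> carrier V" for x y z
  proof -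
    have "dot (x \<oplus>\<^bsub>V\<^esub> y) z = (\<Oplus>i\<in>{..<n}. x i \<otimes> z i \<oplus> y i \<otimes> z i)"
      unfolding dot_def using that by (intro R.finsum_cong') (auto simp: vec_in l_distr add_eval)
    then show ?thesis unfolding dot_def using that by (simp add: R.finsum_addf vec_in Pi_def)
  qed
  have sm: "dot (c \<odot>\<^bsub>V\<^esub> x) z = c \<otimes> dot x z"
    if "c \<in> carrier F" "x \<in> carrier V" "z \<in> carrier V" for c x z
  proof -
    have "dot (c \<odot>\<^bsub>V\<^esub> x) z = (\<Oplus>i\<in>{..<n}. c \<otimes> (x i \<otimes> z i))"
      unfolding dot_def using that by (intro R.finsum_cong') (auto simp: vec_in m_assoc smult_eval)
    then show ?thesis unfolding dot_def using that by (simp add: R.finsum_rdistr vec_in Pi_def)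
  qed
  show "\<And>x y. x \<in> carrier V \<Longrightarrow> y \<in> carrier V \<Longrightarrow> dot x y \<in> carrier F" by (rule cl)
  show "\<And>x y z. x \<in> carrier V \<Longrightarrow> y \<in> carrier V \<Longrightarrow> z \<in> carrier V \<Longrightarrow> dot (x \<oplus>\<^bsub>V\<^esub> y) z = dot x z \<oplus> dot y z" by (rule add)
  show "\<And>x y z. x \<in> carrier V \<Longrightarrow> y \<in> carrier V \<Longrightarrow> z \<in> carrier V \<Longrightarrow> dot z (x \<oplus>\<^bsub>V\<^esub> y) = dot z x \<oplus> dot z y"
    using comm add by simp
  show "\<And>c x y. c \<in> carrier F \<Longrightarrow> x \<in> carrier V \<Longrightarrow> y \<in> carrier V \<Longrightarrow> dot (c \<odot>\<^bsub>V\<^esub> x) y = c \<otimes> dot x y" by (rule sm)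
  show "\<And>c x y. c \<in> carrier F \<Longrightarrow> x \<in> carrier V \<Longrightarrow> y \<in> carrier V \<Longrightarrow> dot x (c \<odot>\<^bsub>V\<^esub> y) = c \<otimes> dot x y"
    using comm sm by simp
  show "\<And>x y. x \<in> carrier V \<Longrightarrow> y \<in> carrier V \<Longrightarrow> dot x y = \<zero> \<Longrightarrow> dot y x = \<zero>" using comm by simp
  show "x = \<zero>\<^bsub>V\<^esub>" if x: "x \<in> carrier V" and z: "\<And>y. y \<in> carrier V \<Longrightarrow> dot x y = \<zero>" for x
  proof (rule vec_eqI[OF x M.zero_closed])
    fix i assume i: "i < n"
    have "dot x (unit_v i) = (\<Oplus>k\<in>{..<n}. if i = k then x k else \<zero>)"
      unfolding dot_def using x by (intro R.finsum_cong') (auto simp: unit_v_def vec_in)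
    also have "\<dots> = x i" using x i by (intro R.finsum_singleton) (auto simp: vec_in)
    finally show "x i = \<zero>\<^bsub>V\<^esub> i" using z[OF unit_v_closed, of i] i by (simp add: coord_simps(2))
  qed
qed auto

lemma linear_class_bounds:
  assumes "h \<in> SL_set F n" "n > 0"
  shows "class_bounds 2 n (SL_set F n) h"
proof -
  interpret f: form_space F V dot "\<lambda>c. c" by (rule dot_form_space)
  interpret fa: form_action F V dot "\<lambda>c. c" "GL F n" "\<lambda>g v. vm v g" by unfold_locales
  show ?thesis
  proof (rule fa.class_bounds_dual_pair[OF subgroup_SL assms(1) card_V assms(2)])
    fix w p assume "w \<in> carrier V" "p \<in> carrier V" "dot w p = \<zero>"
    then show "\<exists>u\<in>SL_set F n. \<forall>x\<in>carrier V. vm x u = x \<oplus>\<^bsub>V\<^esub> dot x p \<odot>\<^bsub>V\<^esub> w"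
      by (intro transvection_SL f.linear_on_f sub_carrier)
  qed
qed

lemma form_space_sesquilinear:
  assumes "sesquilinear_form F n \<tau> f" "nondegenerate F n f"
    "\<And>x y. x \<in> carrier V \<Longrightarrow> y \<in> carrier V \<Longrightarrow> f x y = \<zero> \<Longrightarrow> f y x = \<zero>"
    "\<And>c. c \<in> carrier F \<Longrightarrow> \<tau> c \<in> carrier F" "\<And>c. c \<in> carrier F \<Longrightarrow> \<tau> (\<tau> c) = c"
  shows "form_space F V f \<tau>"
proof unfold_locales
  show "\<And>x. x \<in> carrier V \<Longrightarrow> (\<And>y. y \<in> carrier V \<Longrightarrow> f x y = \<zero>) \<Longrightarrow> x = \<zero>\<^bsub>V\<^esub>"
    using assms(2) unfolding nondegenerate_def by blast
qed (use assms in \<open>auto simp: sesquilinear_form_def\<close>)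

lemma symplectic_class_bounds:
  assumes alt: "alternating_form F n f" and nd: "nondegenerate F n f"
    and h: "h \<in> isometries F n f" and n: "n \<ge> 12"
  shows "subgroup (isometries F n f) (GL F n)" "class_bounds 1 n (isometries F n f) h"
proof -
  have ses: "sesquilinear_form F n (\<lambda>c. c) f" and z: "\<And>v. v \<in> carrier V \<Longrightarrow> f v v = \<zero>"
    using alt by (auto simp: alternating_form_def)
  have cl: "\<And>u v. u \<in> carrier V \<Longrightarrow> v \<in> carrier V \<Longrightarrow> f u v \<in> carrier F" using ses by (auto simp: sesquilinear_form_def)
  have skew: "f y x = \<ominus> f x y" if "x \<in> carrier V" "y \<in> carrier V" for x y
  proof -
    have "f (x \<oplus>\<^bsub>V\<^esub> y) (x \<oplus>\<^bsub>V\<^esub> y) = f x y \<oplus> f y x"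
    proof -
      have "f (x \<oplus>\<^bsub>V\<^esub> y) (x \<oplus>\<^bsub>V\<^esub> y) = (f x x \<oplus> f y x) \<oplus> (f x y \<oplus> f y y)"
        using ses that by (simp add: sesquilinear_form_def)
      then show ?thesis using that z cl by (simp add: R.a_comm)
    qed
    then have "f y x \<oplus> f x y = \<zero>" using z that cl by (simp add: R.a_comm)
    then show ?thesis using cl that by (simp add: R.minus_equality)
  qed
  have fs: "form_space F V f (\<lambda>c. c)"
  proof (rule form_space_sesquilinear[OF ses nd])
    show "f y x = \<zero>" if "x \<in> carrier V" "y \<in> carrier V" "f x y = \<zero>" for x y
      unfolding skew[OF that(1,2)] that(3) by simp
  qed auto
  interpret f: form_space F V f "\<lambda>c. c" by fact
  \<comment> \<open>An alternating form vanishes on the diagonal, so every vector counts as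
    singular.\<close>
  interpret p: polar_space F V f "\<lambda>c. c" "carrier V"
  proof unfold_locales
    show "\<exists>c\<in>carrier F. v \<oplus>\<^bsub>V\<^esub> c \<odot>\<^bsub>V\<^esub> e \<in> carrier V" if "e \<in> carrier V" "v \<in> carrier V" for e v
      using that by (intro bexI[of _ \<zero>]) auto
    show "\<exists>v\<in>Y \<inter> carrier V. v \<noteq> \<zero>\<^bsub>V\<^esub>" if Y: "sub Y" and c: "card (carrier F) ^ 5 \<le> card Y" for Y
    proof -
      have "1 < Q ^ 5" using Q_ge_2 by (intro one_less_power) auto
      then have "card {\<zero>\<^bsub>V\<^esub>} < card Y" using c by (simp add: Q_def)
      then show ?thesis using exists_not_in[OF sub_triv] sub_in[OF Y] by blast
    qed
  qed (use z in auto)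
  interpret pa: polar_action F V f "\<lambda>c. c" "carrier V" "GL F n" "\<lambda>g v. vm v g" by unfold_locales
  show sg: "subgroup (isometries F n f) (GL F n)" by (rule subgroup_isometries[OF cl])
  show "class_bounds 1 n (isometries F n f) h"
  proof (rule pa.class_bounds_polar[OF sg h card_V n])
    show "f.isometry (\<lambda>v. vm v t)" if "t \<in> isometries F n f" for t
      using that act_lin by (auto simp: f.isometry_def isometries_def)
    fix e v assume e: "e \<in> carrier V" and v: "v \<in> carrier V" "f v e = \<zero>"
    \<comment> \<open>The Siegel transformation with \<epsilon> = -1; as \<open>f v v\<close> is
      zero, c = 0 satisfies the condition.\<close>
    obtain u where u: "u \<in> SL_set F n" "\<And>x. x \<in> carrier V \<Longrightarrow>
      vm x u = ((x \<oplus>\<^bsub>V\<^esub> f x v \<odot>\<^bsub>V\<^esub> e) \<oplus>\<^bsub>V\<^esub> (\<ominus> (\<ominus> \<one> \<otimes> f x e)) \<odot>\<^bsub>V\<^esub> v) \<oplus>\<^bsub>V\<^esub> (\<zero> \<otimes> f x e) \<odot>\<^bsub>V\<^esub> e"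
      using transvection_triple[OF fs _ _ e z[OF e] v, of "\<ominus> \<one>" \<zero>] by blast
    have "f (vm x u) (vm y u) = f x y" if x: "x \<in> carrier V" and y: "y \<in> carrier V" for x y
    proof (rule f.siegel_isometry[of "\<ominus> \<one>" e v \<zero> x y "\<lambda>x. vm x u", OF _ _ _ _ _ _ e z[OF e] v _ _ x y u(2)])
      show "f y x = \<ominus> \<one> \<otimes> f x y" if "x \<in> carrier V" "y \<in> carrier V" for x y
        unfolding skew[OF that] using that cl by (simp add: l_minus)
    qed (use v z in \<open>auto simp: l_minus r_minus\<close>)
    then have "u \<in> isometries F n f" using u by (auto simp: isometries_def SL_set_def)
    moreover have "vm y u = y \<oplus>\<^bsub>V\<^esub> f y v \<odot>\<^bsub>V\<^esub> e" if "y \<in> carrier V" "f y e = \<zero>" for y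
      using u(2)[OF that(1)] that e v by simp
    ultimately show "\<exists>u\<in>isometries F n f. \<forall>y\<in>carrier V. f y e = \<zero> \<longrightarrow> vm y u = y \<oplus>\<^bsub>V\<^esub> f y v \<odot>\<^bsub>V\<^esub> e"
      by blast
  qed
qed

end

section \<open>Norm and trace of a quadratic extension of finite fields\<close>

context field
begin

text \<open>A nonzero fixed point of the q-th power is a root of unity of order dividing q -
  1.\<close>

lemma card_frobenius_fixed_le:
  assumes fin: "finite (carrier R)" and q: "q \<ge> 2"
  shows "card {a \<in> carrier R. a [^] (q::nat) = a} \<le> q" "card {a \<in> carrier R. a \<noteq> \<zero> \<and> a [^] (q::nat) = a} \<le> q - 1"
proof -
  have eq: "a [^] (q - 1) = \<one>" if "a \<in> carrier R" "a \<noteq> \<zero>" "a [^] q = a" for a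
  proof -
    have "q = Suc (q - 1)" using q by simp
    then have "a [^] (q - 1) \<otimes> a = \<one> \<otimes> a" using that by (metis l_one nat_pow_Suc)
    then show ?thesis using that m_rcancel[of a "a [^] (q - 1)" \<one>] by simp
  qed
  have "card {a \<in> carrier R. a \<noteq> \<zero> \<and> a [^] q = a} \<le> card {a \<in> carrier R. a [^] (q - 1) = \<one>}"
    by (rule card_mono) (use fin eq in auto)
  also have "\<dots> \<le> q - 1" by (rule num_roots_le_deg[OF fin]) (use q in auto)
  finally show le: "card {a \<in> carrier R. a \<noteq> \<zero> \<and> a [^] q = a} \<le> q - 1" .
  have "card {a \<in> carrier R. a [^] q = a} \<le> card (insert \<zero> {a \<in> carrier R. a \<noteq> \<zero> \<and> a [^] q = a})"
    by (rule card_mono) (use fin in auto)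
  also have "\<dots> \<le> Suc (q - 1)" using le fin by (subst card_insert_disjoint) auto
  finally show "card {a \<in> carrier R. a [^] q = a} \<le> q" using q by simp
qed

text \<open>Pure counting: the q^2 - 1 nonzero elements have norm fibres of size at most q + 1, so
  at least q - 1 norms occur, and at most q - 1 nonzero elements are fixed by the q-th
  power.\<close>

lemma frobenius_norm_surj:
  assumes fin: "finite (carrier R)" and card: "card (carrier R) = q * q" and q: "q \<ge> 2"
    and a: "a \<in> carrier R" "a \<noteq> \<zero>" "a [^] q = a"
  shows "\<exists>c\<in>carrier R. c \<otimes> c [^] q = a"
proof -
  let ?S = "carrier R - {\<zero>}" and ?N = "\<lambda>c. c \<otimes> c [^] q"
  let ?X = "{a \<in> carrier R. a \<noteq> \<zero> \<and> a [^] q = a}"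
  have N: "?N c = c [^] Suc q" if "c \<in> carrier R" for c using that by (simp add: m_comm)
  have "card {y \<in> ?S. ?N y = ?N x} \<le> Suc q" if "x \<in> ?S" for x
  proof -
    have "{y \<in> ?S. ?N y = ?N x} = {y \<in> carrier R. y \<noteq> \<zero> \<and> y [^] Suc q = ?N x}" using N by auto
    then show ?thesis using card_coset_roots_le[OF fin, of "Suc q"] by simp
  qed
  then have "card ?S \<le> Suc q * card (?N ` ?S)" using fin by (intro card_fibres_le) auto
  moreover have "card ?S = Suc q * (q - 1)"
  proof -
    have "card ?S = q * q - 1" using fin card by (simp add: card_Diff_singleton)
    then show ?thesis using q by (cases q) auto
  qed
  ultimately have "Suc q * (q - 1) \<le> Suc q * card (?N ` ?S)" by simp
  then have le: "q - 1 \<le> card (?N ` ?S)" by (simp only: mult_le_cancel1)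
  have sub: "?N ` ?S \<subseteq> ?X"
  proof clarify
    fix c assume c: "c \<in> carrier R" "c \<noteq> \<zero>"
    have "(c [^] q) [^] q = c" using finite_field_power_card[OF fin c(1)] card c by (simp add: nat_pow_pow)
    then have "?N c [^] q = ?N c" using c by (simp add: nat_pow_distrib m_comm)
    moreover have "c [^] q \<noteq> \<zero>" using c integral_iff by (induction q) auto
    ultimately show "?N c \<in> carrier R \<and> ?N c \<noteq> \<zero> \<and> ?N c [^] q = ?N c" using c integral_iff by auto
  qed
  have "?N ` ?S = ?X"
    by (rule card_seteq[OF _ sub]) (use fin le card_frobenius_fixed_le(2)[OF fin q] in auto)
  then have "a \<in> ?N ` ?S" using a by auto
  then show ?thesis by auto
qed

text \<open>The same count additively. The kernel has at most \<open>q\<close> elements, because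
  dividing its elements by a fixed nonzero one gives fixed points of the q-th power. Additivity of
  that power is a hypothesis; in the unitary case it is derived from the form.\<close>

lemma frobenius_trace_surj:
  assumes fin: "finite (carrier R)" and card: "card (carrier R) = q * q" and q: "q \<ge> 2"
    and add: "\<And>a b. a \<in> carrier R \<Longrightarrow> b \<in> carrier R \<Longrightarrow> (a \<oplus> b) [^] q = a [^] q \<oplus> b [^] q"
    and a: "a \<in> carrier R" "a [^] q = a"
  shows "\<exists>c\<in>carrier R. c \<oplus> c [^] q = a"
proof -
  let ?T = "\<lambda>c. c \<oplus> c [^] q"
  let ?X = "{a \<in> carrier R. a [^] q = a}"
  have q0: "q \<noteq> 0" using q by simp
  have zq: "\<zero> [^] q = \<zero>" using q by (cases q) auto
  have neg: "(\<ominus> a) [^] q = \<ominus> (a [^] q)" if "a \<in> carrier R" for a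
    using add[of "\<ominus> a" a] that zq by (simp add: l_neg minus_equality)
  have ker: "card {c \<in> carrier R. ?T c = \<zero>} \<le> q"
  proof (cases "\<exists>c0\<in>carrier R. c0 \<noteq> \<zero> \<and> ?T c0 = \<zero>")
    case True
    then obtain c0 where c0: "c0 \<in> carrier R" "c0 \<noteq> \<zero>" "?T c0 = \<zero>" by auto
    have i: "inv c0 \<in> carrier R" "c0 \<otimes> inv c0 = \<one>" "inv c0 \<otimes> c0 = \<one>" using c0 by (auto simp: field_Units)
    have p: "c [^] q = \<ominus> c" if "c \<in> carrier R" "?T c = \<zero>" for c
      using that minus_equality[of "c [^] q" c] by (simp add: a_comm)
    have "c0 [^] q \<otimes> inv c0 [^] q = \<one>" using i c0 by (simp add: nat_pow_distrib[symmetric])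
    then have "\<ominus> (c0 \<otimes> inv c0 [^] q) = \<one>" using p[OF c0(1,3)] c0(1) i(1) by (simp add: l_minus)
    then have "inv c0 \<otimes> (\<ominus> (c0 \<otimes> inv c0 [^] q)) = inv c0" using i by simp
    then have ip: "\<ominus> (inv c0 [^] q) = inv c0" using i c0 by (simp add: r_minus m_assoc[symmetric])
    have "card {c \<in> carrier R. ?T c = \<zero>} \<le> card ?X"
    proof (rule card_inj_on_le[of "\<lambda>x. x \<otimes> inv c0"])
      show "inj_on (\<lambda>x. x \<otimes> inv c0) {c \<in> carrier R. ?T c = \<zero>}"
      proof (rule inj_onI)
        fix x y assume h: "x \<in> {c \<in> carrier R. ?T c = \<zero>}" "y \<in> {c \<in> carrier R. ?T c = \<zero>}" "x \<otimes> inv c0 = y \<otimes> inv c0"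
        then have "x \<otimes> inv c0 \<otimes> c0 = y \<otimes> inv c0 \<otimes> c0" by simp
        then show "x = y" using h(1,2) i c0 by (simp add: m_assoc)
      qed
      show "(\<lambda>x. x \<otimes> inv c0) ` {c \<in> carrier R. ?T c = \<zero>} \<subseteq> ?X"
      proof clarify
        fix c assume c: "c \<in> carrier R" "?T c = \<zero>"
        have "(c \<otimes> inv c0) [^] q = (\<ominus> c) \<otimes> inv c0 [^] q" using c i p by (simp add: nat_pow_distrib)
        also have "\<dots> = c \<otimes> (\<ominus> (inv c0 [^] q))" using c i by (simp add: l_minus r_minus)
        finally show "c \<otimes> inv c0 \<in> carrier R \<and> (c \<otimes> inv c0) [^] q = c \<otimes> inv c0" using ip c i by simp
      qed
    qed (use fin in auto)
    then show ?thesis using card_frobenius_fixed_le(1)[OF fin q] by simp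
  next
    case False
    then have "{c \<in> carrier R. ?T c = \<zero>} \<subseteq> {\<zero>}" by auto
    then have "card {c \<in> carrier R. ?T c = \<zero>} \<le> card {\<zero>}" by (intro card_mono) auto
    then show ?thesis using q by simp
  qed
  have "card {y \<in> carrier R. ?T y = ?T x} \<le> q" if x: "x \<in> carrier R" for x
  proof -
    have "card {y \<in> carrier R. ?T y = ?T x} \<le> card {c \<in> carrier R. ?T c = \<zero>}"
    proof (rule card_inj_on_le[of "\<lambda>y. y \<oplus> \<ominus> x"])
      show "inj_on (\<lambda>y. y \<oplus> \<ominus> x) {y \<in> carrier R. ?T y = ?T x}" using x by (intro inj_onI) auto
      show "(\<lambda>y. y \<oplus> \<ominus> x) ` {y \<in> carrier R. ?T y = ?T x} \<subseteq> {c \<in> carrier R. ?T c = \<zero>}"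
      proof clarify
        fix y assume y: "y \<in> carrier R" "?T y = ?T x"
        have "?T (y \<oplus> \<ominus> x) = ?T y \<oplus> \<ominus> ?T x" using x y(1) by (simp add: add neg minus_add a_ac)
        also have "\<dots> = \<zero>" using y x by (simp add: r_neg)
        finally show "y \<oplus> \<ominus> x \<in> carrier R \<and> ?T (y \<oplus> \<ominus> x) = \<zero>" using x y by simp
      qed
    qed (use fin in auto)
    then show ?thesis using ker by simp
  qed
  then have "card (carrier R) \<le> q * card (?T ` carrier R)" using fin by (intro card_fibres_le) auto
  then have le: "q \<le> card (?T ` carrier R)" using card q by simp
  have sub: "?T ` carrier R \<subseteq> ?X"
  proof clarify
    fix c assume c: "c \<in> carrier R"
    have "(c [^] q) [^] q = c" using finite_field_power_card[OF fin c(1)] card c by (simp add: nat_pow_pow)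
    then show "?T c \<in> carrier R \<and> ?T c [^] q = ?T c" using c by (simp add: add a_comm)
  qed
  have "?T ` carrier R = ?X"
    by (rule card_seteq[OF _ sub]) (use fin le card_frobenius_fixed_le(1)[OF fin q] in auto)
  then have "a \<in> ?T ` carrier R" using a by auto
  then show ?thesis by auto
qed

end

section \<open>Unitary groups\<close>

context finite_coord
begin

lemma unitary_class_bounds:
  assumes herm: "hermitian_form F n q f" and nd: "nondegenerate F n f"
    and card: "card (carrier F) = q * q" and q: "q \<ge> 2"
    and h: "h \<in> SL_set F n \<inter> isometries F n f" and n: "n \<ge> 12"
  shows "subgroup (SL_set F n \<inter> isometries F n f) (GL F n)"
    "class_bounds 1 n (SL_set F n \<inter> isometries F n f) h"
proof -
  define \<tau> where "\<tau> c = c [^] q" for c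
  have ses: "sesquilinear_form F n \<tau> f"
    using herm unfolding hermitian_form_def \<tau>_def[abs_def] by blast
  have sym: "\<And>u v. u \<in> carrier V \<Longrightarrow> v \<in> carrier V \<Longrightarrow> f v u = \<tau> (f u v)"
    using herm unfolding hermitian_form_def \<tau>_def by blast
  have cl: "\<And>u v. u \<in> carrier V \<Longrightarrow> v \<in> carrier V \<Longrightarrow> f u v \<in> carrier F" using ses by (auto simp: sesquilinear_form_def)
  have \<tau>c: "\<tau> c \<in> carrier F" if "c \<in> carrier F" for c using that by (simp add: \<tau>_def)
  have \<tau>\<tau>: "\<tau> (\<tau> c) = c" if "c \<in> carrier F" for c
    using finite_field_power_card[OF finite_F that] card that by (simp add: \<tau>_def nat_pow_pow)
  have \<tau>0: "\<tau> \<zero> = \<zero>" using q by (cases q) (auto simp: \<tau>_def)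
  have \<tau>m: "\<tau> (a \<otimes> b) = \<tau> a \<otimes> \<tau> b" if "a \<in> carrier F" "b \<in> carrier F" for a b
    using that by (simp add: \<tau>_def nat_pow_distrib)
  have fs: "form_space F V f \<tau>"
  proof (rule form_space_sesquilinear[OF ses nd])
    show "f y x = \<zero>" if "x \<in> carrier V" "y \<in> carrier V" "f x y = \<zero>" for x y
      unfolding sym[OF that(1,2)] that(3) by (rule \<tau>0)
  qed (use \<tau>c \<tau>\<tau> in auto)
  interpret f: form_space F V f \<tau> by fact
  \<comment> \<open>Additivity of the q-th power comes from the form: the value at (a + b) y in the
    second argument is expanded in two ways, for a vector at which the form does not vanish.\<close>
  have \<tau>add: "\<tau> (a \<oplus> b) = \<tau> a \<oplus> \<tau> b" if ab: "a \<in> carrier F" "b \<in> carrier F" for a b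
  proof -
    have "unit_v 0 0 = \<one>" using n by (simp add: unit_v_def)
    moreover have "\<zero>\<^bsub>V\<^esub> 0 = \<zero>" using n by (simp add: coord_simps(2))
    ultimately have "unit_v 0 \<noteq> \<zero>\<^bsub>V\<^esub>" by (metis one_not_zero)
    then obtain y where y: "y \<in> carrier V" "f (unit_v 0) y \<noteq> \<zero>" using f.f_nondeg[OF unit_v_closed] by blast
    let ?x = "unit_v 0"
    have x: "?x \<in> carrier V" by (rule unit_v_closed)
    have "\<tau> (a \<oplus> b) \<otimes> f ?x y = (\<tau> a \<oplus> \<tau> b) \<otimes> f ?x y"
      using f.f_smult_right[of "a \<oplus> b" ?x y] f.f_add_right[of "a \<odot>\<^bsub>V\<^esub> y" "b \<odot>\<^bsub>V\<^esub> y" ?x] ab x y \<tau>c cl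
      by (simp add: smult_l_distr f.f_smult_right l_distr)
    then show ?thesis using m_rcancel[OF y(2)] cl x y \<tau>c ab by simp
  qed
  have \<tau>neg: "\<tau> (\<ominus> a) = \<ominus> \<tau> a" if "a \<in> carrier F" for a
    using \<tau>add[of "\<ominus> a" a] that \<tau>0 \<tau>c by (simp add: R.l_neg R.minus_equality)
  have trace: "\<exists>c\<in>carrier F. c \<oplus> \<tau> c = a" if "a \<in> carrier F" "\<tau> a = a" for a
    using frobenius_trace_surj[OF finite_F card q, of a] \<tau>add that by (simp add: \<tau>_def)
  have norm: "\<exists>c\<in>carrier F. c \<otimes> \<tau> c = a" if "a \<in> carrier F" "a \<noteq> \<zero>" "\<tau> a = a" for a
    using frobenius_norm_surj[OF finite_F card q, of a] that by (simp add: \<tau>_def)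
  let ?S = "{v \<in> carrier V. f v v = \<zero>}"
  interpret p: polar_space F V f \<tau> ?S
  proof unfold_locales
    show "c \<odot>\<^bsub>V\<^esub> v \<in> ?S" if "c \<in> carrier F" "v \<in> ?S" for c v
      using that \<tau>c by (simp add: f.f_smult_left f.f_smult_right)
    show "u \<oplus>\<^bsub>V\<^esub> v \<in> ?S" if "u \<in> ?S" "v \<in> ?S" "f u v = \<zero>" for u v
      using that f.f_refl[of u v] by (simp add: f.f_add_left f.f_add_right)
    \<comment> \<open>At v + c e the form takes the value \<open>f v v\<close> plus a trace, and
      surjectivity of the trace lets it cancel \<open>f v v\<close>.\<close>
    show "\<exists>c\<in>carrier F. v \<oplus>\<^bsub>V\<^esub> c \<odot>\<^bsub>V\<^esub> e \<in> ?S" if e: "e \<in> ?S" and v: "v \<in> carrier V" "f v e \<noteq> \<zero>" for e v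
    proof -
      have eV: "e \<in> carrier V" "f e e = \<zero>" using e by auto
      have ev: "f e v \<in> carrier F" "f e v \<noteq> \<zero>" 
        using cl[OF eV(1) v(1)] f.f_refl[OF eV(1) v(1)] v(2) by blast+
      have i: "inv (f e v) \<in> carrier F" "inv (f e v) \<otimes> f e v = \<one>" using ev by (auto simp: field_Units)
      have "\<tau> (\<ominus> f v v) = \<ominus> f v v" using \<tau>neg sym[of v v, symmetric] cl v by simp
      then obtain d where d: "d \<in> carrier F" "d \<oplus> \<tau> d = \<ominus> f v v" using trace[of "\<ominus> f v v"] cl v by auto
      define c where "c = d \<otimes> inv (f e v)"
      have c: "c \<in> carrier F" "c \<otimes> f e v = d" using d i ev by (auto simp: c_def m_assoc)
      have s: "\<tau> c \<otimes> f v e = \<tau> d" 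
        unfolding sym[OF eV(1) v(1)] using \<tau>m[of c "f e v"] c ev by simp
      have "f (v \<oplus>\<^bsub>V\<^esub> c \<odot>\<^bsub>V\<^esub> e) (v \<oplus>\<^bsub>V\<^esub> c \<odot>\<^bsub>V\<^esub> e) = f v v \<oplus> (d \<oplus> \<tau> d)"
        using eV v c \<tau>c d(1) s cl by (simp add: f.f_add_left f.f_add_right f.f_smult_left f.f_smult_right R.a_ac)
      also have "\<dots> = \<zero>" using d(2) cl v by (simp add: R.r_neg)
      finally show ?thesis using c eV v by (intro bexI[of _ c]) auto
    qed
    \<comment> \<open>If \<open>u\<close> is not isotropic, take a nonzero \<open>v\<close>
      orthogonal to it. If \<open>v\<close> is not isotropic either, choose \<open>c\<close> with
      norm - f(u, u) / f(v, v); then u + c v is isotropic.\<close>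
    show "\<exists>v\<in>Y \<inter> ?S. v \<noteq> \<zero>\<^bsub>V\<^esub>" if Y: "sub Y" and c5: "card (carrier F) ^ 5 \<le> card Y" for Y
    proof -
      have YV: "\<And>y. y \<in> Y \<Longrightarrow> y \<in> carrier V" using Y sub_in by auto
      have "Q ^ 1 < Q ^ 5" using Q_ge_2 by (intro power_strict_increasing) auto
      then have cY: "Q < card Y" using c5 by (simp add: Q_def)
      then have "card {\<zero>\<^bsub>V\<^esub>} < card Y" using Q_ge_2 by simp
      then obtain u where u: "u \<in> Y" "u \<noteq> \<zero>\<^bsub>V\<^esub>" using exists_not_in[OF sub_triv] by blast
      show ?thesis
      proof (cases "f u u = \<zero>")
        case False
        have uF: "f u u \<in> carrier F" using cl YV u by auto
        have lin: "linear_on Y (\<lambda>y. f y u)" by (rule f.linear_on_f[OF Y YV[OF u(1)]])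
        let ?K = "{y \<in> Y. f y u = \<zero>}"
        have "card Y \<le> Q * card ?K" by (rule card_kernel_ge[OF Y lin])
        then have "card {\<zero>\<^bsub>V\<^esub>} < card ?K" using cY by (cases "card ?K"; cases "card ?K - 1") auto
        then obtain v where v: "v \<in> Y" "f v u = \<zero>" "v \<noteq> \<zero>\<^bsub>V\<^esub>" using exists_not_in[OF sub_triv, of ?K] by blast
        have uv: "f u v = \<zero>" by (rule f.f_refl) (use v u YV in auto)
        show ?thesis
        proof (cases "f v v = \<zero>")
          case False2: False
          have vF: "f v v \<in> carrier F" using cl YV v by auto
          have i: "inv (f v v) \<in> carrier F" "inv (f v v) \<otimes> f v v = \<one>" "f v v \<otimes> inv (f v v) = \<one>"
            using vF False2 by (auto simp: field_Units)
          have si: "\<tau> (inv (f v v)) = inv (f v v)"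
          proof -
            have "\<tau> (inv (f v v)) \<otimes> f v v = \<one>"
              using \<tau>m[OF i(1) vF] sym[of v v, symmetric] YV v i by (simp add: \<tau>_def)
            then have "\<tau> (inv (f v v)) \<otimes> f v v \<otimes> inv (f v v) = inv (f v v)" using i by simp
            then show ?thesis using i vF \<tau>c by (simp add: m_assoc)
          qed
          let ?a = "\<ominus> (f u u \<otimes> inv (f v v))"
          have "\<tau> ?a = ?a" using \<tau>neg \<tau>m si i uF sym[of u u, symmetric] YV u by simp
          moreover have "inv (f v v) \<noteq> \<zero>" using i vF by auto
          then have "?a \<noteq> \<zero>" using i uF False integral_iff by (simp add: R.add.inv_eq_1_iff)
          ultimately obtain c where c: "c \<in> carrier F" "c \<otimes> \<tau> c = ?a" using norm[of ?a] i uF by auto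
          let ?w = "u \<oplus>\<^bsub>V\<^esub> c \<odot>\<^bsub>V\<^esub> v"
          have "f ?w ?w = f u u \<oplus> (c \<otimes> \<tau> c) \<otimes> f v v"
            using c(1) \<tau>c[OF c(1)] YV u v uv cl by (simp add: f.f_add_left f.f_add_right f.f_smult_left f.f_smult_right m_ac)
          also have "\<dots> = \<zero>" using c(2) i vF uF by (simp add: l_minus m_assoc R.r_neg)
          finally have "f ?w ?w = \<zero>" .
          moreover have "?w \<noteq> \<zero>\<^bsub>V\<^esub>"
          proof
            assume "?w = \<zero>\<^bsub>V\<^esub>"
            then have "f ?w u = \<zero>" using YV u by simp
            then show False using False c YV u v uF by (simp add: f.f_add_left f.f_smult_left)
          qed
          moreover have "?w \<in> Y" using Y u v c sub_add sub_smult by auto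
          ultimately show ?thesis using YV by (intro bexI[of _ ?w]) auto
        qed (use v YV in auto)
      qed (use u YV in auto)
    qed
  qed auto
  interpret pa: polar_action F V f \<tau> ?S "GL F n" "\<lambda>g v. vm v g" by unfold_locales
  let ?M = "SL_set F n \<inter> isometries F n f"
  show sg: "subgroup ?M (GL F n)"
    by (rule Gp.subgroups_Inter_pair[OF subgroup_SL subgroup_isometries[OF cl]])
  show "class_bounds 1 n ?M h"
  proof (rule pa.class_bounds_polar[OF sg h card_V n])
    show "f.isometry (\<lambda>v. vm v t)" if "t \<in> ?M" for t
      using that act_lin by (auto simp: f.isometry_def isometries_def)
    fix e v assume e: "e \<in> ?S" and v: "v \<in> carrier V" "f v e = \<zero>"
    have eV: "e \<in> carrier V" "f e e = \<zero>" using e by auto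
    have "\<tau> (\<ominus> f v v) = \<ominus> f v v" using \<tau>neg sym[of v v, symmetric] cl v by simp
    then obtain c where c: "c \<in> carrier F" "c \<oplus> \<tau> c = \<ominus> f v v" using trace[of "\<ominus> f v v"] cl v by auto
    obtain u where u: "u \<in> SL_set F n" "\<And>x. x \<in> carrier V \<Longrightarrow>
      vm x u = ((x \<oplus>\<^bsub>V\<^esub> f x v \<odot>\<^bsub>V\<^esub> e) \<oplus>\<^bsub>V\<^esub> (\<ominus> (\<one> \<otimes> f x e)) \<odot>\<^bsub>V\<^esub> v) \<oplus>\<^bsub>V\<^esub> (c \<otimes> f x e) \<odot>\<^bsub>V\<^esub> e"
      using transvection_triple[OF fs _ c(1) eV v, of "\<one>"] by blast
    have c0: "c \<oplus> (\<one> \<otimes> \<tau> c \<oplus> \<one> \<otimes> f v v) = \<zero>"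
    proof -
      have "c \<oplus> (\<one> \<otimes> \<tau> c \<oplus> \<one> \<otimes> f v v) = (c \<oplus> \<tau> c) \<oplus> f v v" 
        using c(1) \<tau>c[OF c(1)] cl v by (simp add: R.a_assoc)
      also have "\<dots> = \<zero>" unfolding c(2) using cl v by (simp add: R.l_neg)
      finally show ?thesis .
    qed
    have "f (vm x u) (vm y u) = f x y" if x: "x \<in> carrier V" and y: "y \<in> carrier V" for x y
    proof (rule f.siegel_isometry[of "\<one>" e v c x y "\<lambda>x. vm x u", OF _ _ _ _ \<tau>m \<tau>neg eV v c(1) c0 x y u(2)])
      show "\<tau> (f y x) = \<one> \<otimes> f x y" if "x \<in> carrier V" "y \<in> carrier V" for x y
        using sym[OF that(2,1)] cl that by simp
    qed (auto simp: \<tau>_def)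
    then have "u \<in> ?M" using u by (auto simp: isometries_def SL_set_def)
    moreover have "vm y u = y \<oplus>\<^bsub>V\<^esub> f y v \<odot>\<^bsub>V\<^esub> e" if "y \<in> carrier V" "f y e = \<zero>" for y
      using u(2)[OF that(1)] that eV v c by simp
    ultimately show "\<exists>u\<in>?M. \<forall>y\<in>carrier V. f y e = \<zero> \<longrightarrow> vm y u = y \<oplus>\<^bsub>V\<^esub> f y v \<odot>\<^bsub>V\<^esub> e"
      by blast
  qed
qed

end

section \<open>Orthogonal groups\<close>

text \<open>In every characteristic more than half of the field elements are squares, so the values
  of a x^2 and of -(b y^2 + c) must meet.\<close>

lemma (in field) diagonal_ternary_zero:
  assumes fin: "finite (carrier R)" and abc: "a \<in> carrier R" "b \<in> carrier R" "c \<in> carrier R" "a \<noteq> \<zero>" "b \<noteq> \<zero>"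
  shows "\<exists>x\<in>carrier R. \<exists>y\<in>carrier R. a \<otimes> (x \<otimes> x) \<oplus> b \<otimes> (y \<otimes> y) \<oplus> c = \<zero>"
proof -
  let ?sq = "(\<lambda>x. x \<otimes> x) ` carrier R" and ?sq1 = "(\<lambda>x. x \<otimes> x) ` (carrier R - {\<zero>})"
  have "card {y \<in> carrier R - {\<zero>}. y \<otimes> y = x \<otimes> x} \<le> 2" if x: "x \<in> carrier R - {\<zero>}" for x
  proof -
    have e: "y [^] (2::nat) = y \<otimes> y" if "y \<in> carrier R" for y using that by (simp add: numeral_2_eq_2)
    have "{y \<in> carrier R - {\<zero>}. y \<otimes> y = x \<otimes> x} = {y \<in> carrier R. y \<noteq> \<zero> \<and> y [^] (2::nat) = x \<otimes> x}"
      using e by auto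
    then show ?thesis using card_coset_roots_le[OF fin, of 2] by simp
  qed
  then have "card (carrier R - {\<zero>}) \<le> 2 * card ?sq1" using fin by (intro card_fibres_le) auto
  moreover have "card (carrier R - {\<zero>}) = card (carrier R) - 1" using fin by (simp add: card_Diff_singleton)
  moreover have "Suc (card ?sq1) \<le> card ?sq"
  proof -
    have "\<zero> \<notin> ?sq1"
    proof
      assume "\<zero> \<in> ?sq1"
      then obtain x where "x \<in> carrier R" "x \<noteq> \<zero>" "\<zero> = x \<otimes> x" by blast
      then show False using integral_iff[of x x] by simp
    qed
    then have "Suc (card ?sq1) = card (insert \<zero> ?sq1)" using fin by simp
    also have "insert \<zero> ?sq1 \<subseteq> ?sq" by (auto intro: image_eqI[of _ _ \<zero>])
    then have "card (insert \<zero> ?sq1) \<le> card ?sq" using fin by (intro card_mono) auto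
    finally show ?thesis .
  qed
  moreover have "card (carrier R) > 0" using fin by (auto simp: card_gt_0_iff)
  ultimately have big: "card (carrier R) < 2 * card ?sq" by linarith
  have sqR: "?sq \<subseteq> carrier R" by auto
  let ?A = "(\<lambda>s. a \<otimes> s) ` ?sq" and ?B = "(\<lambda>s. \<ominus> (b \<otimes> s \<oplus> c)) ` ?sq"
  have cA: "card ?A = card ?sq"
    using abc by (intro card_image inj_onI) (auto simp: m_lcancel)
  have cB: "card ?B = card ?sq"
  proof (intro card_image inj_onI)
    fix s t assume st: "s \<in> ?sq" "t \<in> ?sq" "\<ominus> (b \<otimes> s \<oplus> c) = \<ominus> (b \<otimes> t \<oplus> c)"
    have "s \<in> carrier R" "t \<in> carrier R" using st by auto
    then have "b \<otimes> s \<oplus> c = b \<otimes> t \<oplus> c" using st(3) abc by (metis a_closed m_closed minus_minus)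
    then show "s = t" using \<open>s \<in> carrier R\<close> \<open>t \<in> carrier R\<close> abc by (simp add: m_lcancel)
  qed
  have "?A \<inter> ?B \<noteq> {}"
  proof
    assume d: "?A \<inter> ?B = {}"
    have "card (?A \<union> ?B) = card ?A + card ?B" using fin d by (intro card_Un_disjoint) auto
    moreover have "card (?A \<union> ?B) \<le> card (carrier R)" using fin abc by (intro card_mono) auto
    ultimately show False using big cA cB by linarith
  qed
  then obtain x y where xy: "x \<in> carrier R" "y \<in> carrier R" "a \<otimes> (x \<otimes> x) = \<ominus> (b \<otimes> (y \<otimes> y) \<oplus> c)" by auto
  have "a \<otimes> (x \<otimes> x) \<oplus> b \<otimes> (y \<otimes> y) \<oplus> c = \<ominus> (b \<otimes> (y \<otimes> y) \<oplus> c) \<oplus> (b \<otimes> (y \<otimes> y) \<oplus> c)"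
    using xy(1,2) abc by (simp add: xy(3) a_assoc del: minus_add)
  also have "\<dots> = \<zero>" using xy(1,2) abc by (intro l_neg) auto
  finally show ?thesis using xy by blast
qed

locale quadratic_space = finite_coord F n for F :: "'a ring" (structure) and n :: nat +
  fixes q :: "(nat \<Rightarrow> 'a) \<Rightarrow> 'a"
  assumes nondegenerate_q: "nondegenerate_quadratic_form F n q"
begin

definition pf :: "(nat \<Rightarrow> 'a) \<Rightarrow> (nat \<Rightarrow> 'a) \<Rightarrow> 'a" where "pf = polar_form F n q"

lemma q_closed [simp]: "v \<in> carrier V \<Longrightarrow> q v \<in> carrier F"
  and q_smult: "c \<in> carrier F \<Longrightarrow> v \<in> carrier V \<Longrightarrow> q (c \<odot>\<^bsub>V\<^esub> v) = c \<otimes> c \<otimes> q v"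
  and ses_pf: "sesquilinear_form F n (\<lambda>c. c) pf"
  and nondeg_pf: "nondegenerate F n pf"
  using nondegenerate_q
  by (auto simp: nondegenerate_quadratic_form_def quadratic_form_def pf_def)

lemma pf_eq: "pf u v = q (u \<oplus>\<^bsub>V\<^esub> v) \<ominus> q u \<ominus> q v"
  by (simp add: pf_def polar_form_def)

lemma q_add: "u \<in> carrier V \<Longrightarrow> v \<in> carrier V \<Longrightarrow> q (u \<oplus>\<^bsub>V\<^esub> v) = q u \<oplus> q v \<oplus> pf u v"
proof -
  assume V: "u \<in> carrier V" "v \<in> carrier V"
  have "q u \<in> carrier F" "q v \<in> carrier F" "q (u \<oplus>\<^bsub>V\<^esub> v) \<in> carrier F" using V by auto
  then show ?thesis unfolding pf_eq by algebra
qed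

lemma pf_sym: "u \<in> carrier V \<Longrightarrow> v \<in> carrier V \<Longrightarrow> pf u v = pf v u"
proof -
  assume V: "u \<in> carrier V" "v \<in> carrier V"
  have c: "u \<oplus>\<^bsub>V\<^esub> v = v \<oplus>\<^bsub>V\<^esub> u" using V by (rule M.a_comm)
  have "q u \<in> carrier F" "q v \<in> carrier F" "q (v \<oplus>\<^bsub>V\<^esub> u) \<in> carrier F" using V by auto
  then show ?thesis unfolding pf_eq c by algebra
qed

lemma form_space_pf: "form_space F V pf (\<lambda>c. c)"
proof (rule form_space_sesquilinear[OF ses_pf nondeg_pf])
  show "pf y x = \<zero>" if "x \<in> carrier V" "y \<in> carrier V" "pf x y = \<zero>" for x y
    using pf_sym[OF that(2,1)] that(3) by simp
qed auto

end

sublocale quadratic_space \<subseteq> form_action F "coord_space F n" pf "\<lambda>c. c" "GL F n" "\<lambda>g v. vec_mat F n v g"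
  by (intro form_action.intro form_space_pf linear_action_axioms)

context quadratic_space
begin

definition singular :: "(nat \<Rightarrow> 'a) set" where "singular = {v \<in> carrier V. q v = \<zero>}"

lemma pf_self: "v \<in> carrier V \<Longrightarrow> pf v v = q v \<oplus> q v"
proof -
  assume v: "v \<in> carrier V"
  have "v \<oplus>\<^bsub>V\<^esub> v = (\<one> \<oplus> \<one>) \<odot>\<^bsub>V\<^esub> v" using v by (simp add: smult_l_distr)
  then have "q (v \<oplus>\<^bsub>V\<^esub> v) = (\<one> \<oplus> \<one>) \<otimes> (\<one> \<oplus> \<one>) \<otimes> q v" using q_smult v by simp
  moreover have "q v \<in> carrier F" using v by simp
  ultimately show ?thesis unfolding pf_eq by algebra
qed

text \<open>The substance is the existence of singular vectors. Three independent, mutually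
  orthogonal, nonsingular vectors give a diagonal ternary form, which has a zero. In characteristic
  2 a vector is orthogonal to itself, so the second one is taken off the line of the first and the
  third off the plane of both. Two orthogonality conditions must therefore leave more than two
  dimensions; hence 5.\<close>

lemma polar_space_pf: "polar_space F V pf (\<lambda>c. c) singular"
proof unfold_locales
  show "singular \<subseteq> carrier V" by (auto simp: singular_def)
  show "c \<odot>\<^bsub>V\<^esub> v \<in> singular" if "c \<in> carrier F" "v \<in> singular" for c v
    using that by (simp add: singular_def q_smult)
  show "u \<oplus>\<^bsub>V\<^esub> v \<in> singular" if "u \<in> singular" "v \<in> singular" "pf u v = \<zero>" for u v
    using that by (simp add: singular_def q_add)
  show "pf v v = \<zero>" if "v \<in> singular" for v using that pf_self by (simp add: singular_def)
  show "\<exists>c\<in>carrier F. v \<oplus>\<^bsub>V\<^esub> c \<odot>\<^bsub>V\<^esub> e \<in> singular"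
    if e: "e \<in> singular" and v: "v \<in> carrier V" "pf v e \<noteq> \<zero>" for e v
  proof -
    have eV: "e \<in> carrier V" "q e = \<zero>" using e by (auto simp: singular_def)
    have i: "inv (pf v e) \<in> carrier F" "inv (pf v e) \<otimes> pf v e = \<one>" using v eV by (auto simp: field_Units)
    let ?c = "\<ominus> (q v \<otimes> inv (pf v e))"
    have c: "?c \<in> carrier F" using i v by simp
    have "q (v \<oplus>\<^bsub>V\<^esub> ?c \<odot>\<^bsub>V\<^esub> e) = q v \<oplus> ?c \<otimes> pf v e"
      using eV v c by (simp add: q_add q_smult f_smult_right)
    also have "?c \<otimes> pf v e = \<ominus> q v" using i v eV by (simp add: l_minus m_assoc)
    finally show ?thesis using c eV v by (intro bexI[of _ ?c]) (auto simp: singular_def R.r_neg)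
  qed
  show "\<exists>v\<in>Y \<inter> singular. v \<noteq> \<zero>\<^bsub>V\<^esub>" if Y: "sub Y" and c5: "card (carrier F) ^ 5 \<le> card Y" for Y
  proof (rule ccontr)
    assume "\<not> ?thesis"
    then have ns: "q y \<noteq> \<zero>" if "y \<in> Y" "y \<noteq> \<zero>\<^bsub>V\<^esub>" for y
      using that Y sub_in by (auto simp: singular_def)
    have YV: "\<And>y. y \<in> Y \<Longrightarrow> y \<in> carrier V" using Y sub_in by auto
    have c5': "Q ^ 5 \<le> card Y" using c5 by (simp add: Q_def)
    have Qp: "Q ^ i < Q ^ j" if "i < j" for i j using that Q_ge_2 by (intro power_strict_increasing) auto
    have "card {\<zero>\<^bsub>V\<^esub>} < card Y" using Qp[of 0 5] c5' by simp
    then obtain u where u: "u \<in> Y" "u \<noteq> \<zero>\<^bsub>V\<^esub>" using exists_not_in[OF sub_triv] by blast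
    have uV: "u \<in> carrier V" using YV u by auto
    let ?K = "{y \<in> Y. pf y u = \<zero>}"
    have sK: "sub ?K" by (rule sub_linear_kernel[OF Y linear_on_f[OF Y uV]])
    have "card Y \<le> Q * card ?K" by (rule card_kernel_ge[OF Y linear_on_f[OF Y uV]])
    from order_trans[OF c5' this] have "Q * Q ^ 4 \<le> Q * card ?K" by (simp add: numeral_eq_Suc)
    then have cK: "Q ^ 4 \<le> card ?K" using Q_ge_2 by simp
    have "card (line u) < card ?K" using card_line_le[of u] cK Qp[of 1 4] by simp
    then obtain v where v: "v \<in> ?K" "v \<notin> line u" using exists_not_in[OF sub_line[OF uV]] by blast
    have vV: "v \<in> carrier V" using YV v by auto
    let ?K2 = "{y \<in> ?K. pf y v = \<zero>}"
    have "card ?K \<le> Q * card ?K2" by (rule card_kernel_ge[OF sK linear_on_f[OF sK vV]])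
    from order_trans[OF cK this] have "Q * Q ^ 3 \<le> Q * card ?K2" by (simp add: numeral_eq_Suc)
    then have cK2: "Q ^ 3 \<le> card ?K2" using Q_ge_2 by simp
    have sl: "sub (adj (line u) v)" by (rule sub_adj[OF sub_line[OF uV] vV])
    have "card (adj (line u) v) = Q * card (line u)" by (rule card_adj[OF sub_line[OF uV] vV v(2)])
    also have "\<dots> \<le> Q * Q" using card_line_le[of u] by simp
    also have "\<dots> < Q ^ 3" using Qp[of 2 3] by (simp add: power2_eq_square)
    also have "\<dots> \<le> card ?K2" by (rule cK2)
    finally obtain w where w: "w \<in> ?K2" "w \<notin> adj (line u) v" using exists_not_in[OF sl] by blast
    have wV: "w \<in> carrier V" using YV w by auto
    have "v \<noteq> \<zero>\<^bsub>V\<^esub>" using v sub_zero[OF sub_line[OF uV]] by auto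
    then have nz: "q u \<noteq> \<zero>" "q v \<noteq> \<zero>" using ns[OF u] ns[of v] v(1) by blast+
    have "\<exists>x\<in>carrier F. \<exists>y\<in>carrier F. q u \<otimes> (x \<otimes> x) \<oplus> q v \<otimes> (y \<otimes> y) \<oplus> q w = \<zero>"
      by (rule diagonal_ternary_zero[OF finite_F q_closed[OF uV] q_closed[OF vV] q_closed[OF wV] nz])
    then obtain x y where xy: "x \<in> carrier F" "y \<in> carrier F" "q u \<otimes> (x \<otimes> x) \<oplus> q v \<otimes> (y \<otimes> y) \<oplus> q w = \<zero>"
      by (elim bexE)
    let ?a = "x \<odot>\<^bsub>V\<^esub> u \<oplus>\<^bsub>V\<^esub> y \<odot>\<^bsub>V\<^esub> v"
    have aV: "?a \<in> carrier V" using xy uV vV by simp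
    have al: "?a \<in> adj (line u) v" using xy by (auto simp: in_adj_iff line_def)
    have o: "pf u v = \<zero>" "pf u w = \<zero>" "pf v w = \<zero>"
      using v w pf_sym[OF uV vV] pf_sym[OF uV wV] pf_sym[OF vV wV] by simp_all
    have "q ?a = x \<otimes> x \<otimes> q u \<oplus> y \<otimes> y \<otimes> q v"
      using xy uV vV o by (simp add: q_add q_smult f_smult_left f_smult_right)
    moreover have "pf ?a w = \<zero>" using xy uV vV wV o by (simp add: f_add_left f_smult_left)
    ultimately have "q (?a \<oplus>\<^bsub>V\<^esub> w) = \<zero>" using xy(1,2) xy(3)[symmetric] uV vV wV aV by (simp add: q_add m_comm)
    moreover have "?a \<oplus>\<^bsub>V\<^esub> w \<in> Y" using Y u v w xy by (auto intro!: sub_add sub_smult)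
    moreover have "?a \<oplus>\<^bsub>V\<^esub> w \<noteq> \<zero>\<^bsub>V\<^esub>"
    proof
      assume z: "?a \<oplus>\<^bsub>V\<^esub> w = \<zero>\<^bsub>V\<^esub>"
      have "w = (?a \<oplus>\<^bsub>V\<^esub> w) \<ominus>\<^bsub>V\<^esub> ?a" using aV wV add_minus_cancel by simp
      also have "\<dots> \<in> adj (line u) v" unfolding z by (rule sub_minus[OF sl sub_zero[OF sl] al])
      finally show False using w by simp
    qed
    ultimately show False using ns by blast
  qed
qed

end

sublocale quadratic_space \<subseteq> polar_action F "coord_space F n" pf "\<lambda>c. c" singular "GL F n" "\<lambda>g v. vec_mat F n v g"
  by (intro polar_action.intro polar_space_pf form_action_axioms)

section \<open>Siegel transformations and the derived subgroup\<close>

context quadratic_space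
begin

abbreviation Oq where "Oq \<equiv> orthogonal_set F n q"

lemma subgroup_Oq: "subgroup Oq (GL F n)"
proof (rule Gp.subgroupI)
  show "Oq \<noteq> {}" using act_one Gp.one_closed by (auto simp: orthogonal_set_def)
  show "a \<otimes>\<^bsub>GL F n\<^esub> b \<in> Oq" if "a \<in> Oq" "b \<in> Oq" for a b
    using that by (auto simp: orthogonal_set_def act_mult act_closed)
  show "inv\<^bsub>GL F n\<^esub> a \<in> Oq" if a: "a \<in> Oq" for a
  proof -
    have aG: "a \<in> carrier (GL F n)" using a by (auto simp: orthogonal_set_def)
    have "q (vm u (inv\<^bsub>GL F n\<^esub> a)) = q u" if u: "u \<in> carrier V" for u
    proof -
      have "vm u (inv\<^bsub>GL F n\<^esub> a) \<in> carrier V" using u aG act_closed by auto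
      then have "q (vm (vm u (inv\<^bsub>GL F n\<^esub> a)) a) = q (vm u (inv\<^bsub>GL F n\<^esub> a))" using a by (auto simp: orthogonal_set_def)
      then show ?thesis using act_inv aG u by simp
    qed
    then show ?thesis using aG by (auto simp: orthogonal_set_def)
  qed
qed (auto simp: orthogonal_set_def)

lemma pf_preserved:
  assumes "lin T" "\<And>v. v \<in> carrier V \<Longrightarrow> q (T v) = q v"
  shows "isometry T"
  using assms by (simp add: isometry_def pf_eq lin_add[symmetric])

lemma Oq_isometry: "g \<in> Oq \<Longrightarrow> isometry (\<lambda>v. vm v g)"
  using act_lin by (intro pf_preserved) (auto simp: orthogonal_set_def)

text \<open>The Siegel transformation, written with \<open>q v\<close> instead of half of
  \<open>pf v v\<close>, so that for singular \<open>e\<close> and \<open>v\<close> orthogonal to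
  \<open>e\<close> it preserves the quadratic form in characteristic 2 as well.\<close>

definition siegel :: "(nat \<Rightarrow> 'a) \<Rightarrow> (nat \<Rightarrow> 'a) \<Rightarrow> (nat \<Rightarrow> 'a) \<Rightarrow> (nat \<Rightarrow> 'a)" where
  "siegel e v x = (x \<oplus>\<^bsub>V\<^esub> (pf x v \<ominus> q v \<otimes> pf x e) \<odot>\<^bsub>V\<^esub> e) \<ominus>\<^bsub>V\<^esub> pf x e \<odot>\<^bsub>V\<^esub> v"

lemma lin_siegel: "e \<in> carrier V \<Longrightarrow> v \<in> carrier V \<Longrightarrow> lin (siegel e v)"
  unfolding lin_def
proof (intro conjI ballI)
  assume e: "e \<in> carrier V" and v: "v \<in> carrier V"
  show "siegel e v \<in> carrier V \<rightarrow> carrier V" using e v by (auto simp: siegel_def)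
  fix x y assume x: "x \<in> carrier V" and y: "y \<in> carrier V"
  have s: "pf (x \<oplus>\<^bsub>V\<^esub> y) v \<ominus> q v \<otimes> pf (x \<oplus>\<^bsub>V\<^esub> y) e = (pf x v \<ominus> q v \<otimes> pf x e) \<oplus> (pf y v \<ominus> q v \<otimes> pf y e)"
  proof -
    have "pf x v \<in> carrier F" "pf y v \<in> carrier F" "pf x e \<in> carrier F" "pf y e \<in> carrier F" "q v \<in> carrier F" using e v x y by auto
    then show ?thesis using e v x y unfolding f_add_left[OF x y v] f_add_left[OF x y e] by algebra
  qed
  have F: "pf x v \<ominus> q v \<otimes> pf x e \<in> carrier F" "pf y v \<ominus> q v \<otimes> pf y e \<in> carrier F" using e v x y by auto
  show "siegel e v (x \<oplus>\<^bsub>V\<^esub> y) = siegel e v x \<oplus>\<^bsub>V\<^esub> siegel e v y"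
    unfolding siegel_def s unfolding f_add_left[OF x y e] smult_l_distr[OF F e] smult_l_distr[OF f_closed[OF x e] f_closed[OF y e] v]
    using e v x y by (simp add: a_minus_def M.minus_add M.a_ac)
next
  assume e: "e \<in> carrier V" and v: "v \<in> carrier V"
  fix c x assume c: "c \<in> carrier F" and x: "x \<in> carrier V"
  have F: "pf x v \<in> carrier F" "pf x e \<in> carrier F" "q v \<in> carrier F" "pf x v \<ominus> q v \<otimes> pf x e \<in> carrier F" using e v x by auto
  have s: "c \<otimes> pf x v \<ominus> q v \<otimes> (c \<otimes> pf x e) = c \<otimes> (pf x v \<ominus> q v \<otimes> pf x e)" using c F(1-3) by algebra
  show "siegel e v (c \<odot>\<^bsub>V\<^esub> x) = c \<odot>\<^bsub>V\<^esub> siegel e v x"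
    unfolding siegel_def f_smult_left[OF c x v] f_smult_left[OF c x e] s
    using e v c x F by (simp add: a_minus_def smult_r_distr smult_r_minus smult_assoc1 del: f_closed)
qed

lemma q_siegel:
  assumes e: "e \<in> singular" and v: "v \<in> carrier V" "pf v e = \<zero>" and x: "x \<in> carrier V"
  shows "q (siegel e v x) = q x"
proof -
  have eV: "e \<in> carrier V" "q e = \<zero>" using e by (auto simp: singular_def)
  have ev: "pf e v = \<zero>" using pf_sym eV v by simp
  define a b where "a = pf x v" and "b = pf x e"
  have F: "a \<in> carrier F" "b \<in> carrier F" "q v \<in> carrier F" "q x \<in> carrier F" using x v eV by (auto simp: a_def b_def)
  define d where "d = a \<ominus> q v \<otimes> b"
  have d: "d \<in> carrier F" using F by (simp add: d_def)
  let ?z = "d \<odot>\<^bsub>V\<^esub> e \<oplus>\<^bsub>V\<^esub> (\<ominus> b) \<odot>\<^bsub>V\<^esub> v"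
  have zV: "?z \<in> carrier V" using d F eV v by simp
  have s: "siegel e v x = x \<oplus>\<^bsub>V\<^esub> ?z"
    unfolding siegel_def a_def[symmetric] b_def[symmetric] d_def[symmetric]
    using x d F eV v by (simp add: a_minus_def M.a_assoc smult_l_minus)
  have "q ?z = (\<ominus> b) \<otimes> (\<ominus> b) \<otimes> q v"
    using d F eV v ev by (simp add: q_add q_smult f_smult_left f_smult_right)
  moreover have "pf x ?z = d \<otimes> b \<oplus> (\<ominus> b) \<otimes> a"
    using d F x eV v by (simp add: f_add_right f_smult_right a_def b_def)
  ultimately have "q (siegel e v x) = q x \<oplus> (\<ominus> b) \<otimes> (\<ominus> b) \<otimes> q v \<oplus> (d \<otimes> b \<oplus> (\<ominus> b) \<otimes> a)"
    unfolding s using q_add x zV by simp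
  also have "\<dots> = q x" unfolding d_def using F by algebra
  finally show ?thesis .
qed

lemma siegel_exists:
  assumes "e \<in> singular" "v \<in> carrier V" "pf v e = \<zero>"
  shows "\<exists>u\<in>Oq. \<forall>x\<in>carrier V. vm x u = siegel e v x"
proof -
  have e: "e \<in> carrier V" using assms by (auto simp: singular_def)
  have "inj_on (siegel e v) (carrier V)"
    using assms by (intro isometry_inj pf_preserved lin_siegel q_siegel e)
  then obtain u where "u \<in> carrier (GL F n)" "\<forall>x\<in>carrier V. vm x u = siegel e v x"
    using lin_inj_imp_GL[OF lin_siegel[OF e assms(2)]] by blast
  then show ?thesis using q_siegel[OF assms] by (intro bexI[of _ u]) (auto simp: orthogonal_set_def)
qed

text \<open>The cross term from applying the second map to the multiple of \<open>v\<close> is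
  absorbed by q(v + w) = q(v) + q(w) + pf(v, w). For fixed \<open>e\<close> this is a homomorphism
  from the additive group of the vectors orthogonal to \<open>e\<close>.\<close>

lemma siegel_add:
  assumes e: "e \<in> singular" and v: "v \<in> carrier V" "pf v e = \<zero>" and w: "w \<in> carrier V" "pf w e = \<zero>"
    and x: "x \<in> carrier V"
  shows "siegel e w (siegel e v x) = siegel e (v \<oplus>\<^bsub>V\<^esub> w) x"
proof -
  have eV: "e \<in> carrier V" "q e = \<zero>" using e by (auto simp: singular_def)
  have ev: "pf e w = \<zero>" "pf e e = \<zero>" using pf_sym eV w pf_self by auto
  define a b a' c where "a = pf x v" and "b = pf x e" and "a' = pf x w" and "c = pf v w"
  have F: "a \<in> carrier F" "b \<in> carrier F" "a' \<in> carrier F" "c \<in> carrier F" "q v \<in> carrier F" "q w \<in> carrier F"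
    using x v w eV by (auto simp: a_def b_def a'_def c_def)
  define d where "d = a \<ominus> q v \<otimes> b"
  have d: "d \<in> carrier F" using F by (simp add: d_def)
  let ?y = "(x \<oplus>\<^bsub>V\<^esub> d \<odot>\<^bsub>V\<^esub> e) \<ominus>\<^bsub>V\<^esub> b \<odot>\<^bsub>V\<^esub> v"
  have y: "siegel e v x = ?y" by (simp add: siegel_def a_def b_def d_def)
  have yV: "?y \<in> carrier V" using x d F eV v by simp
  have fe: "pf ?y e = b" using x d F eV v ev by (simp add: f_minus_left f_add_left f_smult_left b_def[symmetric] R.minus_eq)
  have fw: "pf ?y w = a' \<ominus> b \<otimes> c"
    using x d F eV v w ev by (simp add: f_minus_left f_add_left f_smult_left a'_def[symmetric] c_def[symmetric])
  define d' where "d' = (a' \<ominus> b \<otimes> c) \<ominus> q w \<otimes> b"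
  have d': "d' \<in> carrier F" using F by (simp add: d'_def)
  have l: "siegel e w (siegel e v x) = (?y \<oplus>\<^bsub>V\<^esub> d' \<odot>\<^bsub>V\<^esub> e) \<ominus>\<^bsub>V\<^esub> b \<odot>\<^bsub>V\<^esub> w"
    unfolding y siegel_def[of e w] fe fw d'_def by simp
  have "pf x (v \<oplus>\<^bsub>V\<^esub> w) \<ominus> q (v \<oplus>\<^bsub>V\<^esub> w) \<otimes> pf x e = d \<oplus> d'"
    unfolding f_add_right[OF v(1) w(1) x] q_add[OF v(1) w(1)] a_def[symmetric] b_def[symmetric] a'_def[symmetric]
      c_def[symmetric] d_def d'_def using F by algebra
  then have r: "siegel e (v \<oplus>\<^bsub>V\<^esub> w) x = (x \<oplus>\<^bsub>V\<^esub> (d \<oplus> d') \<odot>\<^bsub>V\<^esub> e) \<ominus>\<^bsub>V\<^esub> b \<odot>\<^bsub>V\<^esub> (v \<oplus>\<^bsub>V\<^esub> w)"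
    by (simp add: siegel_def b_def)
  show ?thesis unfolding l r using x d d' F eV v w
    by (simp add: a_minus_def smult_l_distr smult_r_distr M.minus_add M.a_ac)
qed

text \<open>\<open>siegel\<close> is built from \<open>q\<close>, \<open>pf\<close> and
  \<open>e\<close>, all of which \<open>g\<close> preserves.\<close>

lemma siegel_conj:
  assumes e: "e \<in> carrier V" and w: "w \<in> carrier V" and g: "g \<in> Oq" "vm e g = e" and x: "x \<in> carrier V"
  shows "vm (siegel e w x) g = siegel e (vm w g) (vm x g)"
proof -
  have gG: "g \<in> carrier (GL F n)" and qg: "q (vm w g) = q w" using g w by (auto simp: orthogonal_set_def)
  have lg: "lin (\<lambda>v. vm v g)" and iso: "\<And>x y. x \<in> carrier V \<Longrightarrow> y \<in> carrier V \<Longrightarrow> pf (vm x g) (vm y g) = pf x y"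
    using Oq_isometry[OF g(1)] by (auto simp: isometry_def)
  have "pf (vm x g) e = pf x e" "pf (vm x g) (vm w g) = pf x w" using iso[of x e] iso[of x w] g e w x by auto
  then show ?thesis
    unfolding siegel_def using x e w qg g(2) by (simp add: lin_minus[OF lg] lin_add[OF lg] lin_smult[OF lg])
qed

text \<open>\<Omega> is a derived subgroup, so Siegel transformations must be exhibited as
  commutators. For a singular s orthogonal to \<open>e\<close>, take w and a orthogonal to
  \<open>e\<close> and s with pf(w, a) = 1. The Siegel transformation with centre s and parameter a
  fixes \<open>e\<close> and sends w to w + s; its commutator with the one with centre
  \<open>e\<close> and parameter w therefore has centre \<open>e\<close> and parameter s. All other
  parameters are generated by the singular ones.\<close>

lemma siegel_Omega:
  assumes n: "n \<ge> 12" and e: "e \<in> singular" and v: "v \<in> carrier V" "pf v e = \<zero>"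
  shows "\<exists>u\<in>Omega_set F n q. \<forall>x\<in>carrier V. vm x u = siegel e v x"
proof -
  have eV: "e \<in> carrier V" "q e = \<zero>" using e by (auto simp: singular_def)
  have sO: "subgroup (Omega_set F n q) (GL F n)"
    unfolding Omega_set_def by (rule Gp.derived_is_subgroup) (auto simp: orthogonal_set_def)
  have OG: "u \<in> Oq \<Longrightarrow> u \<in> carrier (GL F n)" for u by (auto simp: orthogonal_set_def)
  define \<Omega> where "\<Omega> = Omega_set F n q"
  \<comment> \<open>The parameters already realised in \<Omega>. They are closed under differences
    by \<open>siegel_add\<close>, which is all that \<open>singular_generate\<close> asks
    for.\<close>
  define A where "A = {v \<in> carrier V. pf v e = \<zero> \<and> (\<exists>u\<in>\<Omega>. \<forall>x\<in>carrier V. vm x u = siegel e v x)}"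
  have OmG: "u \<in> \<Omega> \<Longrightarrow> u \<in> carrier (GL F n)" for u using subgroup.subset[OF sO] by (auto simp: \<Omega>_def)
  have zero: "siegel e \<zero>\<^bsub>V\<^esub> x = x" if "x \<in> carrier V" for x
  proof -
    have "q \<zero>\<^bsub>V\<^esub> = \<zero>" using q_smult[of \<zero> "\<zero>\<^bsub>V\<^esub>"] by simp
    then show ?thesis using that eV by (simp add: siegel_def a_minus_def)
  qed
  have inverse: "vm x (inv\<^bsub>GL F n\<^esub> u) = siegel e (\<ominus>\<^bsub>V\<^esub> w) x"
    if u: "u \<in> carrier (GL F n)" "\<forall>x\<in>carrier V. vm x u = siegel e w x" and w: "w \<in> carrier V" "pf w e = \<zero>"
      and x: "x \<in> carrier V" for u w x
  proof -
    have nw: "\<ominus>\<^bsub>V\<^esub> w \<in> carrier V" "pf (\<ominus>\<^bsub>V\<^esub> w) e = \<zero>" using w eV by (auto simp: f_neg_left)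
    have sx: "siegel e (\<ominus>\<^bsub>V\<^esub> w) x \<in> carrier V" using lin_closed[OF lin_siegel[OF eV(1) nw(1)] x] .
    have "vm (siegel e (\<ominus>\<^bsub>V\<^esub> w) x) u = x"
      using u(2) sx siegel_add[OF e nw w x] zero[OF x] w by (simp add: M.l_neg)
    then have "vm (vm (siegel e (\<ominus>\<^bsub>V\<^esub> w) x) u) (inv\<^bsub>GL F n\<^esub> u) = vm x (inv\<^bsub>GL F n\<^esub> u)" by simp
    then show ?thesis using act_inv(1)[OF u(1) sx] by simp
  qed
  have Aminus: "a \<ominus>\<^bsub>V\<^esub> b \<in> A" if a: "a \<in> A" and b: "b \<in> A" for a b
  proof -
    obtain u where u: "u \<in> \<Omega>" "\<forall>x\<in>carrier V. vm x u = siegel e a x" using a by (auto simp: A_def)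
    obtain t where t: "t \<in> \<Omega>" "\<forall>x\<in>carrier V. vm x t = siegel e b x" using b by (auto simp: A_def)
    have aV: "a \<in> carrier V" "pf a e = \<zero>" and bV: "b \<in> carrier V" "pf b e = \<zero>" using a b by (auto simp: A_def)
    have nb: "\<ominus>\<^bsub>V\<^esub> b \<in> carrier V" "pf (\<ominus>\<^bsub>V\<^esub> b) e = \<zero>" using bV eV by (auto simp: f_neg_left)
    let ?u = "u \<otimes>\<^bsub>GL F n\<^esub> inv\<^bsub>GL F n\<^esub> t"
    have "vm x ?u = siegel e (a \<ominus>\<^bsub>V\<^esub> b) x" if x: "x \<in> carrier V" for x
    proof -
      have "siegel e a x \<in> carrier V" using lin_closed[OF lin_siegel[OF eV(1) aV(1)] x] .
      then show ?thesis
        using act_mult[OF OmG[OF u(1)] Gp.inv_closed[OF OmG[OF t(1)]] x] u(2) x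
          inverse[OF OmG[OF t(1)] t(2) bV] siegel_add[OF e aV nb x] by (simp add: a_minus_def)
    qed
    moreover have "?u \<in> \<Omega>" using u t sO by (simp add: \<Omega>_def subgroup.m_closed subgroup.m_inv_closed)
    moreover have "pf (a \<ominus>\<^bsub>V\<^esub> b) e = \<zero>" using aV bV eV by (simp add: f_minus_left R.minus_eq)
    ultimately show ?thesis using aV bV unfolding A_def by (intro CollectI conjI bexI[of _ ?u]) auto
  qed
  let ?Y = "perp (line e)"
  have sl: "sub (line e)" by (rule sub_line[OF eV(1)])
  have sY: "sub ?Y" using sub_perp sub_subset[OF sl] by auto
  have Yin: "y \<in> ?Y \<longleftrightarrow> y \<in> carrier V \<and> pf y e = \<zero>" for y using perp_line[OF eV(1)] by auto
  have sing: "?Y \<inter> singular \<subseteq> A"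
  proof
    fix s assume "s \<in> ?Y \<inter> singular"
    then have s: "s \<in> singular" "s \<in> carrier V" "q s = \<zero>" "pf s e = \<zero>" "pf e s = \<zero>"
      using Yin[of s] pf_sym[OF eV(1), of s] by (simp_all add: singular_def)
    let ?W = "adj (line e) s"
    have sW: "sub ?W" by (rule sub_adj[OF sl s(2)])
    \<comment> \<open>The span of \<open>e\<close> and \<open>s\<close> has dimension at most 2, too
      small to contain its orthogonal space. This supplies two vectors of \<open>perp ?W\<close>
      that are not orthogonal to each other.\<close>
    have "\<not> perp ?W \<subseteq> ?W"
    proof
      assume "perp ?W \<subseteq> ?W"
      then have "card (perp ?W) \<le> card ?W" by (rule card_mono[OF sub_finite[OF sW]])
      then have "card ?W * card (perp ?W) \<le> card ?W * card ?W" by (rule mult_le_mono2)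
      then have "Q ^ n \<le> card ?W * card ?W" using card_perp[OF sW] card_V by simp
      also have "card ?W \<le> Q * Q"
        unfolding adj_eq_plus_line
        by (rule order_trans[OF card_plus_le[OF sl sub_line[OF s(2)]]]) (intro mult_mono card_line_le, auto)
      then have "card ?W * card ?W \<le> (Q * Q) * (Q * Q)" by (intro mult_mono) auto
      also have "\<dots> = Q ^ 4" by (simp add: numeral_eq_Suc)
      also have "\<dots> < Q ^ n" using n Q_ge_2 by (intro power_strict_increasing) auto
      finally show False by simp
    qed
    then have "\<not> perp ?W \<subseteq> perp (perp ?W)" using perp_perp[OF sW] by simp
    then obtain w0 a where wa: "w0 \<in> perp ?W" "a \<in> perp ?W" "pf w0 a \<noteq> \<zero>" by (auto simp: perp_def)
    have V: "w0 \<in> carrier V" "a \<in> carrier V" using wa perp_in by auto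
    have spW: "sub (perp ?W)" using sub_perp sub_subset[OF sW] by auto
    have i: "inv (pf w0 a) \<in> carrier F" "inv (pf w0 a) \<otimes> pf w0 a = \<one>" using wa V by (auto simp: field_Units)
    define w where "w = inv (pf w0 a) \<odot>\<^bsub>V\<^esub> w0"
    have w: "w \<in> perp ?W" "pf w a = \<one>" "w \<in> carrier V"
      using wa i V sub_smult[OF spW] by (auto simp: w_def f_smult_left)
    have eW: "e \<in> ?W" "s \<in> ?W" using adj_upper[OF sl s(2)] line_self[OF eV(1)] by auto
    have o: "pf w e = \<zero>" "pf w s = \<zero>" "pf a e = \<zero>" "pf a s = \<zero>" "pf e a = \<zero>"
      using w wa eW pf_sym[OF eV(1) V(2)] by (simp_all add: perp_def)
    obtain g where g: "g \<in> Oq" "\<forall>x\<in>carrier V. vm x g = siegel s a x" using siegel_exists[OF s(1) V(2) o(4)] by blast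
    obtain t where t: "t \<in> Oq" "\<forall>x\<in>carrier V. vm x t = siegel e w x" using siegel_exists[OF e w(3) o(1)] by blast
    have ge: "vm e g = e" using g(2) eV s o V by (simp add: siegel_def a_minus_def)
    have gw: "vm w g = w \<oplus>\<^bsub>V\<^esub> s" using g(2) w s o V by (simp add: siegel_def a_minus_def)
    have gG: "g \<in> carrier (GL F n)" and tG: "t \<in> carrier (GL F n)" using g t OG by auto
    \<comment> \<open>The commutator is formed from the inverses of \<open>t\<close> and
      \<open>g\<close>, in the shape prescribed by \<open>derived_set\<close>; the double inverses
      are \<open>t\<close> and \<open>g\<close> themselves.\<close>
    let ?u = "inv\<^bsub>GL F n\<^esub> t \<otimes>\<^bsub>GL F n\<^esub> inv\<^bsub>GL F n\<^esub> g \<otimes>\<^bsub>GL F n\<^esub> inv\<^bsub>GL F n\<^esub> (inv\<^bsub>GL F n\<^esub> t) \<otimes>\<^bsub>GL F n\<^esub> inv\<^bsub>GL F n\<^esub> (inv\<^bsub>GL F n\<^esub> g)"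
    have "?u \<in> derived_set (GL F n) Oq"
      using subgroup.m_inv_closed[OF subgroup_Oq] g(1) t(1) by blast
    then have uO: "?u \<in> \<Omega>" unfolding \<Omega>_def Omega_set_def derived_def by (rule generate.incl)
    have "vm x ?u = siegel e s x" if x: "x \<in> carrier V" for x
    proof -
      have nw: "\<ominus>\<^bsub>V\<^esub> w \<in> carrier V" "pf (\<ominus>\<^bsub>V\<^esub> w) e = \<zero>" using w o eV by (auto simp: f_neg_left)
      let ?x1 = "siegel e (\<ominus>\<^bsub>V\<^esub> w) x"
      have x1: "?x1 \<in> carrier V" using lin_closed[OF lin_siegel[OF eV(1) nw(1)] x] .
      let ?y = "vm ?x1 (inv\<^bsub>GL F n\<^esub> g)"
      have y: "?y \<in> carrier V" "vm ?y g = ?x1" using x1 gG act_closed act_inv by auto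
      have "vm x ?u = vm (vm (vm (vm x (inv\<^bsub>GL F n\<^esub> t)) (inv\<^bsub>GL F n\<^esub> g)) t) g"
        using x gG tG act_closed by (simp add: act_mult)
      also have "\<dots> = vm (siegel e w ?y) g" using inverse[OF tG t(2) w(3) o(1) x] t(2) y by simp
      also have "\<dots> = siegel e (w \<oplus>\<^bsub>V\<^esub> s) ?x1" using siegel_conj[OF eV(1) w(3) g(1) ge y(1)] y gw by simp
      also have "\<dots> = siegel e (\<ominus>\<^bsub>V\<^esub> w \<oplus>\<^bsub>V\<^esub> (w \<oplus>\<^bsub>V\<^esub> s)) x"
        using w s o eV by (intro siegel_add[OF e nw _ _ x]) (auto simp: f_add_left)
      also have "\<ominus>\<^bsub>V\<^esub> w \<oplus>\<^bsub>V\<^esub> (w \<oplus>\<^bsub>V\<^esub> s) = s" using w s by (simp add: M.r_neg1)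
      finally show ?thesis .
    qed
    then show "s \<in> A" using s uO unfolding A_def by blast
  qed
  have "?Y \<subseteq> A"
  proof (rule singular_generate[OF sY sl _ _ Aminus sing])
    have "card (line e) * card ?Y = Q ^ n" using card_perp[OF sl] card_V by simp
    then have "Q ^ n \<le> Q * card ?Y" using card_line_le[of e] by (metis mult_le_mono1)
    moreover have "Q ^ n = Q * Q ^ (n - 1)" using n by (cases n) auto
    ultimately have "Q ^ (n - 1) \<le> card ?Y" using Q_ge_2 by simp
    moreover have "Q ^ 5 * card (line e) \<le> Q ^ 5 * Q" using card_line_le by simp
    moreover have "Q ^ 5 * Q \<le> Q ^ (n - 1)" 
    proof -
      have "Q ^ 6 \<le> Q ^ (n - 1)" using n Q_ge_2 by (intro power_increasing) auto
      moreover have "Q ^ 5 * Q = Q ^ 6" by (simp add: numeral_eq_Suc mult_ac)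
      ultimately show ?thesis by simp
    qed
    ultimately show "Q ^ 5 * card (line e) \<le> card ?Y" by linarith
    show "\<exists>y\<in>?Y. pf y x \<noteq> \<zero>" if x: "x \<in> ?Y" "x \<notin> line e" for x
    proof (rule ccontr)
      assume "\<not> ?thesis"
      then have "x \<in> perp ?Y" using x Yin pf_sym by (auto simp: perp_def[of ?Y])
      then show False using x perp_perp[OF sl] by auto
    qed
  qed
  then show ?thesis using v Yin by (auto simp: A_def \<Omega>_def)
qed

lemma orthogonal_class_bounds:
  assumes h: "h \<in> Omega_set F n q" and n: "n \<ge> 12"
  shows "subgroup (Omega_set F n q) (GL F n)" "class_bounds 1 n (Omega_set F n q) h"
proof -
  show sO: "subgroup (Omega_set F n q) (GL F n)"
    unfolding Omega_set_def by (rule Gp.derived_is_subgroup) (auto simp: orthogonal_set_def)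
  have Oq: "Omega_set F n q \<subseteq> Oq"
    unfolding Omega_set_def by (rule Gp.derived_incl[OF subset_refl subgroup_Oq])
  show "class_bounds 1 n (Omega_set F n q) h"
  proof (rule class_bounds_polar[OF sO h card_V n])
    show "isometry (\<lambda>v. vm v t)" if "t \<in> Omega_set F n q" for t using Oq_isometry Oq that by auto
    fix e v assume e: "e \<in> singular" and v: "v \<in> carrier V" "pf v e = \<zero>"
    have eV: "e \<in> carrier V" using e by (auto simp: singular_def)
    obtain u where u: "u \<in> Omega_set F n q" "\<forall>x\<in>carrier V. vm x u = siegel e v x"
      using siegel_Omega[OF n e v] by blast
    have "vm y u = y \<oplus>\<^bsub>V\<^esub> pf y v \<odot>\<^bsub>V\<^esub> e" if "y \<in> carrier V" "pf y e = \<zero>" for y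
      using u(2) that eV v by (simp add: siegel_def a_minus_def)
    then show "\<exists>u\<in>Omega_set F n q. \<forall>y\<in>carrier V. pf y e = \<zero> \<longrightarrow> vm y u = y \<oplus>\<^bsub>V\<^esub> pf y v \<odot>\<^bsub>V\<^esub> e"
      using u by blast
  qed
qed

end

section \<open>The support over the algebraic closure\<close>

context coord
begin

text \<open>The hypothesis \<open>gen\<close> expresses that \<open>B\<close> spans \<open>W\<close>
  through containment in subspaces, which is the form in which spanning is available later.\<close>

lemma
  assumes W: "sub W" and B: "finite B" "B \<subseteq> W" and gen: "\<And>I. sub I \<Longrightarrow> B \<subseteq> I \<Longrightarrow> W \<subseteq> I"
  shows subspace_dim_le: "subspace_dim F n W \<le> card B"
    and card_le_subspace_dim: "\<And>A. A \<subseteq> W \<Longrightarrow> lin_indpt A \<Longrightarrow> card A \<le> subspace_dim F n W"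
proof -
  have vs: "vectorspace F (V\<lparr>carrier := W\<rparr>)" by (rule subspace_is_vs[OF W])
  have subm: "LinearCombinations.submodule F W V" using W by (simp add: subspace_def)
  have BV: "B \<subseteq> carrier V" using B W sub_subset by blast
  have "W \<subseteq> LinearCombinations.module.span F V B"
    by (rule gen[OF span_is_subspace[OF BV] in_own_span[OF BV]])
  then have "LinearCombinations.module.span F V B = W" using span_is_subset[OF B(2) subm] by blast
  then have gs: "LinearCombinations.module.span F (V\<lparr>carrier := W\<rparr>) B = carrier (V\<lparr>carrier := W\<rparr>)"
    using span_li_not_depend(1)[OF B(2) subm] by simp
  show "subspace_dim F n W \<le> card B"
    unfolding subspace_dim_def using vectorspace.gen_ge_dim[OF vs B(1) _ gs] B by simp
  have fd: "vectorspace.fin_dim F (V\<lparr>carrier := W\<rparr>)"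
    unfolding vectorspace.fin_dim_def[OF vs] using gs B by auto
  show "card A \<le> subspace_dim F n W" if A: "A \<subseteq> W" "lin_indpt A" for A
    unfolding subspace_dim_def
    using vectorspace.li_le_dim(2)[OF vs fd, of A] A span_li_not_depend(2)[OF A(1) subm] by simp
qed

end

lemma finsum_subring:
  assumes "abelian_monoid (L\<lparr>carrier := K\<rparr>)" "abelian_monoid L" "K \<subseteq> carrier L" "finite A" "g \<in> A \<rightarrow> K"
  shows "finsum (L\<lparr>carrier := K\<rparr>) g A = finsum L g A"
  using assms(4,5)
proof (induction rule: finite_induct)
  case empty
  then show ?case using assms by (simp add: abelian_monoid.finsum_empty)
next
  case (insert x A)
  then have "g \<in> A \<rightarrow> K" "g x \<in> K" "g \<in> A \<rightarrow> carrier L" "g x \<in> carrier L" using assms(3) by auto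
  then show ?case using insert assms by (simp add: abelian_monoid.finsum_insert)
qed

text \<open>The subfield is the record \<open>L\<close> with its carrier cut down to
  \<open>K\<close>, so vectors and matrices over the subfield are literally vectors and matrices
  over \<open>L\<close>. What has to be compared are finite sums and differences, which depend on
  the carrier.\<close>

locale coord_extension =
  L: coord L n + F: finite_coord "L\<lparr>carrier := K\<rparr>" n for L :: "'a ring" and K n +
  assumes K_subset: "K \<subseteq> carrier L"
begin

abbreviation VL where "VL \<equiv> coord_space L n"
abbreviation VF where "VF \<equiv> coord_space (L\<lparr>carrier := K\<rparr>) n"

lemma VF_subset: "v \<in> carrier VF \<Longrightarrow> v \<in> carrier VL"
  using K_subset by (auto simp: L.coord_simps F.coord_simps)

lemma VF_ops: "x \<oplus>\<^bsub>VF\<^esub> y = x \<oplus>\<^bsub>VL\<^esub> y" "c \<odot>\<^bsub>VF\<^esub> x = c \<odot>\<^bsub>VL\<^esub> x" "\<zero>\<^bsub>VF\<^esub> = \<zero>\<^bsub>VL\<^esub>"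
  by (simp_all add: L.coord_simps F.coord_simps)

lemma VF_minus: "x \<in> carrier VF \<Longrightarrow> y \<in> carrier VF \<Longrightarrow> x \<ominus>\<^bsub>VF\<^esub> y = x \<ominus>\<^bsub>VL\<^esub> y"
proof -
  assume x: "x \<in> carrier VF" and y: "y \<in> carrier VF"
  let ?z = "x \<ominus>\<^bsub>VF\<^esub> y"
  have z: "?z \<in> carrier VL" using VF_subset[OF F.minus_in_carrier[OF x y]] .
  have "?z \<oplus>\<^bsub>VL\<^esub> y = x" using F.add_minus_cancel(3)[OF x y] by (simp add: VF_ops)
  then show ?thesis using L.add_minus_cancel(2)[OF z VF_subset[OF y]] by simp
qed

lemma VF_vec_mat:
  assumes "v \<in> carrier VF" "g \<in> carrier (mat_monoid (L\<lparr>carrier := K\<rparr>) n)"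
  shows "vec_mat (L\<lparr>carrier := K\<rparr>) n v g = vec_mat L n v g"
proof -
  have "(\<Oplus>\<^bsub>L\<lparr>carrier := K\<rparr>\<^esub>k\<in>{..<n}. v k \<otimes>\<^bsub>L\<^esub> g k j) = (\<Oplus>\<^bsub>L\<^esub>k\<in>{..<n}. v k \<otimes>\<^bsub>L\<^esub> g k j)" if j: "j < n" for j
  proof (rule finsum_subring[OF _ _ K_subset])
    show "abelian_monoid (L\<lparr>carrier := K\<rparr>)" "abelian_monoid L"
      by (rule F.R.abelian_monoid_axioms, rule L.R.abelian_monoid_axioms)
    show "(\<lambda>k. v k \<otimes>\<^bsub>L\<^esub> g k j) \<in> {..<n} \<rightarrow> K"
      using F.R.m_closed F.vec_in[OF assms(1)] F.mat_entry[OF assms(2) _ j] by simp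
  qed simp
  then show ?thesis by (auto simp: vec_mat_def)
qed

lemma sub_restrict: "L.sub I \<Longrightarrow> F.sub (carrier VF \<inter> I)"
proof (rule F.subI)
  assume I: "L.sub I"
  show "\<zero>\<^bsub>VF\<^esub> \<in> carrier VF \<inter> I" using L.sub_zero[OF I] F.M.zero_closed by (simp add: VF_ops(3))
  show "x \<oplus>\<^bsub>VF\<^esub> y \<in> carrier VF \<inter> I" if "x \<in> carrier VF \<inter> I" "y \<in> carrier VF \<inter> I" for x y
    using that F.M.a_closed[of x y] L.sub_add[OF I] by (simp add: VF_ops(1))
  show "c \<odot>\<^bsub>VF\<^esub> x \<in> carrier VF \<inter> I" if "c \<in> carrier (L\<lparr>carrier := K\<rparr>)" "x \<in> carrier VF \<inter> I" for c x
    using that F.smult_closed[of c x] L.sub_smult[OF I] K_subset by (auto simp: VF_ops(2))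
qed auto

text \<open>
  The vectors are chosen in echelon form, so their independence over the subfield and over the
  large field are the same.
\<close>

lemma exists_independent:
  assumes "F.sub U" "F.Q ^ r \<le> card U"
  shows "\<exists>A\<subseteq>U. finite A \<and> card A = r \<and> L.lin_indpt A"
  using assms
proof (induction r arbitrary: U)
  case 0
  have "L.lin_indpt {}" by (simp add: L.lin_dep_def)
  then show ?case by auto
next
  case (Suc r)
  have "1 < F.Q ^ Suc r" using F.Q_ge_2 by (intro one_less_power) auto
  then have "card {\<zero>\<^bsub>VF\<^esub>} < card U" using Suc by simp
  then obtain x where x: "x \<in> U" "x \<noteq> \<zero>\<^bsub>VF\<^esub>" using F.exists_not_in[OF F.sub_triv] by blast
  have xV: "x \<in> carrier VF" using F.sub_in[OF Suc.prems(1)] x by auto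
  have "\<exists>j<n. x j \<noteq> \<zero>\<^bsub>L\<^esub>"
  proof (rule ccontr)
    assume "\<not> ?thesis"
    then have "x = \<zero>\<^bsub>VF\<^esub>"
      by (intro F.vec_eqI[OF xV F.M.zero_closed]) (auto simp: F.coord_simps(2))
    then show False using x by simp
  qed
  then obtain j where j: "j < n" "x j \<noteq> \<zero>\<^bsub>L\<^esub>" by blast
  let ?Y = "{y \<in> U. y j = \<zero>\<^bsub>L\<^esub>}"
  have lF: "F.linear_on U (\<lambda>y. y j)"
    using F.sub_in[OF Suc.prems(1)] F.vec_in j by (auto simp: F.linear_on_def F.add_eval F.smult_eval)
  have sY: "F.sub ?Y" using F.sub_linear_kernel[OF Suc.prems(1) lF] by simp
  have "card U \<le> F.Q * card ?Y" using F.card_kernel_ge[OF Suc.prems(1) lF] by simp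
  from order_trans[OF Suc.prems(2) this] have "F.Q ^ r \<le> card ?Y" using F.Q_ge_2 by simp
  then obtain A where A: "A \<subseteq> ?Y" "finite A" "card A = r" "L.lin_indpt A" using Suc.IH[OF sY] by auto
  let ?N = "{y \<in> carrier VL. y j = \<zero>\<^bsub>L\<^esub>}"
  have AN: "A \<subseteq> ?N" using A F.sub_in[OF Suc.prems(1)] VF_subset by auto
  have lL: "L.linear_on (carrier VL) (\<lambda>y. y j)"
    using L.vec_in j by (auto simp: L.linear_on_def L.add_eval L.smult_eval)
  have "L.sub ?N" by (rule L.sub_linear_kernel[OF L.sub_carrier lL])
  then have "LinearCombinations.module.span L VL A \<subseteq> ?N"
    by (intro L.span_is_subset[OF AN]) (simp add: subspace_def)
  then have xs: "x \<notin> LinearCombinations.module.span L VL A" using j by auto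
  have xA: "x \<notin> A" using A j by auto
  have "A \<subseteq> carrier VL" using AN by auto
  then have "L.lin_indpt (A \<union> {x})"
    using L.lin_dep_iff_in_span[OF _ A(4) VF_subset[OF xV] xA] xs by auto
  then show ?case using A x xA by (intro exI[of _ "A \<union> {x}"]) auto
qed

text \<open>For the scalar \<open>a\<close> the image of g - a over \<open>L\<close> is spanned by
  its part over \<open>K\<close>, of dimension \<open>r\<close>. For any other c the image of g - c
  contains the eigenspace of \<open>a\<close>, on which g - c is multiplication by a - c; that
  eigenspace has dimension n - r \<ge> r. So the minimum is \<open>r\<close>.\<close>

lemma support_eq:
  assumes g: "g \<in> carrier (GL (L\<lparr>carrier := K\<rparr>) n)" and a: "a \<in> K" "a \<noteq> \<zero>\<^bsub>L\<^esub>"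
    and r: "F.Q ^ r * card (F.eigenspace g a) = F.Q ^ n" "2 * r \<le> n"
  shows "support L n g = r"
proof -
  have gF: "g \<in> carrier (mat_monoid (L\<lparr>carrier := K\<rparr>) n)" using g by (rule F.GL_in_MM)
  have gL: "g \<in> carrier (mat_monoid L n)"
    using gF K_subset by (auto simp: F.mat_carrier L.mat_carrier PiE_iff subset_iff)
  have aL: "a \<in> carrier L" using a K_subset by auto
  define T where "T c v = vec_mat L n v g \<ominus>\<^bsub>VL\<^esub> c \<odot>\<^bsub>VL\<^esub> v" for c v
  define I where "I c = T c ` carrier VL" for c
  have lT: "L.lin (T c)" if "c \<in> carrier L" for c
    unfolding T_def[abs_def] by (rule L.lin_shift[OF L.vm_lin[OF gL] that])
  have sI: "L.sub (I c)" if "c \<in> carrier L" for c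
    unfolding I_def by (rule L.sub_image[OF lT[OF that] L.sub_carrier])
  \<comment> \<open>The commutator space of d g is the image of g minus the inverse of d, since the
    vectors can be rescaled by d. Minimising over scalars of g is thus minimising over eigenvalue
    candidates.\<close>
  have cs: "comm_space L n (scalar_mat L n d \<otimes>\<^bsub>mat_monoid L n\<^esub> g) = I (inv\<^bsub>L\<^esub> d)"
    if d: "d \<in> carrier L" "d \<noteq> \<zero>\<^bsub>L\<^esub>" for d
  proof -
    have i: "inv\<^bsub>L\<^esub> d \<in> carrier L" "inv\<^bsub>L\<^esub> d \<otimes>\<^bsub>L\<^esub> d = \<one>\<^bsub>L\<^esub>" "d \<otimes>\<^bsub>L\<^esub> inv\<^bsub>L\<^esub> d = \<one>\<^bsub>L\<^esub>"
      using d by (auto simp: L.field_Units)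
    have e: "vec_mat L n v (scalar_mat L n d \<otimes>\<^bsub>mat_monoid L n\<^esub> g) \<ominus>\<^bsub>VL\<^esub> v = T (inv\<^bsub>L\<^esub> d) (d \<odot>\<^bsub>VL\<^esub> v)"
      if v: "v \<in> carrier VL" for v
    proof -
      have "inv\<^bsub>L\<^esub> d \<odot>\<^bsub>VL\<^esub> (d \<odot>\<^bsub>VL\<^esub> v) = v" using i d v L.smult_assoc1[of "inv\<^bsub>L\<^esub> d" d v] by simp
      then show ?thesis
        using L.vm_mult[OF v L.scalar_mat_closed[OF d(1)] gL] L.vm_scalar[OF v d(1)] by (simp add: T_def)
    qed
    show ?thesis
    proof
      show "comm_space L n (scalar_mat L n d \<otimes>\<^bsub>mat_monoid L n\<^esub> g) \<subseteq> I (inv\<^bsub>L\<^esub> d)"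
        unfolding comm_space_def I_def using e L.smult_closed[OF d(1)] by auto
      show "I (inv\<^bsub>L\<^esub> d) \<subseteq> comm_space L n (scalar_mat L n d \<otimes>\<^bsub>mat_monoid L n\<^esub> g)"
      proof
        fix y assume "y \<in> I (inv\<^bsub>L\<^esub> d)"
        then obtain w where w: "w \<in> carrier VL" "y = T (inv\<^bsub>L\<^esub> d) w" by (auto simp: I_def)
        let ?v = "inv\<^bsub>L\<^esub> d \<odot>\<^bsub>VL\<^esub> w"
        have v: "?v \<in> carrier VL" using L.smult_closed[OF i(1) w(1)] .
        have "d \<odot>\<^bsub>VL\<^esub> ?v = w" using i d w L.smult_assoc1[of d "inv\<^bsub>L\<^esub> d" w] by simp
        then have "y = vec_mat L n ?v (scalar_mat L n d \<otimes>\<^bsub>mat_monoid L n\<^esub> g) \<ominus>\<^bsub>VL\<^esub> ?v" using e[OF v] w by simp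
        then show "y \<in> comm_space L n (scalar_mat L n d \<otimes>\<^bsub>mat_monoid L n\<^esub> g)"
          unfolding comm_space_def using v by blast
      qed
    qed
  qed
  have gen: "I c \<subseteq> J" if c: "c \<in> carrier L" and J: "L.sub J" "\<And>i. i < n \<Longrightarrow> T c (L.unit_v i) \<in> J" for c J
  proof -
    have "carrier VL \<subseteq> {v \<in> carrier VL. T c v \<in> J}"
      using J L.unit_v_closed by (intro L.unit_v_generate L.sub_vimage lT c) auto
    then show ?thesis by (auto simp: I_def)
  qed
  let ?B = "\<lambda>c. (\<lambda>i. T c (L.unit_v i)) ` {..<n}"
  have B: "finite (?B c)" "?B c \<subseteq> I c" "card (?B c) \<le> n" for c
    using L.unit_v_closed card_image_le[of "{..<n}" "\<lambda>i. T c (L.unit_v i)"] by (auto simp: I_def)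
  have genB: "\<And>J. L.sub J \<Longrightarrow> ?B c \<subseteq> J \<Longrightarrow> I c \<subseteq> J" if "c \<in> carrier L" for c
    by (rule gen[OF that]) auto
  have dim_n: "subspace_dim L n (I c) \<le> n" if c: "c \<in> carrier L" for c
    using L.subspace_dim_le[OF sI[OF c] B(1,2) genB[OF c]] B(3)[of c] by linarith
  have dim_ge: "r \<le> subspace_dim L n (I c)"
    if c: "c \<in> carrier L" and U: "F.sub U" "U \<subseteq> I c" "F.Q ^ r \<le> card U" for c U
  proof -
    obtain A where A: "A \<subseteq> U" "card A = r" "L.lin_indpt A" using exists_independent[OF U(1,3)] by auto
    then show ?thesis
      using L.card_le_subspace_dim[OF sI[OF c] B(1,2) genB[OF c], of A] U by auto
  qed
  have aF: "a \<in> carrier (L\<lparr>carrier := K\<rparr>)" using a by simp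
  have eigen: "v \<in> carrier VL \<and> vec_mat L n v g = a \<odot>\<^bsub>VL\<^esub> v" if "v \<in> F.eigenspace g a" for v
    using that VF_vec_mat[OF _ gF] VF_subset by (auto simp: F.eigenspace_def VF_ops)
  let ?W = "(\<lambda>v. vec_mat (L\<lparr>carrier := K\<rparr>) n v g \<ominus>\<^bsub>VF\<^esub> a \<odot>\<^bsub>VF\<^esub> v) ` carrier VF"
  have sW: "F.sub ?W" by (rule F.sub_image[OF F.lin_shift[OF F.vm_lin[OF gF] aF] F.sub_carrier])
  have sE: "F.sub (F.eigenspace g a)" by (rule F.sub_eigenspace[OF g aF])
  have cW: "card ?W = F.Q ^ r"
  proof -
    have "card ?W * card (F.eigenspace g a) = F.Q ^ r * card (F.eigenspace g a)"
      using F.card_comm_image[OF g aF] r F.card_V by simp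
    then show ?thesis using F.sub_card_pos[OF sE] by simp
  qed
  have WT: "vec_mat (L\<lparr>carrier := K\<rparr>) n v g \<ominus>\<^bsub>VF\<^esub> a \<odot>\<^bsub>VF\<^esub> v = T a v" if v: "v \<in> carrier VF" for v
    using VF_minus[OF F.vm_closed[OF v gF] F.smult_closed[OF aF v]] VF_vec_mat[OF v gF] by (simp add: T_def VF_ops)
  have WI: "?W \<subseteq> I a" using WT VF_subset by (auto simp: I_def)
  have cE: "F.Q ^ r \<le> card (F.eigenspace g a)"
  proof -
    have "F.Q ^ r * card (F.eigenspace g a) = F.Q ^ r * F.Q ^ (n - r)" using r by (simp add: power_add[symmetric])
    then have "card (F.eigenspace g a) = F.Q ^ (n - r)" using F.Q_ge_2 by simp
    moreover have "F.Q ^ r \<le> F.Q ^ (n - r)" using r F.Q_ge_2 by (intro power_increasing) auto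
    ultimately show ?thesis by simp
  qed
  have ge: "r \<le> subspace_dim L n (I c)" if c: "c \<in> carrier L" for c
  proof (cases "c = a")
    case True
    then show ?thesis using dim_ge[OF aL sW WI] cW by simp
  next
    case False
    have nz: "a \<ominus>\<^bsub>L\<^esub> c \<noteq> \<zero>\<^bsub>L\<^esub>" "a \<ominus>\<^bsub>L\<^esub> c \<in> carrier L" using False aL c by auto
    then have i: "inv\<^bsub>L\<^esub> (a \<ominus>\<^bsub>L\<^esub> c) \<in> carrier L" "inv\<^bsub>L\<^esub> (a \<ominus>\<^bsub>L\<^esub> c) \<otimes>\<^bsub>L\<^esub> (a \<ominus>\<^bsub>L\<^esub> c) = \<one>\<^bsub>L\<^esub>"
      by (auto simp: L.field_Units)
    have "F.eigenspace g a \<subseteq> I c"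
    proof
      fix v assume v: "v \<in> F.eigenspace g a"
      have vL: "v \<in> carrier VL" "vec_mat L n v g = a \<odot>\<^bsub>VL\<^esub> v" using eigen[OF v] by auto
      have "T c v = (a \<ominus>\<^bsub>L\<^esub> c) \<odot>\<^bsub>VL\<^esub> v"
        unfolding T_def vL(2) using aL c vL by (simp add: a_minus_def L.smult_l_distr L.smult_l_minus)
      then have "T c (inv\<^bsub>L\<^esub> (a \<ominus>\<^bsub>L\<^esub> c) \<odot>\<^bsub>VL\<^esub> v) = v"
        using L.lin_smult[OF lT[OF c] i(1) vL(1)] L.smult_assoc1[OF i(1) nz(2) vL(1)] i(2) vL(1) by simp
      then show "v \<in> I c" unfolding I_def using L.smult_closed[OF i(1) vL(1)] by (metis image_eqI)
    qed
    then show ?thesis using dim_ge[OF c sE _ cE] by simp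
  qed
  \<comment> \<open>The images of the unit vectors have entries in \<open>K\<close>, so they lie in
    \<open>?W\<close>, and \<open>r\<close> vectors spanning \<open>?W\<close> over \<open>K\<close>
    span the image over \<open>L\<close>.\<close>
  have le: "subspace_dim L n (I a) \<le> r"
  proof -
    obtain b where b: "b \<in> {..<r} \<rightarrow>\<^sub>E ?W" "F.gen b r = ?W" using F.sub_eq_gen'[OF sW cW] by auto
    have "subspace_dim L n (I a) \<le> card (b ` {..<r})"
    proof (rule L.subspace_dim_le[OF sI[OF aL]])
      show "b ` {..<r} \<subseteq> I a" using b WI by auto
      fix J assume J: "L.sub J" "b ` {..<r} \<subseteq> J"
      have "F.gen b r \<subseteq> carrier VF \<inter> J"
      proof (rule F.gen_least[OF sub_restrict[OF J(1)]])
        fix i assume "i < r"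
        then have "b i \<in> ?W" "b i \<in> J" using b(1) J(2) by (auto simp: PiE_iff simp del: image_iff)
        then show "b i \<in> carrier VF \<inter> J" using F.sub_in[OF sW, of "b i"] by blast
      qed
      then have WJ: "?W \<subseteq> J" using b by auto
      show "I a \<subseteq> J"
      proof (rule gen[OF aL J(1)])
        fix i assume "i < n"
        have u: "F.unit_v i = L.unit_v i" by (simp cong: if_cong add: F.unit_v_def L.unit_v_def)
        have "T a (F.unit_v i) \<in> ?W"
          by (rule image_eqI, rule WT[symmetric], rule F.unit_v_closed, rule F.unit_v_closed)
        then show "T a (L.unit_v i) \<in> J" using WJ u by auto
      qed
    qed simp
    also have "\<dots> \<le> r" using card_image_le[of "{..<r}" b] by simp
    finally show ?thesis .
  qed
  let ?D = "(\<lambda>c. subspace_dim L n (comm_space L n (scalar_mat L n c \<otimes>\<^bsub>mat_monoid L n\<^esub> g))) ` (carrier L - {\<zero>\<^bsub>L\<^esub>})"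
  have inv: "inv\<^bsub>L\<^esub> d \<in> carrier L" if "d \<in> carrier L" "d \<noteq> \<zero>\<^bsub>L\<^esub>" for d using that by (auto simp: L.field_Units)
  have D: "\<exists>c\<in>carrier L. y = subspace_dim L n (I c)" if y: "y \<in> ?D" for y
  proof -
    obtain d where d: "y = subspace_dim L n (comm_space L n (scalar_mat L n d \<otimes>\<^bsub>mat_monoid L n\<^esub> g))"
      "d \<in> carrier L - {\<zero>\<^bsub>L\<^esub>}"
      using y by (rule imageE)
    then have "d \<in> carrier L" "d \<noteq> \<zero>\<^bsub>L\<^esub>" by auto
    then show ?thesis unfolding d(1) by (intro bexI[of _ "inv\<^bsub>L\<^esub> d"] inv) (simp_all add: cs)
  qed
  have "Min ?D = r"
  proof (rule Min_eqI)
    have "?D \<subseteq> {..n}"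
    proof
      fix y assume "y \<in> ?D"
      then obtain c where "c \<in> carrier L" "y = subspace_dim L n (I c)" using D by blast
      then show "y \<in> {..n}" using dim_n by simp
    qed
    then show "finite ?D" by (rule finite_subset) simp
    show "r \<le> y" if "y \<in> ?D" for y using D[OF that] ge by auto
    have aU: "a \<in> Units L" using a aL by (simp add: L.field_Units)
    have ia: "inv\<^bsub>L\<^esub> a \<in> carrier L" "inv\<^bsub>L\<^esub> a \<noteq> \<zero>\<^bsub>L\<^esub>" "inv\<^bsub>L\<^esub> (inv\<^bsub>L\<^esub> a) = a"
      using L.R.Units_inv_Units[OF aU] L.R.Units_inv_inv[OF aU] by (auto simp: L.field_Units)
    have "r = subspace_dim L n (I a)" using le ge[OF aL] by simp
    also have "\<dots> = subspace_dim L n (comm_space L n (scalar_mat L n (inv\<^bsub>L\<^esub> a) \<otimes>\<^bsub>mat_monoid L n\<^esub> g))"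
      using cs[OF ia(1,2)] ia(3) by simp
    finally show "r \<in> ?D" using ia by (intro image_eqI[of _ _ "inv\<^bsub>L\<^esub> a"]) simp_all
  qed
  then show ?thesis by (simp add: support_def)
qed

end

section \<open>The projective groups\<close>

context finite_coord
begin

lemma scalar_mat_central:
  assumes "c \<in> carrier F" "c \<noteq> \<zero>" "g \<in> carrier (GL F n)"
  shows "g \<otimes>\<^bsub>GL F n\<^esub> scalar_mat F n c = scalar_mat F n c \<otimes>\<^bsub>GL F n\<^esub> g"
proof (rule act_faithful)
  have s: "scalar_mat F n c \<in> carrier (GL F n)" using scalar_mat_GL assms by simp
  then show "g \<otimes>\<^bsub>GL F n\<^esub> scalar_mat F n c \<in> carrier (GL F n)"
    "scalar_mat F n c \<otimes>\<^bsub>GL F n\<^esub> g \<in> carrier (GL F n)" using assms(3) by auto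
  show "vm v (g \<otimes>\<^bsub>GL F n\<^esub> scalar_mat F n c) = vm v (scalar_mat F n c \<otimes>\<^bsub>GL F n\<^esub> g)" if v: "v \<in> carrier V" for v
    using act_mult[OF assms(3) s v] act_mult[OF s assms(3) v] vm_scalar[OF _ assms(1)] v
      lin_smult[OF act_lin[OF assms(3)] assms(1) v] act_closed[OF assms(3) v] by simp
qed

lemma scalar_mat_mult:
  assumes "c \<in> carrier F" "c \<noteq> \<zero>" "d \<in> carrier F" "d \<noteq> \<zero>"
  shows "scalar_mat F n c \<otimes>\<^bsub>GL F n\<^esub> scalar_mat F n d = scalar_mat F n (c \<otimes> d)"
proof (rule act_faithful)
  have s: "scalar_mat F n c \<in> carrier (GL F n)" "scalar_mat F n d \<in> carrier (GL F n)"
    using scalar_mat_GL assms by auto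
  then show "scalar_mat F n c \<otimes>\<^bsub>GL F n\<^esub> scalar_mat F n d \<in> carrier (GL F n)" by simp
  show "scalar_mat F n (c \<otimes> d) \<in> carrier (GL F n)"
    using assms by (intro scalar_mat_GL) (auto simp: integral_iff)
  show "vm v (scalar_mat F n c \<otimes>\<^bsub>GL F n\<^esub> scalar_mat F n d) = vm v (scalar_mat F n (c \<otimes> d))"
    if v: "v \<in> carrier V" for v
    using act_mult[OF s v] assms v by (simp add: vm_scalar smult_assoc1[symmetric] m_comm)
qed

lemma scalars_normal: "scalars F n \<lhd> GL F n"
  unfolding Gp.normal_inv_iff
proof (intro conjI ballI)
  have sG: "scalars F n \<subseteq> carrier (GL F n)" using scalar_mat_GL by (auto simp: scalars_def)
  show "subgroup (scalars F n) (GL F n)"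
  proof (rule Gp.subgroupI[OF sG])
    show "scalars F n \<noteq> {}" using one_not_zero by (auto simp: scalars_def)
    show "inv\<^bsub>GL F n\<^esub> a \<in> scalars F n" if a: "a \<in> scalars F n" for a
    proof -
      obtain c where c: "c \<in> carrier F" "c \<noteq> \<zero>" "a = scalar_mat F n c" using a by (auto simp: scalars_def)
      then have i: "inv c \<in> carrier F" "inv c \<noteq> \<zero>" "inv c \<otimes> c = \<one>"
        using R.Units_inv_Units[of c] by (auto simp: field_Units)
      have "scalar_mat F n (inv c) \<otimes>\<^bsub>GL F n\<^esub> a = \<one>\<^bsub>GL F n\<^esub>"
        using scalar_mat_mult[OF i(1,2) c(1,2)] i c by (simp add: GL_simps(3) one_MM)
      then have "inv\<^bsub>GL F n\<^esub> a = scalar_mat F n (inv c)"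
        using scalar_mat_GL c i by (intro Gp.inv_equality) auto
      then show ?thesis using i by (auto simp: scalars_def)
    qed
    show "a \<otimes>\<^bsub>GL F n\<^esub> b \<in> scalars F n" if "a \<in> scalars F n" "b \<in> scalars F n" for a b
      using that scalar_mat_mult integral_iff by (auto simp: scalars_def)
  qed
  show "x \<otimes>\<^bsub>GL F n\<^esub> h \<otimes>\<^bsub>GL F n\<^esub> inv\<^bsub>GL F n\<^esub> x \<in> scalars F n"
    if x: "x \<in> carrier (GL F n)" and "h \<in> scalars F n" for x h
  proof -
    obtain c where c: "c \<in> carrier F" "c \<noteq> \<zero>" "h = scalar_mat F n c"
      using \<open>h \<in> scalars F n\<close> by (auto simp: scalars_def)
    have "h \<in> carrier (GL F n)" using sG \<open>h \<in> scalars F n\<close> by auto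
    then have "x \<otimes>\<^bsub>GL F n\<^esub> h \<otimes>\<^bsub>GL F n\<^esub> inv\<^bsub>GL F n\<^esub> x = h"
      using scalar_mat_central[OF c(1,2) x] c(3) x by (simp add: Gp.m_assoc)
    then show ?thesis using \<open>h \<in> scalars F n\<close> by simp
  qed
qed

lemma coset_elem:
  assumes "g \<in> scalars F n #>\<^bsub>GL F n\<^esub> h" "h \<in> carrier (GL F n)"
  shows "g \<in> carrier (GL F n)"
    and "\<exists>c\<in>carrier F. c \<noteq> \<zero> \<and> (\<forall>v\<in>carrier V. vm v g = c \<odot>\<^bsub>V\<^esub> vm v h)"
proof -
  obtain c where c: "c \<in> carrier F" "c \<noteq> \<zero>" "g = scalar_mat F n c \<otimes>\<^bsub>GL F n\<^esub> h"
    using assms(1) by (auto simp: r_coset_def scalars_def)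
  have s: "scalar_mat F n c \<in> carrier (GL F n)" using scalar_mat_GL c by simp
  show "g \<in> carrier (GL F n)" using s c(3) assms(2) by simp
  have "vm v g = c \<odot>\<^bsub>V\<^esub> vm v h" if v: "v \<in> carrier V" for v
    using act_mult[OF s assms(2) v] c v lin_smult[OF act_lin[OF assms(2)] c(1) v] by (simp add: vm_scalar)
  then show "\<exists>c\<in>carrier F. c \<noteq> \<zero> \<and> (\<forall>v\<in>carrier V. vm v g = c \<odot>\<^bsub>V\<^esub> vm v h)" using c by blast
qed

lemma conj_class_proj_image:
  assumes H: "subgroup H (GL F n)" and G: "group (proj_image F n H)" and h: "h \<in> H"
  shows "conj_class (proj_image F n H) (scalars F n #>\<^bsub>GL F n\<^esub> h)
    = (\<lambda>t. scalars F n #>\<^bsub>GL F n\<^esub> conj h t) ` H"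
proof -
  let ?c = "\<lambda>h. scalars F n #>\<^bsub>GL F n\<^esub> h"
  have HG: "t \<in> carrier (GL F n)" if "t \<in> H" for t using subgroup.mem_carrier[OF H that] .
  have mult: "?c a \<otimes>\<^bsub>proj_image F n H\<^esub> ?c b = ?c (a \<otimes>\<^bsub>GL F n\<^esub> b)"
    if "a \<in> carrier (GL F n)" "b \<in> carrier (GL F n)" for a b
    using normal.rcos_sum[OF scalars_normal that] by (simp add: proj_image_def FactGroup_def)
  have carr: "carrier (proj_image F n H) = ?c ` H" by (simp add: proj_image_def)
  have one: "\<one>\<^bsub>proj_image F n H\<^esub> = ?c \<one>\<^bsub>GL F n\<^esub>"
    using Gp.coset_mult_one[of "scalars F n"] subgroup.subset[OF normal_imp_subgroup[OF scalars_normal]]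
    by (simp add: proj_image_def FactGroup_def)
  have inv: "inv\<^bsub>proj_image F n H\<^esub> ?c t = ?c (inv\<^bsub>GL F n\<^esub> t)" if t: "t \<in> H" for t
    using t HG[OF t] subgroup.m_inv_closed[OF H t]
    by (intro group.inv_equality[OF G]) (auto simp: mult carr one)
  have "inv\<^bsub>proj_image F n H\<^esub> ?c t \<otimes>\<^bsub>proj_image F n H\<^esub> ?c h \<otimes>\<^bsub>proj_image F n H\<^esub> ?c t = ?c (conj h t)"
    if t: "t \<in> H" for t
    using HG[OF t] HG[OF h] by (simp add: inv[OF t] mult)
  then show ?thesis unfolding conj_class_def carr image_image by (intro image_cong) auto
qed

text \<open>Conjugates in the same coset of the scalars are proportional, which
  \<open>separated\<close> excludes for distinct elements of \<open>T\<close>. The order is bounded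
  crudely by the number of all n by n matrices.\<close>

lemma
  assumes H: "subgroup H (GL F n)" and G: "group (proj_image F n H)" and h: "h \<in> H"
  shows separated_le_conj_class:
      "\<And>T. T \<subseteq> H \<Longrightarrow> separated h T \<Longrightarrow> card T \<le> card (conj_class (proj_image F n H) (scalars F n #>\<^bsub>GL F n\<^esub> h))"
    and conj_class_le: "card (conj_class (proj_image F n H) (scalars F n #>\<^bsub>GL F n\<^esub> h)) \<le> card (conj h ` H)"
    and order_proj_image_le: "Coset.order (proj_image F n H) \<le> Q ^ (n * n)"
proof -
  have HG: "t \<in> carrier (GL F n)" if "t \<in> H" for t using subgroup.mem_carrier[OF H that] .
  have HM: "H \<subseteq> carrier MM" using HG GL_in_MM by auto
  have fM: "finite (carrier MM)" using finite_field by (auto simp: mat_carrier intro!: finite_PiE)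
  have fH: "finite H" using finite_subset[OF HM fM] .
  note cc = conj_class_proj_image[OF H G h]
  show "card (conj_class (proj_image F n H) (scalars F n #>\<^bsub>GL F n\<^esub> h)) \<le> card (conj h ` H)"
    unfolding cc image_image[of "\<lambda>a. scalars F n #>\<^bsub>GL F n\<^esub> a" "conj h", symmetric]
    using fH by (intro card_image_le) auto
  show "card T \<le> card (conj_class (proj_image F n H) (scalars F n #>\<^bsub>GL F n\<^esub> h))"
    if T: "T \<subseteq> H" "separated h T" for T
    unfolding cc
  proof (rule card_inj_on_le)
    show "inj_on (\<lambda>t. scalars F n #>\<^bsub>GL F n\<^esub> conj h t) T"
    proof (rule inj_onI)
      fix t t' assume t: "t \<in> T" "t' \<in> T"
        and eq: "scalars F n #>\<^bsub>GL F n\<^esub> conj h t = scalars F n #>\<^bsub>GL F n\<^esub> conj h t'"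
      have tG: "conj h t \<in> carrier (GL F n)" "conj h t' \<in> carrier (GL F n)" using t T HG h by auto
      have "conj h t \<in> scalars F n #>\<^bsub>GL F n\<^esub> conj h t'"
        using Gp.rcos_self[OF tG(1) normal_imp_subgroup[OF scalars_normal]] eq by simp
      from coset_elem(2)[OF this tG(2)] show "t = t'" using T(2) t by (auto simp: separated_def)
    qed
  qed (use T fH in auto)
  have "Coset.order (proj_image F n H) \<le> card H"
    using card_image_le[OF fH] by (simp add: Coset.order_def proj_image_def)
  also have "\<dots> \<le> card (carrier MM)" using card_mono[OF fM HM] .
  also have "\<dots> = Q ^ (n * n)" by (simp add: mat_carrier card_PiE Q_def power_mult)
  finally show "Coset.order (proj_image F n H) \<le> Q ^ (n * n)" .
qed

section \<open>Estimates for the classes of all families\<close>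

lemma classical_class_bounds:
  assumes "is_linear_classical c F n q H" "h \<in> H" "n \<ge> 12" "card (carrier F) = q ^ field_deg c" "q \<ge> 2"
  shows "subgroup H (GL F n)" "class_bounds (if c = Linear then 2 else 1) n H h"
proof -
  have orth: "subgroup (Omega_set F n f) (GL F n) \<and> class_bounds 1 n (Omega_set F n f) h"
    if "nondegenerate_quadratic_form F n f" "h \<in> Omega_set F n f" for f
  proof -
    interpret quadratic_space F n f by unfold_locales (rule that)
    show ?thesis using orthogonal_class_bounds that assms by blast
  qed
  have "subgroup H (GL F n) \<and> class_bounds (if c = Linear then 2 else 1) n H h"
  proof (cases c)
    case Linear
    then show ?thesis using assms subgroup_SL linear_class_bounds[of h] by simp
  next
    case Unitary
    then obtain f where "hermitian_form F n q f" "nondegenerate F n f" "H = SL_set F n \<inter> isometries F n f"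
      using assms by auto
    then show ?thesis
      using unitary_class_bounds[of q f h] assms Unitary by (auto simp: field_deg_def power2_eq_square)
  next
    case Symplectic
    then obtain f where "alternating_form F n f" "nondegenerate F n f" "H = isometries F n f"
      using assms by auto
    then show ?thesis using symplectic_class_bounds[of f h] assms Symplectic by auto
  qed (use assms orth in auto)
  then show "subgroup H (GL F n)" "class_bounds (if c = Linear then 2 else 1) n H h" by auto
qed

text \<open>With 8 m \<le> n at most a quarter of the exponent b n m is lost, so a class of size at
  most |G|^\<delta> forces 3 m \<le> 4 \<delta> n. This is far from the cap, so there is an
  eigenspace of codimension r \<le> 3 m \<le> 4 \<delta> n. The loss 2 b r^2 in the lower bound for
  this r is then at most 8 \<delta> b n r.\<close>

lemma conj_class_estimates:
  fixes \<delta> :: real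
  assumes H: "subgroup H (GL F n)" and G: "group (proj_image F n H)" and h: "h \<in> H"
    and cb: "class_bounds b n H h" and b: "b \<ge> 1" and n: "n \<ge> 100"
    and \<delta>: "0 < \<delta>" "\<delta> \<le> 1 / 64"
  defines "N \<equiv> real (card (conj_class (proj_image F n H) (scalars F n #>\<^bsub>GL F n\<^esub> h)))"
  assumes small: "N \<le> real (Coset.order (proj_image F n H)) powr \<delta>"
  shows "\<exists>c\<in>carrier F. \<exists>r. Q ^ r * card (eigenspace h c) = Q ^ n \<and> 2 * r < n \<and>
    real Q powr (real b * (1 - 8 * \<delta>) * real n * real r) \<le> N \<and> N \<le> real Q powr (real b * real n * real r)"
proof -
  have Q: "real Q > 1" using Q_ge_2 by simp
  have hG: "h \<in> carrier (GL F n)" using subgroup.mem_carrier[OF H h] .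
  have low: "real Q powr (real (b * n * m) - real (2 * b * m * m)) \<le> N"
    if T: "T \<subseteq> H" "separated h T" "card T * Q ^ (2 * b * m * m) = Q ^ (b * n * m)" for T m
  proof -
    have pw: "real Q ^ k = real Q powr real k" for k using Q by (simp add: powr_realpow)
    have "real (card T) * real Q ^ (2 * b * m * m) = real Q ^ (b * n * m)"
      using T(3) by (metis of_nat_mult of_nat_power)
    then have "real Q powr real (b * n * m) = real (card T) * real Q powr real (2 * b * m * m)"
      by (simp only: pw)
    then have "real (card T) = real Q powr (real (b * n * m) - real (2 * b * m * m))"
      unfolding powr_diff using Q by simp
    then show ?thesis using separated_le_conj_class[OF H G h T(1,2)] unfolding N_def by simp
  qed
  obtain m T where T: "8 * m \<le> n" "T \<subseteq> H" "separated h T" "card T * Q ^ (2 * b * m * m) = Q ^ (b * n * m)"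
    and alt: "n < 8 * (m + 2) \<or> (\<exists>c\<in>carrier F. Q ^ n \<le> Q ^ (3 * m) * card (eigenspace h c))"
    using cb unfolding class_bounds_def by blast
  have "N \<le> (real Q ^ (n * n)) powr \<delta>"
  proof -
    have "real (Coset.order (proj_image F n H)) \<le> real Q ^ (n * n)"
      using order_proj_image_le[OF H G h] by (metis of_nat_le_iff of_nat_power)
    then show ?thesis using small \<delta> by (meson less_imp_le of_nat_0_le_iff order_trans powr_mono2)
  qed
  also have "(real Q ^ (n * n)) powr \<delta> = real Q powr (real n * real n * \<delta>)"
    using Q by (simp add: powr_realpow[symmetric] powr_powr)
  finally have "real Q powr (real (b * n * m) - real (2 * b * m * m)) \<le> real Q powr (real n * real n * \<delta>)"
    using low[OF T(2-4)] by linarith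
  then have le: "real (b * n * m) - real (2 * b * m * m) \<le> real n * real n * \<delta>" using Q by simp
  have "4 * (2 * b * m * m) \<le> b * n * m" using mult_left_mono[OF T(1), of "b * m"] by (simp add: mult_ac)
  then have "4 * real (2 * b * m * m) \<le> real (b * n * m)" by (metis of_nat_le_iff of_nat_mult of_nat_numeral)
  then have "3 * real (b * n * m) \<le> 4 * (real n * real n * \<delta>)" using le by linarith
  moreover have "real (n * m) \<le> real (b * n * m)"
  proof -
    have "1 * (n * m) \<le> b * (n * m)" using b by (rule mult_le_mono1)
    then show ?thesis by (simp only: of_nat_le_iff mult_1 mult.assoc)
  qed
  ultimately have "3 * real (n * m) \<le> 4 * (real n * real n * \<delta>)" by linarith
  then have "real n * (3 * real m) \<le> real n * (4 * \<delta> * real n)" by (simp add: mult_ac)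
  then have m: "3 * real m \<le> 4 * \<delta> * real n" using n by simp
  \<comment> \<open>The bound 1/64 gives m \<le> n / 48. For n \<ge> 100 this excludes n < 8 (m +
    2), and it leaves room for 9 + 3 r \<le> n.\<close>
  have "4 * \<delta> * real n \<le> real n / 16" using mult_right_mono[OF \<delta>(2), of "real n"] by simp
  then have m16: "48 * m \<le> n" using m by linarith
  then obtain c where c: "c \<in> carrier F" "Q ^ n \<le> Q ^ (3 * m) * card (eigenspace h c)" using alt n by auto
  obtain k where k: "card (eigenspace h c) = Q ^ k" using card_sub_power[OF sub_eigenspace[OF hG c(1)]] by blast
  have "card (eigenspace h c) \<le> Q ^ n"
    unfolding card_V[symmetric] using finite_V by (intro card_mono) (auto simp: eigenspace_def)
  then have "k \<le> n" unfolding k using Q_ge_2 by (simp add: power_increasing_iff)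
  have "n \<le> 3 * m + k" using c(2) Q_ge_2 unfolding k power_add[symmetric] by (simp add: power_increasing_iff)
  define r where "r = n - k"
  have r: "r \<le> 3 * m" "Q ^ r * card (eigenspace h c) = Q ^ n"
    using \<open>k \<le> n\<close> \<open>n \<le> 3 * m + k\<close> by (auto simp: r_def k power_add[symmetric])
  have r9: "9 + 3 * r \<le> n" using r m16 n by linarith
  have up: "card (conj h ` H) \<le> Q ^ (b * n * r)"
    and ex: "\<exists>T\<subseteq>H. separated h T \<and> card T * Q ^ (2 * b * r * r) = Q ^ (b * n * r)"
    using cb c(1) r(2) r9 unfolding class_bounds_def by blast+
  have "N \<le> real (Q ^ (b * n * r))"
    using order_trans[OF conj_class_le[OF H G h] up] unfolding N_def by linarith
  also have "\<dots> = real Q powr real (b * n * r)" using Q by (simp only: powr_realpow of_nat_power)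
  finally have N: "N \<le> real Q powr (real b * real n * real r)" by simp
  have "real r \<le> 4 * \<delta> * real n" using m r by linarith
  from mult_left_mono[OF this, of "2 * real b * real r"]
  have "real (2 * b * r * r) \<le> real b * (8 * \<delta>) * real n * real r" by (simp add: mult_ac)
  then have "real b * (1 - 8 * \<delta>) * real n * real r \<le> real (b * n * r) - real (2 * b * r * r)"
    by (simp add: algebra_simps)
  then have "real Q powr (real b * (1 - 8 * \<delta>) * real n * real r)
      \<le> real Q powr (real (b * n * r) - real (2 * b * r * r))" using Q by simp
  also have "\<dots> \<le> N" using ex low by blast
  finally show ?thesis using c(1) r(2) N r9 by (intro bexI[of _ c] exI[of _ r]) auto
qed

end

text \<open>Multiplying \<open>h\<close> by a scalar multiplies the eigenvalue and keeps the
  eigenspace, so any preimage gives the same support. The new eigenvalue is nonzero, since otherwise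
  the eigenspace would be zero, against 2 r < n.\<close>

lemma (in coord_extension) support_coset:
  assumes h: "h \<in> carrier (GL (L\<lparr>carrier := K\<rparr>) n)"
    and g: "g \<in> scalars (L\<lparr>carrier := K\<rparr>) n #>\<^bsub>GL (L\<lparr>carrier := K\<rparr>) n\<^esub> h"
    and c: "c \<in> K" and r: "F.Q ^ r * card (F.eigenspace h c) = F.Q ^ n" "2 * r < n"
  shows "support L n g = r"
proof -
  obtain d where d: "d \<in> K" "d \<noteq> \<zero>\<^bsub>L\<^esub>"
    and gd: "\<And>v. v \<in> carrier VF \<Longrightarrow> vec_mat (L\<lparr>carrier := K\<rparr>) n v g = d \<odot>\<^bsub>VF\<^esub> vec_mat (L\<lparr>carrier := K\<rparr>) n v h"
    using F.coset_elem(2)[OF g h] by auto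
  have gG: "g \<in> carrier (GL (L\<lparr>carrier := K\<rparr>) n)" by (rule F.coset_elem(1)[OF g h])
  have dF: "d \<in> carrier (L\<lparr>carrier := K\<rparr>)" and cF: "c \<in> carrier (L\<lparr>carrier := K\<rparr>)" using d c by auto
  have dc: "d \<otimes>\<^bsub>L\<^esub> c \<in> K" using F.R.m_closed[OF dF cF] by simp
  have "F.eigenspace g (d \<otimes>\<^bsub>L\<^esub> c) = F.eigenspace h c"
  proof -
    have "vec_mat (L\<lparr>carrier := K\<rparr>) n v g = (d \<otimes>\<^bsub>L\<^esub> c) \<odot>\<^bsub>VF\<^esub> v \<longleftrightarrow> vec_mat (L\<lparr>carrier := K\<rparr>) n v h = c \<odot>\<^bsub>VF\<^esub> v"
      if v: "v \<in> carrier VF" for v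
    proof -
      let ?i = "inv\<^bsub>L\<lparr>carrier := K\<rparr>\<^esub> d"
      have i: "?i \<in> carrier (L\<lparr>carrier := K\<rparr>)" "?i \<otimes>\<^bsub>L\<^esub> d = \<one>\<^bsub>L\<^esub>"
        using F.R.Units_l_inv[of d] F.R.Units_inv_closed[of d] F.field_Units d by auto
      have canc: "?i \<odot>\<^bsub>VF\<^esub> (d \<odot>\<^bsub>VF\<^esub> w) = w" if w: "w \<in> carrier VF" for w
        using F.smult_assoc1[OF i(1) dF w] F.smult_one[OF w] i(2) by simp
      have "(d \<otimes>\<^bsub>L\<^esub> c) \<odot>\<^bsub>VF\<^esub> v = d \<odot>\<^bsub>VF\<^esub> (c \<odot>\<^bsub>VF\<^esub> v)" using F.smult_assoc1[OF dF cF v] by simp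
      then show ?thesis using gd[OF v] canc F.act_closed[OF h v] F.smult_closed[OF cF v] by metis
    qed
    then show ?thesis by (auto simp: F.eigenspace_def)
  qed
  then have r': "F.Q ^ r * card (F.eigenspace g (d \<otimes>\<^bsub>L\<^esub> c)) = F.Q ^ n" using r by simp
  have "d \<otimes>\<^bsub>L\<^esub> c \<noteq> \<zero>\<^bsub>L\<^esub>"
  proof
    assume z: "d \<otimes>\<^bsub>L\<^esub> c = \<zero>\<^bsub>L\<^esub>"
    have E0: "F.eigenspace g (d \<otimes>\<^bsub>L\<^esub> c) \<subseteq> {\<zero>\<^bsub>VF\<^esub>}"
    proof
      fix v assume "v \<in> F.eigenspace g (d \<otimes>\<^bsub>L\<^esub> c)"
      then have v: "v \<in> carrier VF" "vec_mat (L\<lparr>carrier := K\<rparr>) n v g = \<zero>\<^bsub>VF\<^esub>"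
        unfolding F.eigenspace_def z using F.smult_l_null by auto
      have "vec_mat (L\<lparr>carrier := K\<rparr>) n \<zero>\<^bsub>VF\<^esub> g = \<zero>\<^bsub>VF\<^esub>"
        using F.lin_smult[OF F.act_lin[OF gG] F.R.zero_closed v(1)] v F.smult_l_null
          F.act_closed[OF gG v(1)] by simp
      then show "v \<in> {\<zero>\<^bsub>VF\<^esub>}" using inj_onD[OF F.act_inj[OF gG]] v F.M.zero_closed by auto
    qed
    have "card (F.eigenspace g (d \<otimes>\<^bsub>L\<^esub> c)) \<le> 1" using card_mono[OF _ E0] by simp
    then have "F.Q ^ r * card (F.eigenspace g (d \<otimes>\<^bsub>L\<^esub> c)) \<le> F.Q ^ r * 1" by (rule mult_le_mono2)
    then have "F.Q ^ n \<le> F.Q ^ r" unfolding r' by simp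
    then show False using F.Q_ge_2 r(2) by (simp add: power_increasing_iff)
  qed
  then show ?thesis using r(2) by (intro support_eq[OF gG dc _ r']) auto
qed

lemma coord_extensionI:
  assumes "algebraic_closure L K" "finite K" shows "coord_extension L K n"
proof -
  interpret algebraic_closure L K by fact
  have "field (L\<lparr>carrier := K\<rparr>)" using subfield_iff(2) subfield_axioms by simp
  then show ?thesis
    using assms(2) coordI[OF field_axioms] finite_coordI[of "L\<lparr>carrier := K\<rparr>"] subset
    by (intro coord_extension.intro coord_extension_axioms.intro) auto
qed

theorem proposition3p4:
  shows "\<exists>n0::nat. \<forall>\<epsilon>1::real. \<epsilon>1 > 0 \<longrightarrow> (\<exists>\<delta>::real. \<delta> > 0 \<and>
    (\<forall>(n::nat) (q::nat) (c::classical_family) (L::'a ring) (K::'a set) G.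
       n \<ge> n0 \<and> primepow q \<and>
       algebraic_closure L K \<and> finite K \<and> card K = q ^ field_deg c \<and>
       simple_classical_group c (L\<lparr>carrier := K\<rparr>) n q G \<longrightarrow>
       (\<forall>x\<in>carrier G. \<forall>xhat\<in>x. \<forall>s::nat.
          support L n xhat = s \<and>
          real (card (conj_class G x)) \<le> real (order G) powr \<delta> \<longrightarrow>
          real q powr ((2 * a_const c - \<epsilon>1) * real n * real s) \<le> real (card (conj_class G x)) \<and>
          real (card (conj_class G x)) \<le> real q powr ((2 * a_const c + \<epsilon>1) * real n * real s))))"
proof (intro exI[of _ "100::nat"] allI impI)
  fix \<epsilon>1 :: real assume \<epsilon>1: "\<epsilon>1 > 0"
  \<comment> \<open>The lower exponent will be 2 a (1 - 8 \<delta>) n s, and 16 a \<delta> \<le> 16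
    \<delta> \<le> \<epsilon>1 because a \<le> 1. The bound 1/64 is the one required by
    \<open>conj_class_estimates\<close>.\<close>
  define \<delta> where "\<delta> = min (\<epsilon>1 / 16) (1 / 64)"
  have \<delta>: "\<delta> > 0" "\<delta> \<le> 1 / 64" "16 * \<delta> \<le> \<epsilon>1" using \<epsilon>1 by (auto simp: \<delta>_def)
  show "\<exists>\<delta>::real. \<delta> > 0 \<and>
    (\<forall>(n::nat) (q::nat) (c::classical_family) (L::'a ring) (K::'a set) G.
       n \<ge> 100 \<and> primepow q \<and>
       algebraic_closure L K \<and> finite K \<and> card K = q ^ field_deg c \<and>
       simple_classical_group c (L\<lparr>carrier := K\<rparr>) n q G \<longrightarrow>
       (\<forall>x\<in>carrier G. \<forall>xhat\<in>x. \<forall>s::nat.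
          support L n xhat = s \<and>
          real (card (conj_class G x)) \<le> real (order G) powr \<delta> \<longrightarrow>
          real q powr ((2 * a_const c - \<epsilon>1) * real n * real s) \<le> real (card (conj_class G x)) \<and>
          real (card (conj_class G x)) \<le> real q powr ((2 * a_const c + \<epsilon>1) * real n * real s)))"
  proof (intro exI[of _ \<delta>] conjI[OF \<delta>(1)] allI impI ballI)
    fix n q :: nat and c and L :: "'a ring" and K :: "'a set" and G x xhat and s :: nat
    assume A: "n \<ge> 100 \<and> primepow q \<and> algebraic_closure L K \<and> finite K \<and> card K = q ^ field_deg c \<and>
       simple_classical_group c (L\<lparr>carrier := K\<rparr>) n q G"
      and x: "x \<in> carrier G" "xhat \<in> x"
      and S: "support L n xhat = s \<and> real (card (conj_class G x)) \<le> real (order G) powr \<delta>"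
    interpret coord_extension L K n using A by (intro coord_extensionI) auto
    define b :: nat where "b = (if c = Linear then 2 else 1)"
    define N where "N = real (card (conj_class G x))"
    have q: "q \<ge> 2" using A primepow_gt_Suc_0[of q] by simp
    obtain H where H: "is_linear_classical c (L\<lparr>carrier := K\<rparr>) n q H" "G = proj_image (L\<lparr>carrier := K\<rparr>) n H"
      and G: "group G" using A by (auto simp: simple_classical_group_def simple_group_def)
    obtain h where h: "h \<in> H" "x = scalars (L\<lparr>carrier := K\<rparr>) n #>\<^bsub>GL (L\<lparr>carrier := K\<rparr>) n\<^esub> h"
      using x(1) H(2) by (auto simp: proj_image_def)
    have sH: "subgroup H (GL (L\<lparr>carrier := K\<rparr>) n)" and cb: "F.class_bounds b n H h"
      using F.classical_class_bounds[OF H(1) h(1)] A q by (auto simp: b_def)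
    have "group (proj_image (L\<lparr>carrier := K\<rparr>) n H)" "b \<ge> 1" "n \<ge> 100" using G H(2) A by (auto simp: b_def)
    moreover have "N \<le> real (order G) powr \<delta>" using S by (simp add: N_def)
    ultimately have "\<exists>d\<in>K. \<exists>r. F.Q ^ r * card (F.eigenspace h d) = F.Q ^ n \<and> 2 * r < n \<and>
        real F.Q powr (real b * (1 - 8 * \<delta>) * real n * real r) \<le> N \<and> N \<le> real F.Q powr (real b * real n * real r)"
      using F.conj_class_estimates[OF sH _ h(1) cb _ _ \<delta>(1,2)] unfolding N_def H(2) h(2) by simp
    then obtain d r where d: "d \<in> K" and r: "F.Q ^ r * card (F.eigenspace h d) = F.Q ^ n" "2 * r < n"
      and N: "real F.Q powr (real b * (1 - 8 * \<delta>) * real n * real r) \<le> N" "N \<le> real F.Q powr (real b * real n * real r)"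
      by blast
    have s: "s = r" using support_coset[OF subgroup.mem_carrier[OF sH h(1)] _ d r, of xhat] S x(2) h(2) by simp
    \<comment> \<open>Passing from the field size to q multiplies \<open>b\<close> by the field
      degree: 2 times 1 for linear groups, 1 times 2 for unitary groups and 1 times 1 otherwise,
      which is 2 a in every case.\<close>
    have bu: "real (field_deg c) * real b = 2 * a_const c" "a_const c \<le> 1"
      by (auto simp: field_deg_def b_def a_const_def)
    have Q: "real F.Q powr (real b * y) = real q powr (2 * a_const c * y)" for y
    proof -
      have "real F.Q = real q powr real (field_deg c)" using A q by (simp add: F.Q_def powr_realpow)
      then show ?thesis using bu(1) by (simp add: powr_powr mult.assoc[symmetric])
    qed
    have nr: "0 \<le> real n * real r" by simp
    have "2 * a_const c - \<epsilon>1 \<le> 2 * a_const c * (1 - 8 * \<delta>)"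
    proof -
      have "a_const c * (16 * \<delta>) \<le> 1 * (16 * \<delta>)" using bu(2) \<delta>(1) by (intro mult_right_mono) auto
      then show ?thesis using \<delta>(3) by (simp add: algebra_simps)
    qed
    from mult_right_mono[OF this nr]
    have "real q powr ((2 * a_const c - \<epsilon>1) * real n * real r) \<le> real q powr (2 * a_const c * ((1 - 8 * \<delta>) * real n * real r))"
      using q by (intro powr_mono) (auto simp: mult_ac)
    also have "\<dots> \<le> N" using N(1) unfolding Q[symmetric] by (simp add: mult_ac)
    finally have 1: "real q powr ((2 * a_const c - \<epsilon>1) * real n * real r) \<le> N" .
    have "N \<le> real q powr (2 * a_const c * (real n * real r))" using N(2) unfolding Q[symmetric] by (simp add: mult_ac)
    also have "\<dots> \<le> real q powr ((2 * a_const c + \<epsilon>1) * real n * real r)"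
      using mult_right_mono[OF _ nr, of "2 * a_const c" "2 * a_const c + \<epsilon>1"] q \<epsilon>1
      by (intro powr_mono) (auto simp: mult_ac)
    finally have "N \<le> real q powr ((2 * a_const c + \<epsilon>1) * real n * real r)" .
    with 1 show "real q powr ((2 * a_const c - \<epsilon>1) * real n * real s) \<le> real (card (conj_class G x)) \<and>
      real (card (conj_class G x)) \<le> real q powr ((2 * a_const c + \<epsilon>1) * real n * real s)"
      unfolding s N_def by auto
  qed
qed

end
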